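(* Let $\beta=\omega=1$, let $\delta\in[0,2\pi]$, and for small $\epsilon>0$ let $\Phi_{n,m}(\epsilon)$ be the family of scalar vortex-cross solutions defined in the context. Consider the $(1,1)$ vector vortex cross $\phi_{n,m}=\cos\delta\,\Phi_{n,m}(\epsilon)$, $\psi_{n,m}=\sin\delta\,\Phi_{n,m}(\epsilon)$. The linearized problem $\mathcal{H}(\epsilon)\varphi=i\lambda\sigma\varphi$ (defined in the context) for this solution has zero eigenvalue of algebraic multiplicity six and geometric multiplicity five, and five small pairs of purely imaginary eigenvalues given asymptotically by $$\lambda_{1,2},\lambda_{3,4}=\pm 2i\epsilon+O(\epsilon^2),\quad \lambda_{5,6}=\pm 2i\epsilon^2+O(\epsilon^3),\quad \lambda_{7,8}=\pm 6i\epsilon^2+O(\epsilon^3),\quad \lambda_{9,10}=\pm 4i\epsilon^2+O(\epsilon^3).$$ The rest of the spectrum is bounded away from the origin as $\epsilon\to 0$ and it is located on the imaginary axis of $\lambda$.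
   Context: Write $(\Delta f)_{n,m}=f_{n+1,m}+f_{n-1,m}+f_{n,m+1}+f_{n,m-1}$ on $\mathbb{Z}^2$. Let $S^{(0)}=\{(-1,0);(0,-1);(1,0);(0,1)\}\subset\mathbb{Z}^2$, enumerated in this order by $j=1,2,3,4$. For small $\epsilon\ge 0$, the scalar vortex cross $\Phi(\epsilon)$ is the unique (up to $\Phi\mapsto e^{i\alpha}\Phi$) family of localized ($\ell^2(\mathbb{Z}^2)$) solutions, real analytic in $\epsilon$, of $(1-|\Phi_{n,m}|^2)\Phi_{n,m}=\epsilon(\Delta\Phi)_{n,m}$ with $\Phi_{n,m}(0)=e^{i\pi(j-1)/2}$ at the $j$-th node of $S^{(0)}$ and $\Phi_{n,m}(0)=0$ for $(n,m)\notin S^{(0)}$. The coupled stationary system with parameters $\beta,\omega$ is $$(1-|\phi|^2-\beta|\psi|^2)\phi=\epsilon\Delta\phi,\qquad (\omega-\beta|\phi|^2-|\psi|^2)\psi=\epsilon\Delta\psi$$ (at every node $(n,m)$); it describes solutions $u=\phi e^{it}$, $v=\psi e^{i\omega t}$ of the coupled discrete nonlinear Schrödinger equations $i\dot u+\epsilon\Delta u+(|u|^2+\beta|v|^2)u=0$, $i\dot v+\epsilon\Delta v+(\beta|u|^2+|v|^2)v=0$. For $\beta=\omega=1$ the pair $(\cos\delta\,\Phi,\sin\delta\,\Phi)$ solves it. The linearized problem at a solution $(\phi,\psi)$ is $\mathcal{H}(\epsilon)\varphi=i\lambda\sigma\varphi$ in $\ell^2(\mathbb{Z}^2,\mathbb{C}^4)$,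 where $\sigma=\mathrm{diag}(1,-1,1,-1)$ at each node and $(\mathcal{H}(\epsilon)\varphi)_{n,m}=H_{n,m}\varphi_{n,m}-\epsilon(\Delta\varphi)_{n,m}$ with $$H_{n,m}=\begin{pmatrix}1-2|\phi|^2-\beta|\psi|^2&-\phi^2&-\beta\phi\bar\psi&-\beta\phi\psi\\-\bar\phi^2&1-2|\phi|^2-\beta|\psi|^2&-\beta\bar\phi\bar\psi&-\beta\bar\phi\psi\\-\beta\bar\phi\psi&-\beta\phi\psi&\omega-\beta|\phi|^2-2|\psi|^2&-\psi^2\\-\beta\bar\phi\bar\psi&-\beta\phi\bar\psi&-\bar\psi^2&\omega-\beta|\phi|^2-2|\psi|^2\end{pmatrix},\quad \phi=\phi_{n,m},\ \psi=\psi_{n,m}.$$ *)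

theory Defs
  imports "HOL-Analysis.Analysis" "HOL-Library.Landau_Symbols"
    "HOL-Library.Function_Algebras"
begin

type_synonym lattice = "int \<times> int"

definition lap :: "(lattice \<Rightarrow> 'a::real_normed_vector) \<Rightarrow> lattice \<Rightarrow> 'a" where
  "lap f = (\<lambda>(n, m). f (n + 1, m) + f (n - 1, m) + f (n, m + 1) + f (n, m - 1))"

text \<open>The space of square-summable lattice functions, as a carrier set. On
  \<^typ>\<open>complex^4\<close> the norm is the Euclidean one.\<close>

definition l2 :: "(lattice \<Rightarrow> 'a::real_normed_vector) set" where
  "l2 = {f. (\<lambda>p. (norm (f p))\<^sup>2) summable_on UNIV}"

definition l2_norm :: "(lattice \<Rightarrow> 'a::real_normed_vector) \<Rightarrow> real" where
  "l2_norm f = sqrt (\<Sum>\<^sub>\<infinity>p. (norm (f p))\<^sup>2)"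

text \<open>Real analyticity of a map into the Banach space \<open>\<ell>\<^sup>2\<close>, on a set \<open>S\<close> of parameters:
  near every \<open>x \<in> S\<close> the map is the sum of a power series converging in \<open>\<ell>\<^sup>2\<close>. At an
  end point of an interval \<open>S\<close> only the parameters on the side of \<open>S\<close> are
  constrained.\<close>

definition l2_real_analytic_on ::
    "(real \<Rightarrow> lattice \<Rightarrow> 'a::real_normed_vector) \<Rightarrow> real set \<Rightarrow> bool" where
  "l2_real_analytic_on F S \<longleftrightarrow>
     (\<forall>y\<in>S. F y \<in> l2) \<and>
     (\<forall>x\<in>S. \<exists>\<rho>>0. \<exists>a :: nat \<Rightarrow> lattice \<Rightarrow> 'a.
        (\<forall>k. a k \<in> l2) \<and>
        (\<forall>y\<in>S. \<bar>y - x\<bar> < \<rho> \<longrightarrow>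
           (\<lambda>N. l2_norm (\<lambda>p. F y p - (\<Sum>k<N. (y - x) ^ k *\<^sub>R a k p))) \<longlonglongrightarrow> 0))"

definition scalar_stationary :: "real \<Rightarrow> (lattice \<Rightarrow> complex) \<Rightarrow> bool" where
  "scalar_stationary \<epsilon> f \<longleftrightarrow>
     (\<forall>p. of_real (1 - (cmod (f p))\<^sup>2) * f p = of_real \<epsilon> * lap f p)"

definition cross_nodes :: "lattice list" where
  "cross_nodes = [(-1, 0), (0, -1), (1, 0), (0, 1)]"

text \<open>\<^term>\<open>cross_nodes\<close> is indexed from \<open>0\<close>, so the phase of its \<open>j\<close>-th entry is
  \<open>\<pi>j/2\<close>. The family is determined only up to a phase factor (which may depend on
  \<open>\<epsilon>\<close>); the predicate holds for each of its representatives.\<close>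

definition vortex_cross_family :: "real \<Rightarrow> (real \<Rightarrow> lattice \<Rightarrow> complex) \<Rightarrow> bool" where
  "vortex_cross_family \<epsilon>\<^sub>0 \<Phi> \<longleftrightarrow>
     l2_real_analytic_on \<Phi> {0..<\<epsilon>\<^sub>0} \<and>
     (\<forall>\<epsilon>\<in>{0..<\<epsilon>\<^sub>0}. scalar_stationary \<epsilon> (\<Phi> \<epsilon>)) \<and>
     (\<forall>j<4. \<Phi> 0 (cross_nodes ! j) = cis (pi * real j / 2)) \<and>
     (\<forall>p. p \<notin> set cross_nodes \<longrightarrow> \<Phi> 0 p = 0)"

definition H_node :: "real \<Rightarrow> real \<Rightarrow> complex \<Rightarrow> complex \<Rightarrow> complex^4^4" where
  "H_node \<beta> \<omega> a b =
    (let A = of_real (1 - 2 * (cmod a)\<^sup>2 - \<beta> * (cmod b)\<^sup>2);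
         B = of_real (\<omega> - \<beta> * (cmod a)\<^sup>2 - 2 * (cmod b)\<^sup>2);
         k = of_real \<beta>
     in vector
       [vector [A, - a\<^sup>2, - k * a * cnj b, - k * a * b],
        vector [- (cnj a)\<^sup>2, A, - k * cnj a * cnj b, - k * cnj a * b],
        vector [- k * cnj a * b, - k * a * b, B, - b\<^sup>2],
        vector [- k * cnj a * cnj b, - k * a * cnj b, - (cnj b)\<^sup>2, B]])"

definition H_op :: "real \<Rightarrow> real \<Rightarrow> real \<Rightarrow> (lattice \<Rightarrow> complex) \<Rightarrow> (lattice \<Rightarrow> complex) \<Rightarrow>
    (lattice \<Rightarrow> complex^4) \<Rightarrow> lattice \<Rightarrow> complex^4" where
  "H_op \<beta> \<omega> \<epsilon> \<phi> \<psi> f = (\<lambda>p. H_node \<beta> \<omega> (\<phi> p) (\<psi> p) *v f p - \<epsilon> *\<^sub>R lap f p)"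

definition sigma :: "complex^4 \<Rightarrow> complex^4" where
  "sigma v = vector [v $ 1, - v $ 2, v $ 3, - v $ 4]"

text \<open>From here on \<open>\<mu>\<close> is the spectral parameter of the problem \<open>H f = i\<mu>\<sigma>f\<close> in \<open>\<ell>\<^sup>2\<close>.\<close>

definition pencil :: "((lattice \<Rightarrow> complex^4) \<Rightarrow> lattice \<Rightarrow> complex^4) \<Rightarrow> complex \<Rightarrow>
    (lattice \<Rightarrow> complex^4) \<Rightarrow> lattice \<Rightarrow> complex^4" where
  "pencil H \<mu> f = (\<lambda>p. H f p - (\<i> * \<mu>) *s sigma (f p))"

text \<open>\<open>\<mu>\<close> is in the resolvent set if \<open>H - i\<mu>\<sigma>\<close> is a bijection of \<open>\<ell>\<^sup>2\<close> with bounded inverse.\<close>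

definition spectrum :: "((lattice \<Rightarrow> complex^4) \<Rightarrow> lattice \<Rightarrow> complex^4) \<Rightarrow> complex set" where
  "spectrum H = {\<mu>. \<not> (bij_betw (pencil H \<mu>) l2 l2 \<and>
                      (\<exists>K. \<forall>f\<in>l2. l2_norm f \<le> K * l2_norm (pencil H \<mu> f)))}"

definition eigenspace :: "((lattice \<Rightarrow> complex^4) \<Rightarrow> lattice \<Rightarrow> complex^4) \<Rightarrow> complex \<Rightarrow>
    (lattice \<Rightarrow> complex^4) set" where
  "eigenspace H \<mu> = {f \<in> l2. \<forall>p. H f p = (\<i> * \<mu>) *s sigma (f p)}"

text \<open>As \<open>\<sigma>\<^sup>2 = 1\<close>, the problem \<open>H f = i\<mu>\<sigma>f\<close> is the eigenvalue problem of
  \<open>A = -i\<sigma>H\<close>; the generalized eigenspace is the union of the kernels of the powers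
  of \<open>A - \<mu> = -i\<sigma>(H - i\<mu>\<sigma>)\<close>.\<close>

definition shifted_op :: "((lattice \<Rightarrow> complex^4) \<Rightarrow> lattice \<Rightarrow> complex^4) \<Rightarrow> complex \<Rightarrow>
    (lattice \<Rightarrow> complex^4) \<Rightarrow> lattice \<Rightarrow> complex^4" where
  "shifted_op H \<mu> f = (\<lambda>p. (- \<i>) *s sigma (H f p) - \<mu> *s f p)"

definition gen_eigenspace :: "((lattice \<Rightarrow> complex^4) \<Rightarrow> lattice \<Rightarrow> complex^4) \<Rightarrow> complex \<Rightarrow>
    (lattice \<Rightarrow> complex^4) set" where
  "gen_eigenspace H \<mu> = {f \<in> l2. \<exists>k. (shifted_op H \<mu> ^^ k) f = (\<lambda>p. 0)}"

text \<open>The dimension over the complex numbers. It is \<open>0\<close> for infinite-dimensional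
  subspaces, so only a positive value says that the dimension is finite.\<close>

definition cdim :: "(lattice \<Rightarrow> complex^4) set \<Rightarrow> nat" where
  "cdim = vector_space.dim (\<lambda>c f p. c *s f p)"

definition geom_mult :: "((lattice \<Rightarrow> complex^4) \<Rightarrow> lattice \<Rightarrow> complex^4) \<Rightarrow> complex \<Rightarrow> nat" where
  "geom_mult H \<mu> = cdim (eigenspace H \<mu>)"

definition alg_mult :: "((lattice \<Rightarrow> complex^4) \<Rightarrow> lattice \<Rightarrow> complex^4) \<Rightarrow> complex \<Rightarrow> nat" where
  "alg_mult H \<mu> = cdim (gen_eigenspace H \<mu>)"

lemma vector_space_lattice: "vector_space (\<lambda>c (f :: lattice \<Rightarrow> complex^4) p. c *s f p)"
  by unfold_locales (auto simp: fun_eq_iff vec_eq_iff algebra_simps)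

lemma vector_4_nth [simp]:
  "(vector [a, b, c, d] :: 'a::zero^4) $ 1 = a"
  "(vector [a, b, c, d] :: 'a::zero^4) $ 2 = b"
  "(vector [a, b, c, d] :: 'a::zero^4) $ 3 = c"
  "(vector [a, b, c, d] :: 'a::zero^4) $ 4 = d"
  unfolding vector_def by auto

lemma shifted_op_pencil: "shifted_op H \<mu> f = (\<lambda>p. (- \<i>) *s sigma (pencil H \<mu> f p))"
  by (auto simp: shifted_op_def pencil_def sigma_def fun_eq_iff vec_eq_iff forall_4
      algebra_simps)

lemma eigenspace_shifted_op: "eigenspace H \<mu> = {f \<in> l2. shifted_op H \<mu> f = (\<lambda>p. 0)}"
  unfolding eigenspace_def shifted_op_pencil
  by (auto simp: pencil_def sigma_def fun_eq_iff vec_eq_iff forall_4 neg_eq_iff_add_eq_0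
      eq_neg_iff_add_eq_0 algebra_simps)

end

theory Submission
  imports Defs
begin

text \<open>Write \<open>z = \<i>\<mu>\<close>. The problem becomes \<open>(H - z\<sigma>)f = 0\<close> with \<open>H\<close> and \<open>\<sigma>\<close>
self-adjoint and \<open>\<sigma>\<^sup>2 = 1\<close>, and imaginary \<open>\<mu>\<close> are real \<open>z\<close>.

\<^bold>\<open>Reduction.\<close> For \<open>\<beta> = \<omega> = 1\<close> the system has an internal rotation symmetry. A constant unitary
matrix commuting with \<open>\<sigma>\<close> turns \<open>(cos \<delta> \<Phi>, sin \<delta> \<Phi>)\<close> into \<open>(\<Phi>, 0)\<close>, and a phase
factor makes \<open>\<Phi>(-1,0)\<close> real (\<open>H_node_MW\<close>, \<open>cross_family_gauge\<close>). It remains to treat a scalar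
cross \<open>\<Psi>\<close> with parameters independent of \<open>\<delta>\<close>. Analyticity is used once, to see that \<open>\<Psi>\<close> is
uniformly close to the four unit vortices at \<open>\<epsilon> = 0\<close>; from there on everything is an explicit
estimate at a fixed small \<open>\<epsilon>\<close>.

\<^bold>\<open>Symmetry.\<close> A solution that close to the cross inherits its symmetries (\<open>odd\<close>,
\<open>conj_reflection\<close>, \<open>diagonal_symmetry\<close>): the difference between \<open>\<Psi>\<close> and a mirror image
is controlled by its values on the four nodes, and the node equations force these to vanish. So
\<open>\<Psi>\<close> is multiplied by \<open>\<i>\<close> under a quarter turn, and there is a unitary \<open>U\<close> of order twelve
commuting with \<open>H\<close> and \<open>\<sigma>\<close>. At \<open>\<epsilon> = 0\<close> the kernel of \<open>H\<close> is spanned by twelve phase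
modes \<open>b\<^sub>i\<close>, one in each eigenspace (sector) of \<open>U\<close>.

\<^bold>\<open>Scalar equations.\<close> Adding the projection onto the phase modes makes \<open>H - z\<sigma>\<close> invertible for
\<open>\<bar>z\<bar> \<le> 1/100\<close>. If \<open>e\<^sub>i(z)\<close> is the preimage of \<open>b\<^sub>i\<close> then
\<open>(H - z\<sigma>) e\<^sub>i(z) = k\<^sub>i(z) b\<^sub>i\<close> with a scalar function \<open>k\<^sub>i\<close>, and the small
eigenvalues are the zeros of the twelve \<open>k\<^sub>i\<close> (\<open>kernel\<close>, \<open>resolvent_small\<close>). Their divided
differences are Krein forms \<open>\<langle>e, \<sigma>e\<rangle>\<close>; in eight sectors \<open>b\<^sub>i\<close> is an eigenvector of
\<open>\<sigma>\<close> and \<open>k\<^sub>i\<close> is nearly affine with slope \<open>\<plusminus>1\<close>, in the sectors \<open>0, 3, 6, 9\<close> it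
is nearly \<open>k\<^sub>i(0) + z\<^sup>2/2\<close>. This counts the zeros, and nondegeneracy of the form at a zero
excludes Jordan blocks (\<open>generalized_kernel_simple\<close>). The values \<open>k\<^sub>i(0)\<close> come from a Rayleigh
formula. The phase symmetries give zero in sectors \<open>0, 4, 5, 10, 11\<close>; the double zero in sector
\<open>0\<close> carries a Jordan chain of length two, whence the multiplicities six and five at the origin. In sectors
\<open>1, 2\<close> the value is \<open>-6\<epsilon>\<^sup>2\<close>, in \<open>7, 8\<close> it is \<open>2\<epsilon>\<^sup>2\<close>, in \<open>3, 9\<close> it is
\<open>-2\<epsilon>\<^sup>2\<close>, to leading order (\<open>kr_trial\<close>). In sector \<open>6\<close> the second order vanishes; a trial function built from
\<open>\<Psi>\<close> itself gives \<open>-8\<epsilon>\<^sup>4\<close>, the only contribution coming from the four diagonal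
neighbours of the origin (\<open>kr_6\<close>). Solving \<open>k\<^sub>i(z) = 0\<close> produces the ten eigenvalues (\<open>root_list\<close>).

\<^bold>\<open>Away from the origin.\<close> For nonreal \<open>z\<close> a solution of \<open>(H - z\<sigma>)f = g\<close> satisfies
\<open>\<langle>f, \<sigma>f\<rangle> = O(\<parallel>f\<parallel> \<parallel>g\<parallel>)\<close>, hence so is \<open>\<langle>f, Hf\<rangle>\<close>. The form of \<open>H\<close> is positive except
on the nodes, and the part of \<open>f\<close> there is small if \<open>\<bar>z\<bar> \<ge> 1/100\<close>, because \<open>\<sigma>H\<close> is nearly
nilpotent on it. So \<open>H - z\<sigma>\<close> is bounded below, and invertible (\<open>nonreal_resolvent\<close>).\<close>

section \<open>From analyticity in the sequence space to uniform continuity\<close>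

lemma norm_le_l2_norm:
  assumes "f \<in> l2" shows "norm (f p) \<le> l2_norm f"
proof -
  have "(\<Sum>q\<in>{p}. (norm (f q))\<^sup>2) \<le> (\<Sum>\<^sub>\<infinity>q. (norm (f q))\<^sup>2)"
    by (rule finite_sum_le_infsum) (use assms in \<open>auto simp: l2_def\<close>)
  then show ?thesis unfolding l2_norm_def by (intro real_le_rsqrt) simp
qed

lemma l2_add:
  assumes "f \<in> l2" "g \<in> l2" shows "(\<lambda>p. f p + g p) \<in> l2"
proof -
  have "(\<lambda>p. 2 * (norm (f p))\<^sup>2 + 2 * (norm (g p))\<^sup>2) summable_on UNIV"
    using assms by (intro summable_on_add summable_on_cmult_right) (auto simp: l2_def)
  then show ?thesis unfolding l2_def mem_Collect_eq
  proof (rule summable_on_comparison_test, goal_cases)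
    case (1 p)
    have "(norm (f p + g p))\<^sup>2 \<le> (norm (f p) + norm (g p))\<^sup>2"
      by (intro power_mono norm_triangle_ineq) auto
    also have "\<dots> \<le> 2 * (norm (f p))\<^sup>2 + 2 * (norm (g p))\<^sup>2"
      using sum_squares_bound[of "norm (f p)" "norm (g p)"] by (simp add: power2_sum)
    finally show ?case .
  qed auto
qed

lemma l2_scaleR:
  assumes "f \<in> l2" shows "(\<lambda>p. c *\<^sub>R f p) \<in> l2"
  using assms unfolding l2_def
  by (auto simp: power_mult_distrib intro: summable_on_cmult_right)

lemma l2_diff:
  assumes "f \<in> l2" "g \<in> l2" shows "(\<lambda>p. f p - g p) \<in> l2"
  using l2_add[OF assms(1) l2_scaleR[OF assms(2), of "-1"]] by simp

lemma l2_zero: "(\<lambda>p. 0) \<in> l2"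
  by (simp add: l2_def)

lemma l2_sum:
  fixes f :: "'i \<Rightarrow> lattice \<Rightarrow> 'a::real_normed_vector"
  assumes "\<And>i. i \<in> A \<Longrightarrow> f i \<in> l2" shows "(\<lambda>p. \<Sum>i\<in>A. f i p) \<in> l2"
  using assms by (induction A rule: infinite_finite_induct) (auto simp: l2_zero l2_add)

text \<open>At one parameter \<open>y > 0\<close> the partial sums of the power series are bounded in \<open>\<ell>\<^sup>2\<close>. This is a
  Cauchy estimate for the coefficients in the sup norm, so for \<open>0 \<le> x < y\<close> the series without its
  constant term is dominated by a geometric series in \<open>x/y\<close>, the same at every site.\<close>

lemma l2_real_analytic_sup_continuous:
  fixes F :: "real \<Rightarrow> lattice \<Rightarrow> 'a::banach"
  assumes "l2_real_analytic_on F {0..<\<epsilon>\<^sub>0}" "\<epsilon>\<^sub>0 > 0" "\<eta> > 0"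
  obtains \<epsilon>\<^sub>1 where "\<epsilon>\<^sub>1 > 0" "\<epsilon>\<^sub>1 \<le> \<epsilon>\<^sub>0"
    "\<And>\<epsilon> p. 0 \<le> \<epsilon> \<Longrightarrow> \<epsilon> < \<epsilon>\<^sub>1 \<Longrightarrow> norm (F \<epsilon> p - F 0 p) \<le> \<eta>"
proof -
  have l2F: "F y \<in> l2" if "0 \<le> y" "y < \<epsilon>\<^sub>0" for y
    using assms(1) that by (auto simp: l2_real_analytic_on_def)
  obtain \<rho> a where \<rho>: "\<rho> > 0" and a: "\<And>k. a k \<in> l2" and
    lim: "\<And>y. 0 \<le> y \<Longrightarrow> y < \<epsilon>\<^sub>0 \<Longrightarrow> \<bar>y\<bar> < \<rho> \<Longrightarrow>
        (\<lambda>N. l2_norm (\<lambda>p. F y p - (\<Sum>k<N. y ^ k *\<^sub>R a k p))) \<longlonglongrightarrow> 0"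
  proof -
    have "0 \<in> {0..<\<epsilon>\<^sub>0}" using assms(2) by simp
    with assms(1) have "\<exists>\<rho>>0. \<exists>a :: nat \<Rightarrow> lattice \<Rightarrow> 'a. (\<forall>k. a k \<in> l2) \<and>
        (\<forall>y\<in>{0..<\<epsilon>\<^sub>0}. \<bar>y - 0\<bar> < \<rho> \<longrightarrow>
           (\<lambda>N. l2_norm (\<lambda>p. F y p - (\<Sum>k<N. (y - 0) ^ k *\<^sub>R a k p))) \<longlonglongrightarrow> 0)"
      unfolding l2_real_analytic_on_def by blast
    then show ?thesis using that by (auto simp: Ball_def)
  qed
  define r where "r y N p = F y p - (\<Sum>k<N. y ^ k *\<^sub>R a k p)" for y N p
  have rl2: "r y N \<in> l2" if "0 \<le> y" "y < \<epsilon>\<^sub>0" for y N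
    unfolding r_def using that by (intro l2_diff l2_sum l2_scaleR l2F a)
  have sums: "(\<lambda>k. y ^ k *\<^sub>R a k p) sums F y p" if "0 \<le> y" "y < \<epsilon>\<^sub>0" "y < \<rho>" for y p
  proof -
    have "(\<lambda>N. norm (r y N p)) \<longlonglongrightarrow> 0"
    proof (rule Lim_null_comparison)
      show "(\<lambda>N. l2_norm (r y N)) \<longlonglongrightarrow> 0" using lim[of y] that by (simp add: r_def[abs_def])
      show "\<forall>\<^sub>F N in sequentially. norm (norm (r y N p)) \<le> l2_norm (r y N)"
        using norm_le_l2_norm[OF rl2] that by (intro always_eventually) auto
    qed
    then have "(\<lambda>N. F y p - r y N p) \<longlonglongrightarrow> F y p - 0"
      by (rule tendsto_diff[OF tendsto_const tendsto_norm_zero_cancel])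
    then show ?thesis by (simp add: sums_def r_def)
  qed
  define y where "y = min \<rho> \<epsilon>\<^sub>0 / 2"
  have y: "0 < y" "y < \<rho>" "y < \<epsilon>\<^sub>0" using \<rho> assms(2) by (auto simp: y_def min_def)
  have "Bseq (\<lambda>N. l2_norm (r y N))"
    using lim[of y] y by (intro convergent_imp_Bseq convergentI[of _ 0]) (simp add: r_def[abs_def])
  then obtain B where B: "B > 0" "\<And>N. norm (l2_norm (r y N)) \<le> B" by (auto simp: Bseq_def)
  \<comment> \<open>consecutive remainders at y differ by one term of the series\<close>
  have coeff: "norm (a k p) \<le> 2 * B / y ^ k" for k p
  proof -
    have "y ^ k *\<^sub>R a k p = r y k p - r y (Suc k) p" by (simp add: r_def)
    then have "y ^ k * norm (a k p) \<le> norm (r y k p) + norm (r y (Suc k) p)"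
      by (metis norm_triangle_ineq4 norm_scaleR abs_of_pos y(1) zero_less_power)
    also have "\<dots> \<le> l2_norm (r y k) + l2_norm (r y (Suc k))"
      by (intro add_mono norm_le_l2_norm rl2) (use y in auto)
    also have "\<dots> \<le> B + B"
      using B(2)[of k] B(2)[of "Suc k"] by (simp add: abs_le_iff)
    finally show ?thesis using y by (simp add: field_simps)
  qed
  have bound: "norm (F x p - F 0 p) \<le> 2 * B * (x / y) / (1 - x / y)" if x: "0 \<le> x" "x < y" for x p
  proof -
    have "(\<lambda>k. 0 ^ k *\<^sub>R a k p) sums (\<Sum>k\<in>{0}. 0 ^ k *\<^sub>R a k p)"
      by (rule sums_finite) auto
    then have "(\<lambda>k. 0 ^ k *\<^sub>R a k p) sums a 0 p" by simp
    then have F0: "F 0 p = a 0 p" using sums[of 0 p] \<rho> assms(2) sums_unique2 by blast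
    have "(\<lambda>k. x ^ Suc k *\<^sub>R a (Suc k) p) sums (F x p - F 0 p)"
      using sums[of x p] x y by (subst sums_Suc_iff) (auto simp: F0)
    moreover have "(\<lambda>k. 2 * B * (x / y) * (x / y) ^ k) sums (2 * B * (x / y) * (1 / (1 - x / y)))"
      by (intro sums_mult geometric_sums) (use x in auto)
    moreover have "norm (x ^ Suc k *\<^sub>R a (Suc k) p) \<le> 2 * B * (x / y) * (x / y) ^ k" for k
      using mult_left_mono[OF coeff[of "Suc k" p], of "x ^ Suc k"] x
      by (simp add: power_divide field_simps)
    ultimately have "norm (F x p - F 0 p) \<le> 2 * B * (x / y) * (1 / (1 - x / y))"
      by (rule norm_sums_le)
    then show ?thesis by simp
  qed
  have "((\<lambda>x. 2 * B * (x / y) / (1 - x / y)) \<longlongrightarrow> 2 * B * (0 / y) / (1 - 0 / y)) (at 0)"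
    by (intro tendsto_intros) (use y in auto)
  then have "\<forall>\<^sub>F x in at 0. 2 * B * (x / y) / (1 - x / y) < \<eta>"
    by (rule order_tendstoD) (use assms(3) in simp)
  then obtain d where d: "d > 0" "\<And>x. x \<noteq> 0 \<Longrightarrow> dist x 0 < d \<Longrightarrow> 2 * B * (x / y) / (1 - x / y) < \<eta>"
    unfolding eventually_at by auto
  show ?thesis
  proof (rule that[of "min d y"])
    show "norm (F x p - F 0 p) \<le> \<eta>" if "0 \<le> x" "x < min d y" for x p
      using bound[of x p] d(2)[of x] that assms(3) by (cases "x = 0") auto
  qed (use d y in auto)
qed

section \<open>Stationary solutions near the cross\<close>

abbreviation nodes :: "lattice set" where "nodes \<equiv> set cross_nodes"

lemma nodes_eq: "nodes = {(-1, 0), (0, -1), (1, 0), (0, 1)}"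
  by (auto simp: cross_nodes_def)

text \<open>The vortex cross at \<open>\<epsilon> = 0\<close>.\<close>

definition cross :: "lattice \<Rightarrow> complex" where
  "cross p = (if p = (-1, 0) then 1 else if p = (0, -1) then \<i> else
     if p = (1, 0) then -1 else if p = (0, 1) then - \<i> else 0)"

lemma norm_add4: "norm (a + b + c + d) \<le> norm a + norm b + norm c + norm (d :: 'a::real_normed_vector)"
  using norm_triangle_ineq[of "a + b + c" d] norm_triangle_ineq[of "a + b" c] norm_triangle_ineq[of a b]
  by linarith

lemma norm_lap_le:
  assumes "\<And>p. norm (f p) \<le> M" shows "norm (lap f p) \<le> 4 * M"
proof -
  obtain n m where p: "p = (n, m)" by (cases p)
  show ?thesis unfolding p lap_def
    using assms[of "(n+1,m)"] assms[of "(n-1,m)"] assms[of "(n,m+1)"] assms[of "(n,m-1)"]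
    by (auto intro!: order_trans[OF norm_add4])
qed

text \<open>Off the nodes \<open>f\<close> is determined by the source \<open>a\<close> and by its own neighbours, which enter with the
  factor \<open>\<epsilon>\<close>. A maximum principle bounds it by \<open>a\<close> and by \<open>\<epsilon>\<close> times its size \<open>t\<close>
  on the nodes. The constants are slightly more than \<open>1\<close> and \<open>4\<close>.\<close>

lemma off_node_bound:
  fixes f :: "lattice \<Rightarrow> 'a::real_normed_vector"
  assumes bdd: "\<And>p. norm (f p) \<le> B" and t: "\<And>p. p \<in> nodes \<Longrightarrow> norm (f p) \<le> t"
    and off: "\<And>p. p \<notin> nodes \<Longrightarrow> (1 - \<kappa>) * norm (f p) \<le> a + \<epsilon> * norm (lap f p)"
    and c: "\<kappa> \<le> 1 / 100" "0 \<le> \<epsilon>" "\<epsilon> \<le> 1 / 1000" "0 \<le> a"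
    and p: "p \<notin> nodes"
  shows "norm (f p) \<le> 1.02 * a + 4.1 * \<epsilon> * t"
proof -
  have t0: "0 \<le> t" using t[of "(1,0)"] order_trans[OF norm_ge_zero] by (auto simp: nodes_eq)
  define s where "s = (SUP p\<in>-nodes. norm (f p))"
  have s: "norm (f q) \<le> s" if "q \<notin> nodes" for q
    unfolding s_def by (rule cSUP_upper) (use that bdd in \<open>auto intro!: bdd_aboveI2\<close>)
  have s0: "0 \<le> s" using s[OF p] norm_ge_zero order_trans by blast
  have "norm (lap f q) \<le> 4 * max t s" for q
    by (rule norm_lap_le) (metis max.coboundedI1 max.coboundedI2 t s)
  then have lap: "\<epsilon> * norm (lap f q) \<le> \<epsilon> * (4 * max t s)" for q
    using c by (intro mult_left_mono) auto
  have est: "0.99 * norm (f q) \<le> a + 4 * \<epsilon> * max t s" if "q \<notin> nodes" for q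
  proof -
    have "0.99 * norm (f q) \<le> (1 - \<kappa>) * norm (f q)"
      using c by (intro mult_right_mono) auto
    with off[OF that] lap[of q] show ?thesis by simp
  qed
  have s_le: "0.99 * s \<le> a + 4 * \<epsilon> * max t s"
  proof -
    have "s \<le> (a + 4 * \<epsilon> * max t s) / 0.99"
      unfolding s_def by (rule cSUP_least) (use p est in \<open>auto simp: field_simps s_def\<close>)
    then show ?thesis by (simp add: field_simps)
  qed
  show ?thesis
  proof (cases "s \<le> t")
    case True
    have "0 \<le> \<epsilon> * t" using c t0 by simp
    with est[OF p] True c show ?thesis by (simp add: max_def)
  next
    case False
    have "4 * \<epsilon> * s \<le> 4 * (1/1000) * s" using c s0 by (intro mult_right_mono) auto
    moreover have "0 \<le> \<epsilon> * t" using c t0 by simp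
    ultimately show ?thesis using s[OF p] s_le False c by (simp add: max_def)
  qed
qed

text \<open>The numbers \<open>1/1000\<close> are far from optimal; they make all later estimates hold with room to spare.\<close>

locale near_cross =
  fixes \<epsilon> :: real and \<Psi> :: "lattice \<Rightarrow> complex"
  assumes eps: "0 < \<epsilon>" "\<epsilon> \<le> 1 / 1000"
    and stat: "scalar_stationary \<epsilon> \<Psi>"
    and near: "\<And>p. cmod (\<Psi> p - cross p) \<le> 1 / 1000"
begin

lemma eqn: "of_real (1 - (cmod (\<Psi> p))\<^sup>2) * \<Psi> p = of_real \<epsilon> * lap \<Psi> p"
  using stat unfolding scalar_stationary_def by blast

lemma node_norm: "p \<in> nodes \<Longrightarrow> cmod (\<Psi> p) \<le> 1001 / 1000" "p \<in> nodes \<Longrightarrow> 999 / 1000 \<le> cmod (\<Psi> p)"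
proof -
  assume p: "p \<in> nodes"
  have "cmod (cross p) = 1" using p by (auto simp: nodes_eq cross_def)
  then show "cmod (\<Psi> p) \<le> 1001 / 1000" "999 / 1000 \<le> cmod (\<Psi> p)"
    using near[of p] norm_triangle_ineq2[of "\<Psi> p" "cross p"] norm_triangle_ineq2[of "cross p" "\<Psi> p"]
    by (auto simp: norm_minus_commute)
qed

lemma off_small: "p \<notin> nodes \<Longrightarrow> cmod (\<Psi> p) \<le> 1 / 1000"
  using near[of p] by (simp add: cross_def nodes_eq split: if_splits)

lemma off_bound: 
  assumes p: "p \<notin> nodes" shows "cmod (\<Psi> p) \<le> 4.1 * \<epsilon>"
proof -
  have all: "cmod (\<Psi> p) \<le> 1001 / 1000" for p
    using node_norm[of p] off_small[of p] by (cases "p \<in> nodes") auto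
  have "(1 - 1/100) * cmod (\<Psi> p) \<le> (1 - (cmod (\<Psi> p))\<^sup>2) * cmod (\<Psi> p)"
  proof (intro mult_right_mono)
    have "(cmod (\<Psi> p))\<^sup>2 \<le> (1 / 1000)\<^sup>2" by (intro power_mono off_small p) auto
    then show "1 - 1/100 \<le> 1 - (cmod (\<Psi> p))\<^sup>2" by (simp add: power2_eq_square)
  qed auto
  also have "\<dots> \<le> cmod (of_real (1 - (cmod (\<Psi> p))\<^sup>2) * \<Psi> p)"
    by (simp add: norm_mult mult_right_mono del: of_real_diff)
  also have "\<dots> = \<epsilon> * cmod (lap \<Psi> p)" using eps by (simp only: eqn norm_mult) simp
  also have "\<dots> \<le> \<epsilon> * (4 * (1001/1000))" using eps by (intro mult_left_mono norm_lap_le all) auto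
  finally show ?thesis using eps by simp
qed

end

text \<open>Two solutions are compared through their half sum \<open>S\<close> and half difference \<open>A\<close>. With the
  half sum \<open>Q\<close> and half difference \<open>N\<close> of the squared moduli as coefficients these satisfy a coupled
  linear system, in which \<open>N\<close> is of first order in \<open>A\<close>.\<close>

locale near_cross_pair = P: near_cross \<epsilon> \<Psi> + P': near_cross \<epsilon> \<Psi>' for \<epsilon> \<Psi> \<Psi>'
begin

definition "S p = (\<Psi> p + \<Psi>' p) / 2"
definition "A p = (\<Psi> p - \<Psi>' p) / 2"
definition "Q p = ((cmod (\<Psi> p))\<^sup>2 + (cmod (\<Psi>' p))\<^sup>2) / 2"
definition "N p = ((cmod (\<Psi> p))\<^sup>2 - (cmod (\<Psi>' p))\<^sup>2) / 2"

lemmas eps = P.eps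

lemma N_eq: "N p = 2 * Re (S p * cnj (A p))"
  unfolding N_def S_def A_def cmod_power2 by (simp add: field_simps power2_eq_square)

lemma abs_N: "\<bar>N p\<bar> \<le> 2 * cmod (S p) * cmod (A p)"
  using abs_Re_le_cmod[of "S p * cnj (A p)"] by (simp add: N_eq norm_mult abs_mult)

lemma eqn_S: "of_real (1 - Q p) * S p - of_real (N p) * A p = of_real \<epsilon> * lap S p"
  and eqn_A: "of_real (1 - Q p) * A p - of_real (N p) * S p = of_real \<epsilon> * lap A p"
proof -
  have lapS: "lap S p = (lap \<Psi> p + lap \<Psi>' p) / 2" and lapA: "lap A p = (lap \<Psi> p - lap \<Psi>' p) / 2"
    by (auto simp: lap_def S_def A_def field_simps split: prod.splits)
  show "of_real (1 - Q p) * S p - of_real (N p) * A p = of_real \<epsilon> * lap S p"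
    using P.eqn[of p] P'.eqn[of p] unfolding lapS S_def A_def Q_def N_def
    by (simp add: field_simps) algebra
  show "of_real (1 - Q p) * A p - of_real (N p) * S p = of_real \<epsilon> * lap A p"
    using P.eqn[of p] P'.eqn[of p] unfolding lapA S_def A_def Q_def N_def
    by (simp add: field_simps) algebra
qed

lemma S_off: "p \<notin> nodes \<Longrightarrow> cmod (S p) \<le> 4.1 * \<epsilon>"
  and A_off0: "p \<notin> nodes \<Longrightarrow> cmod (A p) \<le> 4.1 * \<epsilon>"
  using P.off_bound[of p] P'.off_bound[of p] norm_triangle_ineq[of "\<Psi> p" "\<Psi>' p"]
    norm_triangle_ineq4[of "\<Psi> p" "\<Psi>' p"] by (auto simp: S_def A_def norm_divide)

lemma Q_off: "p \<notin> nodes \<Longrightarrow> 0 \<le> Q p \<and> Q p \<le> 17 * \<epsilon>\<^sup>2"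
  using power_mono[OF P.off_bound[of p], of 2] power_mono[OF P'.off_bound[of p], of 2]
  by (simp add: Q_def power_mult_distrib power2_eq_square) (use zero_le_square[of \<epsilon>] in linarith)

lemma NS_off: "p \<notin> nodes \<Longrightarrow> cmod (of_real (N p) * S p) \<le> 34 * \<epsilon>\<^sup>2 * cmod (A p)"
proof -
  assume p: "p \<notin> nodes"
  have "\<bar>N p\<bar> * cmod (S p) \<le> 2 * (cmod (S p))\<^sup>2 * cmod (A p)"
    using mult_right_mono[OF abs_N[of p], of "cmod (S p)"] by (simp add: power2_eq_square mult_ac)
  also have "\<dots> \<le> 2 * (4.1 * \<epsilon>)\<^sup>2 * cmod (A p)"
    by (intro mult_right_mono mult_left_mono power_mono S_off p) auto
  also have "\<dots> \<le> 34 * \<epsilon>\<^sup>2 * cmod (A p)"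
    by (intro mult_right_mono) (auto simp: power2_eq_square)
  finally show ?thesis by (simp add: norm_mult)
qed

lemma A_approx: 
  assumes "p \<notin> nodes" shows "cmod (A p - of_real \<epsilon> * lap A p) \<le> 51 * \<epsilon>\<^sup>2 * cmod (A p)"
proof -
  have "A p - of_real \<epsilon> * lap A p = of_real (Q p) * A p + of_real (N p) * S p"
    using eqn_A[of p] by (simp add: algebra_simps)
  moreover have "cmod (of_real (Q p) * A p) \<le> 17 * \<epsilon>\<^sup>2 * cmod (A p)"
    using Q_off[OF assms] by (auto simp: norm_mult intro: mult_right_mono)
  ultimately show ?thesis
    using NS_off[OF assms] norm_triangle_ineq[of "of_real (Q p) * A p" "of_real (N p) * S p"] by simp
qed

lemma eps2: "\<epsilon>\<^sup>2 \<le> \<epsilon> / 1000"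
  using mult_left_mono[OF eps(2), of \<epsilon>] eps(1) by (simp add: power2_eq_square)

lemma bdd_A: "cmod (A p) \<le> 1 / 1000"
proof -
  have "cmod (\<Psi> p - \<Psi>' p) \<le> cmod (\<Psi> p - cross p) + cmod (\<Psi>' p - cross p)"
    by (metis norm_triangle_ineq4 diff_diff_eq2 diff_add_cancel add_diff_cancel)
  then show ?thesis using P.near[of p] P'.near[of p] by (simp add: A_def norm_divide)
qed

lemma S_near: "cmod (S p - cross p) \<le> 1 / 1000"
proof -
  have "S p - cross p = ((\<Psi> p - cross p) + (\<Psi>' p - cross p)) / 2" by (simp add: S_def field_simps)
  then have "cmod (S p - cross p) = cmod ((\<Psi> p - cross p) + (\<Psi>' p - cross p)) / 2"
    by (simp only: norm_divide) simp
  then show ?thesis using P.near[of p] P'.near[of p] norm_triangle_ineq[of "\<Psi> p - cross p" "\<Psi>' p - cross p"]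
    by linarith
qed

lemma A_off:
  assumes t: "\<And>p. p \<in> nodes \<Longrightarrow> cmod (A p) \<le> t" and p: "p \<notin> nodes"
  shows "cmod (A p) \<le> 4.1 * \<epsilon> * t"
proof -
  have "cmod (A p) \<le> 1.02 * 0 + 4.1 * \<epsilon> * t"
  proof (rule off_node_bound[where \<kappa> = "51 * \<epsilon>\<^sup>2", OF bdd_A t])
    fix q assume q: "q \<notin> nodes"
    have "cmod (A q) - cmod (of_real \<epsilon> * lap A q) \<le> 51 * \<epsilon>\<^sup>2 * cmod (A q)"
      using A_approx[OF q] norm_triangle_ineq2 order_trans by blast
    then show "(1 - 51 * \<epsilon>\<^sup>2) * cmod (A q) \<le> 0 + \<epsilon> * cmod (lap A q)"
      using eps by (simp add: norm_mult algebra_simps)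
  qed (use eps eps2 p in auto)
  then show ?thesis by simp
qed

text \<open>Equality of two solutions has to be checked on the four nodes only.\<close>

lemma A_zero:
  assumes t: "\<And>p. p \<in> nodes \<Longrightarrow> A p = 0" shows "\<Psi> p = \<Psi>' p"
proof -
  have "A p = 0" using A_off[of 0 p] t by (cases "p \<in> nodes") auto
  then show ?thesis by (simp add: A_def)
qed

end

context near_cross begin

text \<open>The stationary equation is invariant under lattice symmetries \<open>\<pi>\<close> and under isometries
  \<open>G\<close> of the plane of values. When \<open>(G, \<pi>)\<close> also fixes the limiting cross, the image of
  a solution near the cross is again one, and can be compared with the solution itself.\<close>

lemma symmetric_image:
  assumes lap: "\<And>p. lap (\<lambda>q. G (\<Psi> (\<pi> q))) p = G (lap \<Psi> (\<pi> p))" and norm: "\<And>z. cmod (G z) = cmod z"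
    and scale: "\<And>r z. G (of_real r * z) = of_real r * G z" and diff: "\<And>a b. G (a - b) = G a - G b"
    and fixed: "\<And>p. G (cross (\<pi> p)) = cross p"
  shows "near_cross \<epsilon> (\<lambda>p. G (\<Psi> (\<pi> p)))"
proof (unfold_locales; (rule eps)?)
  show "scalar_stationary \<epsilon> (\<lambda>p. G (\<Psi> (\<pi> p)))"
    unfolding scalar_stationary_def norm lap by (intro allI) (simp only: scale[symmetric] eqn)
  show "cmod (G (\<Psi> (\<pi> p)) - cross p) \<le> 1 / 1000" for p
    unfolding fixed[of p, symmetric] by (simp only: diff[symmetric] norm near)
qed

lemma point_reflect: "near_cross \<epsilon> (\<lambda>p. - \<Psi> (- fst p, - snd p))"
  by (rule symmetric_image[of uminus "\<lambda>p. (- fst p, - snd p)"])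
    (auto simp: lap_def cross_def algebra_simps split: prod.splits)

lemma rotate: "near_cross \<epsilon> (\<lambda>p. - \<i> * \<Psi> (- snd p, fst p))"
  by (rule symmetric_image[of "\<lambda>z. - \<i> * z" "\<lambda>p. (- snd p, fst p)"])
    (auto simp: lap_def cross_def norm_mult algebra_simps split: prod.splits)

lemma axis_reflect: "near_cross \<epsilon> (\<lambda>p. cnj (\<Psi> (fst p, - snd p)))"
  by (rule symmetric_image[of cnj "\<lambda>p. (fst p, - snd p)"])
    (auto simp: lap_def cross_def algebra_simps split: prod.splits)

lemma diagonal_reflect: "near_cross \<epsilon> (\<lambda>p. \<i> * cnj (\<Psi> (snd p, fst p)))"
  by (rule symmetric_image[of "\<lambda>z. \<i> * cnj z" "\<lambda>p. (snd p, fst p)"])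
    (auto simp: lap_def cross_def norm_mult algebra_simps split: prod.splits)

end

context near_cross_pair begin

text \<open>One step away from the nodes, to the next order: the value is \<open>\<epsilon>\<close> times the sum \<open>d\<close> of
  the neighbouring node values, up to a small multiple of \<open>\<epsilon>\<^sup>2\<close>.\<close>

lemma A_nbr:
  assumes t: "\<And>p. p \<in> nodes \<Longrightarrow> cmod (A p) \<le> t" and p: "p \<notin> nodes"
    and d: "cmod (lap A p - d) \<le> r"
  shows "cmod (A p - of_real \<epsilon> * d) \<le> \<epsilon> * r + 21/100 * \<epsilon>\<^sup>2 * t"
proof -
  have t0: "0 \<le> t" using t[of "(1,0)"] order_trans[OF norm_ge_zero] by (auto simp: nodes_eq)
  have "A p - of_real \<epsilon> * d = (A p - of_real \<epsilon> * lap A p) + of_real \<epsilon> * (lap A p - d)"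
    by (simp add: algebra_simps)
  then have "cmod (A p - of_real \<epsilon> * d) \<le> 51 * \<epsilon>\<^sup>2 * cmod (A p) + \<epsilon> * cmod (lap A p - d)"
  proof (elim ssubst)
    show "cmod ((A p - of_real \<epsilon> * lap A p) + of_real \<epsilon> * (lap A p - d)) \<le> 51 * \<epsilon>\<^sup>2 * cmod (A p) + \<epsilon> * cmod (lap A p - d)"
      using A_approx[OF p] norm_triangle_ineq[of "A p - of_real \<epsilon> * lap A p" "of_real \<epsilon> * (lap A p - d)"] eps
      by (simp add: norm_mult)
  qed
  moreover have "51 * \<epsilon>\<^sup>2 * cmod (A p) \<le> 51 * \<epsilon>\<^sup>2 * (4.1 * (1/1000) * t)"
    by (intro mult_left_mono order_trans[OF A_off[OF t p]] mult_right_mono) (use eps t0 in auto)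
  moreover have "\<epsilon> * cmod (lap A p - d) \<le> \<epsilon> * r" using d eps by (intro mult_left_mono) auto
  moreover have "0 \<le> \<epsilon>\<^sup>2 * t" using t0 by simp
  ultimately show ?thesis by (simp add: algebra_simps)
qed

lemma S_nbr:
  assumes p: "p \<notin> nodes" and d: "cmod (lap S p - d) \<le> r"
  shows "cmod (S p - of_real \<epsilon> * d) \<le> \<epsilon> * r + 21/100 * \<epsilon>\<^sup>2"
proof -
  have "S p - of_real \<epsilon> * d = of_real (Q p) * S p + of_real (N p) * A p + of_real \<epsilon> * (lap S p - d)"
    using eqn_S[of p] by (simp add: algebra_simps)
  then have "cmod (S p - of_real \<epsilon> * d) \<le> Q p * cmod (S p) + \<bar>N p\<bar> * cmod (A p) + \<epsilon> * cmod (lap S p - d)"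
    using Q_off[OF p] eps norm_triangle_ineq[of "of_real (Q p) * S p + of_real (N p) * A p" "of_real \<epsilon> * (lap S p - d)"]
      norm_triangle_ineq[of "of_real (Q p) * S p" "of_real (N p) * A p"]
    by (simp add: norm_mult)
  moreover have "Q p * cmod (S p) \<le> 17 * \<epsilon>\<^sup>2 * (4.1 * \<epsilon>)"
    using Q_off[OF p] S_off[OF p] eps by (intro mult_mono) auto
  moreover have "17 * \<epsilon>\<^sup>2 * (4.1 * \<epsilon>) = 69.7 * (\<epsilon> * \<epsilon>\<^sup>2)" by simp
  moreover have "\<bar>N p\<bar> * cmod (A p) \<le> (2 * (4.1 * \<epsilon>) * (4.1 * \<epsilon>)) * (4.1 * \<epsilon>)"
    using S_off[OF p] A_off0[OF p] eps
    by (intro mult_mono order_trans[OF abs_N]) auto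
  moreover have "(2 * (4.1 * \<epsilon>) * (4.1 * \<epsilon>)) * (4.1 * \<epsilon>) \<le> 138 * (\<epsilon> * \<epsilon>\<^sup>2)"
    using eps by (simp add: power2_eq_square)
  moreover have "\<epsilon> * cmod (lap S p - d) \<le> \<epsilon> * r" using d eps by (intro mult_left_mono) auto
  moreover have "\<epsilon> * \<epsilon>\<^sup>2 \<le> (1/1000) * \<epsilon>\<^sup>2" using eps by (intro mult_right_mono) auto
  moreover have "0 \<le> \<epsilon>\<^sup>2" by simp
  ultimately show ?thesis by linarith
qed

end

text \<open>Here \<open>x\<close> and \<open>p\<close> are the odd and even parts of a solution at the node \<open>(-1,0)\<close>, and \<open>q\<close> is
  the even part at \<open>(0,-1)\<close>. As \<open>p\<^sup>2 - x\<^sup>2\<close> is close to \<open>-1\<close>, the node equation makes the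
  component of \<open>p\<close> along \<open>x\<close> of size \<open>\<epsilon>\<^sup>2\<close>: the amplitude of the cross is rigid.\<close>

lemma node_alg_re:
  assumes x: "cmod (x - 1) \<le> 1/1000" and p: "cmod p \<le> t" and q: "cmod q \<le> t" and t: "t \<le> 1/1000"
    and e: "0 < \<epsilon>" "\<epsilon> \<le> 1/1000"
    and eq: "cmod (of_real (2 * Re (x * cnj p)) * (p\<^sup>2 - x\<^sup>2) - of_real (\<epsilon>\<^sup>2) * x * (2 * p + 4 * q)) \<le> 70 * \<epsilon>^3 * t"
  shows "\<bar>Re (x * cnj p)\<bar> \<le> 4 * \<epsilon>\<^sup>2 * t"
proof -
  have t0: "0 \<le> t" using p norm_ge_zero order_trans by blast
  have x1: "cmod x \<le> 1001/1000" "999/1000 \<le> cmod x"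
    using x norm_triangle_ineq2[of x 1] norm_triangle_ineq2[of 1 x] by (auto simp: norm_minus_commute)
  have "(999/1000)\<^sup>2 \<le> (cmod x)\<^sup>2" using x1 by (intro power_mono) auto
  moreover have "(cmod p)\<^sup>2 \<le> (1/1000)\<^sup>2" using p t by (intro power_mono) auto
  moreover have "(cmod x)\<^sup>2 - (cmod p)\<^sup>2 \<le> cmod (p\<^sup>2 - x\<^sup>2)"
    using norm_triangle_ineq2[of "x\<^sup>2" "p\<^sup>2"] by (simp add: norm_power norm_minus_commute)
  ultimately have d: "0.99 \<le> cmod (p\<^sup>2 - x\<^sup>2)" by (simp add: power2_eq_square)
  have "cmod (2 * p + 4 * q) \<le> 6 * t"
    using p q norm_triangle_ineq[of "2 * p" "4 * q"] by (simp add: norm_mult)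
  then have "cmod (of_real (\<epsilon>\<^sup>2) * x * (2 * p + 4 * q)) \<le> \<epsilon>\<^sup>2 * (1001/1000) * (6 * t)"
    unfolding norm_mult using x1 by (intro mult_mono) (auto simp: norm_power)
  then have "cmod (of_real (\<epsilon>\<^sup>2) * x * (2 * p + 4 * q)) \<le> 6006/1000 * (\<epsilon>\<^sup>2 * t)" by (simp add: mult.commute)
  moreover have "70 * \<epsilon>^3 * t \<le> 70 * (\<epsilon>\<^sup>2 * (1/1000)) * t"
    unfolding power3_eq_cube power2_eq_square using e t0 by (intro mult_right_mono mult_left_mono) auto
  then have "70 * \<epsilon>^3 * t \<le> 7/100 * (\<epsilon>\<^sup>2 * t)" by simp
  ultimately have "cmod (of_real (2 * Re (x * cnj p)) * (p\<^sup>2 - x\<^sup>2)) \<le> 61/10 * (\<epsilon>\<^sup>2 * t)"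
    using eq norm_triangle_sub[of "of_real (2 * Re (x * cnj p)) * (p\<^sup>2 - x\<^sup>2)" "of_real (\<epsilon>\<^sup>2) * x * (2 * p + 4 * q)"]
      mult_nonneg_nonneg[OF zero_le_power2[of \<epsilon>] t0]
    by linarith
  moreover have "cmod (of_real (2 * Re (x * cnj p)) * (p\<^sup>2 - x\<^sup>2)) = 2 * \<bar>Re (x * cnj p)\<bar> * cmod (p\<^sup>2 - x\<^sup>2)"
    by (simp only: norm_mult norm_of_real abs_mult abs_numeral)
  moreover have "2 * \<bar>Re (x * cnj p)\<bar> * 0.99 \<le> 2 * \<bar>Re (x * cnj p)\<bar> * cmod (p\<^sup>2 - x\<^sup>2)"
    using d by (intro mult_left_mono) auto
  moreover have "0 \<le> \<epsilon>\<^sup>2 * t" using t0 by simp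
  ultimately show ?thesis by simp
qed

text \<open>The component of \<open>p\<close> across \<open>x\<close> is a phase, and is seen only at order \<open>\<epsilon>\<^sup>2\<close>: multiplied by
  \<open>cnj x\<close> squared, the node equation has the imaginary part \<open>\<epsilon>\<^sup>2 (2 Im w + 4 Im (q cnj x))\<close> up to
  smaller terms, \<open>w = cnj x p\<close>. Since \<open>q\<close> is nearly orthogonal to \<open>y\<close>, which is close to \<open>\<i>\<close>, while
  \<open>x\<close> is close to \<open>1\<close>, the second term is small as well.\<close>

lemma node_alg_im:
  assumes x: "cmod (x - 1) \<le> 1/1000" and y: "cmod (y - \<i>) \<le> 1/1000"
    and p: "cmod p \<le> t" and q: "cmod q \<le> t" and t: "t \<le> 1/1000"
    and e: "0 < \<epsilon>" "\<epsilon> \<le> 1/1000"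
    and eq: "cmod (of_real (2 * Re (x * cnj p)) * (p\<^sup>2 - x\<^sup>2) - of_real (\<epsilon>\<^sup>2) * x * (2 * p + 4 * q)) \<le> 70 * \<epsilon>^3 * t"
    and rq: "\<bar>Re (y * cnj q)\<bar> \<le> 4 * \<epsilon>\<^sup>2 * t"
  shows "cmod p \<le> t / 10"
proof -
  have t0: "0 \<le> t" using p norm_ge_zero order_trans by blast
  have x1: "cmod x \<le> 1001/1000" "999/1000 \<le> cmod x"
    using x norm_triangle_ineq2[of x 1] norm_triangle_ineq2[of 1 x] by (auto simp: norm_minus_commute)
  note rp = node_alg_re[OF x p q t e eq]
  define err where "err = of_real (2 * Re (x * cnj p)) * (p\<^sup>2 - x\<^sup>2) - of_real (\<epsilon>\<^sup>2) * x * (2 * p + 4 * q)"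
  define w where "w = cnj x * p"
  define X where "X = (cmod x)\<^sup>2"
  have X: "x * cnj x = of_real X" unfolding X_def by (simp only: complex_norm_square)
  have X1: "0.99 \<le> X" "X \<le> 1.01"
    using power_mono[OF x1(1), of 2] power_mono[OF x1(2), of 2] by (auto simp: X_def power2_eq_square)
  have Rew: "Re w = Re (x * cnj p)" by (simp add: w_def algebra_simps)
  have "err * (cnj x)\<^sup>2 = of_real (2 * Re w) * (w\<^sup>2 - of_real (X\<^sup>2)) - of_real (\<epsilon>\<^sup>2 * X) * (2 * w + 4 * (q * cnj x))"
    unfolding err_def Rew of_real_power of_real_mult X[symmetric] w_def by (simp add: algebra_simps power2_eq_square)
  then have im: "Im (err * (cnj x)\<^sup>2) = 2 * Re w * Im (w\<^sup>2) - \<epsilon>\<^sup>2 * X * (2 * Im w + 4 * Im (q * cnj x))"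
    by (simp del: of_real_power of_real_mult)
  have "\<bar>Im (err * (cnj x)\<^sup>2)\<bar> \<le> cmod err * X"
    using abs_Im_le_cmod[of "err * (cnj x)\<^sup>2"] by (simp add: norm_mult norm_power X_def)
  also have "\<dots> \<le> (70 * \<epsilon>^3 * t) * X" using eq X1 by (intro mult_right_mono) (auto simp: err_def)
  finally have err: "\<bar>Im (err * (cnj x)\<^sup>2)\<bar> \<le> X * (70 * \<epsilon>^3 * t)" by (simp add: mult_ac)
  have "cmod (w\<^sup>2) \<le> X * (1/1000)\<^sup>2" using p t
    by (auto simp: w_def norm_mult norm_power power_mult_distrib X_def intro!: mult_left_mono power_mono)
  then have "\<bar>Im (w\<^sup>2)\<bar> \<le> X * (1/1000)\<^sup>2" using abs_Im_le_cmod order_trans by blast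
  then have w2: "\<bar>2 * Re w * Im (w\<^sup>2)\<bar> \<le> 2 * (4 * \<epsilon>\<^sup>2 * t) * (X * (1/1000)\<^sup>2)"
    unfolding abs_mult Rew using rp t0 by (intro mult_mono) auto
  have "q * cnj x = \<i> * (q * cnj y) + q * (cnj (x - 1) + (- \<i>) * cnj (y - \<i>))" by (simp add: algebra_simps)
  then have "\<bar>Im (q * cnj x)\<bar> \<le> \<bar>Re (q * cnj y)\<bar> + cmod (q * (cnj (x - 1) + (- \<i>) * cnj (y - \<i>)))"
    using abs_Im_le_cmod[of "q * (cnj (x - 1) + (- \<i>) * cnj (y - \<i>))"] by simp
  also have "cmod (q * (cnj (x - 1) + (- \<i>) * cnj (y - \<i>))) \<le> t * (2/1000)"
    unfolding norm_mult using x y q norm_triangle_ineq[of "cnj (x - 1)" "(- \<i>) * cnj (y - \<i>)"]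
    by (intro mult_mono) (auto simp: norm_mult t0 simp del: complex_cnj_diff)
  also have "Re (q * cnj y) = Re (y * cnj q)" by (simp add: algebra_simps)
  finally have "\<bar>Im (q * cnj x)\<bar> \<le> 4 * \<epsilon>\<^sup>2 * t + t * (2/1000)" using rq by simp
  moreover have e2: "\<epsilon>\<^sup>2 \<le> 1/1000000" using power_mono[OF e(2), of 2] e by (simp add: power2_eq_square)
  then have "\<epsilon>\<^sup>2 * t \<le> 1/1000000 * t" by (rule mult_right_mono) (fact t0)
  ultimately have qx: "\<bar>Im (q * cnj x)\<bar> \<le> 21/10000 * t" using t0 by linarith
  have "\<bar>\<epsilon>\<^sup>2 * X * (2 * Im w + 4 * Im (q * cnj x))\<bar> \<le> X * (70 * \<epsilon>^3 * t) + 2 * (4 * \<epsilon>\<^sup>2 * t) * (X * (1/1000)\<^sup>2)"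
    using im err w2 by linarith
  also have "\<dots> = \<epsilon>\<^sup>2 * X * (70 * \<epsilon> * t + 8 * t * (1/1000)\<^sup>2)"
    by (simp add: algebra_simps power2_eq_square power3_eq_cube)
  finally have "\<epsilon>\<^sup>2 * X * \<bar>2 * Im w + 4 * Im (q * cnj x)\<bar> \<le> \<epsilon>\<^sup>2 * X * (70 * \<epsilon> * t + 8 * t * (1/1000)\<^sup>2)"
    using X1 by (simp add: abs_mult)
  then have "\<bar>2 * Im w + 4 * Im (q * cnj x)\<bar> \<le> 70 * \<epsilon> * t + 8 * t * (1/1000)\<^sup>2"
    using e X1 by (subst (asm) mult_le_cancel_left_pos) auto
  moreover have "70 * \<epsilon> * t \<le> (7/100) * t" using e t0 by (intro mult_right_mono) auto
  moreover have "8 * t * (1/1000)\<^sup>2 \<le> 1/1000 * t" using t0 by (simp add: power2_eq_square)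
  ultimately have "\<bar>Im w\<bar> \<le> 5/100 * t" using qx t0 by linarith
  moreover have "\<bar>Re w\<bar> \<le> 0.001 * t" using rp \<open>\<epsilon>\<^sup>2 * t \<le> 1/1000000 * t\<close> t0 by (simp add: Rew)
  ultimately have "cmod w \<le> 0.06 * t" using cmod_le[of w] t0 by simp
  moreover have "0.99 * cmod p \<le> cmod w" using mult_right_mono[of "0.99" "cmod x" "cmod p"] x1 by (simp add: w_def norm_mult)
  ultimately show ?thesis using t0 by simp
qed

context near_cross_pair begin

text \<open>A node influences itself through its three neighbours other than the origin. Each contributes
  \<open>\<epsilon>\<close> times the node value, and the contributions of the two adjacent nodes cancel by oddness.\<close>

lemma lap_S_node:
  assumes o: "S (1,0) = - S (-1,0)" "S (0,1) = - S (0,-1)" "S (0,0) = 0"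
  shows "cmod (lap S (-1,0) - of_real \<epsilon> * (3 * S (-1,0))) \<le> 32 * \<epsilon>\<^sup>2"
proof -
  define x where "x = S (-1,0)"
  define y where "y = S (0,-1)"
  have vS: "S (-1,0) = x" "S (1,0) = - x" "S (0,-1) = y" "S (0,1) = - y" "S (0,0) = 0"
    by (simp_all add: x_def y_def o)
  have two': "cmod (a + b) \<le> 2 * (41/10 * \<epsilon>)" if "cmod a \<le> 41/10 * \<epsilon>" "cmod b \<le> 41/10 * \<epsilon>" for a b
    using that norm_triangle_ineq[of a b] by linarith
  have three': "cmod (a + b + c) \<le> 3 * (41/10 * \<epsilon>)" if "cmod a \<le> 41/10 * \<epsilon>" "cmod b \<le> 41/10 * \<epsilon>" "cmod c \<le> 41/10 * \<epsilon>" for a b c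
    using that norm_triangle_ineq[of a b] norm_triangle_ineq[of "a + b" c] by linarith
  note Soff = S_off
  have S2: "cmod (S (-2,0) - of_real \<epsilon> * x) \<le> \<epsilon> * (3 * (41/10 * \<epsilon>)) + 21/100 * \<epsilon>\<^sup>2"
  proof (rule S_nbr)
    have "lap S (-2,0) - x = S (-3,0) + S (-2,1) + S (-2,-1)" by (simp add: lap_def vS)
    then show "cmod (lap S (-2,0) - x) \<le> 3 * (41/10 * \<epsilon>)"
      using three'[OF Soff Soff Soff, of "(-3,0)" "(-2,1)" "(-2,-1)"] by (simp add: nodes_eq)
  qed (auto simp: nodes_eq)
  have S3: "cmod (S (-1,1) - of_real \<epsilon> * (x - y)) \<le> \<epsilon> * (2 * (41/10 * \<epsilon>)) + 21/100 * \<epsilon>\<^sup>2"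
  proof (rule S_nbr)
    have "lap S (-1,1) - (x - y) = S (-2,1) + S (-1,2)" by (simp add: lap_def vS)
    then show "cmod (lap S (-1,1) - (x - y)) \<le> 2 * (41/10 * \<epsilon>)"
      using two'[OF Soff Soff, of "(-2,1)" "(-1,2)"] by (simp add: nodes_eq)
  qed (auto simp: nodes_eq)
  have S4: "cmod (S (-1,-1) - of_real \<epsilon> * (x + y)) \<le> \<epsilon> * (2 * (41/10 * \<epsilon>)) + 21/100 * \<epsilon>\<^sup>2"
  proof (rule S_nbr)
    have "lap S (-1,-1) - (x + y) = S (-2,-1) + S (-1,-2)" by (simp add: lap_def vS)
    then show "cmod (lap S (-1,-1) - (x + y)) \<le> 2 * (41/10 * \<epsilon>)"
      using two'[OF Soff Soff, of "(-2,-1)" "(-1,-2)"] by (simp add: nodes_eq)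
  qed (auto simp: nodes_eq)
  have lapS: "lap S (-1,0) = S (-2,0) + S (-1,1) + S (-1,-1)"
    by (simp add: lap_def vS)
  have "cmod (lap S (-1,0) - of_real \<epsilon> * (3 * x)) \<le> 32 * \<epsilon>\<^sup>2"
  proof -
    have "lap S (-1,0) - of_real \<epsilon> * (3 * x) = (S (-2,0) - of_real \<epsilon> * x)
       + (S (-1,1) - of_real \<epsilon> * (x - y)) + (S (-1,-1) - of_real \<epsilon> * (x + y)) + 0"
      unfolding lapS by (simp add: algebra_simps)
    also have "cmod \<dots> \<le> \<epsilon> * (7 * (41/10 * \<epsilon>)) + 3 * (21/100 * \<epsilon>\<^sup>2)"
      using S2 S3 S4 by (intro order_trans[OF norm_add4]) simp
    also have "\<dots> \<le> 32 * \<epsilon>\<^sup>2" by (simp add: power2_eq_square)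
    finally show ?thesis .
  qed
  then show ?thesis by (simp only: x_def)
qed

end

context near_cross begin

text \<open>The equations for the odd and the even part at a node have the same coefficient \<open>1 - Q\<close>.
  Eliminating it leaves an equation without terms of order \<open>\<epsilon>\<close>.\<close>

lemma node_equation:
  assumes t: "\<And>p. p \<in> nodes \<Longrightarrow> cmod ((\<Psi> p + \<Psi> (- fst p, - snd p)) / 2) \<le> t"
    and p: "p = (\<Psi> (-1, 0) + \<Psi> (1, 0)) / 2" and q: "q = (\<Psi> (0, -1) + \<Psi> (0, 1)) / 2"
    and x: "x = (\<Psi> (-1, 0) - \<Psi> (1, 0)) / 2"
  shows "cmod (of_real (2 * Re (x * cnj p)) * (p\<^sup>2 - x\<^sup>2) - of_real (\<epsilon>\<^sup>2) * x * (2 * p + 4 * q)) \<le> 70 * \<epsilon>^3 * t"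
proof -
  interpret PP: near_cross_pair \<epsilon> \<Psi> "\<lambda>p. - \<Psi> (- fst p, - snd p)"
    using point_reflect near_cross_axioms by (simp add: near_cross_pair_def)
  have tA: "cmod (PP.A a) \<le> t" if "a \<in> nodes" for a using t[OF that] by (simp add: PP.A_def)
  have t0: "0 \<le> t" using tA[of "(1,0)"] order_trans[OF norm_ge_zero] by (auto simp: nodes_eq)
  note Aoff = PP.A_off[OF tA]
  define y where "y = (\<Psi> (0, -1) - \<Psi> (0, 1)) / 2"
  have vA: "PP.A (-1,0) = p" "PP.A (1,0) = p" "PP.A (0,-1) = q" "PP.A (0,1) = q"
    by (auto simp: PP.A_def p q)
  have vS: "PP.S (-1,0) = x" "PP.S (1,0) = - x" "PP.S (0,-1) = y" "PP.S (0,1) = - y" "PP.S (0,0) = 0"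
    by (auto simp: PP.S_def x y_def field_simps)
  have two: "cmod (a + b) \<le> 2 * (41/10 * \<epsilon> * t)" if "cmod a \<le> 41/10 * \<epsilon> * t" "cmod b \<le> 41/10 * \<epsilon> * t" for a b
    using that norm_triangle_ineq[of a b] by linarith
  have three: "cmod (a + b + c) \<le> 3 * (41/10 * \<epsilon> * t)" if "cmod a \<le> 41/10 * \<epsilon> * t" "cmod b \<le> 41/10 * \<epsilon> * t" "cmod c \<le> 41/10 * \<epsilon> * t" for a b c
    using that norm_triangle_ineq[of a b] norm_triangle_ineq[of "a + b" c] by linarith
  have A1: "cmod (PP.A (0,0) - of_real \<epsilon> * (2 * p + 2 * q)) \<le> \<epsilon> * 0 + 21/100 * \<epsilon>\<^sup>2 * t"
    by (rule PP.A_nbr[OF tA]) (auto simp: nodes_eq lap_def vA)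
  have A2: "cmod (PP.A (-2,0) - of_real \<epsilon> * p) \<le> \<epsilon> * (3 * (41/10 * \<epsilon> * t)) + 21/100 * \<epsilon>\<^sup>2 * t"
  proof (rule PP.A_nbr[OF tA])
    have "lap PP.A (-2,0) - p = PP.A (-3,0) + PP.A (-2,1) + PP.A (-2,-1)" by (simp add: lap_def vA)
    then show "cmod (lap PP.A (-2,0) - p) \<le> 3 * (41/10 * \<epsilon> * t)"
      using three[OF Aoff Aoff Aoff, of "(-3,0)" "(-2,1)" "(-2,-1)"] by (simp add: nodes_eq)
  qed (auto simp: nodes_eq)
  have A3: "cmod (PP.A (-1,1) - of_real \<epsilon> * (p + q)) \<le> \<epsilon> * (2 * (41/10 * \<epsilon> * t)) + 21/100 * \<epsilon>\<^sup>2 * t"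
  proof (rule PP.A_nbr[OF tA])
    have "lap PP.A (-1,1) - (p + q) = PP.A (-2,1) + PP.A (-1,2)" by (simp add: lap_def vA)
    then show "cmod (lap PP.A (-1,1) - (p + q)) \<le> 2 * (41/10 * \<epsilon> * t)"
      using two[OF Aoff Aoff, of "(-2,1)" "(-1,2)"] by (simp add: nodes_eq)
  qed (auto simp: nodes_eq)
  have A4: "cmod (PP.A (-1,-1) - of_real \<epsilon> * (p + q)) \<le> \<epsilon> * (2 * (41/10 * \<epsilon> * t)) + 21/100 * \<epsilon>\<^sup>2 * t"
  proof (rule PP.A_nbr[OF tA])
    have "lap PP.A (-1,-1) - (p + q) = PP.A (-2,-1) + PP.A (-1,-2)" by (simp add: lap_def vA)
    then show "cmod (lap PP.A (-1,-1) - (p + q)) \<le> 2 * (41/10 * \<epsilon> * t)"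
      using two[OF Aoff Aoff, of "(-2,-1)" "(-1,-2)"] by (simp add: nodes_eq)
  qed (auto simp: nodes_eq)
  have lapA: "lap PP.A (-1,0) = PP.A (0,0) + PP.A (-2,0) + PP.A (-1,1) + PP.A (-1,-1)"
    by (simp add: lap_def)
  have "cmod (lap PP.A (-1,0) - of_real \<epsilon> * (5 * p + 4 * q)) \<le> 32 * \<epsilon>\<^sup>2 * t"
  proof -
    have "lap PP.A (-1,0) - of_real \<epsilon> * (5 * p + 4 * q) = (PP.A (0,0) - of_real \<epsilon> * (2 * p + 2 * q))
      + (PP.A (-2,0) - of_real \<epsilon> * p) + (PP.A (-1,1) - of_real \<epsilon> * (p + q)) + (PP.A (-1,-1) - of_real \<epsilon> * (p + q))"
      unfolding lapA by (simp add: algebra_simps)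
    also have "cmod \<dots> \<le> \<epsilon> * (7 * (41/10 * \<epsilon> * t)) + 4 * (21/100 * \<epsilon>\<^sup>2 * t)"
      using A1 A2 A3 A4 by (intro order_trans[OF norm_add4]) (simp add: algebra_simps)
    also have "\<dots> \<le> 32 * \<epsilon>\<^sup>2 * t" using t0 eps by (simp add: power2_eq_square)
    finally show ?thesis .
  qed
  moreover define e1 where "e1 = lap PP.A (-1,0) - of_real \<epsilon> * (5 * p + 4 * q)"
  ultimately have e1: "lap PP.A (-1,0) = of_real \<epsilon> * (5 * p + 4 * q) + e1" "cmod e1 \<le> 32 * \<epsilon>\<^sup>2 * t"
    by simp_all
  have "cmod (lap PP.S (-1,0) - of_real \<epsilon> * (3 * PP.S (-1,0))) \<le> 32 * \<epsilon>\<^sup>2"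
    by (rule PP.lap_S_node) (simp_all add: vS)
  then have "cmod (lap PP.S (-1,0) - of_real \<epsilon> * (3 * x)) \<le> 32 * \<epsilon>\<^sup>2" by (simp only: vS)
  moreover define e2 where "e2 = lap PP.S (-1,0) - of_real \<epsilon> * (3 * x)"
  ultimately have e2: "lap PP.S (-1,0) = of_real \<epsilon> * (3 * x) + e2" "cmod e2 \<le> 32 * \<epsilon>\<^sup>2"
    by simp_all
  have N: "PP.N (-1,0) = 2 * Re (x * cnj p)" by (simp only: PP.N_eq vA vS)
  define n where "n = (of_real (2 * Re (x * cnj p)) :: complex)"
  define c where "c = (of_real (1 - PP.Q (-1,0)) :: complex)"
  have q1: "c * p - n * x = of_real \<epsilon> * (of_real \<epsilon> * (5 * p + 4 * q) + e1)"
    using PP.eqn_A[of "(-1,0)"] unfolding N vA vS e1(1) c_def n_def .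
  have q2: "c * x - n * p = of_real \<epsilon> * (of_real \<epsilon> * (3 * x) + e2)"
    using PP.eqn_S[of "(-1,0)"] unfolding N vA vS e2(1) c_def n_def .
  \<comment> \<open>the coefficient c cancels\<close>
  have "n * (p\<^sup>2 - x\<^sup>2) = x * (c * p - n * x) - p * (c * x - n * p)"
    by (simp add: algebra_simps power2_eq_square)
  also have "\<dots> = of_real (\<epsilon>\<^sup>2) * x * (2 * p + 4 * q) + of_real \<epsilon> * (x * e1 - p * e2)"
    unfolding q1 q2 by (simp add: algebra_simps power2_eq_square)
  finally have "n * (p\<^sup>2 - x\<^sup>2) - of_real (\<epsilon>\<^sup>2) * x * (2 * p + 4 * q) = of_real \<epsilon> * (x * e1 - p * e2)" by simp
  then have "cmod (n * (p\<^sup>2 - x\<^sup>2) - of_real (\<epsilon>\<^sup>2) * x * (2 * p + 4 * q)) = \<epsilon> * cmod (x * e1 - p * e2)"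
    using eps by (simp only: norm_mult norm_of_real abs_of_pos)
  also have "\<dots> \<le> \<epsilon> * (1001/1000 * (32 * \<epsilon>\<^sup>2 * t) + t * (32 * \<epsilon>\<^sup>2))"
  proof (intro mult_left_mono order_trans[OF norm_triangle_ineq4] add_mono)
    have "cmod x \<le> 1001/1000" using PP.S_near[of "(-1,0)"] norm_triangle_ineq2[of x 1]
      by (simp add: vS cross_def)
    then show "cmod (x * e1) \<le> 1001/1000 * (32 * \<epsilon>\<^sup>2 * t)"
      unfolding norm_mult using e1(2) t0 by (intro mult_mono) auto
    show "cmod (p * e2) \<le> t * (32 * \<epsilon>\<^sup>2)"
      unfolding norm_mult using e2(2) t0 tA[of "(-1,0)"] by (intro mult_mono) (auto simp: vA nodes_eq)
  qed (use eps in auto)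
  also have "\<dots> = 64032/1000 * \<epsilon>^3 * t" by (simp add: power2_eq_square power3_eq_cube)
  also have "\<dots> \<le> 70 * \<epsilon>^3 * t" using eps t0 by (intro mult_right_mono) auto
  finally show ?thesis unfolding n_def .
qed

text \<open>The even parts \<open>p\<close>, \<open>q\<close> at two adjacent nodes satisfy two node equations which are exchanged by a
  quarter turn. Together these give \<open>t \<le> t/10\<close> for \<open>t = max \<bar>p\<bar> \<bar>q\<bar>\<close>.\<close>

theorem odd: "\<Psi> (- n, - m) = - \<Psi> (n, m)"
proof -
  interpret PP: near_cross_pair \<epsilon> \<Psi> "\<lambda>p. - \<Psi> (- fst p, - snd p)"
    using point_reflect near_cross_axioms by (simp add: near_cross_pair_def)
  interpret R: near_cross \<epsilon> "\<lambda>p. - \<i> * \<Psi> (- snd p, fst p)" by (rule rotate)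
  define p q x y where defs: "p = (\<Psi> (-1, 0) + \<Psi> (1, 0)) / 2" "q = (\<Psi> (0, -1) + \<Psi> (0, 1)) / 2"
    "x = (\<Psi> (-1, 0) - \<Psi> (1, 0)) / 2" "y = (\<Psi> (0, -1) - \<Psi> (0, 1)) / 2"
  define t where "t = max (cmod p) (cmod q)"
  have nd: "cmod ((\<Psi> a + \<Psi> (- fst a, - snd a)) / 2) \<le> t" if "a \<in> nodes" for a
    using that by (auto simp: nodes_eq t_def defs add.commute)
  have "cmod (PP.A a) \<le> 1/1000" for a by (rule PP.bdd_A)
  from this[of "(-1,0)"] this[of "(0,-1)"] have t: "t \<le> 1/1000"
    by (auto simp: t_def PP.A_def defs)
  have x: "cmod (x - 1) \<le> 1/1000" using PP.S_near[of "(-1,0)"] by (simp add: PP.S_def defs cross_def)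
  have y: "cmod (y - \<i>) \<le> 1/1000" using PP.S_near[of "(0,-1)"] by (simp add: PP.S_def defs cross_def)
  have pt: "cmod p \<le> t" and qt: "cmod q \<le> t" by (auto simp: t_def)
  note e1 = node_equation[OF nd defs(1-3)]
  have "cmod (of_real (2 * Re ((- \<i> * y) * cnj (- \<i> * q))) * ((- \<i> * q)\<^sup>2 - (- \<i> * y)\<^sup>2)
      - of_real (\<epsilon>\<^sup>2) * (- \<i> * y) * (2 * (- \<i> * q) + 4 * (- \<i> * p))) \<le> 70 * \<epsilon>^3 * t"
  proof (rule R.node_equation)
    fix a assume a: "a \<in> nodes"
    have "(- \<i> * \<Psi> (- snd a, fst a) + - \<i> * \<Psi> (- snd (- fst a, - snd a), fst (- fst a, - snd a))) / 2 =
      - \<i> * ((\<Psi> (- snd a, fst a) + \<Psi> (snd a, - fst a)) / 2)" by (simp add: algebra_simps)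
    then show "cmod ((- \<i> * \<Psi> (- snd a, fst a) + - \<i> * \<Psi> (- snd (- fst a, - snd a), fst (- fst a, - snd a))) / 2) \<le> t"
      using nd[of "(- snd a, fst a)"] a by (simp only: norm_mult) (auto simp: nodes_eq)
  qed (auto simp: defs algebra_simps)
  note e2 = this
  have x': "cmod (- \<i> * y - 1) \<le> 1/1000"
  proof -
    have "- \<i> * y - 1 = - \<i> * (y - \<i>)" by (simp add: algebra_simps)
    then show ?thesis using y by (simp only: norm_mult) simp
  qed
  have y': "cmod (\<i> * x - \<i>) \<le> 1/1000"
  proof -
    have "\<i> * x - \<i> = \<i> * (x - 1)" by (simp add: algebra_simps)
    then show ?thesis using x by (simp only: norm_mult) simp
  qed
  have iq: "cmod (- \<i> * q) \<le> t" "cmod (- \<i> * p) \<le> t" "cmod (\<i> * p) \<le> t" using pt qt by (auto simp: norm_mult)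
  have "\<bar>Re ((- \<i> * y) * cnj (- \<i> * q))\<bar> \<le> 4 * \<epsilon>\<^sup>2 * t"
    by (rule node_alg_re[OF x' iq(1,2) t eps e2])
  then have r2: "\<bar>Re (y * cnj q)\<bar> \<le> 4 * \<epsilon>\<^sup>2 * t" by simp
  have r1: "\<bar>Re (x * cnj p)\<bar> \<le> 4 * \<epsilon>\<^sup>2 * t"
    by (rule node_alg_re[OF x pt qt t eps e1])
  then have r1': "\<bar>Re ((\<i> * x) * cnj (- \<i> * p))\<bar> \<le> 4 * \<epsilon>\<^sup>2 * t" by simp
  have "cmod p \<le> t / 10" by (rule node_alg_im[OF x y pt qt t eps e1 r2])
  moreover have "cmod (- \<i> * q) \<le> t / 10" by (rule node_alg_im[OF x' y' iq(1,2) t eps e2 r1'])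
  ultimately have "t \<le> t / 10" by (subst t_def) (simp add: norm_mult)
  then have "t \<le> 0" by simp
  with pt qt have "cmod p \<le> 0" "cmod q \<le> 0" by linarith+
  then have "p = 0" "q = 0" by simp_all
  then have "\<Psi> (1, 0) = - \<Psi> (-1, 0)" "\<Psi> (0, 1) = - \<Psi> (0, -1)" by (auto simp: defs eq_neg_iff_add_eq_0 add.commute)
  then have "\<Psi> (n, m) = - \<Psi> (- fst (n, m), - snd (n, m))"
    by (intro PP.A_zero) (auto simp: PP.A_def nodes_eq)
  then show ?thesis by simp
qed

end

section \<open>Reflection and rotation symmetry of the vortex cross\<close>

text \<open>If \<open>A\<close> is real on the nodes then \<open>Im A\<close> is generated only by the term \<open>N Im S\<close> off the nodes,
  where \<open>S\<close>, \<open>A\<close> and \<open>N\<close> carry one, one and two factors \<open>\<epsilon>\<close>.\<close>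

lemma (in near_cross_pair) imag_A_bound:
  assumes t: "\<And>p. p \<in> nodes \<Longrightarrow> cmod (A p) \<le> t" and Im0: "\<And>p. p \<in> nodes \<Longrightarrow> Im (A p) = 0"
  shows "\<bar>Im (A p)\<bar> \<le> 150 * \<epsilon>^3 * t"
    and "p \<notin> nodes \<Longrightarrow> \<bar>N p * Im (S p)\<bar> \<le> \<bar>Im (A p)\<bar> + \<epsilon> * \<bar>Im (lap A p)\<bar>"
    and "p \<notin> nodes \<Longrightarrow> N p = 0 \<Longrightarrow> 99/100 * \<bar>Im (A p)\<bar> \<le> \<epsilon> * \<bar>Im (lap A p)\<bar>"
proof -
  have t0: "0 \<le> t" using t[of "(1,0)"] order_trans[OF norm_ge_zero] by (auto simp: nodes_eq)
  have lapIm: "lap (\<lambda>p. Im (A p)) p = Im (lap A p)" for p by (simp add: lap_def split: prod.splits)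
  have eq: "(1 - Q p) * Im (A p) - N p * Im (S p) = \<epsilon> * Im (lap A p)" for p
    using arg_cong[OF eqn_A[of p], of Im] by simp
  have NS: "\<bar>N p * Im (S p)\<bar> \<le> 140 * \<epsilon>^3 * t" if p: "p \<notin> nodes" for p
  proof -
    have "\<bar>N p * Im (S p)\<bar> \<le> cmod (of_real (N p) * S p)"
      using abs_Im_le_cmod[of "S p"] by (auto simp: abs_mult norm_mult intro: mult_left_mono)
    also have "\<dots> \<le> 34 * \<epsilon>\<^sup>2 * cmod (A p)" by (rule NS_off[OF p])
    also have "\<dots> \<le> 34 * \<epsilon>\<^sup>2 * (4.1 * \<epsilon> * t)" by (intro mult_left_mono A_off t p) auto
    also have "\<dots> = 139.4 * \<epsilon>^3 * t" by (simp add: power2_eq_square power3_eq_cube)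
    also have "\<dots> \<le> 140 * \<epsilon>^3 * t" using t0 eps by (intro mult_right_mono) auto
    finally show ?thesis .
  qed
  have Q: "(1 - 17 * \<epsilon>\<^sup>2) * \<bar>Im (A p)\<bar> \<le> \<bar>N p * Im (S p)\<bar> + \<epsilon> * \<bar>Im (lap A p)\<bar>" if p: "p \<notin> nodes" for p
  proof -
    have "(1 - Q p) * Im (A p) = N p * Im (S p) + \<epsilon> * Im (lap A p)" using eq[of p] by simp
    then have "\<bar>1 - Q p\<bar> * \<bar>Im (A p)\<bar> \<le> \<bar>N p * Im (S p)\<bar> + \<epsilon> * \<bar>Im (lap A p)\<bar>"
      using eps abs_triangle_ineq[of "N p * Im (S p)" "\<epsilon> * Im (lap A p)"]
      by (simp add: abs_mult[symmetric] abs_mult[of \<epsilon>] del: abs_mult)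
    moreover have "(1 - 17 * \<epsilon>\<^sup>2) * \<bar>Im (A p)\<bar> \<le> \<bar>1 - Q p\<bar> * \<bar>Im (A p)\<bar>"
      using Q_off[OF p] by (intro mult_right_mono) auto
    ultimately show ?thesis by linarith
  qed
  show "\<bar>Im (A p)\<bar> \<le> 150 * \<epsilon>^3 * t"
  proof (cases "p \<in> nodes")
    case True then show ?thesis using Im0 t0 eps by simp
  next
    case False
    have "norm (Im (A p)) \<le> 1.02 * (140 * \<epsilon>^3 * t) + 4.1 * \<epsilon> * 0"
    proof (rule off_node_bound[where \<kappa> = "17 * \<epsilon>\<^sup>2"])
      show "norm (Im (A p)) \<le> 1/1000" for p using bdd_A[of p] abs_Im_le_cmod[of "A p"] by simp
      show "(1 - 17 * \<epsilon>\<^sup>2) * norm (Im (A q)) \<le> 140 * \<epsilon>^3 * t + \<epsilon> * norm (lap (\<lambda>p. Im (A p)) q)"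
        if "q \<notin> nodes" for q
        using Q[OF that] NS[OF that] unfolding lapIm by simp
    qed (use Im0 eps eps2 False t0 in auto)
    moreover have "0 \<le> \<epsilon>^3 * t" using eps t0 by simp
    ultimately show ?thesis by (simp add: algebra_simps)
  qed
  show "\<bar>N p * Im (S p)\<bar> \<le> \<bar>Im (A p)\<bar> + \<epsilon> * \<bar>Im (lap A p)\<bar>" if p: "p \<notin> nodes"
  proof -
    have "N p * Im (S p) = (1 - Q p) * Im (A p) - \<epsilon> * Im (lap A p)" using eq[of p] by simp
    then have "\<bar>N p * Im (S p)\<bar> \<le> \<bar>1 - Q p\<bar> * \<bar>Im (A p)\<bar> + \<epsilon> * \<bar>Im (lap A p)\<bar>"
      using eps abs_triangle_ineq4[of "(1 - Q p) * Im (A p)" "\<epsilon> * Im (lap A p)"] by (simp add: abs_mult)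
    moreover have "\<bar>1 - Q p\<bar> * \<bar>Im (A p)\<bar> \<le> 1 * \<bar>Im (A p)\<bar>"
      using Q_off[OF p] eps eps2 by (intro mult_right_mono) auto
    ultimately show ?thesis by simp
  qed
  show "99/100 * \<bar>Im (A p)\<bar> \<le> \<epsilon> * \<bar>Im (lap A p)\<bar>" if p: "p \<notin> nodes" and N: "N p = 0"
  proof -
    have "99/100 * \<bar>Im (A p)\<bar> \<le> (1 - 17 * \<epsilon>\<^sup>2) * \<bar>Im (A p)\<bar>"
      using eps eps2 by (intro mult_right_mono) auto
    with Q[OF p] N show ?thesis by simp
  qed
qed

context near_cross begin

text \<open>For the mirror image \<open>cnj (\<Psi> (n, -m))\<close> the half difference vanishes at \<open>(-1,0)\<close> and
  \<open>(1,0)\<close> and equals \<open>\<plusminus>\<tau>\<close> at the two other nodes. A relative phase of the two pairs is not seen by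
  the node equations up to order \<open>\<epsilon>\<^sup>2\<close>. It is detected at the diagonal site \<open>(-1,-1)\<close>: the equation at
  \<open>(-1,0)\<close> ties \<open>Im A\<close> there to its much smaller value at \<open>(-2,0)\<close>, while the equation at
  \<open>(-1,-1)\<close> contains the source \<open>N Im S\<close>, which is at least \<open>3/2 \<epsilon>\<^sup>3 \<bar>\<tau>\<bar>\<close>.\<close>

theorem conj_reflection:
  assumes re: "Im (\<Psi> (-1, 0)) = 0"
  shows "\<Psi> (n, - m) = cnj (\<Psi> (n, m))"
proof -
  interpret PP: near_cross_pair \<epsilon> \<Psi> "\<lambda>p. cnj (\<Psi> (fst p, - snd p))"
    using axis_reflect near_cross_axioms by (simp add: near_cross_pair_def)
  define \<tau> where "\<tau> = Re (\<Psi> (0, -1))"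
  define t where "t = \<bar>\<tau>\<bar>"
  define x where "x = Re (\<Psi> (-1, 0))"
  define y where "y = Im (\<Psi> (0, -1))"
  have o: "\<Psi> (1, 0) = - \<Psi> (-1, 0)" "\<Psi> (0, 1) = - \<Psi> (0, -1)" "\<Psi> (0, 0) = 0"
    using odd[of "-1" 0] odd[of 0 "-1"] odd[of 0 0] by auto
  have vA: "PP.A (-1,0) = 0" "PP.A (1,0) = 0" "PP.A (0,-1) = of_real \<tau>" "PP.A (0,1) = - of_real \<tau>" "PP.A (0,0) = 0"
    using re by (auto simp: PP.A_def o \<tau>_def complex_eq_iff)
  have vS: "PP.S (-1,0) = of_real x" "PP.S (0,-1) = \<i> * of_real y"
    using re by (auto simp: PP.S_def o x_def y_def complex_eq_iff)
  have tA: "cmod (PP.A a) \<le> t" if "a \<in> nodes" for a using that by (auto simp: nodes_eq vA t_def)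
  have Im0: "Im (PP.A a) = 0" if "a \<in> nodes" for a using that by (auto simp: nodes_eq vA)
  note im = PP.imag_A_bound[OF tA Im0]
  have t0: "0 \<le> t" by (simp add: t_def)
  have lapIm: "\<bar>Im (lap PP.A p)\<bar> \<le> 4 * (150 * \<epsilon>^3 * t)" for p
  proof -
    have "norm (lap (\<lambda>p. Im (PP.A p)) p) \<le> 4 * (150 * \<epsilon>^3 * t)"
      using im(1) by (intro norm_lap_le) simp
    then show ?thesis by (simp add: lap_def split: prod.splits)
  qed
  \<comment> \<open>N vanishes at this node together with A\<close>
  have "lap PP.A (-1,0) = 0" using PP.eqn_A[of "(-1,0)"] PP.N_eq[of "(-1,0)"] eps by (simp add: vA)
  then have "Im (PP.A (-2,0)) + Im (PP.A (-1,1)) + Im (PP.A (-1,-1)) = 0"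
    by (simp add: lap_def vA complex_eq_iff)
  moreover have "Im (PP.A (-1,1)) = Im (PP.A (-1,-1))" by (simp add: PP.A_def)
  ultimately have "\<bar>Im (PP.A (-1,-1))\<bar> = \<bar>Im (PP.A (-2,0))\<bar> / 2" by simp
  moreover have "99/100 * \<bar>Im (PP.A (-2,0))\<bar> \<le> \<epsilon> * (4 * (150 * \<epsilon>^3 * t))"
  proof (rule order_trans[OF im(3)])
    show "PP.N (-2,0) = 0" by (simp add: PP.N_def)
  qed (use lapIm eps in \<open>auto simp: nodes_eq intro!: mult_left_mono\<close>)
  moreover have "\<bar>PP.N (-1,-1) * Im (PP.S (-1,-1))\<bar> \<le> \<bar>Im (PP.A (-1,-1))\<bar> + \<epsilon> * (4 * (150 * \<epsilon>^3 * t))"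
    by (rule order_trans[OF im(2)]) (use lapIm eps in \<open>auto simp: nodes_eq intro!: mult_left_mono\<close>)
  moreover have "\<epsilon> * (4 * (150 * \<epsilon>^3 * t)) \<le> 1/1000 * (4 * (150 * \<epsilon>^3 * t))"
    using eps t0 by (intro mult_right_mono) auto
  then have "\<epsilon> * (4 * (150 * \<epsilon>^3 * t)) \<le> 6/10 * (\<epsilon>^3 * t)" by simp
  moreover have "0 \<le> \<epsilon>^3 * t" using eps t0 by simp
  ultimately have upper: "\<bar>PP.N (-1,-1) * Im (PP.S (-1,-1))\<bar> \<le> \<epsilon>^3 * t"
    by linarith
  have SS: "cmod (PP.S (-1,-1) - of_real \<epsilon> * (of_real x + \<i> * of_real y)) \<le> \<epsilon> * (2 * (41/10 * \<epsilon>)) + 21/100 * \<epsilon>\<^sup>2"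
  proof (rule PP.S_nbr)
    have "lap PP.S (-1,-1) - (of_real x + \<i> * of_real y) = PP.S (-2,-1) + PP.S (-1,-2)" by (simp add: lap_def vS)
    then show "cmod (lap PP.S (-1,-1) - (of_real x + \<i> * of_real y)) \<le> 2 * (41/10 * \<epsilon>)"
      using PP.S_off[of "(-2,-1)"] PP.S_off[of "(-1,-2)"] norm_triangle_ineq[of "PP.S (-2,-1)" "PP.S (-1,-2)"]
      by (simp add: nodes_eq)
  qed (auto simp: nodes_eq)
  have AA: "cmod (PP.A (-1,-1) - of_real \<epsilon> * of_real \<tau>) \<le> \<epsilon> * (2 * (41/10 * \<epsilon> * t)) + 21/100 * \<epsilon>\<^sup>2 * t"
  proof (rule PP.A_nbr[OF tA])
    have "lap PP.A (-1,-1) - of_real \<tau> = PP.A (-2,-1) + PP.A (-1,-2)" by (simp add: lap_def vA)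
    then show "cmod (lap PP.A (-1,-1) - of_real \<tau>) \<le> 2 * (41/10 * \<epsilon> * t)"
      using PP.A_off[OF tA, of "(-2,-1)"] PP.A_off[OF tA, of "(-1,-2)"] norm_triangle_ineq[of "PP.A (-2,-1)" "PP.A (-1,-2)"]
      by (simp add: nodes_eq)
  qed (auto simp: nodes_eq)
  have x1: "\<bar>x - 1\<bar> \<le> 1/1000"
    using near[of "(-1,0)"] abs_Re_le_cmod[of "\<Psi> (-1,0) - 1"] by (simp add: cross_def x_def)
  have y1: "\<bar>y - 1\<bar> \<le> 1/1000"
    using near[of "(0,-1)"] abs_Im_le_cmod[of "\<Psi> (0,-1) - \<i>"] by (simp add: cross_def y_def)
  have ee: "\<epsilon> * \<epsilon> \<le> 1/1000 * \<epsilon>" using eps by (intro mult_right_mono) auto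
  have r: "\<epsilon> * (2 * (41/10 * \<epsilon>)) + 21/100 * \<epsilon>\<^sup>2 \<le> 1/100 * \<epsilon>" using ee eps by (simp add: power2_eq_square)
  have rx: "\<epsilon> * x \<ge> \<epsilon> * (999/1000)" "\<epsilon> * x \<le> \<epsilon> * (1001/1000)" "\<epsilon> * y \<ge> \<epsilon> * (999/1000)"
  proof -
    have "999/1000 \<le> x" "x \<le> 1001/1000" "999/1000 \<le> y" using x1 y1 by linarith+
    then show "\<epsilon> * x \<ge> \<epsilon> * (999/1000)" "\<epsilon> * x \<le> \<epsilon> * (1001/1000)" "\<epsilon> * y \<ge> \<epsilon> * (999/1000)"
      using eps by (auto intro!: mult_left_mono)
  qed
  have "Re (PP.S (-1,-1)) \<ge> 9/10 * \<epsilon>" "Im (PP.S (-1,-1)) \<ge> 9/10 * \<epsilon>"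
  proof -
    have "\<bar>Re (PP.S (-1,-1)) - \<epsilon> * x\<bar> \<le> 1/100 * \<epsilon>"
      using abs_Re_le_cmod[of "PP.S (-1,-1) - of_real \<epsilon> * (of_real x + \<i> * of_real y)"] order_trans[OF SS r] by simp
    then show "Re (PP.S (-1,-1)) \<ge> 9/10 * \<epsilon>" using rx eps by linarith
    have "\<bar>Im (PP.S (-1,-1)) - \<epsilon> * y\<bar> \<le> 1/100 * \<epsilon>"
      using abs_Im_le_cmod[of "PP.S (-1,-1) - of_real \<epsilon> * (of_real x + \<i> * of_real y)"] order_trans[OF SS r] by simp
    then show "Im (PP.S (-1,-1)) \<ge> 9/10 * \<epsilon>" using rx eps by linarith
  qed
  have "\<Psi> (n, m) = cnj (\<Psi> (fst (n, m), - snd (n, m)))"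
  proof (rule PP.A_zero)
    have "t = 0"
    proof (rule ccontr)
      assume "t \<noteq> 0"
      then have tp: "t > 0" using t0 by simp
      have s: "cmod (PP.S (-1,-1)) \<le> 41/10 * \<epsilon>" using PP.S_off[of "(-1,-1)"] by (simp add: nodes_eq)
      have rA: "\<epsilon> * (2 * (41/10 * \<epsilon> * t)) + 21/100 * \<epsilon>\<^sup>2 * t \<le> 1/100 * \<epsilon> * t"
        using mult_right_mono[OF r t0] by (simp add: algebra_simps)
      have "PP.N (-1,-1) = 2 * Re (PP.S (-1,-1)) * (\<epsilon> * \<tau>) + 2 * Re (PP.S (-1,-1) * cnj (PP.A (-1,-1) - of_real \<epsilon> * of_real \<tau>))"
        unfolding PP.N_eq by (simp add: algebra_simps)
      moreover have "\<bar>Re (PP.S (-1,-1) * cnj (PP.A (-1,-1) - of_real \<epsilon> * of_real \<tau>))\<bar> \<le> (41/10 * \<epsilon>) * (1/100 * \<epsilon> * t)"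
      proof (rule order_trans[OF abs_Re_le_cmod])
        show "cmod (PP.S (-1,-1) * cnj (PP.A (-1,-1) - of_real \<epsilon> * of_real \<tau>)) \<le> (41/10 * \<epsilon>) * (1/100 * \<epsilon> * t)"
          unfolding norm_mult complex_mod_cnj using s order_trans[OF AA rA] eps by (intro mult_mono) auto
      qed
      moreover have "\<bar>2 * Re (PP.S (-1,-1)) * (\<epsilon> * \<tau>)\<bar> \<ge> 2 * (9/10 * \<epsilon>) * (\<epsilon> * t)"
        unfolding abs_mult t_def using \<open>Re (PP.S (-1,-1)) \<ge> 9/10 * \<epsilon>\<close> eps by (intro mult_mono) auto
      ultimately have "\<bar>PP.N (-1,-1)\<bar> \<ge> 17/10 * (\<epsilon> * \<epsilon> * t)"
      proof -
        assume a: "PP.N (-1,-1) = 2 * Re (PP.S (-1,-1)) * (\<epsilon> * \<tau>) + 2 * Re (PP.S (-1,-1) * cnj (PP.A (-1,-1) - of_real \<epsilon> * of_real \<tau>))"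
          "\<bar>Re (PP.S (-1,-1) * cnj (PP.A (-1,-1) - of_real \<epsilon> * of_real \<tau>))\<bar> \<le> (41/10 * \<epsilon>) * (1/100 * \<epsilon> * t)"
          "\<bar>2 * Re (PP.S (-1,-1)) * (\<epsilon> * \<tau>)\<bar> \<ge> 2 * (9/10 * \<epsilon>) * (\<epsilon> * t)"
        have "(41/10 * \<epsilon>) * (1/100 * \<epsilon> * t) = 41/1000 * (\<epsilon> * \<epsilon> * t)"
          "2 * (9/10 * \<epsilon>) * (\<epsilon> * t) = 18/10 * (\<epsilon> * \<epsilon> * t)" "0 \<le> \<epsilon> * \<epsilon> * t" using eps t0 by simp_all
        with a show ?thesis by linarith
      qed
      then have "17/10 * (\<epsilon> * \<epsilon> * t) * (9/10 * \<epsilon>) \<le> \<bar>PP.N (-1,-1) * Im (PP.S (-1,-1))\<bar>"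
        unfolding abs_mult using \<open>Im (PP.S (-1,-1)) \<ge> 9/10 * \<epsilon>\<close> eps by (intro mult_mono) auto
      then have "153/100 * (\<epsilon>^3 * t) \<le> \<epsilon>^3 * t" using upper by (simp add: power3_eq_cube mult_ac)
      moreover have "\<epsilon>^3 * t > 0" using eps tp by simp
      ultimately show False by linarith
    qed
    then have "\<tau> = 0" by (simp add: t_def)
    then show "PP.A p = 0" if "p \<in> nodes" for p using that by (auto simp: nodes_eq vA)
  qed
  then show ?thesis by (metis complex_cnj_cnj fst_conv snd_conv)
qed

text \<open>Now all four node values of the half difference are the same real amplitude \<open>t\<close> up to phase factors, and
  changes of amplitude are excluded at leading order: in the node equation the coefficient of \<open>t\<close> is at
  least \<open>1\<close>.\<close>

theorem diagonal_symmetry: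
  assumes re: "Im (\<Psi> (-1, 0)) = 0"
  shows "\<Psi> (m, n) = \<i> * cnj (\<Psi> (n, m))"
proof -
  interpret PP: near_cross_pair \<epsilon> \<Psi> "\<lambda>p. \<i> * cnj (\<Psi> (snd p, fst p))"
    using diagonal_reflect near_cross_axioms by (simp add: near_cross_pair_def)
  define x where "x = Re (\<Psi> (-1, 0))"
  define y where "y = Im (\<Psi> (0, -1))"
  have o: "\<Psi> (1, 0) = - \<Psi> (-1, 0)" "\<Psi> (0, 1) = - \<Psi> (0, -1)" "\<Psi> (0, 0) = 0"
    using odd[of "-1" 0] odd[of 0 "-1"] odd[of 0 0] by auto
  have "Re (\<Psi> (0, -1)) = 0" using conj_reflection[OF re, of 0 1] unfolding o
    by (simp add: complex_eq_iff)
  then have v: "\<Psi> (-1, 0) = of_real x" "\<Psi> (0, -1) = \<i> * of_real y"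
    using re by (auto simp: x_def y_def complex_eq_iff)
  define t where "t = (x - y) / 2"
  define s where "s = (x + y) / 2"
  have vA: "PP.A (-1,0) = of_real t" "PP.A (1,0) = - of_real t" "PP.A (0,-1) = - \<i> * of_real t" "PP.A (0,1) = \<i> * of_real t"
    by (auto simp: PP.A_def o v t_def complex_eq_iff field_simps)
  have vS: "PP.S (-1,0) = of_real s" by (auto simp: PP.S_def o v s_def complex_eq_iff)
  have tA: "cmod (PP.A a) \<le> \<bar>t\<bar>" if "a \<in> nodes" for a using that by (auto simp: nodes_eq vA norm_mult)
  have x1: "\<bar>x - 1\<bar> \<le> 1/1000"
    using near[of "(-1,0)"] abs_Re_le_cmod[of "\<Psi> (-1,0) - 1"] by (simp add: cross_def x_def)
  have y1: "\<bar>y - 1\<bar> \<le> 1/1000"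
    using near[of "(0,-1)"] abs_Im_le_cmod[of "\<Psi> (0,-1) - \<i>"] by (simp add: cross_def y_def)
  have off: "cmod (PP.A a) \<le> 41/10 * \<epsilon> * \<bar>t\<bar>" if "a \<notin> nodes" for a using PP.A_off[OF tA that] by simp
  have "lap PP.A (-1,0) = PP.A (0,0) + PP.A (-2,0) + PP.A (-1,1) + PP.A (-1,-1)" by (simp add: lap_def)
  then have lap: "cmod (lap PP.A (-1,0)) \<le> 4 * (41/10 * \<epsilon> * \<bar>t\<bar>)"
    using norm_add4[of "PP.A (0,0)" "PP.A (-2,0)" "PP.A (-1,1)" "PP.A (-1,-1)"]
      off[of "(0,0)"] off[of "(-2,0)"] off[of "(-1,1)"] off[of "(-1,-1)"] by (simp add: nodes_eq)
  have Q: "PP.Q (-1,0) = (x\<^sup>2 + y\<^sup>2) / 2" by (simp add: PP.Q_def v norm_mult)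
  have N: "PP.N (-1,0) = 2 * s * t" by (simp add: PP.N_eq vA vS)
  have "of_real ((1 - PP.Q (-1,0)) * t - PP.N (-1,0) * s) = of_real \<epsilon> * lap PP.A (-1,0)"
    using PP.eqn_A[of "(-1,0)"] by (simp add: vA vS)
  then have "cmod (of_real ((1 - PP.Q (-1,0)) * t - PP.N (-1,0) * s)) = cmod (of_real \<epsilon> * lap PP.A (-1,0))"
    by (simp only:)
  then have "\<bar>(1 - PP.Q (-1,0)) * t - PP.N (-1,0) * s\<bar> = \<epsilon> * cmod (lap PP.A (-1,0))"
    using eps by (simp only: norm_mult norm_of_real abs_of_pos)
  also have "(1 - PP.Q (-1,0)) * t - PP.N (-1,0) * s = - (((x\<^sup>2 + y\<^sup>2) / 2 + 2 * s\<^sup>2 - 1) * t)"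
    unfolding Q N by (simp add: algebra_simps power2_eq_square)
  finally have "\<bar>(x\<^sup>2 + y\<^sup>2) / 2 + 2 * s\<^sup>2 - 1\<bar> * \<bar>t\<bar> = \<epsilon> * cmod (lap PP.A (-1,0))" by (simp add: abs_mult)
  also have "\<dots> \<le> \<epsilon> * (4 * (41/10 * \<epsilon> * \<bar>t\<bar>))" using lap eps by (intro mult_left_mono) auto
  also have "\<dots> \<le> 1/10 * \<bar>t\<bar>"
    using mult_right_mono[OF PP.eps2, of "\<bar>t\<bar>"] mult_right_mono[OF eps(2), of "\<bar>t\<bar>"] by (simp add: power2_eq_square)
  finally have "\<bar>(x\<^sup>2 + y\<^sup>2) / 2 + 2 * s\<^sup>2 - 1\<bar> * \<bar>t\<bar> \<le> 1/10 * \<bar>t\<bar>" .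
  moreover have "9/10 \<le> x" "9/10 \<le> y" using x1 y1 by linarith+
  moreover from this have "9/10 \<le> s" unfolding s_def by simp
  ultimately have "\<bar>(x\<^sup>2 + y\<^sup>2) / 2 + 2 * s\<^sup>2 - 1\<bar> * \<bar>t\<bar> \<le> 1/10 * \<bar>t\<bar>" "9/10 \<le> x" "9/10 \<le> y" "9/10 \<le> s" .
  note this(1)
  moreover note \<open>9/10 \<le> x\<close> \<open>9/10 \<le> y\<close> \<open>9/10 \<le> s\<close>
  then have "81/100 \<le> x\<^sup>2" "81/100 \<le> y\<^sup>2" "81/100 \<le> s\<^sup>2"
    using power_mono[of "9/10" x 2] power_mono[of "9/10" y 2] power_mono[of "9/10" s 2] by (auto simp: power2_eq_square)
  then have "1 \<le> (x\<^sup>2 + y\<^sup>2) / 2 + 2 * s\<^sup>2 - 1" unfolding add_divide_distrib by linarith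
  then have "1 \<le> \<bar>(x\<^sup>2 + y\<^sup>2) / 2 + 2 * s\<^sup>2 - 1\<bar>" by (rule order_trans[OF _ abs_ge_self])
  then have "1 * \<bar>t\<bar> \<le> \<bar>(x\<^sup>2 + y\<^sup>2) / 2 + 2 * s\<^sup>2 - 1\<bar> * \<bar>t\<bar>"
    by (intro mult_right_mono) auto
  ultimately have "t = 0" by simp
  have "\<Psi> (m, n) = \<i> * cnj (\<Psi> (snd (m, n), fst (m, n)))"
    by (rule PP.A_zero) (auto simp: nodes_eq vA \<open>t = 0\<close>)
  then show ?thesis by (simp only: fst_conv snd_conv)
qed

theorem rotation_symmetry:
  assumes "Im (\<Psi> (-1, 0)) = 0"
  shows "\<Psi> (- m, n) = \<i> * \<Psi> (n, m)"
proof -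
  have "\<Psi> (- m, n) = \<i> * cnj (\<Psi> (n, - m))" by (rule diagonal_symmetry[OF assms])
  also have "cnj (\<Psi> (n, - m)) = cnj (cnj (\<Psi> (n, m)))" by (rule arg_cong[OF conj_reflection[OF assms]])
  also have "\<dots> = \<Psi> (n, m)" by (rule complex_cnj_cnj)
  finally show ?thesis .
qed

end

section \<open>Asymptotics of the symmetric cross\<close>

text \<open>The gauge in which the first node value is real; by \<open>rotation_symmetry\<close> the four node values are then \<open>x\<close> times
  those of the limiting cross.\<close>

locale symmetric_cross = near_cross +
  assumes real_node: "Im (\<Psi> (-1, 0)) = 0"
begin

definition "x = Re (\<Psi> (-1, 0))"

lemma x_near: "\<bar>x - 1\<bar> \<le> 1/1000"
  using near[of "(-1,0)"] abs_Re_le_cmod[of "\<Psi> (-1,0) - 1"] by (simp add: cross_def x_def)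

lemma rot: "\<Psi> (- m, n) = \<i> * \<Psi> (n, m)"
  by (rule rotation_symmetry[OF real_node])

lemma node_value:
  assumes "p \<in> nodes" shows "\<Psi> p = of_real x * cross p"
proof -
  have 1: "\<Psi> (-1, 0) = of_real x" using real_node by (simp add: x_def complex_eq_iff)
  have 2: "\<Psi> (0, -1) = \<i> * of_real x" using rot[of 0 "-1"] by (simp add: 1)
  have 3: "\<Psi> (1, 0) = - of_real x" using rot[of "-1" 0] by (simp add: 2)
  have 4: "\<Psi> (0, 1) = - \<i> * of_real x" using rot[of 0 1] by (simp add: 3)
  show ?thesis using assms by (auto simp: nodes_eq cross_def 1 2 3 4)
qed

lemma center: "\<Psi> (0, 0) = 0" using odd[of 0 0] by simp

sublocale self: near_cross_pair \<epsilon> \<Psi> \<Psi>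
  by unfold_locales

lemma self_S: "self.S = \<Psi>" by (auto simp: self.S_def)

lemma x_expansion: "\<bar>1 - x\<^sup>2 - 3 * \<epsilon>\<^sup>2\<bar> \<le> 33 * \<epsilon>^3"
proof -
  have v: "\<Psi> (-1,0) = of_real x" using node_value[of "(-1,0)"] by (simp add: nodes_eq cross_def)
  have "cmod (lap self.S (-1,0) - of_real \<epsilon> * (3 * self.S (-1,0))) \<le> 32 * \<epsilon>\<^sup>2"
    by (rule self.lap_S_node) (use odd[of "-1" 0] odd[of 0 "-1"] in \<open>auto simp: self_S center\<close>)
  then have l: "cmod (lap \<Psi> (-1,0) - of_real (3 * \<epsilon> * x)) \<le> 32 * \<epsilon>\<^sup>2" by (simp add: self_S v mult_ac)
  have "of_real ((1 - x\<^sup>2 - 3 * \<epsilon>\<^sup>2) * x) = of_real \<epsilon> * (lap \<Psi> (-1,0) - of_real (3 * \<epsilon> * x))"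
    using eqn[of "(-1,0)"] by (simp add: v power2_eq_square algebra_simps)
  then have "cmod (of_real ((1 - x\<^sup>2 - 3 * \<epsilon>\<^sup>2) * x)) = cmod (of_real \<epsilon> * (lap \<Psi> (-1,0) - of_real (3 * \<epsilon> * x)))"
    by (simp only:)
  then have "\<bar>1 - x\<^sup>2 - 3 * \<epsilon>\<^sup>2\<bar> * \<bar>x\<bar> = \<epsilon> * cmod (lap \<Psi> (-1,0) - of_real (3 * \<epsilon> * x))"
    using eps by (simp only: norm_mult norm_of_real abs_mult abs_of_pos)
  also have "\<dots> \<le> \<epsilon> * (32 * \<epsilon>\<^sup>2)" using l eps by (intro mult_left_mono) auto
  finally have "\<bar>1 - x\<^sup>2 - 3 * \<epsilon>\<^sup>2\<bar> * \<bar>x\<bar> \<le> 32 * \<epsilon>^3" by (simp add: power2_eq_square power3_eq_cube)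
  moreover have "999/1000 \<le> \<bar>x\<bar>" using x_near by linarith
  then have "\<bar>1 - x\<^sup>2 - 3 * \<epsilon>\<^sup>2\<bar> * (999/1000) \<le> \<bar>1 - x\<^sup>2 - 3 * \<epsilon>\<^sup>2\<bar> * \<bar>x\<bar>" by (intro mult_left_mono) auto
  ultimately have "\<bar>1 - x\<^sup>2 - 3 * \<epsilon>\<^sup>2\<bar> * (999/1000) \<le> 32 * \<epsilon>^3" by (rule order_trans[rotated])
  moreover have "0 \<le> \<epsilon>^3" using eps by simp
  moreover have "d \<le> 33 * c" if "d * (999/1000) \<le> 32 * c" "0 \<le> c" for d c :: real
    using that by linarith
  ultimately show ?thesis by blast
qed

lemma x2_near: "\<bar>1 - x\<^sup>2\<bar> \<le> 4 * \<epsilon>\<^sup>2"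
proof -
  have "\<epsilon>^3 \<le> 1/1000 * \<epsilon>\<^sup>2" using mult_right_mono[OF eps(2), of "\<epsilon>\<^sup>2"] by (simp add: power3_eq_cube power2_eq_square)
  then show ?thesis using x_expansion zero_le_power2[of \<epsilon>] by linarith
qed

text \<open>On the coordinate axes \<open>\<Psi>\<close> is real or imaginary.\<close>

lemma axis_power4:
  assumes "n = 0 \<or> m = 0" shows "\<Psi> (n, m) ^ 4 = of_real (cmod (\<Psi> (n, m)) ^ 4)"
proof -
  have *: "z ^ 4 = of_real (cmod z ^ 4)" if "cnj z = z \<or> cnj z = - z" for z
  proof -
    have "of_real (cmod z ^ 4) = ((of_real ((cmod z)\<^sup>2)) :: complex)\<^sup>2"
      by (simp flip: power_mult)
    also have "\<dots> = z\<^sup>2 * (cnj z)\<^sup>2" unfolding complex_norm_square by (simp add: power_mult_distrib)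
    also have "(cnj z)\<^sup>2 = z\<^sup>2" using that by auto
    finally show ?thesis by (simp flip: power_add)
  qed
  have "cnj (\<Psi> (n, m)) = \<Psi> (n, m) \<or> cnj (\<Psi> (n, m)) = - \<Psi> (n, m)"
    using assms conj_reflection[OF real_node, of n m] odd[of n m] by auto
  then show ?thesis by (rule *)
qed

lemma diagonal_value: "cmod (\<Psi> (-1, -1) - of_real \<epsilon> * (1 + \<i>)) \<le> 13 * \<epsilon>\<^sup>2"
proof -
  have v: "\<Psi> (-1,0) = of_real x" "\<Psi> (0,-1) = \<i> * of_real x"
    using node_value[of "(-1,0)"] node_value[of "(0,-1)"] by (auto simp: nodes_eq cross_def)
  have "cmod (self.S (-1,-1) - of_real \<epsilon> * (of_real x * (1 + \<i>))) \<le> \<epsilon> * (2 * (41/10 * \<epsilon>)) + 21/100 * \<epsilon>\<^sup>2"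
  proof (rule self.S_nbr)
    have "lap self.S (-1,-1) - (of_real x * (1 + \<i>)) = \<Psi> (-2,-1) + \<Psi> (-1,-2)"
      by (simp add: lap_def v self_S algebra_simps)
    then show "cmod (lap self.S (-1,-1) - (of_real x * (1 + \<i>))) \<le> 2 * (41/10 * \<epsilon>)"
      using off_bound[of "(-2,-1)"] off_bound[of "(-1,-2)"] norm_triangle_ineq[of "\<Psi> (-2,-1)" "\<Psi> (-1,-2)"]
      by (simp add: nodes_eq)
  qed (auto simp: nodes_eq)
  then have 1: "cmod (\<Psi> (-1,-1) - of_real \<epsilon> * (of_real x * (1 + \<i>))) \<le> 85/10 * \<epsilon>\<^sup>2"
    by (simp add: self_S power2_eq_square) (use zero_le_square[of \<epsilon>] in linarith)
  have "1 \<le> \<bar>1 + x\<bar>" using x_near by linarith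
  then have "\<bar>1 - x\<bar> * 1 \<le> \<bar>1 - x\<bar> * \<bar>1 + x\<bar>" by (rule mult_left_mono) simp
  also have "\<dots> = \<bar>1 - x\<^sup>2\<bar>" by (simp add: abs_mult[symmetric] power2_eq_square algebra_simps)
  finally have x1: "\<bar>1 - x\<bar> \<le> 4 * \<epsilon>\<^sup>2" using x2_near by simp
  have "cmod (1 + \<i>) \<le> 2" using norm_triangle_ineq[of 1 \<i>] by simp
  then have "cmod (of_real \<epsilon> * of_real (x - 1) * (1 + \<i>)) \<le> (1/1000) * (4 * \<epsilon>\<^sup>2) * 2"
    unfolding norm_mult norm_of_real using eps x1 by (intro mult_mono) auto
  moreover have "\<Psi> (-1, -1) - of_real \<epsilon> * (1 + \<i>) = (\<Psi> (-1,-1) - of_real \<epsilon> * (of_real x * (1 + \<i>))) + of_real \<epsilon> * of_real (x - 1) * (1 + \<i>)"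
    by (simp add: algebra_simps)
  moreover note 1 norm_triangle_ineq[of "\<Psi> (-1,-1) - of_real \<epsilon> * (of_real x * (1 + \<i>))" "of_real \<epsilon> * of_real (x - 1) * (1 + \<i>)"]
    zero_le_power2[of \<epsilon>]
  ultimately show ?thesis by (simp only:)
qed

lemma far_bound:
  assumes p: "p \<notin> nodes" and nb: "(fst p + 1, snd p) \<notin> nodes" "(fst p - 1, snd p) \<notin> nodes"
    "(fst p, snd p + 1) \<notin> nodes" "(fst p, snd p - 1) \<notin> nodes"
  shows "cmod (\<Psi> p) \<le> 17 * \<epsilon>\<^sup>2"
proof -
  have "cmod (self.S p - of_real \<epsilon> * 0) \<le> \<epsilon> * (4 * (41/10 * \<epsilon>)) + 21/100 * \<epsilon>\<^sup>2"
  proof (rule self.S_nbr[OF p])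
    have "lap self.S p = \<Psi> (fst p + 1, snd p) + \<Psi> (fst p - 1, snd p) + \<Psi> (fst p, snd p + 1) + \<Psi> (fst p, snd p - 1)"
      by (cases p) (simp add: lap_def self_S)
    then show "cmod (lap self.S p - 0) \<le> 4 * (41/10 * \<epsilon>)"
      using off_bound[OF nb(1)] off_bound[OF nb(2)] off_bound[OF nb(3)] off_bound[OF nb(4)]
      norm_add4[of "\<Psi> (fst p + 1, snd p)" "\<Psi> (fst p - 1, snd p)" "\<Psi> (fst p, snd p + 1)" "\<Psi> (fst p, snd p - 1)"]
      by simp
  qed
  then show ?thesis by (simp add: self_S power2_eq_square) (use zero_le_square[of \<epsilon>] in linarith)
qed

end

section \<open>The Hilbert space of square-summable lattice functions\<close>

text \<open>As a type, \<open>\<ell>\<^sup>2\<close> can be made an instance of the classes of real inner product spaces and complete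
  spaces. Multiplication by \<open>\<i>\<close> will be treated as an operator.\<close>

typedef ell2 = "l2 :: (lattice \<Rightarrow> complex^4) set" morphisms fn Ell
  by (rule exI[of _ "\<lambda>_. 0"]) (rule l2_zero)

setup_lifting type_definition_ell2

lemma fn_l2 [simp]: "fn f \<in> l2" by (rule fn)

lemma ell2_eqI: "(\<And>p. fn f p = fn g p) \<Longrightarrow> f = g"
  by (metis ext fn_inject)

instantiation ell2 :: real_vector
begin
lift_definition zero_ell2 :: ell2 is "\<lambda>p. 0" by (rule l2_zero)
lift_definition plus_ell2 :: "ell2 \<Rightarrow> ell2 \<Rightarrow> ell2" is "\<lambda>f g p. f p + g p" by (rule l2_add)
lift_definition minus_ell2 :: "ell2 \<Rightarrow> ell2 \<Rightarrow> ell2" is "\<lambda>f g p. f p - g p" by (rule l2_diff)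
lift_definition uminus_ell2 :: "ell2 \<Rightarrow> ell2" is "\<lambda>f p. - f p"
  using l2_scaleR[of _ "-1"] by simp
lift_definition scaleR_ell2 :: "real \<Rightarrow> ell2 \<Rightarrow> ell2" is "\<lambda>c f p. c *\<^sub>R f p" by (rule l2_scaleR)
instance by standard (transfer; simp add: fun_eq_iff algebra_simps)+
end

lemmas fn_simps [simp] = zero_ell2.rep_eq plus_ell2.rep_eq minus_ell2.rep_eq uminus_ell2.rep_eq scaleR_ell2.rep_eq

lemma fn_sum [simp]: "fn (\<Sum>i\<in>A. f i) p = (\<Sum>i\<in>A. fn (f i) p)"
  by (induction A rule: infinite_finite_induct) auto

lemma summable_norm2: "f \<in> l2 \<Longrightarrow> (\<lambda>p. (norm (f p))\<^sup>2) summable_on UNIV" by (simp add: l2_def)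

lemma summable_inner:
  fixes f g :: "lattice \<Rightarrow> 'a::real_inner"
  assumes "f \<in> l2" "g \<in> l2" shows "(\<lambda>p. inner (f p) (g p)) summable_on UNIV"
proof (rule abs_summable_summable, rule Infinite_Sum.abs_summable_on_comparison_test)
  show "(\<lambda>p. norm ((norm (f p))\<^sup>2 + (norm (g p))\<^sup>2)) summable_on UNIV"
    using summable_on_add[OF summable_norm2 summable_norm2, OF assms] by simp
  fix p
  have "norm (inner (f p) (g p)) \<le> norm (f p) * norm (g p)" by (simp add: Cauchy_Schwarz_ineq2)
  also have "\<dots> \<le> (norm (f p))\<^sup>2 + (norm (g p))\<^sup>2"
    using sum_squares_bound[of "norm (f p)" "norm (g p)"] mult_nonneg_nonneg[OF norm_ge_zero[of "f p"] norm_ge_zero[of "g p"]]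
    by linarith
  finally show "norm (inner (f p) (g p)) \<le> norm ((norm (f p))\<^sup>2 + (norm (g p))\<^sup>2)" by simp
qed

instantiation ell2 :: real_inner
begin
definition "inner_ell2 f g = (\<Sum>\<^sub>\<infinity>p. inner (fn f p) (fn g p))"
definition "norm_ell2 (f :: ell2) = sqrt (inner f f)"
definition "sgn_ell2 (f :: ell2) = f /\<^sub>R norm f"
definition "dist_ell2 (f :: ell2) g = norm (f - g)"
definition "(uniformity :: (ell2 \<times> ell2) filter) = (INF e\<in>{0<..}. principal {(x, y). dist x y < e})"
definition "open_ell2 (U :: ell2 set) = (\<forall>x\<in>U. \<forall>\<^sub>F (x', y) in uniformity. x' = x \<longrightarrow> y \<in> U)"
instance
proof
  fix f g h :: ell2 and c :: real
  show "inner f g = inner g f" by (simp add: inner_ell2_def inner_commute)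
  show "inner (f + g) h = inner f h + inner g h"
    by (simp add: inner_ell2_def inner_add_left infsum_add summable_inner)
  show "inner (c *\<^sub>R f) g = c * inner f g"
    by (simp add: inner_ell2_def infsum_cmult_right' )
  show "0 \<le> inner f f" by (simp add: inner_ell2_def infsum_nonneg)
  show "inner f f = 0 \<longleftrightarrow> f = 0"
  proof
    assume 0: "inner f f = 0"
    have "fn f p = 0" for p
      using norm_le_l2_norm[of "fn f" p] 0 by (simp add: l2_norm_def inner_ell2_def power2_norm_eq_inner)
    then show "f = 0" by (intro ell2_eqI) simp
  qed (simp add: inner_ell2_def)
qed (simp_all add: norm_ell2_def sgn_ell2_def dist_ell2_def uniformity_ell2_def open_ell2_def)
end

lemma norm_ell2: "norm f = l2_norm (fn f)"
  by (simp add: norm_ell2_def l2_norm_def inner_ell2_def power2_norm_eq_inner)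

lemma norm2_ell2: "(norm f)\<^sup>2 = (\<Sum>\<^sub>\<infinity>p. (norm (fn f p))\<^sup>2)" for f :: ell2
  by (simp add: power2_norm_eq_inner inner_ell2_def)

lemma norm_fn_le: "norm (fn f p) \<le> norm f"
  by (simp add: norm_ell2 norm_le_l2_norm)

lemma finite_norm2_le: "finite F \<Longrightarrow> (\<Sum>p\<in>F. (norm (fn f p))\<^sup>2) \<le> (norm f)\<^sup>2"
  unfolding norm2_ell2 by (rule finite_sum_le_infsum) (auto simp: summable_norm2)

lemma l2_if_bounded:
  assumes "\<And>F. finite F \<Longrightarrow> (\<Sum>p\<in>F. (norm (f p))\<^sup>2) \<le> B" shows "f \<in> l2"
proof -
  have "bdd_above (sum (\<lambda>p. (norm (f p))\<^sup>2) ` {F. F \<subseteq> UNIV \<and> finite F})"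
    using assms by (auto intro!: bdd_aboveI2)
  then show ?thesis unfolding l2_def by (auto intro: nonneg_bdd_above_summable_on)
qed

lemma norm_le_if_bounded:
  assumes "\<And>F. finite F \<Longrightarrow> (\<Sum>p\<in>F. (norm (fn f p))\<^sup>2) \<le> B\<^sup>2" "0 \<le> B" shows "norm f \<le> B"
proof -
  have "(norm f)\<^sup>2 \<le> B\<^sup>2" unfolding norm2_ell2
    by (rule infsum_le_finite_sums) (use assms in \<open>auto simp: summable_norm2\<close>)
  then show ?thesis using assms(2) by (rule power2_le_imp_le)
qed

instance ell2 :: complete_space
proof
  fix X :: "nat \<Rightarrow> ell2" assume X: "Cauchy X"
  have "Cauchy (\<lambda>n. fn (X n) p)" for p
  proof (rule CauchyI)
    fix e :: real assume "0 < e"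
    with X obtain M where "\<forall>m\<ge>M. \<forall>n\<ge>M. norm (X m - X n) < e" by (auto dest: CauchyD)
    then show "\<exists>M. \<forall>m\<ge>M. \<forall>n\<ge>M. norm (fn (X m) p - fn (X n) p) < e"
      using norm_fn_le[of "X _ - X _" p] le_less_trans by (metis minus_ell2.rep_eq)
  qed
  then have "\<forall>p. \<exists>l. (\<lambda>n. fn (X n) p) \<longlonglongrightarrow> l" by (simp add: Cauchy_convergent_iff convergent_def)
  then obtain L where L: "\<And>p. (\<lambda>n. fn (X n) p) \<longlonglongrightarrow> L p" by metis
  have tail: "(\<Sum>p\<in>F. (norm (fn (X m) p - L p))\<^sup>2) \<le> e\<^sup>2"
    if F: "finite F" and M: "\<And>m n. m \<ge> M \<Longrightarrow> n \<ge> M \<Longrightarrow> norm (X m - X n) \<le> e" and m: "m \<ge> M" for F e M m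
  proof (rule LIMSEQ_le_const2)
    show "(\<lambda>n. \<Sum>p\<in>F. (norm (fn (X m) p - fn (X n) p))\<^sup>2) \<longlonglongrightarrow> (\<Sum>p\<in>F. (norm (fn (X m) p - L p))\<^sup>2)"
      by (intro tendsto_intros L)
    have "(\<Sum>p\<in>F. (norm (fn (X m) p - fn (X n) p))\<^sup>2) \<le> e\<^sup>2" if "n \<ge> M" for n
    proof -
      have "(\<Sum>p\<in>F. (norm (fn (X m) p - fn (X n) p))\<^sup>2) \<le> (norm (X m - X n))\<^sup>2"
        using finite_norm2_le[OF F, of "X m - X n"] by simp
      also have "\<dots> \<le> e\<^sup>2" by (intro power_mono M m that) auto
      finally show ?thesis .
    qed
    then show "\<exists>N. \<forall>n\<ge>N. (\<Sum>p\<in>F. (norm (fn (X m) p - fn (X n) p))\<^sup>2) \<le> e\<^sup>2" by blast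
  qed
  obtain M where M: "\<And>m n. m \<ge> M \<Longrightarrow> n \<ge> M \<Longrightarrow> norm (X m - X n) \<le> 1"
    using CauchyD[OF X, of 1] by (meson less_imp_le zero_less_one)
  have "(\<lambda>p. fn (X M) p - L p) \<in> l2" by (rule l2_if_bounded, rule tail[OF _ M]) auto
  from l2_diff[OF fn_l2[of "X M"] this] have "(\<lambda>p. fn (X M) p - (fn (X M) p - L p)) \<in> l2" .
  also have "(\<lambda>p. fn (X M) p - (fn (X M) p - L p)) = L" by (auto simp: fun_eq_iff)
  finally have "L \<in> l2" .
  then have fnL: "fn (Ell L) = L" by (rule Ell_inverse)
  have "X \<longlonglongrightarrow> Ell L"
  proof (rule LIMSEQ_I)
    fix r :: real assume r: "0 < r"
    then obtain M where M: "\<And>m n. m \<ge> M \<Longrightarrow> n \<ge> M \<Longrightarrow> norm (X m - X n) \<le> r / 2"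
      using CauchyD[OF X, of "r/2"] by (meson less_imp_le half_gt_zero)
    have "norm (X m - Ell L) \<le> r / 2" if "m \<ge> M" for m
      by (rule norm_le_if_bounded) (use tail[OF _ M that] r in \<open>auto simp: fnL\<close>)
    then show "\<exists>no. \<forall>n\<ge>no. norm (X n - Ell L) < r" using r by (intro exI[of _ M]) force
  qed
  then show "convergent X" by (auto simp: convergent_def)
qed

definition sitewise :: "(lattice \<Rightarrow> complex^4 \<Rightarrow> complex^4) \<Rightarrow> ell2 \<Rightarrow> ell2" where
  "sitewise M f = Ell (\<lambda>p. M p (fn f p))"

lemma l2_sitewise:
  assumes "\<And>p v. norm (M p v) \<le> c * norm v" "f \<in> l2"
  shows "(\<lambda>p. M p (f p)) \<in> l2"
proof -
  have "(\<lambda>p. c\<^sup>2 * (norm (f p))\<^sup>2) summable_on UNIV"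
    by (intro summable_on_cmult_right summable_norm2 assms)
  then show ?thesis unfolding l2_def mem_Collect_eq
    by (rule summable_on_comparison_test)
      (auto simp flip: power_mult_distrib intro!: power_mono assms)
qed

lemma fn_sitewise:
  assumes "\<And>p v. norm (M p v) \<le> c * norm v"
  shows "fn (sitewise M f) p = M p (fn f p)"
  unfolding sitewise_def by (subst Ell_inverse) (auto intro: l2_sitewise[OF assms])

lemma norm_le_pointwise:
  assumes "\<And>p. norm (fn f p) \<le> c * norm (fn g p)" "0 \<le> c"
  shows "norm f \<le> c * norm g"
proof (rule norm_le_if_bounded)
  fix F :: "lattice set" assume F: "finite F"
  have "(\<Sum>p\<in>F. (norm (fn f p))\<^sup>2) \<le> (\<Sum>p\<in>F. c\<^sup>2 * (norm (fn g p))\<^sup>2)"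
    by (intro sum_mono) (use assms in \<open>auto simp flip: power_mult_distrib intro!: power_mono\<close>)
  also have "\<dots> \<le> c\<^sup>2 * (norm g)\<^sup>2"
    unfolding sum_distrib_left[symmetric] by (intro mult_left_mono finite_norm2_le F) auto
  finally show "(\<Sum>p\<in>F. (norm (fn f p))\<^sup>2) \<le> (c * norm g)\<^sup>2" by (simp add: power_mult_distrib)
qed (use assms in auto)

definition reindex :: "(lattice \<Rightarrow> lattice) \<Rightarrow> ell2 \<Rightarrow> ell2" where
  "reindex \<pi> f = Ell (\<lambda>p. fn f (\<pi> p))"

lemma l2_reindex: "bij \<pi> \<Longrightarrow> f \<in> l2 \<Longrightarrow> (\<lambda>p. f (\<pi> p)) \<in> l2"
  unfolding l2_def using summable_on_reindex_bij_betw[of \<pi> UNIV UNIV "\<lambda>p. (norm (f p))\<^sup>2"] by simp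

lemma fn_reindex: "bij \<pi> \<Longrightarrow> fn (reindex \<pi> f) p = fn f (\<pi> p)"
  unfolding reindex_def by (subst Ell_inverse) (auto intro: l2_reindex)

lemma inner_reindex: "bij \<pi> \<Longrightarrow> inner (reindex \<pi> f) (reindex \<pi> g) = inner f g"
  unfolding inner_ell2_def by (simp add: fn_reindex infsum_reindex_bij_betw[of \<pi> UNIV UNIV "\<lambda>p. inner (fn f p) (fn g p)"])

lemma norm_reindex: "bij \<pi> \<Longrightarrow> norm (reindex \<pi> f) = norm f"
  by (simp add: norm_eq_sqrt_inner inner_reindex)

definition Lap :: "ell2 \<Rightarrow> ell2" where
  "Lap f = reindex (\<lambda>(n, m). (n + 1, m)) f + reindex (\<lambda>(n, m). (n - 1, m)) f
    + reindex (\<lambda>(n, m). (n, m + 1)) f + reindex (\<lambda>(n, m). (n, m - 1)) f"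

lemma bij_shifts:
  "bij (\<lambda>(n::int, m::int). (n + 1, m))" "bij (\<lambda>(n::int, m::int). (n - 1, m))"
  "bij (\<lambda>(n::int, m::int). (n, m + 1))" "bij (\<lambda>(n::int, m::int). (n, m - 1))"
  subgoal by (rule o_bij[of "\<lambda>(n, m). (n - 1, m)"]) (auto simp: fun_eq_iff)
  subgoal by (rule o_bij[of "\<lambda>(n, m). (n + 1, m)"]) (auto simp: fun_eq_iff)
  subgoal by (rule o_bij[of "\<lambda>(n, m). (n, m - 1)"]) (auto simp: fun_eq_iff)
  subgoal by (rule o_bij[of "\<lambda>(n, m). (n, m + 1)"]) (auto simp: fun_eq_iff)
  done

lemma fn_Lap: "fn (Lap f) p = lap (fn f) p"
  by (cases p) (simp add: Lap_def fn_reindex bij_shifts lap_def)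

lemma norm_Lap: "norm (Lap f) \<le> 4 * norm f"
  unfolding Lap_def by (intro norm_triangle_le) (simp add: norm_reindex bij_shifts norm_triangle_le)

lemma reindex_adjoint:
  assumes "\<And>p. \<pi> (\<pi>' p) = p" "\<And>p. \<pi>' (\<pi> p) = p"
  shows "inner (reindex \<pi> f) g = inner f (reindex \<pi>' g)"
proof -
  have b: "bij \<pi>" "bij \<pi>'"
    by (rule o_bij[of \<pi>'], use assms in \<open>auto simp: fun_eq_iff\<close>, rule o_bij[of \<pi>], use assms in \<open>auto simp: fun_eq_iff\<close>)
  have "g = reindex \<pi> (reindex \<pi>' g)" by (rule ell2_eqI) (simp add: fn_reindex b assms)
  then show ?thesis by (metis inner_reindex b(1))
qed

lemma Lap_selfadjoint: "inner (Lap f) g = inner f (Lap g)"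
proof -
  have "inner (reindex (\<lambda>(n, m). (n + 1, m)) f) g = inner f (reindex (\<lambda>(n, m). (n - 1, m)) g)"
    "inner (reindex (\<lambda>(n, m). (n - 1, m)) f) g = inner f (reindex (\<lambda>(n, m). (n + 1, m)) g)"
    "inner (reindex (\<lambda>(n, m). (n, m + 1)) f) g = inner f (reindex (\<lambda>(n, m). (n, m - 1)) g)"
    "inner (reindex (\<lambda>(n, m). (n, m - 1)) f) g = inner f (reindex (\<lambda>(n, m). (n, m + 1)) g)"
    by (rule reindex_adjoint; auto)+
  then show ?thesis by (simp add: Lap_def inner_add_left inner_add_right)
qed

lemma inner_finite_support:
  assumes "finite F" "\<And>p. p \<notin> F \<Longrightarrow> fn f p = 0"
  shows "inner f g = (\<Sum>p\<in>F. inner (fn f p) (fn g p))"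
proof -
  have "inner f g = (\<Sum>\<^sub>\<infinity>p\<in>F. inner (fn f p) (fn g p))"
    unfolding inner_ell2_def by (rule infsum_cong_neutral) (use assms in auto)
  then show ?thesis using assms(1) by simp
qed

lemma l2_finite_support:
  assumes "finite F" "\<And>p. p \<notin> F \<Longrightarrow> f p = 0" shows "f \<in> l2"
proof (rule l2_if_bounded)
  fix G :: "lattice set" assume "finite G"
  then show "(\<Sum>p\<in>G. (norm (f p))\<^sup>2) \<le> (\<Sum>p\<in>F. (norm (f p))\<^sup>2)"
    using assms by (intro order_trans[OF sum_mono2[of "G \<union> F" G] eq_refl[OF sum.mono_neutral_right]]) auto
qed

section \<open>Complex Hilbert spaces and invertibility\<close>

text \<open>Lax-Milgram: for a small \<open>\<kappa> > 0\<close> the map \<open>f \<mapsto> f - \<kappa>(A f - g)\<close> is a contraction, and its fixed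
  point solves \<open>A f = g\<close>.\<close>

lemma coercive_imp_surj:
  fixes A :: "'a::{real_inner,complete_space} \<Rightarrow> 'a"
  assumes A: "linear A" and K: "\<And>f. norm (A f) \<le> K * norm f"
    and c: "0 < c" "\<And>f. c * (norm f)\<^sup>2 \<le> inner f (A f)"
  shows "surj A"
proof -
  define K' where "K' = max K 1 + c"
  have K': "K' > 0" "c < K'" "\<And>f. norm (A f) \<le> K' * norm f"
  proof -
    show "norm (A f) \<le> K' * norm f" for f
    proof -
      have "K \<le> K'" using c by (simp add: K'_def max_def)
      from order_trans[OF K mult_right_mono[OF this norm_ge_zero]] show ?thesis .
    qed
  qed (use c in \<open>auto simp: K'_def\<close>)
  \<comment> \<open>this choice minimizes the quadratic bound for the square of the contraction factor\<close>
  define \<kappa> where "\<kappa> = c / K'\<^sup>2"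
  define q where "q = sqrt (1 - c\<^sup>2 / K'\<^sup>2)"
  have c2: "c\<^sup>2 / K'\<^sup>2 < 1" "0 < c\<^sup>2 / K'\<^sup>2" using K' c by (auto simp: power_strict_mono)
  have q: "0 \<le> q" "q < 1" using c2 by (auto simp: q_def real_sqrt_lt_1_iff)
  have contr: "norm (f - \<kappa> *\<^sub>R A f) \<le> q * norm f" for f
  proof (rule power2_le_imp_le)
    have "(norm (f - \<kappa> *\<^sub>R A f))\<^sup>2 = (norm f)\<^sup>2 - 2 * \<kappa> * inner f (A f) + \<kappa>\<^sup>2 * (norm (A f))\<^sup>2"
      by (simp add: power2_norm_eq_inner inner_diff_left inner_diff_right inner_commute algebra_simps power2_eq_square[of \<kappa>])
    also have "\<dots> \<le> (norm f)\<^sup>2 - 2 * \<kappa> * (c * (norm f)\<^sup>2) + \<kappa>\<^sup>2 * (K' * norm f)\<^sup>2"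
    proof (intro add_mono diff_mono mult_left_mono power_mono)
    qed (use K' c in \<open>auto simp: \<kappa>_def\<close>)
    also have "\<dots> = (1 - c\<^sup>2 / K'\<^sup>2) * (norm f)\<^sup>2"
      using K' by (simp add: \<kappa>_def field_simps power2_eq_square)
    also have "\<dots> = (q * norm f)\<^sup>2" using c2 by (simp add: q_def power_mult_distrib)
    finally show "(norm (f - \<kappa> *\<^sub>R A f))\<^sup>2 \<le> (q * norm f)\<^sup>2" .
  qed (use q in auto)
  show "surj A"
  proof (intro surjI)
    fix g
    have "\<exists>!f. f - \<kappa> *\<^sub>R (A f - g) = f"
    proof (rule banach_fix_type[OF q])
      show "\<forall>x y. dist (x - \<kappa> *\<^sub>R (A x - g)) (y - \<kappa> *\<^sub>R (A y - g)) \<le> q * dist x y"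
      proof (intro allI)
        fix x y
        have "x - \<kappa> *\<^sub>R (A x - g) - (y - \<kappa> *\<^sub>R (A y - g)) = (x - y) - \<kappa> *\<^sub>R A (x - y)"
          by (simp add: linear_diff[OF A] algebra_simps)
        then show "dist (x - \<kappa> *\<^sub>R (A x - g)) (y - \<kappa> *\<^sub>R (A y - g)) \<le> q * dist x y"
          unfolding dist_norm by (simp only: contr)
      qed
    qed
    then obtain f where "f - \<kappa> *\<^sub>R (A f - g) = f" by blast
    then have "A f = g" using c K' by (simp add: \<kappa>_def)
    then show "A (SOME f. A f = g) = g" by (rule someI)
  qed
qed

text \<open>The Neumann series, as a fixed point of \<open>f \<mapsto> K g - K (G f - G\<^sub>0 f)\<close>, where \<open>K\<close> is the inverse
  of \<open>G\<^sub>0\<close>.\<close>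

lemma perturbed_inverse:
  fixes G :: "'a::{real_inner,complete_space} \<Rightarrow> 'a"
  assumes G: "linear G" and K: "linear K" "\<And>f. norm (K f) \<le> norm f"
    and inv: "\<And>f. K (G\<^sub>0 f) = f" "\<And>f. G\<^sub>0 (K f) = f" and G0: "linear G\<^sub>0"
    and q: "\<And>f. norm (G f - G\<^sub>0 f) \<le> 1/2 * norm f"
  shows "bij G" and "norm f \<le> 2 * norm (G f)"
proof -
  have below: "norm f \<le> 2 * norm (G f)" for f
  proof -
    have "norm f = norm (K (G\<^sub>0 f))" by (simp add: inv)
    also have "\<dots> \<le> norm (G\<^sub>0 f)" by (rule K)
    also have "\<dots> \<le> norm (G f) + norm (G f - G\<^sub>0 f)"
      using norm_triangle_ineq4[of "G f" "G f - G\<^sub>0 f"] by simp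
    finally show ?thesis using q[of f] by simp
  qed
  show "norm f \<le> 2 * norm (G f)" by (rule below)
  have "inj G"
  proof (rule injI)
    fix x y assume "G x = G y"
    then have "norm (x - y) \<le> 0" using below[of "x - y"] by (simp add: linear_diff[OF G])
    then show "x = y" by simp
  qed
  moreover have "surj G"
  proof (intro surjI)
    fix g
    have lin: "linear (\<lambda>f. K (G f - G\<^sub>0 f))"
      by (intro linear_compose[OF linear_compose_sub[OF G G0] K(1), unfolded o_def])
    have "\<exists>!f. K g - K (G f - G\<^sub>0 f) = f"
    proof (rule banach_fix_type[of "1/2"])
      show "\<forall>x y. dist (K g - K (G x - G\<^sub>0 x)) (K g - K (G y - G\<^sub>0 y)) \<le> 1/2 * dist x y"
      proof (intro allI)
        fix x y
        have "K g - K (G x - G\<^sub>0 x) - (K g - K (G y - G\<^sub>0 y)) = - K (G (x - y) - G\<^sub>0 (x - y))"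
          using linear_diff[OF lin, of x y] by simp
        then have "dist (K g - K (G x - G\<^sub>0 x)) (K g - K (G y - G\<^sub>0 y)) = norm (K (G (x - y) - G\<^sub>0 (x - y)))"
          unfolding dist_norm by (simp only: norm_minus_cancel)
        also have "\<dots> \<le> 1/2 * norm (x - y)" by (rule order_trans[OF K(2) q])
        finally show "dist (K g - K (G x - G\<^sub>0 x)) (K g - K (G y - G\<^sub>0 y)) \<le> 1/2 * dist x y"
          by (simp only: dist_norm)
      qed
    qed auto
    then obtain f where "K g - K (G f - G\<^sub>0 f) = f" by blast
    then have "G\<^sub>0 (K g - K (G f - G\<^sub>0 f)) = G\<^sub>0 f" by simp
    then have "G f = g" by (simp add: linear_diff[OF G0] inv)
    then show "G (SOME f. G f = g) = g" by (rule someI)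
  qed
  ultimately show "bij G" by (rule bijI)
qed

text \<open>A complex Hilbert space is a real one with an isometric complex structure \<open>J\<close>. The complex inner product
  \<open>ci\<close> is conjugate-linear in its first argument.\<close>

locale complex_hilbert =
  fixes J :: "'a::{real_inner,complete_space} \<Rightarrow> 'a"
  assumes J_linear: "linear J" and JJ: "J (J f) = - f" and J_iso: "inner (J f) (J g) = inner f g"
begin

definition sc :: "complex \<Rightarrow> 'a \<Rightarrow> 'a" (infixr "\<odot>" 75) where "c \<odot> f = Re c *\<^sub>R f + Im c *\<^sub>R J f"

definition ci :: "'a \<Rightarrow> 'a \<Rightarrow> complex" where "ci f g = Complex (inner f g) (inner (J f) g)"

lemma J_skew: "inner f (J g) = - inner (J f) g"
  using J_iso[of f "J g"] J_iso[of "J f" g] JJ[of f] by simp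

lemmas J_lin = linear_add[OF J_linear] linear_diff[OF J_linear] linear_scale[OF J_linear]
  linear_neg[OF J_linear] linear_0[OF J_linear]

lemma sc_add: "c \<odot> (f + g) = c \<odot> f + c \<odot> g"
  and sc_add_left: "(c + d) \<odot> f = c \<odot> f + d \<odot> f"
  and sc_diff: "c \<odot> (f - g) = c \<odot> f - c \<odot> g"
  and sc_diff_left: "(c - d) \<odot> f = c \<odot> f - d \<odot> f"
  and sc_sc: "c \<odot> (d \<odot> f) = (c * d) \<odot> f"
  and sc_1: "1 \<odot> f = f" and sc_0: "0 \<odot> f = 0" and sc_zero: "c \<odot> 0 = 0"
  and sc_neg_left: "(- c) \<odot> f = - (c \<odot> f)"
  and sc_of_real: "of_real r \<odot> f = r *\<^sub>R f"
  and sc_scaleR: "c \<odot> (r *\<^sub>R f) = r *\<^sub>R (c \<odot> f)"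
  by (auto simp: sc_def J_lin JJ algebra_simps)

lemma sc_sum: "c \<odot> (\<Sum>i\<in>A. f i) = (\<Sum>i\<in>A. c \<odot> f i)"
  by (induction A rule: infinite_finite_induct) (auto simp: sc_add sc_zero)

lemma ci_add_right: "ci f (g + h) = ci f g + ci f h"
  and ci_add_left: "ci (f + g) h = ci f h + ci g h"
  and ci_diff_right: "ci f (g - h) = ci f g - ci f h"
  and ci_diff_left: "ci (f - g) h = ci f h - ci g h"
  and ci_sc_right: "ci f (c \<odot> g) = c * ci f g"
  and ci_sc_left: "ci (c \<odot> f) g = cnj c * ci f g"
  and ci_neg_right: "ci f (- g) = - ci f g"
  and ci_0: "ci 0 f = 0" "ci f 0 = 0"
  and Re_ci: "Re (ci f g) = inner f g"
  by (auto simp: ci_def sc_def J_lin JJ complex_eq_iff inner_add_left inner_add_right inner_diff_left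
      inner_diff_right J_skew J_iso algebra_simps)

lemma ci_commute: "ci g f = cnj (ci f g)"
  using J_skew[of f g] by (simp add: ci_def complex_eq_iff inner_commute[of g f] inner_commute[of "J g" f])

lemma ci_sum_right: "ci f (\<Sum>i\<in>A. g i) = (\<Sum>i\<in>A. ci f (g i))"
  by (induction A rule: infinite_finite_induct) (auto simp: ci_add_right ci_0)

lemma ci_self: "ci f f = of_real ((norm f)\<^sup>2)"
proof -
  have "inner (J f) f = 0" using J_skew[of f f] inner_commute[of f "J f"] by linarith
  then show ?thesis by (simp add: ci_def complex_eq_iff power2_norm_eq_inner)
qed

lemma norm_sc: "norm (c \<odot> f) = cmod c * norm f"
proof -
  have "of_real ((norm (c \<odot> f))\<^sup>2) = ci (c \<odot> f) (c \<odot> f)" by (simp only: ci_self)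
  also have "\<dots> = (c * cnj c) * ci f f" by (simp only: ci_sc_left ci_sc_right mult_ac)
  also have "\<dots> = of_real ((cmod c)\<^sup>2) * of_real ((norm f)\<^sup>2)" by (simp only: ci_self complex_norm_square)
  also have "\<dots> = of_real ((cmod c * norm f)\<^sup>2)" by (simp add: power_mult_distrib)
  finally have "(norm (c \<odot> f))\<^sup>2 = (cmod c * norm f)\<^sup>2" by (simp only: of_real_eq_iff)
  then show ?thesis by (simp add: power2_eq_iff_nonneg)
qed

lemma cmod_ci_le: "cmod (ci f g) \<le> norm f * norm g"
proof (cases "ci f g = 0")
  case False
  define w where "w = cnj (ci f g) / of_real (cmod (ci f g))"
  have "ci f (w \<odot> g) = of_real (cmod (ci f g))"
  proof -
    have "cnj (ci f g) * ci f g = of_real (cmod (ci f g)) * of_real (cmod (ci f g))"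
      by (metis complex_norm_square mult.commute of_real_power power2_eq_square)
    then show ?thesis using False unfolding ci_sc_right w_def times_divide_eq_left by simp
  qed
  then have "cmod (ci f g) = inner f (w \<odot> g)" using Re_ci[of f "w \<odot> g"] by simp
  also have "\<dots> \<le> norm f * norm (w \<odot> g)" by (rule norm_cauchy_schwarz)
  also have "norm (w \<odot> g) = norm g" using False by (simp add: norm_sc w_def norm_divide)
  finally show ?thesis .
qed auto

definition clin :: "('a \<Rightarrow> 'a) \<Rightarrow> bool" where
  "clin A \<longleftrightarrow> linear A \<and> (\<forall>f. A (J f) = J (A f)) \<and> (\<exists>K. \<forall>f. norm (A f) \<le> K * norm f)"

lemma clin_linear: "clin A \<Longrightarrow> linear A" by (simp add: clin_def)

lemma clin_sc: "clin A \<Longrightarrow> A (c \<odot> f) = c \<odot> A f"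
  by (simp add: clin_def sc_def linear_add linear_scale)

lemma clin_add: "clin A \<Longrightarrow> A (f + g) = A f + A g"
  and clin_diff: "clin A \<Longrightarrow> A (f - g) = A f - A g"
  and clin_0: "clin A \<Longrightarrow> A 0 = 0"
  and clin_sum: "clin A \<Longrightarrow> A (\<Sum>i\<in>X. h i) = (\<Sum>i\<in>X. A (h i))"
  and clin_scaleR: "clin A \<Longrightarrow> A (r *\<^sub>R f) = r *\<^sub>R A f"
  by (simp_all add: clin_def linear_add linear_diff linear_neg linear_0 linear_sum linear_scale)

lemma clin_adjoint_ci:
  assumes "clin A" "\<And>f g. inner (A f) g = inner f (A g)"
  shows "ci (A f) g = ci f (A g)"
  using assms(1) assms(2)[of f g] assms(2)[of "J f" g] by (simp add: ci_def clin_def)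

end

section \<open>The bordered pencil\<close>

text \<open>Unit eigenvectors \<open>b\<^sub>i\<close> of a unitary symmetry \<open>U\<close>, with distinct eigenvalues. The eigenspace of
  \<open>U\<close> that contains \<open>b\<^sub>i\<close> is called the \<open>i\<close>-th sector.\<close>

locale modes = complex_hilbert J for J :: "'a::{real_inner,complete_space} \<Rightarrow> 'a" +
  fixes U :: "'a \<Rightarrow> 'a" and I :: "'i set" and b :: "'i \<Rightarrow> 'a" and \<zeta> :: "'i \<Rightarrow> complex"
  assumes clin_U: "clin U" and U_iso: "inner (U f) (U g) = inner f g"
    and fin: "finite I" and b_norm: "i \<in> I \<Longrightarrow> norm (b i) = 1"
    and U_b: "i \<in> I \<Longrightarrow> U (b i) = \<zeta> i \<odot> b i"
    and \<zeta>_inj: "inj_on \<zeta> I" and \<zeta>_unit: "i \<in> I \<Longrightarrow> cmod (\<zeta> i) = 1"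
begin

definition Prj :: "'a \<Rightarrow> 'a" where "Prj f = (\<Sum>i\<in>I. ci (b i) f \<odot> b i)"

lemma ci_U: "ci (U f) (U g) = ci f g"
  using clin_U U_iso[of f g] U_iso[of "J f" g] by (simp add: ci_def clin_def)

lemma \<zeta>_mult: "i \<in> I \<Longrightarrow> cnj (\<zeta> i) * \<zeta> i = 1"
  using \<zeta>_unit[of i] complex_norm_square[of "\<zeta> i"] by (simp add: mult.commute)

lemma sector_orth:
  assumes "i \<in> I" "j \<in> I" "i \<noteq> j" "U f = \<zeta> i \<odot> f" "U g = \<zeta> j \<odot> g" shows "ci f g = 0"
proof -
  have "ci f g = cnj (\<zeta> i) * \<zeta> j * ci f g"
    using ci_U[of f g] unfolding assms(4,5) by (simp add: ci_sc_left ci_sc_right mult_ac)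
  then have "\<zeta> i * ci f g = \<zeta> i * (cnj (\<zeta> i) * \<zeta> j * ci f g)" by (simp only:)
  also have "\<dots> = (cnj (\<zeta> i) * \<zeta> i) * (\<zeta> j * ci f g)" by (simp only: mult_ac)
  also have "\<dots> = \<zeta> j * ci f g" by (simp only: \<zeta>_mult[OF assms(1)] mult_1_left)
  finally have "\<zeta> i * ci f g = \<zeta> j * ci f g" .
  moreover have "\<zeta> i \<noteq> \<zeta> j" using \<zeta>_inj assms(1-3) by (auto dest: inj_onD)
  ultimately show ?thesis by simp
qed

lemma ci_bb: "i \<in> I \<Longrightarrow> j \<in> I \<Longrightarrow> ci (b i) (b j) = (if i = j then 1 else 0)"
  using sector_orth[of i j "b i" "b j"] by (auto simp: U_b ci_self b_norm)

lemma ci_b_U: "i \<in> I \<Longrightarrow> ci (b i) (U f) = \<zeta> i * ci (b i) f"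
proof -
  assume i: "i \<in> I"
  have "b i = cnj (\<zeta> i) \<odot> U (b i)" using \<zeta>_mult[OF i] by (simp add: U_b i sc_sc sc_1)
  then have "ci (b i) (U f) = ci (cnj (\<zeta> i) \<odot> U (b i)) (U f)" by simp
  then show ?thesis by (simp add: ci_sc_left ci_U)
qed

lemma clin_Prj: "clin Prj"
proof -
  have "norm (Prj f) \<le> (\<Sum>i\<in>I. norm (b i) * norm (b i)) * norm f" for f
  proof -
    have "norm (Prj f) \<le> (\<Sum>i\<in>I. norm (ci (b i) f \<odot> b i))" unfolding Prj_def by (rule norm_sum)
    also have "\<dots> \<le> (\<Sum>i\<in>I. (norm (b i) * norm f) * norm (b i))"
      unfolding norm_sc by (intro sum_mono mult_right_mono cmod_ci_le) auto
    finally show ?thesis by (simp add: sum_distrib_left sum_distrib_right mult_ac)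
  qed
  moreover have "linear Prj"
  proof (rule linearI)
    show "Prj (f + g) = Prj f + Prj g" for f g
      by (simp add: Prj_def ci_add_right sc_add_left sum.distrib)
    show "Prj (r *\<^sub>R f) = r *\<^sub>R Prj f" for r f
      by (simp add: Prj_def sc_of_real[symmetric] ci_sc_right sc_sum sc_sc)
  qed
  moreover have "Prj (J f) = J (Prj f)" for f
  proof -
    have J: "J g = \<i> \<odot> g" for g by (simp add: sc_def)
    show ?thesis by (simp add: J Prj_def ci_sc_right sc_sum sc_sc)
  qed
  ultimately show ?thesis unfolding clin_def by blast
qed

lemma Prj_sym: "ci (Prj f) g = ci f (Prj g)"
proof -
  have "ci (Prj f) g = cnj (ci g (Prj f))" by (rule ci_commute)
  also have "\<dots> = (\<Sum>i\<in>I. cnj (ci (b i) f) * cnj (ci g (b i)))"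
    by (simp add: Prj_def ci_sum_right ci_sc_right)
  also have "\<dots> = (\<Sum>i\<in>I. ci f (b i) * ci (b i) g)"
    by (intro sum.cong refl) (simp add: ci_commute[of f] ci_commute[of _ g])
  also have "\<dots> = ci f (Prj g)" by (simp add: Prj_def ci_sum_right ci_sc_right mult.commute)
  finally show ?thesis .
qed

lemma Prj_U: "Prj (U f) = U (Prj f)"
  unfolding Prj_def clin_sum[OF clin_U]
  by (intro sum.cong refl) (simp add: ci_b_U clin_sc[OF clin_U] U_b sc_sc mult.commute)

lemma Prj_b: "i \<in> I \<Longrightarrow> Prj (b i) = b i"
proof -
  assume i: "i \<in> I"
  have "Prj (b i) = (\<Sum>j\<in>I. if j = i then b i else 0)"
    unfolding Prj_def by (intro sum.cong refl) (auto simp: ci_bb i sc_1 sc_0)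
  then show ?thesis using fin i by simp
qed

lemma Prj_sector: "i \<in> I \<Longrightarrow> U f = \<zeta> i \<odot> f \<Longrightarrow> Prj f = ci (b i) f \<odot> b i"
proof -
  assume i: "i \<in> I" "U f = \<zeta> i \<odot> f"
  have "Prj f = (\<Sum>j\<in>I. if j = i then ci (b i) f \<odot> b i else 0)"
    unfolding Prj_def by (intro sum.cong refl) (use sector_orth[of _ i _ f] i in \<open>auto simp: sc_0 U_b\<close>)
  then show ?thesis using fin i by simp
qed

end

text \<open>The limit \<open>H\<^sub>0\<close> of \<open>H\<close> annihilates the modes. For \<open>G\<^sub>0 = H\<^sub>0 + Prj\<close> the identity
  \<open>G0_sq\<close> reads \<open>G\<^sub>0\<^sup>2 + G\<^sub>0 = 2\<close>, so its inverse is \<open>(G\<^sub>0 + 1)/2\<close>, and \<open>G0_bound\<close> says that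
  this inverse has norm at most \<open>1\<close>.\<close>

locale krein_pencil = modes J U I b \<zeta>
  for J :: "'a::{real_inner,complete_space} \<Rightarrow> 'a" and U and I :: "'i set" and b \<zeta> +
  fixes H H\<^sub>0 \<sigma> :: "'a \<Rightarrow> 'a" and \<theta> :: real
  assumes clin_H: "clin H" and clin_H0: "clin H\<^sub>0" and clin_\<sigma>: "clin \<sigma>"
    and H_sym: "inner (H f) g = inner f (H g)"
    and \<sigma>_sym: "inner (\<sigma> f) g = inner f (\<sigma> g)" and \<sigma>\<sigma>: "\<sigma> (\<sigma> f) = f"
    and H_U: "H (U f) = U (H f)" and \<sigma>_U: "\<sigma> (U f) = U (\<sigma> f)"
    and near: "norm (H f - H\<^sub>0 f) \<le> \<theta> * norm f" and \<theta>: "0 \<le> \<theta>" "\<theta> \<le> 1 / 10000000"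
    and H0_b: "i \<in> I \<Longrightarrow> H\<^sub>0 (b i) = 0"
    and G0_sq: "(H\<^sub>0 (H\<^sub>0 f + Prj f) + Prj (H\<^sub>0 f + Prj f)) + (H\<^sub>0 f + Prj f) = 2 *\<^sub>R f"
    and G0_bound: "norm (H\<^sub>0 f + Prj f + f) \<le> 2 * norm f"
begin

lemma ci_H: "ci (H f) g = ci f (H g)" by (rule clin_adjoint_ci[OF clin_H H_sym])
lemma ci_\<sigma>: "ci (\<sigma> f) g = ci f (\<sigma> g)" by (rule clin_adjoint_ci[OF clin_\<sigma> \<sigma>_sym])
lemma norm_\<sigma>: "norm (\<sigma> f) = norm f" by (simp add: norm_eq_sqrt_inner \<sigma>_sym \<sigma>\<sigma>)

text \<open>The pencil \<open>P z\<close>, the bordered pencil \<open>Ht z\<close> and its inverse \<open>R z\<close>. In each sector the bordered problem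
  has one unknown scalar, and \<open>k i\<close> is the resulting Schur complement (see \<open>P_e\<close>).\<close>

definition P :: "complex \<Rightarrow> 'a \<Rightarrow> 'a" where "P z f = H f - z \<odot> \<sigma> f"
definition Ht :: "complex \<Rightarrow> 'a \<Rightarrow> 'a" where "Ht z f = P z f + Prj f"
definition G\<^sub>0 :: "'a \<Rightarrow> 'a" where "G\<^sub>0 f = H\<^sub>0 f + Prj f"
definition R :: "complex \<Rightarrow> 'a \<Rightarrow> 'a" where "R z = inv (Ht z)"
definition e :: "'i \<Rightarrow> complex \<Rightarrow> 'a" where "e i z = R z (b i)"
definition k :: "'i \<Rightarrow> complex \<Rightarrow> complex" where "k i z = 1 - ci (b i) (e i z)"

lemma P_add: "P z (f + g) = P z f + P z g" and P_sc: "P z (c \<odot> f) = c \<odot> P z f"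
  and P_diff: "P z (f - g) = P z f - P z g" and P_0: "P z 0 = 0"
  by (simp_all add: P_def clin_add clin_diff clin_sc clin_0 clin_H clin_\<sigma> sc_add sc_diff sc_sc sc_zero mult.commute algebra_simps)

lemma P_sum: "P z (\<Sum>i\<in>X. f i) = (\<Sum>i\<in>X. P z (f i))"
  by (induction X rule: infinite_finite_induct) (simp_all add: P_add P_0)

lemma P_U: "P z (U f) = U (P z f)"
  by (simp add: P_def H_U \<sigma>_U clin_diff[OF clin_U] clin_sc[OF clin_U])

lemma P_adj: "ci (P z f) g = ci f (P (cnj z) g)"
  by (simp add: P_def ci_diff_left ci_diff_right ci_H ci_sc_left ci_sc_right ci_\<sigma>)

lemma P_bounded: "\<exists>K. \<forall>f. norm (P z f) \<le> K * norm f"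
proof -
  obtain K where K: "\<And>f. norm (H f) \<le> K * norm f" using clin_H by (auto simp: clin_def)
  have "norm (P z f) \<le> (K + cmod z) * norm f" for f
    unfolding P_def using norm_triangle_ineq4[of "H f" "z \<odot> \<sigma> f"] K[of f]
    by (simp add: norm_sc norm_\<sigma> algebra_simps)
  then show ?thesis by blast
qed

lemma P_linear: "linear (P z)"
  by (rule linearI) (simp_all add: P_add P_sc[of z "of_real _", unfolded sc_of_real])

lemma Ht_linear: "linear (Ht z)"
  unfolding Ht_def[abs_def] by (rule linear_compose_add[OF P_linear clin_linear[OF clin_Prj]])

lemma Ht_sc: "Ht z (c \<odot> f) = c \<odot> Ht z f"
  by (simp add: Ht_def P_sc clin_sc[OF clin_Prj] sc_add)

lemma Ht_U: "Ht z (U f) = U (Ht z f)"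
  by (simp add: Ht_def P_U Prj_U clin_add[OF clin_U])

lemma Ht_adj: "ci (Ht z f) g = ci f (Ht (cnj z) g)"
  by (simp add: Ht_def ci_add_left ci_add_right P_adj Prj_sym)

lemma Ht_near: "norm (Ht z f - G\<^sub>0 f) \<le> (\<theta> + cmod z) * norm f"
proof -
  have "Ht z f - G\<^sub>0 f = (H f - H\<^sub>0 f) - z \<odot> \<sigma> f" by (simp add: Ht_def G\<^sub>0_def P_def)
  then have "norm (Ht z f - G\<^sub>0 f) \<le> norm (H f - H\<^sub>0 f) + norm (z \<odot> \<sigma> f)"
    by (simp only: norm_triangle_ineq4)
  then show ?thesis using near[of f] by (simp add: norm_sc norm_\<sigma> algebra_simps)
qed

lemma G0_linear: "linear G\<^sub>0"
  unfolding G\<^sub>0_def[abs_def] by (rule linear_compose_add[OF clin_linear[OF clin_H0] clin_linear[OF clin_Prj]])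

context
  fixes z :: complex assumes z: "cmod z \<le> 1 / 100"
begin

lemma Ht_bij: "bij (Ht z)" and Ht_below: "norm f \<le> 2 * norm (Ht z f)"
proof -
  let ?K = "\<lambda>f. (1/2) *\<^sub>R (G\<^sub>0 f + f)"
  have K: "linear ?K"
    by (rule linearI) (simp_all add: linear_add[OF G0_linear] linear_scale[OF G0_linear] algebra_simps)
  have nK: "norm (?K f) \<le> norm f" for f
    using G0_bound[of f] by (simp add: G\<^sub>0_def)
  have GG: "G\<^sub>0 (G\<^sub>0 f) + G\<^sub>0 f = 2 *\<^sub>R f" for f using G0_sq[of f] by (simp add: G\<^sub>0_def)
  have inv1: "?K (G\<^sub>0 f) = f" for f using GG[of f] by simp
  have inv2: "G\<^sub>0 (?K f) = f" for f using GG[of f]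
    by (simp add: linear_add[OF G0_linear] linear_scale[OF G0_linear])
  have q: "norm (Ht z f - G\<^sub>0 f) \<le> 1/2 * norm f" for f
    by (rule order_trans[OF Ht_near mult_right_mono]) (use z \<theta> in auto)
  note inst = perturbed_inverse[OF Ht_linear K nK inv1 inv2 G0_linear q]
  show "bij (Ht z)" by (rule inst(1))
  show "norm f \<le> 2 * norm (Ht z f)" by (rule inst(2))
qed

lemma Ht_R [simp]: "Ht z (R z g) = g"
  unfolding R_def using Ht_bij by (simp add: bij_is_surj surj_f_inv_f)

lemma R_Ht [simp]: "R z (Ht z f) = f"
  unfolding R_def using Ht_bij by (simp add: bij_is_inj)

lemma R_eqI: "Ht z f = g \<Longrightarrow> R z g = f" by (metis R_Ht)

lemma R_norm: "norm (R z g) \<le> 2 * norm g" using Ht_below[of "R z g"] by simp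

lemma R_add: "R z (f + g) = R z f + R z g"
  by (rule R_eqI) (simp add: linear_add[OF Ht_linear])
lemma R_diff: "R z (f - g) = R z f - R z g"
  by (rule R_eqI) (simp add: linear_diff[OF Ht_linear])
lemma R_sc: "R z (c \<odot> f) = c \<odot> R z f"
  by (rule R_eqI) (simp add: Ht_sc)
lemma R_0: "R z 0 = 0" using R_diff[of 0 0] by simp
lemma R_sum: "R z (\<Sum>i\<in>X. f i) = (\<Sum>i\<in>X. R z (f i))"
  by (induction X rule: infinite_finite_induct) (simp_all add: R_add R_0)
lemma R_U: "R z (U f) = U (R z f)" by (rule R_eqI) (simp add: Ht_U)

lemma e_U: "i \<in> I \<Longrightarrow> U (e i z) = \<zeta> i \<odot> e i z"
  by (simp add: e_def R_U[symmetric] U_b R_sc)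

lemma P_e: assumes i: "i \<in> I" shows "P z (e i z) = k i z \<odot> b i"
proof -
  have "P z (e i z) = b i - Prj (e i z)" using Ht_R[of "b i"] by (simp add: Ht_def e_def algebra_simps)
  then show ?thesis by (simp add: Prj_sector[OF i e_U[OF i]] k_def sc_diff_left sc_1)
qed

lemma decomposition: "f = R z (P z f) + (\<Sum>i\<in>I. ci (b i) f \<odot> e i z)"
proof -
  have "f = R z (P z f + Prj f)" using R_Ht[of f] by (simp add: Ht_def)
  then show ?thesis by (simp add: R_add Prj_def R_sum R_sc e_def)
qed

lemma ci_b_e: "i \<in> I \<Longrightarrow> j \<in> I \<Longrightarrow> ci (b i) (e j z) = (if i = j then 1 - k i z else 0)"
  using sector_orth[of i j "b i" "e j z"] by (auto simp: k_def U_b e_U)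

lemma norm_e_near: "i \<in> I \<Longrightarrow> norm (e i z - b i) \<le> 2 * (\<theta> + cmod z)"
proof -
  assume i: "i \<in> I"
  have "G\<^sub>0 (b i) = b i" by (simp add: G\<^sub>0_def H0_b i Prj_b)
  then have n: "norm (Ht z (b i) - b i) \<le> \<theta> + cmod z" using Ht_near[of z "b i"] by (simp add: b_norm i)
  have "e i z - b i = - R z (Ht z (b i) - b i)" by (simp add: e_def R_diff)
  then have "norm (e i z - b i) \<le> 2 * norm (Ht z (b i) - b i)" by (simp only: norm_minus_cancel R_norm)
  then show ?thesis using n by simp
qed

text \<open>By \<open>decomposition\<close> an element of the kernel is a combination of the \<open>e\<^sub>i(z)\<close>; pairing it with
  \<open>b\<^sub>j\<close> shows that only those with \<open>k\<^sub>j(z) = 0\<close> occur.\<close>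

lemma kernel:
  "P z f = 0 \<longleftrightarrow> (\<exists>c. f = (\<Sum>i\<in>{i\<in>I. k i z = 0}. c i \<odot> e i z))"
proof
  assume "P z f = 0"
  then have f: "f = (\<Sum>i\<in>I. ci (b i) f \<odot> e i z)" using decomposition[of f] by (simp add: R_0)
  have "ci (b i) f = 0" if i: "i \<in> I" "k i z \<noteq> 0" for i
  proof -
    have "ci (b i) f = (\<Sum>j\<in>I. ci (b j) f * ci (b i) (e j z))"
      by (subst f) (simp add: ci_sum_right ci_sc_right)
    also have "\<dots> = (\<Sum>j\<in>I. if j = i then ci (b i) f * (1 - k i z) else 0)"
      by (intro sum.cong refl) (auto simp: ci_b_e i)
    finally have "ci (b i) f * k i z = 0" using fin i by (simp add: algebra_simps)
    then show ?thesis using i by simp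
  qed
  then have "(\<Sum>i\<in>I. ci (b i) f \<odot> e i z) = (\<Sum>i\<in>{i\<in>I. k i z = 0}. ci (b i) f \<odot> e i z)"
    by (intro sum.mono_neutral_right fin) (auto simp: sc_0)
  then show "\<exists>c. f = (\<Sum>i\<in>{i\<in>I. k i z = 0}. c i \<odot> e i z)" using f by metis
next
  assume "\<exists>c. f = (\<Sum>i\<in>{i\<in>I. k i z = 0}. c i \<odot> e i z)"
  then show "P z f = 0" by (auto simp: P_sum P_sc P_e sc_zero sc_0 intro!: sum.neutral)
qed

text \<open>The solution of \<open>P z f = g\<close> is \<open>R z g\<close> corrected in each sector by a multiple of \<open>e\<^sub>i(z)\<close>, with
  \<open>k\<^sub>i(z)\<close> in the denominator.\<close>

lemma resolvent_small:
  assumes nz: "\<And>i. i \<in> I \<Longrightarrow> k i z \<noteq> 0"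
  shows "bij (P z)" and "\<exists>K. \<forall>f. norm f \<le> K * norm (P z f)"
proof -
  define S where "S g = R z g + (\<Sum>i\<in>I. (ci (b i) (R z g) / k i z) \<odot> e i z)" for g
  have PS: "P z (S g) = g" for g
  proof -
    have "P z (R z g) = g - Prj (R z g)" using Ht_R[of g] by (simp add: Ht_def algebra_simps)
    moreover have "P z (\<Sum>i\<in>I. (ci (b i) (R z g) / k i z) \<odot> e i z) = Prj (R z g)"
      unfolding Prj_def P_sum by (intro sum.cong refl) (simp add: P_sc P_e sc_sc nz)
    ultimately show ?thesis by (simp add: S_def P_add)
  qed
  have inj: "f = 0" if P0: "P z f = 0" for f
  proof -
    have "{i\<in>I. k i z = 0} = {}" using nz by auto
    moreover obtain c where "f = (\<Sum>i\<in>{i\<in>I. k i z = 0}. c i \<odot> e i z)" using P0 kernel[of f] by blast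
    ultimately show ?thesis by (simp only: sum.empty)
  qed
  have SP: "S (P z f) = f" for f
    using inj[of "S (P z f) - f"] by (simp add: P_diff PS)
  show "bij (P z)" by (rule o_bij[of S]) (auto simp: SP PS)
  define K where "K = 2 + (\<Sum>i\<in>I. 2 / cmod (k i z) * norm (e i z))"
  have "norm (S g) \<le> K * norm g" for g
  proof -
    have "norm (S g) \<le> norm (R z g) + (\<Sum>i\<in>I. norm ((ci (b i) (R z g) / k i z) \<odot> e i z))"
      unfolding S_def by (intro order_trans[OF norm_triangle_ineq] add_left_mono norm_sum)
    also have "\<dots> \<le> 2 * norm g + (\<Sum>i\<in>I. (2 / cmod (k i z) * norm (e i z)) * norm g)"
    proof (intro add_mono R_norm sum_mono)
      fix i assume i: "i \<in> I"
      have "cmod (ci (b i) (R z g)) \<le> 2 * norm g"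
        using cmod_ci_le[of "b i" "R z g"] R_norm[of g] by (simp add: b_norm i)
      then have "cmod (ci (b i) (R z g)) / cmod (k i z) * norm (e i z) \<le> 2 * norm g / cmod (k i z) * norm (e i z)"
        by (intro mult_right_mono divide_right_mono) auto
      then show "norm ((ci (b i) (R z g) / k i z) \<odot> e i z) \<le> (2 / cmod (k i z) * norm (e i z)) * norm g"
        by (simp add: norm_sc norm_divide mult_ac)
    qed
    also have "\<dots> = K * norm g" by (simp only: K_def distrib_right sum_distrib_right)
    finally show ?thesis .
  qed
  then show "\<exists>K. \<forall>f. norm f \<le> K * norm (P z f)" by (metis SP)
qed

end

lemma R_adj: "cmod z \<le> 1/100 \<Longrightarrow> ci (R z f) g = ci f (R (cnj z) g)"
proof -
  assume z: "cmod z \<le> 1/100"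
  have "ci (R z f) g = ci (R z f) (Ht (cnj z) (R (cnj z) g))" using z by simp
  also have "\<dots> = ci (Ht z (R z f)) (R (cnj z) g)" by (simp add: Ht_adj)
  finally show ?thesis using z by simp
qed

lemma resolvent_identity:
  assumes z: "cmod z \<le> 1/100" and w: "cmod w \<le> 1/100"
  shows "R z g - R w g = (z - w) \<odot> R z (\<sigma> (R w g))"
proof -
  have "Ht z (R w g) = g - (z - w) \<odot> \<sigma> (R w g)"
    using Ht_R[OF w, of g] by (simp add: Ht_def P_def sc_diff_left algebra_simps)
  then have "R w g = R z (g - (z - w) \<odot> \<sigma> (R w g))" using R_Ht[OF z, of "R w g"] by simp
  then have "R w g = R z g - (z - w) \<odot> R z (\<sigma> (R w g))" using z by (simp add: R_diff R_sc)
  moreover define X where "X = (z - w) \<odot> R z (\<sigma> (R w g))"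
  ultimately have "R w g = R z g - X" by simp
  then show ?thesis unfolding X_def[symmetric] by simp
qed

text \<open>The first and second divided differences of \<open>k\<^sub>i\<close>, by \<open>k_diff\<close> and \<open>d1_diff\<close>. The first one is a Krein
  form: on the real diagonal it is \<open>-\<langle>e\<^sub>i, \<sigma>e\<^sub>i\<rangle>\<close>.\<close>

definition d1 :: "'i \<Rightarrow> complex \<Rightarrow> complex \<Rightarrow> complex" where
  "d1 i z w = - ci (e i (cnj z)) (\<sigma> (e i w))"
definition d2 :: "'i \<Rightarrow> complex \<Rightarrow> complex \<Rightarrow> complex \<Rightarrow> complex" where
  "d2 i z w v = - ci (e i (cnj z)) (\<sigma> (R w (\<sigma> (e i v))))"

lemma k_diff:
  assumes z: "cmod z \<le> 1/100" and w: "cmod w \<le> 1/100"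
  shows "k i z - k i w = (z - w) * d1 i z w"
proof -
  have "k i z - k i w = - ci (b i) (e i z - e i w)" by (simp add: k_def ci_diff_right)
  also have "e i z - e i w = (z - w) \<odot> R z (\<sigma> (e i w))"
    unfolding e_def by (rule resolvent_identity[OF z w])
  also have "ci (b i) ((z - w) \<odot> R z (\<sigma> (e i w))) = (z - w) * ci (R (cnj z) (b i)) (\<sigma> (e i w))"
    using R_adj[of "cnj z" "b i"] z by (simp add: ci_sc_right)
  finally show ?thesis by (simp add: d1_def e_def)
qed

lemma d1_diff:
  assumes w: "cmod w \<le> 1/100" and v: "cmod v \<le> 1/100"
  shows "d1 i z w - d1 i z v = (w - v) * d2 i z w v"
proof -
  have "d1 i z w - d1 i z v = - ci (e i (cnj z)) (\<sigma> (e i w - e i v))"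
    by (simp add: d1_def ci_diff_right clin_diff[OF clin_\<sigma>])
  also have "e i w - e i v = (w - v) \<odot> R w (\<sigma> (e i v))"
    unfolding e_def by (rule resolvent_identity[OF w v])
  finally show ?thesis by (simp add: d2_def clin_sc[OF clin_\<sigma>] ci_sc_right)
qed

lemma k_cnj: "cmod z \<le> 1/100 \<Longrightarrow> k i (cnj z) = cnj (k i z)"
  using R_adj[of z "b i" "b i"] by (simp add: k_def e_def flip: ci_commute)

text \<open>Any \<open>f\<close> in the \<open>i\<close>-th sector is \<open>R 0 (H f)\<close> plus a multiple of \<open>e\<^sub>i(0)\<close>. Hence the
  value \<open>k\<^sub>i(0)\<close> is the energy of \<open>f\<close> up to an error quadratic in the residual \<open>H f\<close>.\<close>

lemma rayleigh:
  assumes i: "i \<in> I" and f: "U f = \<zeta> i \<odot> f"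
  shows "of_real ((cmod (ci (b i) f))\<^sup>2) * k i 0 = ci f (H f) - ci (H f) (R 0 (H f))"
    and "of_real ((cmod (ci (b i) f))\<^sup>2) * d1 i 0 0 = - ci (f - R 0 (H f)) (\<sigma> (f - R 0 (H f)))"
proof -
  define c where "c = ci (b i) f"
  have P0: "P 0 = H" by (simp add: P_def fun_eq_iff sc_0)
  have z: "cmod 0 \<le> 1/100" by simp
  have "f = R 0 (H f + c \<odot> b i)"
    using R_Ht[OF z, of f] by (simp add: Ht_def P0 Prj_sector[OF i f] c_def)
  then have f2: "f = R 0 (H f) + c \<odot> e i 0" by (simp add: R_add R_sc e_def)
  then have ce: "f - R 0 (H f) = c \<odot> e i 0" by (metis add_diff_cancel_left')
  have "c = ci (b i) (R 0 (H f)) + c * (1 - k i 0)"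
    using arg_cong[OF f2, of "ci (b i)"] by (simp add: ci_add_right ci_sc_right ci_b_e[OF z] i flip: c_def)
  then have "c * k i 0 = ci (b i) (R 0 (H f))" by (simp add: algebra_simps)
  also have "\<dots> = ci (e i 0) (H f)" using R_adj[OF z, of "b i"] by (simp add: e_def)
  finally have "cnj c * c * k i 0 = ci (c \<odot> e i 0) (H f)" by (simp add: ci_sc_left)
  also have "\<dots> = ci f (H f) - ci (H f) (R 0 (H f))"
    using R_adj[OF z, of "H f" "H f"] by (simp add: ce[symmetric] ci_diff_left)
  finally show "of_real ((cmod (ci (b i) f))\<^sup>2) * k i 0 = ci f (H f) - ci (H f) (R 0 (H f))"
    by (simp only: complex_norm_square c_def mult_ac)
  have "cnj c * c * d1 i 0 0 = - ci (c \<odot> e i 0) (\<sigma> (c \<odot> e i 0))"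
    by (simp add: d1_def ci_sc_left ci_sc_right clin_sc[OF clin_\<sigma>])
  then show "of_real ((cmod (ci (b i) f))\<^sup>2) * d1 i 0 0 = - ci (f - R 0 (H f)) (\<sigma> (f - R 0 (H f)))"
    unfolding ce by (simp only: complex_norm_square c_def mult_ac)
qed

end

section \<open>Multiplicities and divided differences\<close>

context krein_pencil begin

text \<open>The operator whose generalized kernel is the generalized eigenspace.\<close>

definition T :: "complex \<Rightarrow> 'a \<Rightarrow> 'a" where "T z f = \<sigma> (P z f)"

lemma \<sigma>_eq_0: "\<sigma> f = 0 \<longleftrightarrow> f = 0" using norm_\<sigma>[of f] by (metis norm_eq_zero)

lemma T_0: "T z 0 = 0" by (simp add: T_def P_0 clin_0[OF clin_\<sigma>])

lemma T_eq_0: "T z f = 0 \<longleftrightarrow> P z f = 0" by (simp add: T_def \<sigma>_eq_0)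

lemma P_eq_\<sigma>_T: "P z f = \<sigma> (T z f)" by (simp add: T_def \<sigma>\<sigma>)

abbreviation "zeros z \<equiv> {i\<in>I. k i z = 0}"

context
  fixes z :: complex assumes z: "cmod z \<le> 1 / 100" and real: "cnj z = z"
begin

text \<open>The Fredholm condition which a function in the range of \<open>P z\<close> has to satisfy.\<close>

lemma solvability:
  assumes "j \<in> zeros z" shows "ci (e j z) (P z f) = 0"
proof -
  have "ci (e j z) (P z f) = ci (P z (e j z)) f" by (simp add: P_adj real)
  then show ?thesis using assms by (simp add: P_e[OF z] sc_0 ci_0)
qed

lemma \<sigma>_sector: "U f = \<zeta> i \<odot> f \<Longrightarrow> U (\<sigma> f) = \<zeta> i \<odot> \<sigma> f"
  by (simp add: \<sigma>_U[symmetric] clin_sc[OF clin_\<sigma>])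

lemma ci_e_\<sigma>: 
  assumes "i \<in> I" "j \<in> I" "i \<noteq> j" shows "ci (e j z) (\<sigma> (e i z)) = 0"
  using sector_orth[of j i "e j z" "\<sigma> (e i z)"] assms by (auto simp: e_U[OF z] \<sigma>_sector)

lemma ci_e_sum:
  assumes "j \<in> zeros z"
  shows "ci (e j z) (\<sigma> (\<Sum>i\<in>zeros z. c i \<odot> e i z)) = c j * ci (e j z) (\<sigma> (e j z))"
proof -
  have "ci (e j z) (\<sigma> (\<Sum>i\<in>zeros z. c i \<odot> e i z)) = (\<Sum>i\<in>zeros z. c i * ci (e j z) (\<sigma> (e i z)))"
    by (simp add: clin_sum[OF clin_\<sigma>] clin_sc[OF clin_\<sigma>] ci_sum_right ci_sc_right)
  also have "\<dots> = (\<Sum>i\<in>zeros z. if i = j then c j * ci (e j z) (\<sigma> (e j z)) else 0)"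
    by (intro sum.cong refl) (use assms ci_e_\<sigma> in auto)
  also have "\<dots> = c j * ci (e j z) (\<sigma> (e j z))" using fin assms by simp
  finally show ?thesis .
qed

lemma e_independent:
  assumes "(\<Sum>i\<in>zeros z. c i \<odot> e i z) = 0" "j \<in> zeros z" shows "c j = 0"
proof -
  have "0 = ci (b j) (\<Sum>i\<in>zeros z. c i \<odot> e i z)" by (simp add: assms ci_0)
  also have "\<dots> = (\<Sum>i\<in>zeros z. if i = j then c j else 0)"
    unfolding ci_sum_right ci_sc_right using assms(2) by (intro sum.cong refl) (auto simp: ci_b_e[OF z])
  also have "\<dots> = c j" using fin assms(2) by simp
  finally show ?thesis by simp
qed

text \<open>A Jordan chain over \<open>\<Sum> c\<^sub>i e\<^sub>i\<close> would require \<open>\<sigma>\<close> of this element to satisfy the solvability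
  condition, that is \<open>c\<^sub>i \<langle>e\<^sub>i, \<sigma>e\<^sub>i\<rangle> = 0\<close> for all \<open>i\<close>.\<close>

lemma generalized_kernel_simple:
  assumes nd: "\<And>i. i \<in> zeros z \<Longrightarrow> ci (e i z) (\<sigma> (e i z)) \<noteq> 0"
  shows "(\<exists>n. (T z ^^ n) f = 0) \<longleftrightarrow> (\<exists>c. f = (\<Sum>i\<in>zeros z. c i \<odot> e i z))"
proof -
  have step: "T z f = 0" if "T z (T z f) = 0" for f
  proof -
    obtain c where c: "T z f = (\<Sum>i\<in>zeros z. c i \<odot> e i z)" using \<open>T z (T z f) = 0\<close> kernel[OF z] by (auto simp: T_eq_0)
    have "c j = 0" if j: "j \<in> zeros z" for j
      using solvability[OF j, of f] ci_e_sum[OF j, of c] nd[OF j] by (simp add: P_eq_\<sigma>_T c)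
    then show ?thesis unfolding c by (simp add: sc_0)
  qed
  have "(T z ^^ Suc n) f = 0 \<Longrightarrow> T z f = 0" for n f
    by (induction n) (use step in auto)
  have "(\<exists>n. (T z ^^ n) f = 0) \<longleftrightarrow> T z f = 0"
  proof
    assume "\<exists>n. (T z ^^ n) f = 0"
    then obtain n where "(T z ^^ n) f = 0" by blast
    then have "(T z ^^ Suc n) f = 0" by (simp add: T_0)
    then show "T z f = 0" by (rule \<open>\<And>n f. (T z ^^ Suc n) f = 0 \<Longrightarrow> T z f = 0\<close>)
  next
    assume "T z f = 0"
    then show "\<exists>n. (T z ^^ n) f = 0" by (intro exI[of _ 1]) simp
  qed
  then show ?thesis by (simp add: T_eq_0 kernel[OF z])
qed

text \<open>If the form vanishes for exactly one \<open>e\<^sub>i\<close>, a chain can be started there and only there. Its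
  second element is \<open>w\<close>, and a third one would contradict \<open>\<langle>e\<^sub>i, \<sigma>w\<rangle> \<noteq> 0\<close>.\<close>

lemma generalized_kernel_chain:
  assumes i0: "i\<^sub>0 \<in> zeros z" and neutral: "ci (e i\<^sub>0 z) (\<sigma> (e i\<^sub>0 z)) = 0"
    and w: "w = R z (\<sigma> (e i\<^sub>0 z))" and m: "ci (e i\<^sub>0 z) (\<sigma> w) \<noteq> 0"
    and nd: "\<And>i. i \<in> zeros z \<Longrightarrow> i \<noteq> i\<^sub>0 \<Longrightarrow> ci (e i z) (\<sigma> (e i z)) \<noteq> 0"
  shows "(\<exists>n. (T z ^^ n) f = 0) \<longleftrightarrow> (\<exists>c d. f = (\<Sum>i\<in>zeros z. c i \<odot> e i z) + d \<odot> w)"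
    and "(\<Sum>i\<in>zeros z. c i \<odot> e i z) + d \<odot> w = 0 \<Longrightarrow> d = 0"
proof -
  have I0: "i\<^sub>0 \<in> I" using i0 by simp
  have Uw: "U w = \<zeta> i\<^sub>0 \<odot> w" unfolding w R_U[OF z, symmetric]
    by (simp add: \<sigma>_sector e_U[OF z I0] R_sc[OF z])
  have bw: "ci (b j) w = 0" if j: "j \<in> I" for j
  proof (cases "j = i\<^sub>0")
    case True
    then show ?thesis using R_adj[OF z, of "b i\<^sub>0" "\<sigma> (e i\<^sub>0 z)"] neutral by (simp add: w real e_def)
  next
    case False
    then show ?thesis using sector_orth[of j i\<^sub>0 "b j" w] j I0 by (simp add: U_b Uw)
  qed
  \<comment> \<open>the correction by the projection vanishes, as w is orthogonal to the modes\<close>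
  have Pw: "P z w = \<sigma> (e i\<^sub>0 z)"
    using Ht_R[OF z, of "\<sigma> (e i\<^sub>0 z)"] Prj_sector[OF I0 Uw] bw[OF I0] by (simp add: Ht_def w sc_0)
  have Tw: "T z w = e i\<^sub>0 z" by (simp add: T_def Pw \<sigma>\<sigma>)
  have Tsc: "T z (c \<odot> g) = c \<odot> T z g" and Tdiff: "T z (g - h) = T z g - T z h" and Tadd: "T z (g + h) = T z g + T z h" for c g h
    by (simp_all add: T_def P_sc P_diff P_add clin_sc[OF clin_\<sigma>] clin_diff[OF clin_\<sigma>] clin_add[OF clin_\<sigma>])
  have Te: "T z (e i\<^sub>0 z) = 0" using i0 by (simp add: T_eq_0 P_e[OF z] sc_0)
  have single: "(\<Sum>i\<in>zeros z. c i \<odot> e i z) = c i\<^sub>0 \<odot> e i\<^sub>0 z" if "\<And>j. j \<in> zeros z \<Longrightarrow> j \<noteq> i\<^sub>0 \<Longrightarrow> c j = 0" for c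
  proof -
    have "(\<Sum>i\<in>zeros z. c i \<odot> e i z) = (\<Sum>i\<in>zeros z. if i = i\<^sub>0 then c i\<^sub>0 \<odot> e i\<^sub>0 z else 0)"
      by (intro sum.cong refl) (use that in \<open>auto simp: sc_0\<close>)
    then show ?thesis using fin i0 by simp
  qed
  have two: "\<exists>c d. f = (\<Sum>i\<in>zeros z. c i \<odot> e i z) + d \<odot> w" if TT: "T z (T z f) = 0" for f
  proof -
    obtain c where c: "T z f = (\<Sum>i\<in>zeros z. c i \<odot> e i z)" using TT kernel[OF z] unfolding T_eq_0 by blast
    have "c j = 0" if j: "j \<in> zeros z" "j \<noteq> i\<^sub>0" for j
      using solvability[OF j(1), of f] ci_e_sum[OF j(1), of c] nd[OF j] by (simp add: P_eq_\<sigma>_T c)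
    then have "T z f = c i\<^sub>0 \<odot> e i\<^sub>0 z" unfolding c by (rule single)
    then have "T z (f - c i\<^sub>0 \<odot> w) = 0" by (simp add: Tdiff Tsc Tw)
    then obtain c' where "f - c i\<^sub>0 \<odot> w = (\<Sum>i\<in>zeros z. c' i \<odot> e i z)" using kernel[OF z] by (auto simp: T_eq_0)
    then have "f = (\<Sum>i\<in>zeros z. c' i \<odot> e i z) + c i\<^sub>0 \<odot> w" by (simp add: algebra_simps)
    then show ?thesis by blast
  qed
  have three: "T z (T z f) = 0" if TTT: "T z (T z (T z f)) = 0" for f
  proof -
    obtain c d where g: "T z f = (\<Sum>i\<in>zeros z. c i \<odot> e i z) + d \<odot> w" using two[OF TTT] by blast
    have sol: "c j * ci (e j z) (\<sigma> (e j z)) + d * ci (e j z) (\<sigma> w) = 0" if j: "j \<in> zeros z" for j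
      using solvability[OF j, of f] ci_e_sum[OF j, of c]
      by (simp add: P_eq_\<sigma>_T g clin_add[OF clin_\<sigma>] clin_sc[OF clin_\<sigma>] ci_add_right ci_sc_right)
    have "d = 0" using sol[OF i0] neutral m by simp
    moreover have "c j = 0" if j: "j \<in> zeros z" "j \<noteq> i\<^sub>0" for j
      using sol[OF j(1)] nd[OF j] \<open>d = 0\<close> by simp
    ultimately have "T z f = c i\<^sub>0 \<odot> e i\<^sub>0 z" using g single[of c] by (simp add: sc_0)
    then show ?thesis by (simp add: Tsc Te sc_zero)
  qed
  \<comment> \<open>powers of T above the second can be lowered one at a time\<close>
  have reduce: "(T z ^^ Suc (Suc n)) f = 0 \<Longrightarrow> T z (T z f) = 0" for n f
  proof (induction n)
    case (Suc n)
    then have "T z (T z (T z ((T z ^^ n) f))) = 0" by simp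
    then have "T z (T z ((T z ^^ n) f)) = 0" by (rule three)
    then show ?case using Suc.IH by simp
  qed simp
  show "(\<exists>n. (T z ^^ n) f = 0) \<longleftrightarrow> (\<exists>c d. f = (\<Sum>i\<in>zeros z. c i \<odot> e i z) + d \<odot> w)"
  proof
    assume "\<exists>n. (T z ^^ n) f = 0"
    then obtain n where n: "(T z ^^ n) f = 0" by blast
    have "(T z ^^ Suc (Suc n)) f = 0" using n by (simp add: T_0)
    then show "\<exists>c d. f = (\<Sum>i\<in>zeros z. c i \<odot> e i z) + d \<odot> w" by (intro two reduce)
  next
    assume "\<exists>c d. f = (\<Sum>i\<in>zeros z. c i \<odot> e i z) + d \<odot> w"
    then obtain c d where f: "f = (\<Sum>i\<in>zeros z. c i \<odot> e i z) + d \<odot> w" by blast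
    have "T z (\<Sum>i\<in>zeros z. c i \<odot> e i z) = 0" using kernel[OF z] T_eq_0 by blast
    then have "(T z ^^ 2) f = 0" by (simp add: f numeral_2_eq_2 Tadd Tsc Tw Te sc_zero)
    then show "\<exists>n. (T z ^^ n) f = 0" by blast
  qed
  assume 0: "(\<Sum>i\<in>zeros z. c i \<odot> e i z) + d \<odot> w = 0"
  have "T z (\<Sum>i\<in>zeros z. c i \<odot> e i z) = 0" using kernel[OF z] T_eq_0 by blast
  with arg_cong[OF 0, of "T z"] have "d \<odot> e i\<^sub>0 z = 0" by (simp add: Tadd Tsc Tw T_0)
  then have "d = 0 \<or> e i\<^sub>0 z = 0" using norm_sc[of d "e i\<^sub>0 z"] by auto
  moreover have "e i\<^sub>0 z \<noteq> 0" using ci_b_e[OF z I0 I0] i0 by (auto simp: ci_0)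
  ultimately show "d = 0" by blast
qed

end

lemma norm_e_le: "i \<in> I \<Longrightarrow> cmod z \<le> 1/100 \<Longrightarrow> norm (e i z) \<le> 2"
  unfolding e_def using R_norm[of z "b i"] by (simp add: b_norm)

lemma d1_bound: "i \<in> I \<Longrightarrow> cmod z \<le> 1/100 \<Longrightarrow> cmod w \<le> 1/100 \<Longrightarrow> cmod (d1 i z w) \<le> 4"
proof -
  assume a: "i \<in> I" "cmod z \<le> 1/100" "cmod w \<le> 1/100"
  have "cmod (d1 i z w) \<le> norm (e i (cnj z)) * norm (e i w)"
    using cmod_ci_le[of "e i (cnj z)" "\<sigma> (e i w)"] by (simp add: d1_def norm_\<sigma>)
  also have "\<dots> \<le> 2 * 2" by (intro mult_mono norm_e_le a) (use a in auto)
  finally show ?thesis by simp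
qed

lemma ci_near: "cmod (ci f g - ci f' g') \<le> norm (f - f') * norm g + norm f' * norm (g - g')"
proof -
  have "ci f g - ci f' g' = ci (f - f') g + ci f' (g - g')" by (simp add: ci_diff_left ci_diff_right)
  then show ?thesis using norm_triangle_ineq[of "ci (f - f') g" "ci f' (g - g')"]
    cmod_ci_le[of "f - f'" g] cmod_ci_le[of f' "g - g'"] by simp
qed

text \<open>A mode with \<open>\<sigma>b = sb\<close> has Krein signature \<open>s\<close>, so \<open>k\<^sub>i\<close> has slope close to \<open>-s\<close>.\<close>

lemma d1_definite:
  assumes i: "i \<in> I" and s: "\<sigma> (b i) = s *\<^sub>R b i" "\<bar>s\<bar> = 1"
    and m: "\<theta> + cmod z \<le> m" "\<theta> + cmod w \<le> m" "cmod z \<le> 1/100" "cmod w \<le> 1/100" "m \<le> 1/10"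
  shows "cmod (d1 i z w + of_real s) \<le> 5 * m"
proof -
  have ez: "norm (e i (cnj z) - b i) \<le> 2 * m" using norm_e_near[of "cnj z" i] i m by simp
  have ew: "norm (e i w - b i) \<le> 2 * m" using norm_e_near[of w i] i m by simp
  have nw: "norm (e i w) \<le> 1 + 2 * m" using ew norm_triangle_sub[of "e i w" "b i"] b_norm[OF i] by simp
  have m0: "0 \<le> m" using m(1) \<theta> norm_ge_zero[of z] by linarith
  have "ci (b i) (\<sigma> (b i)) = of_real s" using b_norm[OF i] by (simp add: s sc_of_real[symmetric] ci_sc_right ci_self)
  then have "cmod (d1 i z w + of_real s) = cmod (ci (e i (cnj z)) (\<sigma> (e i w)) - ci (b i) (\<sigma> (b i)))"
    unfolding d1_def by (simp add: norm_minus_commute)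
  also have "\<dots> \<le> norm (e i (cnj z) - b i) * norm (\<sigma> (e i w)) + norm (b i) * norm (\<sigma> (e i w) - \<sigma> (b i))"
    by (rule ci_near)
  also have "norm (\<sigma> (e i w) - \<sigma> (b i)) = norm (e i w - b i)" by (simp add: clin_diff[OF clin_\<sigma>, symmetric] norm_\<sigma>)
  also have "norm (e i (cnj z) - b i) * norm (\<sigma> (e i w)) \<le> (2 * m) * (1 + 2 * (1/10))"
    unfolding norm_\<sigma> using ez nw m m0 by (intro mult_mono) auto
  finally show ?thesis using ew m0 by (simp add: b_norm[OF i])
qed

text \<open>For a neutral mode \<open>\<sigma>b\<close> is an eigenvector of the limit operator with eigenvalue \<open>-2\<close>. So \<open>R\<close> multiplies it by
  about \<open>-1/2\<close>, and \<open>k\<^sub>i\<close> has second divided difference close to \<open>1/2\<close>.\<close>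

lemma d2_neutral:
  assumes i: "i \<in> I" and n: "H\<^sub>0 (\<sigma> (b i)) = (-2) *\<^sub>R \<sigma> (b i)" "ci (b i) (\<sigma> (b i)) = 0"
    and m: "\<theta> + cmod z \<le> m" "\<theta> + cmod w \<le> m" "\<theta> + cmod v \<le> m"
      "cmod z \<le> 1/100" "cmod w \<le> 1/100" "cmod v \<le> 1/100" "m \<le> 1/10"
  shows "cmod (d2 i z w v - 1/2) \<le> 8 * m"
proof -
  have m0: "0 \<le> m" using m(1) \<theta> norm_ge_zero[of z] by linarith
  have ez: "norm (e i (cnj z) - b i) \<le> 2 * m" using norm_e_near[of "cnj z" i] i m by simp
  have ev: "norm (e i v - b i) \<le> 2 * m" using norm_e_near[of v i] i m by simp
  define s where "s = \<sigma> (b i)"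
  have ns: "norm s = 1" by (simp add: s_def norm_\<sigma> b_norm i)
  have "Prj s = 0" using Prj_sector[OF i, of s] n(2) \<sigma>_U[of "b i"] U_b[OF i]
    by (simp add: s_def sc_0 clin_sc[OF clin_\<sigma>])
  then have G0s: "G\<^sub>0 s = (-2) *\<^sub>R s" using n(1) by (simp add: G\<^sub>0_def s_def)
  define err where "err = Ht w s - G\<^sub>0 s"
  have nerr: "norm err \<le> m" using Ht_near[of w s] m by (simp add: err_def ns)
  have "R w ((-2) *\<^sub>R s) = (-2) *\<^sub>R R w s"
    using R_sc[of w "of_real (-2)" s] m by (simp only: sc_of_real)
  moreover have "R w err = R w (Ht w s) - R w ((-2) *\<^sub>R s)"
    unfolding err_def G0s by (rule R_diff[OF m(5)])
  ultimately have "R w err = s + 2 *\<^sub>R R w s" using m by simp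
  then have "R w s - (-1/2) *\<^sub>R s = (1/2) *\<^sub>R R w err" by (simp add: algebra_simps)
  then have Rs: "norm (R w s - (-1/2) *\<^sub>R s) \<le> m" using R_norm[of w err] m nerr by simp
  have "norm (R w (\<sigma> (e i v)) - R w s) \<le> 2 * (2 * m)"
  proof -
    have "R w (\<sigma> (e i v)) - R w s = R w (\<sigma> (e i v - b i))"
      using m by (simp add: R_diff s_def clin_diff[OF clin_\<sigma>])
    then have "norm (R w (\<sigma> (e i v)) - R w s) \<le> 2 * norm (\<sigma> (e i v - b i))"
      using m by (simp only: R_norm)
    then show ?thesis using ev by (simp add: norm_\<sigma>)
  qed
  then have g: "norm (R w (\<sigma> (e i v)) - (-1/2) *\<^sub>R s) \<le> 5 * m"
    using Rs norm_triangle_ineq[of "R w (\<sigma> (e i v)) - R w s" "R w s - (-1/2) *\<^sub>R s"] by simp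
  define g where "g = \<sigma> (R w (\<sigma> (e i v)))"
  have "g - (-1/2) *\<^sub>R b i = \<sigma> (R w (\<sigma> (e i v)) - (-1/2) *\<^sub>R s)"
    by (simp add: g_def s_def clin_diff[OF clin_\<sigma>] clin_scaleR[OF clin_\<sigma>] \<sigma>\<sigma> clin_add[OF clin_\<sigma>])
  then have gb: "norm (g - (-1/2) *\<^sub>R b i) \<le> 5 * m" using g by (simp only: norm_\<sigma>)
  have ng: "norm g \<le> 1" using norm_triangle_sub[of g "(-1/2) *\<^sub>R b i"] gb m by (simp add: b_norm i)
  have "ci (b i) ((-1/2) *\<^sub>R b i) = - 1/2"
    using b_norm[OF i] by (simp add: sc_of_real[symmetric] ci_sc_right ci_self ci_neg_right)
  then have "d2 i z w v - 1/2 = - (ci (e i (cnj z)) g - ci (b i) ((-1/2) *\<^sub>R b i))"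
    unfolding d2_def g_def by simp
  then have "cmod (d2 i z w v - 1/2) = cmod (ci (e i (cnj z)) g - ci (b i) ((-1/2) *\<^sub>R b i))"
    by (simp only: norm_minus_cancel)
  also have "\<dots> \<le> norm (e i (cnj z) - b i) * norm g + norm (b i) * norm (g - (-1/2) *\<^sub>R b i)"
    by (rule ci_near)
  also have "norm (e i (cnj z) - b i) * norm g \<le> (2 * m) * 1" using ez ng m0 by (intro mult_mono) auto
  finally show ?thesis using gb m0 by (simp add: b_norm i)
qed

end

section \<open>Small real roots and the gap away from the origin\<close>

context krein_pencil begin

definition kr :: "'i \<Rightarrow> real \<Rightarrow> real" where "kr i x = Re (k i (of_real x))"

lemma k_real: "\<bar>x\<bar> \<le> 1/100 \<Longrightarrow> k i (of_real x) = of_real (kr i x)"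
  using k_cnj[of "of_real x" i] by (simp add: kr_def complex_eq_iff)

lemma kr_continuous:
  assumes i: "i \<in> I" shows "continuous_on {-1/100..1/100} (kr i)"
proof (rule lipschitz_on_continuous_on)
  show "4-lipschitz_on {-1/100..1/100} (kr i)"
  proof (rule lipschitz_onI)
    fix x y :: real assume xy: "x \<in> {-1/100..1/100}" "y \<in> {-1/100..1/100}"
    have z: "cmod (of_real x) \<le> 1/100" "cmod (of_real y) \<le> 1/100" using xy by (auto simp: abs_le_iff)
    have "\<bar>kr i x - kr i y\<bar> \<le> cmod (k i (of_real x) - k i (of_real y))"
      unfolding kr_def using abs_Re_le_cmod[of "k i (of_real x) - k i (of_real y)"] by simp
    also have "\<dots> = \<bar>x - y\<bar> * cmod (d1 i (of_real x) (of_real y))"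
      unfolding k_diff[OF z] by (simp only: norm_mult of_real_diff[symmetric] norm_of_real)
    also have "\<dots> \<le> \<bar>x - y\<bar> * 4" by (intro mult_left_mono d1_bound i z) auto
    finally show "dist (kr i x) (kr i y) \<le> 4 * dist x y" by (simp add: dist_real_def mult.commute)
  qed simp
qed

text \<open>Since \<open>s k\<^sub>i\<close> decreases with slope close to \<open>-1\<close> on the real axis, it changes sign within
  distance \<open>2\<bar>k\<^sub>i(0)\<bar>\<close> of the origin; nonvanishing of the divided difference makes the zero unique in the
  complex disc.\<close>

lemma definite_root:
  assumes i: "i \<in> I" and s: "\<sigma> (b i) = s *\<^sub>R b i" "\<bar>s\<bar> = 1" and k0: "\<bar>kr i 0\<bar> \<le> 1/1000"
  obtains x where "\<bar>x\<bar> \<le> 2 * \<bar>kr i 0\<bar>" "k i (of_real x) = 0" "d1 i (of_real x) (of_real x) \<noteq> 0"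
    "\<And>z. cmod z \<le> 1/100 \<Longrightarrow> k i z = 0 \<Longrightarrow> z = of_real x"
    "\<bar>x - s * kr i 0\<bar> \<le> 5 * (\<theta> + \<bar>x\<bar>) * \<bar>x\<bar>"
proof -
  have near: "cmod (d1 i z w + of_real s) \<le> 1/10" if "cmod z \<le> 1/100" "cmod w \<le> 1/100" for z w
    using d1_definite[OF i s, of z "1/50" w] that \<theta> by simp
  have nz: "d1 i z w \<noteq> 0" if "cmod z \<le> 1/100" "cmod w \<le> 1/100" for z w
    using near[OF that] s(2) by auto
  have kx: "kr i x = kr i 0 + x * Re (d1 i (of_real x) 0)" if "\<bar>x\<bar> \<le> 1/100" for x
    using arg_cong[OF k_diff[of "of_real x" 0 i], of Re] that by (simp add: kr_def)
  have dre: "\<bar>Re (d1 i (of_real x) 0) + s\<bar> \<le> 1/10" if "\<bar>x\<bar> \<le> 1/100" for x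
    using near[of "of_real x" 0] abs_Re_le_cmod[of "d1 i (of_real x) 0 + of_real s"] that by simp
  define a where "a = 2 * \<bar>kr i 0\<bar>"
  have a: "0 \<le> a" "a \<le> 1/500" using k0 by (auto simp: a_def)
  have s01: "s = 1 \<or> s = -1" using s(2) by linarith
  have "\<exists>x. -a \<le> x \<and> x \<le> a \<and> s * kr i x = 0"
  proof (rule IVT2')
    have Da: "\<bar>Re (d1 i (of_real a) 0) + s\<bar> \<le> 1/10" "\<bar>Re (d1 i (of_real (-a)) 0) + s\<bar> \<le> 1/10"
      using dre[of a] dre[of "-a"] a by auto
    have 1: "kr i a = kr i 0 + a * Re (d1 i (of_real a) 0)" using kx[of a] a by simp
    have 2: "kr i (-a) = kr i 0 - a * Re (d1 i (of_real (-a)) 0)" using kx[of "-a"] a by simp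
    have sd: "9/10 \<le> - (s * d)" if "\<bar>d + s\<bar> \<le> 1/10" for d
    proof -
      have "d + s \<le> 1/10" "-1/10 \<le> d + s" using that by linarith+
      then show ?thesis using s01 by auto
    qed
    have m1: "a * (9/10) \<le> a * (- (s * Re (d1 i (of_real a) 0)))" using sd[OF Da(1)] a(1) by (rule mult_left_mono)
    have m2: "a * (9/10) \<le> a * (- (s * Re (d1 i (of_real (-a)) 0)))" using sd[OF Da(2)] a(1) by (rule mult_left_mono)
    have ka: "\<bar>s * kr i 0\<bar> = a / 2" by (simp add: a_def abs_mult s)
    have "s * kr i a = s * kr i 0 - a * (- (s * Re (d1 i (of_real a) 0)))" unfolding 1 by (simp add: algebra_simps)
    then show "s * kr i a \<le> 0" using m1 ka a by linarith
    have "s * kr i (-a) = s * kr i 0 + a * (- (s * Re (d1 i (of_real (-a)) 0)))" unfolding 2 by (simp add: algebra_simps)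
    then show "0 \<le> s * kr i (-a)" using m2 ka a by linarith
    show "continuous_on {-a..a} (\<lambda>x. s * kr i x)"
      by (intro continuous_intros continuous_on_subset[OF kr_continuous[OF i]]) (use a in auto)
  qed (use a in auto)
  then obtain x where x: "-a \<le> x" "x \<le> a" "kr i x = 0" using s01 by auto
  have xa: "\<bar>x\<bar> \<le> 2 * \<bar>kr i 0\<bar>" "\<bar>x\<bar> \<le> 1/100" using x a by (auto simp: a_def)
  have kx0: "k i (of_real x) = 0" using k_real[OF xa(2)] x by simp
  show ?thesis
  proof (rule that[OF xa(1) kx0])
    show "d1 i (of_real x) (of_real x) \<noteq> 0" using nz xa by simp
    show "z = of_real x" if "cmod z \<le> 1/100" "k i z = 0" for z
      using k_diff[of z "of_real x" i] nz[of z "of_real x"] that xa kx0 by simp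
    have d: "cmod (d1 i (of_real x) 0 + of_real s) \<le> 5 * (\<theta> + \<bar>x\<bar>)"
      by (rule d1_definite[OF i s]) (use xa \<theta> in auto)
    then have d: "\<bar>Re (d1 i (of_real x) 0) + s\<bar> \<le> 5 * (\<theta> + \<bar>x\<bar>)"
      using abs_Re_le_cmod[of "d1 i (of_real x) 0 + of_real s"] by simp
    have "kr i 0 = - (x * Re (d1 i (of_real x) 0))" using kx[OF xa(2)] x(3) by simp
    then have "x - s * kr i 0 = x * s * (Re (d1 i (of_real x) 0) + s)"
      using s01 by (auto simp: algebra_simps)
    then have "\<bar>x - s * kr i 0\<bar> = \<bar>Re (d1 i (of_real x) 0) + s\<bar> * \<bar>x\<bar>" by (simp add: abs_mult s)
    also have "\<dots> \<le> 5 * (\<theta> + \<bar>x\<bar>) * \<bar>x\<bar>" by (intro mult_right_mono d) auto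
    finally show "\<bar>x - s * kr i 0\<bar> \<le> 5 * (\<theta> + \<bar>x\<bar>) * \<bar>x\<bar>" .
  qed
qed

context
  fixes i assumes i: "i \<in> I"
    and n: "H\<^sub>0 (\<sigma> (b i)) = (-2) *\<^sub>R \<sigma> (b i)" "ci (b i) (\<sigma> (b i)) = 0"
begin

lemma d2_near: "cmod z \<le> 1/100 \<Longrightarrow> cmod w \<le> 1/100 \<Longrightarrow> cmod v \<le> 1/100 \<Longrightarrow> cmod (d2 i z w v - 1/2) \<le> 1/5"
  using d2_neutral[OF i n, of z "1/50" w v] \<theta> by simp

lemma d2_nz: "cmod z \<le> 1/100 \<Longrightarrow> cmod w \<le> 1/100 \<Longrightarrow> cmod v \<le> 1/100 \<Longrightarrow> d2 i z w v \<noteq> 0"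
  using d2_near[of z w v] by (auto simp: norm_divide)

text \<open>A double zero at the origin exhausts the zeros of a function whose second divided difference does not vanish.\<close>

lemma neutral_double_root:
  assumes k0: "k i 0 = 0" and d0: "d1 i 0 0 = 0" and z: "cmod z \<le> 1/100" "k i z = 0"
  shows "z = 0"
proof -
  have "d1 i 0 z = z * d2 i 0 z 0" using d1_diff[of z 0 i 0] z d0 by simp
  moreover have "z * d1 i 0 z = 0" using k_diff[of 0 z i] z k0 by simp
  ultimately show ?thesis using d2_nz[of 0 z 0] z by auto
qed

text \<open>Near the origin \<open>k\<^sub>i\<close> is close to \<open>(x\<^sup>2 - \<kappa>\<^sup>2)/2\<close>, so it changes sign on both sides of the
  origin. A third zero, or a degenerate one, would make the second divided difference vanish. In the constant of
  the estimate \<open>832 = 8 \<cdot> 104\<close> stems from the deviation \<open>104\<epsilon>\<close> of that difference from \<open>1/2\<close>.\<close>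

lemma neutral_roots:
  assumes eps: "0 < \<epsilon>" "\<theta> \<le> 5 * \<epsilon>" "\<epsilon> \<le> 1/1000" and kap: "0 < \<kappa>" "\<kappa> \<le> 4 * \<epsilon>"
    and C: "0 \<le> C" "8 * C * \<epsilon> \<le> 1"
    and k0: "\<bar>kr i 0 + \<kappa>\<^sup>2 / 2\<bar> \<le> C * \<epsilon> * \<kappa>\<^sup>2" and d0: "cmod (d1 i 0 0) \<le> C * \<epsilon> * \<kappa>"
  obtains p q where "0 < p" "q < 0" "p \<le> 1/100" "-1/100 \<le> q" "k i (of_real p) = 0" "k i (of_real q) = 0"
    "\<bar>p - \<kappa>\<bar> \<le> (6 * C + 832) * \<epsilon> * \<kappa>" "\<bar>q + \<kappa>\<bar> \<le> (6 * C + 832) * \<epsilon> * \<kappa>"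
    "d1 i (of_real p) (of_real p) \<noteq> 0" "d1 i (of_real q) (of_real q) \<noteq> 0"
    "\<And>z. cmod z \<le> 1/100 \<Longrightarrow> k i z = 0 \<Longrightarrow> z = of_real p \<or> z = of_real q"
proof -
  define D where "D x = Re (d2 i 0 (of_real x) 0)" for x :: real
  define l where "l = Re (d1 i 0 0)"
  have l: "\<bar>l\<bar> \<le> C * \<epsilon> * \<kappa>" unfolding l_def by (rule order_trans[OF abs_Re_le_cmod d0])
  have k2: "2 * \<kappa> \<le> 1/100" using kap eps by simp
  \<comment> \<open>Taylor expansion at the origin with divided differences\<close>
  have expand: "kr i x = kr i 0 + x * l + x\<^sup>2 * D x" if "\<bar>x\<bar> \<le> 1/100" for x
  proof -
    have z: "cmod (of_real x) \<le> 1/100" "cmod 0 \<le> 1/100" using that by auto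
    have "k i (of_real x) = k i 0 + of_real x * (d1 i 0 0 + of_real x * d2 i 0 (of_real x) 0)"
      using k_diff[OF z(2,1), of i] d1_diff[OF z, of i 0] by (simp add: algebra_simps)
    then show ?thesis by (simp add: kr_def l_def D_def algebra_simps power2_eq_square)
  qed
  have Dnear: "\<bar>D x - 1/2\<bar> \<le> 104 * \<epsilon>" if "\<bar>x\<bar> \<le> 2 * \<kappa>" for x
  proof -
    have "cmod (d2 i 0 (of_real x) 0 - 1/2) \<le> 8 * (13 * \<epsilon>)"
      by (rule d2_neutral[OF i n]) (use eps kap k2 that in auto)
    then show ?thesis unfolding D_def using abs_Re_le_cmod[of "d2 i 0 (of_real x) 0 - 1/2"] by simp
  qed
  have root_est: "\<bar>x\<^sup>2 - \<kappa>\<^sup>2\<bar> \<le> (6 * C + 832) * \<epsilon> * \<kappa>\<^sup>2" if x: "\<bar>x\<bar> \<le> 2 * \<kappa>" "kr i x = 0" for x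
  proof -
    have x2: "x\<^sup>2 \<le> 4 * \<kappa>\<^sup>2" using power_mono[OF x(1), of 2] by (simp add: power_mult_distrib)
    have "x\<^sup>2 - \<kappa>\<^sup>2 = - 2 * (kr i 0 + \<kappa>\<^sup>2 / 2) - 2 * (x * l) - 2 * (x\<^sup>2 * (D x - 1/2))"
      using expand[of x] x k2 by (simp add: algebra_simps)
    moreover have "\<bar>x * l\<bar> \<le> (2 * \<kappa>) * (C * \<epsilon> * \<kappa>)" unfolding abs_mult using x l kap by (intro mult_mono) auto
    moreover have "\<bar>x\<^sup>2 * (D x - 1/2)\<bar> \<le> (4 * \<kappa>\<^sup>2) * (104 * \<epsilon>)"
      unfolding abs_mult using x2 Dnear[OF x(1)] by (intro mult_mono) auto
    moreover have "\<bar>y\<bar> \<le> 2 * a + 2 * b + 2 * c"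
      if "y = - 2 * u - 2 * v - 2 * w" "\<bar>v\<bar> \<le> b" "\<bar>w\<bar> \<le> c" "\<bar>u\<bar> \<le> a" for y u v w a b c :: real
      using that by linarith
    ultimately have "\<bar>x\<^sup>2 - \<kappa>\<^sup>2\<bar> \<le> 2 * (C * \<epsilon> * \<kappa>\<^sup>2) + 2 * ((2 * \<kappa>) * (C * \<epsilon> * \<kappa>)) + 2 * ((4 * \<kappa>\<^sup>2) * (104 * \<epsilon>))"
      using k0 by blast
    also have "\<dots> = (6 * C + 832) * \<epsilon> * \<kappa>\<^sup>2" by (simp add: algebra_simps power2_eq_square)
    finally show ?thesis .
  qed
  have Ce: "C * \<epsilon> * \<kappa>\<^sup>2 \<le> 1/8 * \<kappa>\<^sup>2" using C by (intro mult_right_mono) auto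
  have neg: "kr i 0 < 0" using k0 Ce kap zero_less_power[OF kap(1), of 2] by linarith
  have pos: "kr i x > 0" if x: "\<bar>x\<bar> = 2 * \<kappa>" for x
  proof -
    have "x\<^sup>2 = \<bar>x\<bar>\<^sup>2" by simp
    then have xx: "x\<^sup>2 = 4 * \<kappa>\<^sup>2" unfolding x by (simp add: power_mult_distrib)
    have e: "kr i x = kr i 0 + x * l + (4 * \<kappa>\<^sup>2) * D x" using expand[of x] x k2 xx by simp
    have "\<bar>x * l\<bar> \<le> (2 * \<kappa>) * (C * \<epsilon> * \<kappa>)" unfolding abs_mult using x l kap by (intro mult_mono) auto
    then have "\<bar>x * l\<bar> \<le> 2 * (C * \<epsilon> * \<kappa>\<^sup>2)" by (simp add: power2_eq_square mult_ac)
    moreover have "(4 * \<kappa>\<^sup>2) * (39/100) \<le> (4 * \<kappa>\<^sup>2) * D x"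
      using Dnear[of x] x eps by (intro mult_left_mono) auto
    ultimately show ?thesis using k0 Ce e zero_less_power[OF kap(1), of 2] by linarith
  qed
  have cont: "continuous_on {u..v} (kr i)" if "-1/100 \<le> u" "v \<le> 1/100" for u v
    by (rule continuous_on_subset[OF kr_continuous[OF i]]) (use that in auto)
  have "\<exists>p\<ge>0. p \<le> 2 * \<kappa> \<and> kr i p = 0"
    by (rule IVT') (use neg pos[of "2 * \<kappa>"] kap k2 cont in auto)
  then obtain p where p: "0 \<le> p" "p \<le> 2 * \<kappa>" "kr i p = 0" by blast
  have "\<exists>q\<ge>-(2 * \<kappa>). q \<le> 0 \<and> kr i q = 0"
    by (rule IVT2') (use neg pos[of "- (2 * \<kappa>)"] kap k2 cont in auto)
  then obtain q where q: "-(2 * \<kappa>) \<le> q" "q \<le> 0" "kr i q = 0" by blast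
  have p0: "0 < p" and q0: "q < 0" using p q neg by (auto simp: less_le)
  have kp: "k i (of_real p) = 0" using k_real[of p i] p p0 k2 by simp
  have kq: "k i (of_real q) = 0" using k_real[of q i] q q0 k2 by simp
  have zp: "cmod (of_real p) \<le> 1/100" and zq: "cmod (of_real q) \<le> 1/100" using p q p0 q0 k2 by auto
  \<comment> \<open>both points are zeros, so the mixed first divided differences vanish\<close>
  have pq: "(of_real p :: complex) \<noteq> of_real q" using p0 q0 by simp
  have dpq: "d1 i (of_real p) (of_real q) = 0" "d1 i (of_real q) (of_real p) = 0"
    using k_diff[OF zp zq, of i] k_diff[OF zq zp, of i] kp kq pq by auto
  have est: "\<bar>y - \<kappa>\<bar> \<le> (6 * C + 832) * \<epsilon> * \<kappa>" if y: "0 < y" "\<bar>y\<^sup>2 - \<kappa>\<^sup>2\<bar> \<le> (6 * C + 832) * \<epsilon> * \<kappa>\<^sup>2" for y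
  proof -
    have "\<bar>y - \<kappa>\<bar> * \<kappa> \<le> \<bar>y - \<kappa>\<bar> * \<bar>y + \<kappa>\<bar>" using y kap by (intro mult_left_mono) auto
    also have "\<dots> = \<bar>y\<^sup>2 - \<kappa>\<^sup>2\<bar>" by (simp add: abs_mult[symmetric] algebra_simps power2_eq_square)
    also note y(2)
    finally have "\<bar>y - \<kappa>\<bar> * \<kappa> \<le> ((6 * C + 832) * \<epsilon> * \<kappa>) * \<kappa>" by (simp add: power2_eq_square mult_ac)
    then show ?thesis using kap by (simp only: mult_le_cancel_right_pos)
  qed
  show ?thesis
  proof (rule that[of p q])
    show "\<bar>p - \<kappa>\<bar> \<le> (6 * C + 832) * \<epsilon> * \<kappa>" by (rule est[OF p0 root_est]) (use p in auto)
    have "\<bar>(- q) - \<kappa>\<bar> \<le> (6 * C + 832) * \<epsilon> * \<kappa>"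
      by (rule est) (use q q0 root_est[of q] in auto)
    then show "\<bar>q + \<kappa>\<bar> \<le> (6 * C + 832) * \<epsilon> * \<kappa>" by (simp add: abs_minus_commute add.commute)
    show "d1 i (of_real p) (of_real p) \<noteq> 0"
      using d1_diff[OF zp zq, of i "of_real p"] dpq d2_nz[OF zp zp zq] pq by auto
    show "d1 i (of_real q) (of_real q) \<noteq> 0"
      using d1_diff[OF zq zp, of i "of_real q"] dpq d2_nz[OF zq zq zp] pq by auto
    show "z = of_real p \<or> z = of_real q" if z: "cmod z \<le> 1/100" "k i z = 0" for z
    proof (rule ccontr)
      assume "\<not> (z = of_real p \<or> z = of_real q)"
      then have "d1 i z (of_real p) = 0" "d1 i z (of_real q) = 0"
        using k_diff[OF z(1) zp, of i] k_diff[OF z(1) zq, of i] kp kq z by auto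
      then show False using d1_diff[OF zp zq, of i z] d2_nz[OF z(1) zp zq] pq by auto
    qed
  qed (use p0 q0 kp kq p q k2 in auto)
qed

end

end

text \<open>Here \<open>Q\<close> is the projection onto the sites of the cross. On its range \<open>\<sigma>H\<^sub>0\<close> has square zero, and
  \<open>H\<^sub>0\<close> is at least the identity off this range.\<close>

locale krein_gap = krein_pencil J U I b \<zeta> H H\<^sub>0 \<sigma> \<theta>
  for J :: "'a::{real_inner,complete_space} \<Rightarrow> 'a" and U and I :: "'i set" and b \<zeta> H H\<^sub>0 \<sigma> \<theta> +
  fixes Q :: "'a \<Rightarrow> 'a"
  assumes clin_Q: "clin Q" and norm_Q: "norm (Q f) \<le> norm f"
    and Q_\<sigma>: "Q (\<sigma> f) = \<sigma> (Q f)" and Q_H0: "Q (H\<^sub>0 f) = H\<^sub>0 (Q f)"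
    and nilpotent: "\<sigma> (H\<^sub>0 (\<sigma> (H\<^sub>0 (Q f)))) = 0"
    and H0_bound: "norm (H\<^sub>0 f) \<le> 2 * norm f"
    and H0_lower: "inner f (H\<^sub>0 f) \<ge> (norm f)\<^sup>2 - 3 * (norm (Q f))\<^sup>2"
begin

text \<open>On the range of \<open>Q\<close> the operator \<open>\<sigma>H\<^sub>0 - z\<close> is inverted by \<open>-(\<sigma>H\<^sub>0 + z)/z\<^sup>2\<close>, which is bounded
  for \<open>\<bar>z\<bar> \<ge> 1/100\<close>.\<close>

lemma Q_bound:
  assumes z: "1/100 \<le> cmod z"
  shows "norm (Q f) \<le> 20100 * (norm (P z f) + \<theta> * norm f)"
proof -
  define g where "g = H\<^sub>0 f - z \<odot> \<sigma> f"
  define t where "t = \<sigma> (Q g)"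
  have z0: "z \<noteq> 0" using z by auto
  have "norm g \<le> norm (P z f) + norm (H f - H\<^sub>0 f)"
    using norm_triangle_ineq4[of "P z f" "H f - H\<^sub>0 f"] by (simp add: g_def P_def)
  then have ng: "norm g \<le> norm (P z f) + \<theta> * norm f" using near[of f] by simp
  have t: "t = \<sigma> (H\<^sub>0 (Q f)) - z \<odot> Q f"
    by (simp add: t_def g_def clin_diff[OF clin_Q] clin_sc[OF clin_Q] Q_H0 Q_\<sigma> clin_diff[OF clin_\<sigma>] clin_sc[OF clin_\<sigma>] \<sigma>\<sigma>)
  have "\<sigma> (H\<^sub>0 t) = - (z \<odot> \<sigma> (H\<^sub>0 (Q f)))"
    by (simp add: t clin_diff[OF clin_H0] clin_sc[OF clin_H0] clin_diff[OF clin_\<sigma>] clin_sc[OF clin_\<sigma>] nilpotent)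
  also have "\<sigma> (H\<^sub>0 (Q f)) = t + z \<odot> Q f" by (simp add: t)
  finally have h: "\<sigma> (H\<^sub>0 t) = - (z \<odot> (t + z \<odot> Q f))" .
  have "z \<odot> (z \<odot> Q f) = - (\<sigma> (H\<^sub>0 t) + z \<odot> t)" unfolding h by (simp add: sc_add)
  then have "norm (z \<odot> (z \<odot> Q f)) = norm (\<sigma> (H\<^sub>0 t) + z \<odot> t)" by (simp only: norm_minus_cancel)
  then have "cmod z * (cmod z * norm (Q f)) \<le> norm (\<sigma> (H\<^sub>0 t)) + norm (z \<odot> t)"
    using norm_triangle_ineq[of "\<sigma> (H\<^sub>0 t)" "z \<odot> t"] by (simp add: norm_sc)
  also have "\<dots> \<le> 2 * norm t + cmod z * norm t" using H0_bound[of t] by (simp add: norm_\<sigma> norm_sc)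
  also have "\<dots> \<le> 2 * (100 * cmod z) * norm t + cmod z * norm t"
    using z by (intro add_right_mono mult_right_mono) auto
  also have "\<dots> = cmod z * (201 * norm t)" by simp
  finally have "cmod z * norm (Q f) \<le> 201 * norm t" using z0 by (subst (asm) mult_le_cancel_left_pos) auto
  moreover have "1/100 * norm (Q f) \<le> cmod z * norm (Q f)" using z by (intro mult_right_mono) auto
  moreover have "norm t \<le> norm g" by (simp add: t_def norm_\<sigma> norm_Q)
  ultimately show ?thesis using ng by simp
qed

text \<open>The imaginary part of \<open>\<langle>f, Hf\<rangle> = \<langle>f, g\<rangle> + z\<langle>f, \<sigma>f\<rangle>\<close> bounds \<open>\<langle>f, \<sigma>f\<rangle>\<close> by \<open>\<parallel>f\<parallel> \<parallel>g\<parallel>\<close>; its real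
  part then bounds \<open>\<langle>f, Hf\<rangle>\<close>, which controls \<open>\<parallel>f\<parallel>\<close> except for the part \<open>Q f\<close>.\<close>

lemma nonreal_bounded_below:
  assumes z: "1/100 \<le> cmod z" and im: "Im z \<noteq> 0"
  shows "\<exists>K. \<forall>f. norm f \<le> K * norm (P z f)"
proof -
  \<comment> \<open>L bounds the right-hand side of the real part, M is a large constant that absorbs it\<close>
  define L where "L = 1 + cmod z / \<bar>Im z\<bar>"
  have L: "L \<ge> 1" by (simp add: L_def)
  define M :: real where "M = 4 * 20100\<^sup>2 * 6 + 4 * L"
  have "norm f \<le> M * norm (P z f)" for f
  proof -
    define g where "g = P z f"
    have "H f = g + z \<odot> \<sigma> f" by (simp add: g_def P_def)
    then have eq: "ci f (H f) = ci f g + z * ci f (\<sigma> f)" by (simp add: ci_add_right ci_sc_right)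
    have real: "Im (ci f (H f)) = 0" "Im (ci f (\<sigma> f)) = 0"
      using ci_commute[of f "H f"] ci_H[of f f] ci_commute[of f "\<sigma> f"] ci_\<sigma>[of f f] by (auto simp: complex_eq_iff)
    have fg: "cmod (ci f g) \<le> norm f * norm g" by (rule cmod_ci_le)
    have "Im z * Re (ci f (\<sigma> f)) = - Im (ci f g)" using arg_cong[OF eq, of Im] real by simp
    then have "\<bar>Im z\<bar> * \<bar>Re (ci f (\<sigma> f))\<bar> \<le> norm f * norm g"
      using abs_Im_le_cmod[of "ci f g"] fg by (simp flip: abs_mult)
    then have s: "\<bar>Re (ci f (\<sigma> f))\<bar> \<le> norm f * norm g / \<bar>Im z\<bar>" using im by (simp add: field_simps)
    have "inner f (H f) = Re (ci f g) + Re z * Re (ci f (\<sigma> f))"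
      using arg_cong[OF eq, of Re] real by (simp add: Re_ci)
    also have "\<dots> \<le> norm f * norm g + cmod z * (norm f * norm g / \<bar>Im z\<bar>)"
    proof (intro add_mono)
      show "Re (ci f g) \<le> norm f * norm g" using fg complex_Re_le_cmod order_trans by blast
      have "Re z * Re (ci f (\<sigma> f)) \<le> \<bar>Re z\<bar> * \<bar>Re (ci f (\<sigma> f))\<bar>" by (metis abs_ge_self abs_mult)
      also have "\<dots> \<le> cmod z * (norm f * norm g / \<bar>Im z\<bar>)"
        by (intro mult_mono abs_Re_le_cmod s) auto
      finally show "Re z * Re (ci f (\<sigma> f)) \<le> cmod z * (norm f * norm g / \<bar>Im z\<bar>)" .
    qed
    also have "\<dots> = L * (norm f * norm g)" by (simp add: L_def field_simps)
    finally have up: "inner f (H f) \<le> L * (norm f * norm g)" .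
    have "inner f (H\<^sub>0 f) - inner f (H f) \<le> norm f * norm (H f - H\<^sub>0 f)"
      using Cauchy_Schwarz_ineq2[of f "H f - H\<^sub>0 f"] by (simp add: inner_diff_right)
    also have "\<dots> \<le> norm f * (\<theta> * norm f)" by (intro mult_left_mono near) auto
    also have "\<dots> \<le> 1/4 * (norm f)\<^sup>2" using \<theta> mult_right_mono[of \<theta> "1/4" "norm f * norm f"]
      by (simp add: power2_eq_square mult_ac)
    finally have low: "3/4 * (norm f)\<^sup>2 - 3 * (norm (Q f))\<^sup>2 \<le> L * (norm f * norm g)"
      using up H0_lower[of f] by simp
    have "(norm (Q f))\<^sup>2 \<le> (20100 * (norm g + \<theta> * norm f))\<^sup>2"
      using Q_bound[OF z, of f] by (intro power_mono) (auto simp: g_def)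
    also have "\<dots> \<le> 20100\<^sup>2 * (2 * (norm g)\<^sup>2 + 2 * (\<theta> * norm f)\<^sup>2)"
      unfolding power_mult_distrib[of "20100::real"]
      using sum_squares_bound[of "norm g" "\<theta> * norm f"] by (intro mult_left_mono) (auto simp: power2_sum)
    also have "\<dots> = 2 * 20100\<^sup>2 * (norm g)\<^sup>2 + (2 * 20100\<^sup>2 * \<theta>\<^sup>2) * (norm f)\<^sup>2"
      by (simp add: power_mult_distrib algebra_simps)
    also have "\<dots> \<le> 2 * 20100\<^sup>2 * (norm g)\<^sup>2 + (1/12) * (norm f)\<^sup>2"
    proof (intro add_left_mono mult_right_mono)
      have "\<theta>\<^sup>2 \<le> (1/10000000)\<^sup>2" using \<theta> by (intro power_mono) auto
      then show "2 * 20100\<^sup>2 * \<theta>\<^sup>2 \<le> 1/12" by (simp add: power2_eq_square)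
    qed auto
    finally have "1/2 * (norm f)\<^sup>2 \<le> 6 * 20100\<^sup>2 * (norm g)\<^sup>2 + L * (norm f * norm g)"
      using low by simp
    moreover have "norm f \<le> M * norm g" if "norm f > M * norm g"
    proof -
      have M1: "M \<ge> 1" using L by (simp add: M_def)
      have gf: "norm g \<le> norm f" using mult_right_mono[OF M1 norm_ge_zero[of g]] that by simp
      have "6 * 20100\<^sup>2 * (norm g)\<^sup>2 \<le> (6 * 20100\<^sup>2 * norm g) * norm f"
        using mult_left_mono[OF gf, of "6 * 20100\<^sup>2 * norm g"] by (simp add: power2_eq_square mult_ac)
      moreover have "(6 * 20100\<^sup>2 * norm g) * norm f + L * (norm f * norm g) \<le> (M / 4 * norm g) * norm f"
        by (simp add: M_def algebra_simps)
      moreover have "(M / 4 * norm g) * norm f \<le> (norm f / 4) * norm f"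
        using that by (intro mult_right_mono) auto
      ultimately have "1/2 * (norm f)\<^sup>2 \<le> 1/4 * (norm f)\<^sup>2"
        using \<open>1/2 * (norm f)\<^sup>2 \<le> 6 * 20100\<^sup>2 * (norm g)\<^sup>2 + L * (norm f * norm g)\<close>
        by (simp add: power2_eq_square)
      then have "norm f = 0" by simp
      then show ?thesis using M1 by simp
    qed
    ultimately show ?thesis unfolding g_def by linarith
  qed
  then show ?thesis by blast
qed

text \<open>The adjoint of \<open>P z\<close> is \<open>P (cnj z)\<close>, which is bounded below too. So \<open>P z (P (cnj z))\<close> is coercive, and
  \<open>P z\<close> is onto.\<close>

lemma nonreal_resolvent:
  assumes z: "1/100 \<le> cmod z" and im: "Im z \<noteq> 0"
  shows "bij (P z)" and "\<exists>K. \<forall>f. norm f \<le> K * norm (P z f)"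
proof -
  show K: "\<exists>K. \<forall>f. norm f \<le> K * norm (P z f)" by (rule nonreal_bounded_below[OF z im])
  have inj: "inj (P z)"
  proof (rule injI)
    fix f g assume fg: "P z f = P z g"
    obtain K where "\<And>f. norm f \<le> K * norm (P z f)" using K by blast
    from this[of "f - g"] fg show "f = g" by (simp add: P_diff)
  qed
  obtain K where K: "\<And>f. norm f \<le> K * norm (P (cnj z) f)"
    using nonreal_bounded_below[of "cnj z"] z im by auto
  define K' where "K' = max K 1"
  have K': "K' > 0" "\<And>f. norm f \<le> K' * norm (P (cnj z) f)"
  proof -
    show "norm f \<le> K' * norm (P (cnj z) f)" for f
      by (rule order_trans[OF K mult_right_mono]) (auto simp: K'_def)
  qed (simp add: K'_def)
  obtain B1 where B1: "\<And>f. norm (P z f) \<le> B1 * norm f" using P_bounded by blast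
  obtain B2 where B2: "\<And>f. norm (P (cnj z) f) \<le> B2 * norm f" using P_bounded by blast
  have "surj (\<lambda>f. P z (P (cnj z) f))"
  proof (rule coercive_imp_surj)
    show "linear (\<lambda>f. P z (P (cnj z) f))" using linear_compose[OF P_linear P_linear] by (simp add: o_def)
    show "norm (P z (P (cnj z) f)) \<le> \<bar>B1\<bar> * \<bar>B2\<bar> * norm f" for f
    proof -
      have "norm (P z (P (cnj z) f)) \<le> \<bar>B1\<bar> * norm (P (cnj z) f)"
        by (rule order_trans[OF B1 mult_right_mono]) auto
      also have "\<dots> \<le> \<bar>B1\<bar> * (\<bar>B2\<bar> * norm f)"
        by (intro mult_left_mono order_trans[OF B2 mult_right_mono]) auto
      finally show ?thesis by (simp add: mult_ac)
    qed
    show "0 < 1 / K'\<^sup>2" using K' by simp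
    show "1 / K'\<^sup>2 * (norm f)\<^sup>2 \<le> inner f (P z (P (cnj z) f))" for f
    proof -
      have "ci f (P z (P (cnj z) f)) = ci (P (cnj z) f) (P (cnj z) f)" using P_adj[of "cnj z" f] by simp
      then have "Re (ci f (P z (P (cnj z) f))) = Re (ci (P (cnj z) f) (P (cnj z) f))" by (simp only:)
      then have "inner f (P z (P (cnj z) f)) = (norm (P (cnj z) f))\<^sup>2"
        by (simp only: Re_ci power2_norm_eq_inner)
      moreover have "(norm f)\<^sup>2 \<le> (K' * norm (P (cnj z) f))\<^sup>2" by (intro power_mono K') auto
      ultimately show ?thesis using K' by (simp add: field_simps power_mult_distrib)
    qed
  qed
  then have "\<exists>f. g = P z f" for g unfolding surj_def by blast
  then have "surj (P z)" unfolding surj_def by blast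
  with inj show "bij (P z)" by (rule bijI)
qed

end

section \<open>The twelve phase modes of the uncoupled lattice\<close>

definition hi :: "complex^4 \<Rightarrow> complex^4 \<Rightarrow> complex" where "hi v w = (\<Sum>j\<in>UNIV. cnj (v $ j) * w $ j)"

lemma hi_4: "hi v w = cnj (v$1) * w$1 + cnj (v$2) * w$2 + cnj (v$3) * w$3 + cnj (v$4) * w$4"
  by (simp add: hi_def sum_4)

lemma Re_hi: "Re (hi v w) = inner v w"
  by (simp add: hi_4 inner_vec_def sum_4 inner_complex_def algebra_simps)

lemma Im_hi: "Im (hi v w) = inner (\<i> *s v) w"
  by (simp add: hi_4 inner_vec_def sum_4 inner_complex_def algebra_simps)

lemma norm_scale_vec: "norm (c *s v) = cmod c * norm (v :: complex^4)"
  by (simp add: norm_vec_def L2_set_def norm_mult power_mult_distrib real_sqrt_mult flip: sum_distrib_left)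

lemma norm4_sq: "(norm (v :: complex^4))\<^sup>2 = (cmod (v$1))\<^sup>2 + (cmod (v$2))\<^sup>2 + (cmod (v$3))\<^sup>2 + (cmod (v$4))\<^sup>2"
  by (simp add: norm_vec_def L2_set_def sum_4)

lemma norm4_le: "norm (v :: complex^4) \<le> cmod (v$1) + cmod (v$2) + cmod (v$3) + cmod (v$4)"
  unfolding norm_vec_def using L2_set_le_sum[of UNIV "\<lambda>i. norm (v$i)"] by (simp add: sum_4)

lemma norm4_mono:
  assumes "(cmod (v$1))\<^sup>2 + (cmod (v$2))\<^sup>2 + (cmod (v$3))\<^sup>2 + (cmod (v$4))\<^sup>2
    \<le> c\<^sup>2 * ((cmod (w$1))\<^sup>2 + (cmod (w$2))\<^sup>2 + (cmod (w$3))\<^sup>2 + (cmod (w$4))\<^sup>2)" "0 \<le> c"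
  shows "norm (v :: complex^4) \<le> c * norm (w :: complex^4)"
  by (rule power2_le_imp_le) (use assms in \<open>auto simp: power_mult_distrib norm4_sq\<close>)

lemma vec4_eqI: "v$1 = w$1 \<Longrightarrow> v$2 = w$2 \<Longrightarrow> v$3 = w$3 \<Longrightarrow> v$4 = w$4 \<Longrightarrow> v = (w :: complex^4)"
  by (simp add: vec_eq_iff forall_4)

definition Jop :: "ell2 \<Rightarrow> ell2" where "Jop = sitewise (\<lambda>p v. \<i> *s v)"

lemma fn_Jop [simp]: "fn (Jop f) p = \<i> *s fn f p"
  unfolding Jop_def by (rule fn_sitewise[of _ 1]) (simp add: norm_scale_vec)

lemma complex_hilbert_Jop: "complex_hilbert Jop"
proof (rule complex_hilbert.intro)
  show "linear Jop"
    by (rule linearI) (auto intro!: ell2_eqI vec4_eqI simp: algebra_simps)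
  show "Jop (Jop f) = - f" for f
    by (auto intro!: ell2_eqI vec4_eqI simp: algebra_simps)
  have "inner (\<i> *s v) (\<i> *s w) = inner v w" for v w :: "complex^4"
    by (simp add: inner_vec_def sum_4 inner_complex_def)
  then show "inner (Jop f) (Jop g) = inner f g" for f g
    by (simp add: inner_ell2_def)
qed

interpretation CH: complex_hilbert Jop by (rule complex_hilbert_Jop)

lemma scaleR_nth: "(r *\<^sub>R v) $ i = of_real r * (v :: complex^4) $ i"
  by (subst vector_scaleR_component) (rule scaleR_conv_of_real)

lemma i_mult_i_mult: "\<i> * a * (\<i> * b) = - (a * b)"
proof -
  have "\<i> * a * (\<i> * b) = (\<i> * \<i>) * (a * b)" by (simp only: mult_ac)
  then show ?thesis by simp
qed

lemma fn_sc [simp]: "fn (CH.sc c f) p = c *s fn f p"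
  by (rule vec4_eqI) (simp_all add: CH.sc_def complex_eq_iff)

lemma ci_finite_support:
  assumes "finite F" "\<And>p. p \<notin> F \<Longrightarrow> fn f p = 0"
  shows "CH.ci f g = (\<Sum>p\<in>F. hi (fn f p) (fn g p))"
proof -
  have "inner (Jop f) g = (\<Sum>p\<in>F. inner (fn (Jop f) p) (fn g p))"
    by (rule inner_finite_support) (use assms in \<open>auto intro: vec4_eqI\<close>)
  moreover have "inner f g = (\<Sum>p\<in>F. inner (fn f p) (fn g p))"
    by (rule inner_finite_support) (use assms in auto)
  ultimately show ?thesis unfolding CH.ci_def
    by (simp add: complex_eq_iff Re_hi Im_hi)
qed

lemma clin_sitewise:
  assumes add: "\<And>p v w. M p (v + w) = M p v + M p w" and sc: "\<And>p c v. M p (c *s v) = c *s M p v"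
    and bd: "\<And>p v. norm (M p v) \<le> c * norm v"
  shows "CH.clin (sitewise M)"
proof -
  note fs = fn_sitewise[OF bd]
  have r: "r *\<^sub>R v = of_real r *s v" for r and v :: "complex^4"
    by (rule vec4_eqI) (simp_all add: scaleR_nth del: vector_scaleR_component)
  have "linear (sitewise M)"
    by (rule linearI; rule ell2_eqI) (simp_all add: fs add r sc)
  moreover have "sitewise M (Jop f) = Jop (sitewise M f)" for f
    by (rule ell2_eqI) (simp add: fs sc)
  moreover have "0 \<le> c" using order_trans[OF norm_ge_zero bd[of undefined "axis 1 1"]]
    by (simp add: norm_axis_1 zero_le_mult_iff)
  then have "norm (sitewise M f) \<le> c * norm f" for f
    by (rule norm_le_pointwise[rotated]) (simp add: fs bd)
  ultimately show ?thesis unfolding CH.clin_def by blast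
qed

lemma sitewise_sym:
  assumes bd: "\<And>p v. norm (M p v) \<le> c * norm v" and "\<And>p v w. inner (M p v) w = inner v (M p w)"
  shows "inner (sitewise M f) g = inner f (sitewise M g)"
  unfolding inner_ell2_def fn_sitewise[OF bd] by (simp add: assms)

definition sig :: "ell2 \<Rightarrow> ell2" where "sig = sitewise (\<lambda>p. sigma)"

lemma sigma_nth [simp]: "sigma v $ 1 = v $ 1" "sigma v $ 2 = - v $ 2" "sigma v $ 3 = v $ 3" "sigma v $ 4 = - v $ 4"
  by (simp_all add: sigma_def)

lemma norm_sigma: "norm (sigma v) \<le> 1 * norm v"
  by (rule norm4_mono) simp_all

lemma fn_sig [simp]: "fn (sig f) p = sigma (fn f p)"
  unfolding sig_def by (rule fn_sitewise[OF norm_sigma])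

lemma clin_sig: "CH.clin sig"
  unfolding sig_def by (rule clin_sitewise[OF _ _ norm_sigma]) (auto intro!: vec4_eqI)

lemma sig_sym: "inner (sig f) g = inner f (sig g)"
  unfolding sig_def by (rule sitewise_sym[OF norm_sigma]) (simp add: inner_vec_def sum_4)

lemma sig_sig: "sig (sig f) = f" by (auto intro!: ell2_eqI vec4_eqI)

definition Qop :: "ell2 \<Rightarrow> ell2" where "Qop = sitewise (\<lambda>p v. if p \<in> nodes then v else 0)"

lemma fn_Qop [simp]: "fn (Qop f) p = (if p \<in> nodes then fn f p else 0)"
  unfolding Qop_def by (rule fn_sitewise[of _ 1]) simp

lemma clin_Qop: "CH.clin Qop"
  unfolding Qop_def by (rule clin_sitewise[of _ 1]) (auto intro: vec4_eqI)

lemma norm_Qop: "norm (Qop f) \<le> norm f"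
  using norm_le_pointwise[of "Qop f" 1 f] by simp

text \<open>The linearization at \<open>(cross, 0)\<close> for \<open>\<epsilon> = 0\<close>; on the nodes \<open>cnj cross\<close> and \<open>cross\<close> have the same square.\<close>

definition M0 :: "lattice \<Rightarrow> complex^4 \<Rightarrow> complex^4" where
  "M0 p v = (if p \<in> nodes then vector [- v$1 - (cross p)\<^sup>2 * v$2, - (cross p)\<^sup>2 * v$1 - v$2, 0, 0] else v)"

definition H0op :: "ell2 \<Rightarrow> ell2" where "H0op = sitewise M0"

lemma cross_sq: "p \<in> nodes \<Longrightarrow> (cross p)\<^sup>2 = 1 \<or> (cross p)\<^sup>2 = -1"
  by (auto simp: nodes_eq cross_def)

lemma cross_pow4: "p \<in> nodes \<Longrightarrow> cross p ^ 4 = 1"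
  by (auto simp: nodes_eq cross_def)

lemma cmod_parallelogram: "(cmod (a + b))\<^sup>2 + (cmod (a - b))\<^sup>2 = 2 * ((cmod a)\<^sup>2 + (cmod b)\<^sup>2)"
  unfolding cmod_power2 by (simp add: power2_eq_square algebra_simps)

lemma norm_M0: "norm (M0 p v) \<le> 2 * norm v"
proof (cases "p \<in> nodes")
  case True
  have *: "(cmod (v$1 + v$2))\<^sup>2 \<le> 2 * ((cmod (v$1))\<^sup>2 + (cmod (v$2))\<^sup>2)"
    "(cmod (v$1 - v$2))\<^sup>2 \<le> 2 * ((cmod (v$1))\<^sup>2 + (cmod (v$2))\<^sup>2)"
    using cmod_parallelogram[of "v$1" "v$2"] zero_le_power2[of "cmod (v$1 + v$2)"] zero_le_power2[of "cmod (v$1 - v$2)"]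
    by linarith+
  have c: "cmod (- v$1 - v$2) = cmod (v$1 + v$2)" "cmod (v$2 - v$1) = cmod (v$1 - v$2)" "cmod (- v$1 + v$2) = cmod (v$1 - v$2)"
    by (metis minus_add_distrib norm_minus_cancel diff_conv_add_uminus, rule norm_minus_commute, metis norm_minus_commute add.commute uminus_add_conv_diff)
  from cross_sq[OF True] show ?thesis
  proof
    assume "(cross p)\<^sup>2 = 1"
    then show ?thesis using * True
      by (intro norm4_mono; simp add: M0_def c) (use zero_le_power2[of "cmod (v$3)"] zero_le_power2[of "cmod (v$4)"] in linarith)
  next
    assume "(cross p)\<^sup>2 = - 1"
    then show ?thesis using * True
      by (intro norm4_mono; simp add: M0_def c) (use zero_le_power2[of "cmod (v$3)"] zero_le_power2[of "cmod (v$4)"] in linarith)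
  qed
next
  case False then show ?thesis by (simp add: M0_def)
qed

lemma fn_H0op [simp]: "fn (H0op f) p = M0 p (fn f p)"
  unfolding H0op_def by (rule fn_sitewise[OF norm_M0])

lemma norm_H0op: "norm (H0op f) \<le> 2 * norm f"
  by (rule norm_le_pointwise) (simp_all add: norm_M0)

lemma clin_H0op: "CH.clin H0op"
  unfolding H0op_def by (rule clin_sitewise[OF _ _ norm_M0]) (auto intro!: vec4_eqI simp: M0_def algebra_simps)

definition rotl :: "lattice \<Rightarrow> lattice" where "rotl = (\<lambda>(n, m). (- m, n))"

lemma bij_rotl: "bij rotl"
  by (rule o_bij[of "\<lambda>(n, m). (m, - n)"]) (auto simp: rotl_def fun_eq_iff)

lemma cross_rotl: "cross (rotl p) = \<i> * cross p"
  by (cases p) (auto simp: cross_def rotl_def)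

lemma rotl_nodes: "rotl p \<in> nodes \<longleftrightarrow> p \<in> nodes"
  by (cases p) (auto simp: rotl_def nodes_eq)

definition om :: complex where "om = cis (pi / 6)"

text \<open>A quarter turn multiplies \<open>\<Psi>\<close> by \<open>\<i>\<close>, so the turn has to be combined with the inverse factors in
  the first two components. The factors in the last two, where \<open>H\<close> is diagonal, are chosen so that the twelve
  phase modes belong to distinct eigenvalues.\<close>

definition MU :: "complex^4 \<Rightarrow> complex^4" where
  "MU v = vector [- \<i> * v$1, \<i> * v$2, om * v$3, om\<^sup>2 * v$4]"

definition Uop :: "ell2 \<Rightarrow> ell2" where "Uop f = sitewise (\<lambda>p. MU) (reindex rotl f)"

lemma norm_om: "cmod om = 1" by (simp add: om_def)

lemma norm_MU: "norm (MU v) \<le> 1 * norm v"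
  by (rule norm4_mono) (simp_all add: MU_def norm_mult norm_power norm_om)

lemma fn_Uop [simp]: "fn (Uop f) p = MU (fn f (rotl p))"
  unfolding Uop_def by (simp add: fn_sitewise[OF norm_MU] fn_reindex bij_rotl)

lemma inner_MU: "inner (MU v) (MU w) = inner v w"
proof -
  have "hi (MU v) (MU w) = hi v w"
  proof -
    have "cnj om * om = 1" using complex_norm_square[of om] by (simp add: norm_om mult.commute)
    moreover have "cnj (om * x) * (om * y) = (cnj om * om) * (cnj x * y)" for x y
      by (simp only: complex_cnj_mult mult_ac)
    moreover have "cnj (om\<^sup>2 * x) * (om\<^sup>2 * y) = (cnj om * om)\<^sup>2 * (cnj x * y)" for x y
      by (simp only: complex_cnj_mult complex_cnj_power power_mult_distrib mult_ac)
    ultimately have *: "cnj (om * x) * (om * y) = cnj x * y" "cnj (om\<^sup>2 * x) * (om\<^sup>2 * y) = cnj x * y" for x y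
      by simp_all
    show ?thesis unfolding hi_4 MU_def vector_4_nth * by (simp add: i_mult_i_mult)
  qed
  then show ?thesis by (metis Re_hi)
qed

lemma Uop_iso: "inner (Uop f) (Uop g) = inner f g"
proof -
  have "inner (Uop f) (Uop g) = inner (reindex rotl f) (reindex rotl g)"
    unfolding inner_ell2_def by (simp add: inner_MU fn_reindex bij_rotl)
  then show ?thesis by (simp add: inner_reindex bij_rotl)
qed

lemma clin_Uop: "CH.clin Uop"
proof -
  have "linear Uop" by (rule linearI; rule ell2_eqI; rule vec4_eqI) (simp_all add: MU_def algebra_simps)
  moreover have "Uop (Jop f) = Jop (Uop f)" for f by (rule ell2_eqI; rule vec4_eqI) (simp_all add: MU_def)
  moreover have "norm (Uop f) \<le> 1 * norm f" for f by (simp add: norm_eq_sqrt_inner Uop_iso)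
  ultimately show ?thesis unfolding CH.clin_def by blast
qed

text \<open>The phase mode of index \<open>i = 3k + c\<close>: \<open>k\<close> is the Fourier index on the four nodes, with characters the powers of
  \<open>cross\<close>. For \<open>c = 0\<close> it is a phase rotation of the nodes in the first equation; for \<open>c = 1, 2\<close> it lives in
  the two components of the second equation.\<close>

definition bvec :: "nat \<Rightarrow> lattice \<Rightarrow> complex^4" where
  "bvec i p = (let x = cross p; y = x ^ (i div 3) in
    if p \<notin> nodes then 0
    else if i mod 3 = 0 then (1 / (2 * of_real (sqrt 2))) *s vector [x * y, - cnj x * y, 0, 0]
    else if i mod 3 = 1 then (1 / 2) *s vector [0, 0, y, 0]
    else (1 / 2) *s vector [0, 0, 0, y])"

definition bmode :: "nat \<Rightarrow> ell2" where "bmode i = Ell (bvec i)"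

lemma bvec_off: "p \<notin> nodes \<Longrightarrow> bvec i p = 0" by (simp add: bvec_def)

lemma fn_bmode [simp]: "fn (bmode i) p = bvec i p"
  unfolding bmode_def by (subst Ell_inverse) (auto intro!: l2_finite_support[of nodes] simp: bvec_off)

lemma bvec_0: "p \<in> nodes \<Longrightarrow> bvec (3 * k) p = (1 / (2 * of_real (sqrt 2))) *s vector [cross p * cross p ^ k, - cnj (cross p) * cross p ^ k, 0, 0]"
  and bvec_1: "p \<in> nodes \<Longrightarrow> bvec (Suc (3 * k)) p = (1 / 2) *s vector [0, 0, cross p ^ k, 0]"
  and bvec_2: "p \<in> nodes \<Longrightarrow> bvec (Suc (Suc (3 * k))) p = (1 / 2) *s vector [0, 0, 0, cross p ^ k]"
proof -
  have a: "Suc (3 * k) div 3 = k" "Suc (3 * k) mod 3 = 1" "Suc (Suc (3 * k)) div 3 = k" "Suc (Suc (3 * k)) mod 3 = 2"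
    by presburger+
  show "p \<in> nodes \<Longrightarrow> bvec (3 * k) p = (1 / (2 * of_real (sqrt 2))) *s vector [cross p * cross p ^ k, - cnj (cross p) * cross p ^ k, 0, 0]"
    "p \<in> nodes \<Longrightarrow> bvec (Suc (3 * k)) p = (1 / 2) *s vector [0, 0, cross p ^ k, 0]"
    "p \<in> nodes \<Longrightarrow> bvec (Suc (Suc (3 * k))) p = (1 / 2) *s vector [0, 0, 0, cross p ^ k]"
    unfolding bvec_def by (simp_all add: a Let_def)
qed

lemma mod3_cases: 
  obtains k where "i = 3 * k" | k where "i = Suc (3 * k)" | k where "i = Suc (Suc (3 * k))"
proof -
  have "i = 3 * (i div 3) \<or> i = Suc (3 * (i div 3)) \<or> i = Suc (Suc (3 * (i div 3)))" by presburger
  then show ?thesis using that by blast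
qed

lemma om3: "om ^ 3 = \<i>"
proof -
  have "om ^ 3 = cis (real (3::nat) * (pi / 6))" unfolding om_def by (rule Complex.DeMoivre)
  also have "real (3::nat) * (pi / 6) = pi / 2" by simp
  finally show ?thesis by simp
qed

lemma om_powers: "om ^ (3 * k) = \<i> ^ k" "om ^ Suc (3 * k) = om * \<i> ^ k" "om ^ Suc (Suc (3 * k)) = om\<^sup>2 * \<i> ^ k"
  by (simp_all add: power_mult om3 power2_eq_square)

lemma Uop_bmode: "Uop (bmode i) = CH.sc (om ^ i) (bmode i)"
proof (rule ell2_eqI)
  fix p
  show "fn (Uop (bmode i)) p = fn (CH.sc (om ^ i) (bmode i)) p"
  proof (cases "p \<in> nodes")
    case False
    then show ?thesis by (auto intro!: vec4_eqI simp: bvec_off rotl_nodes MU_def)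
  next
    case True
    then have R: "rotl p \<in> nodes" by (simp add: rotl_nodes)
    show ?thesis
      by (rule mod3_cases[of i]; hypsubst; rule vec4_eqI)
        (simp_all add: bvec_0 bvec_1 bvec_2 True R MU_def cross_rotl om_powers power_mult_distrib
          mult.assoc del: power_Suc)
  qed
qed

lemma om_inj: "inj_on (\<lambda>i. om ^ i) {..<12}"
proof -
  have "inj_on (\<lambda>k. cis (2 * pi * real k / real (12::nat))) {..<12}"
    using bij_betw_imp_inj_on[OF Complex.bij_betw_roots_unity[of 12]] by (simp only: zero_less_numeral simp_thms)
  moreover have "om ^ k = cis (2 * pi * real k / real (12::nat))" for k
    unfolding om_def Complex.DeMoivre by (rule arg_cong[of _ _ cis]) simp
  ultimately show ?thesis by (simp add: inj_on_def)
qed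

lemma cross_norm: "p \<in> nodes \<Longrightarrow> cmod (cross p) = 1" by (auto simp: nodes_eq cross_def)

lemma norm_bmode: "norm (bmode i) = 1"
proof -
  have n: "(norm (bvec i p))\<^sup>2 = 1/4" if p: "p \<in> nodes" for p
    by (rule mod3_cases[of i]; hypsubst)
      (simp_all add: norm4_sq bvec_0 bvec_1 bvec_2 p norm_mult norm_divide norm_power cross_norm power_divide power_mult_distrib)
  have "(norm (bmode i))\<^sup>2 = (\<Sum>p\<in>nodes. (norm (bvec i p))\<^sup>2)"
    unfolding power2_norm_eq_inner by (subst inner_finite_support[of nodes]) (simp_all add: bvec_off)
  also have "\<dots> = (\<Sum>p\<in>nodes. 1/4)" by (intro sum.cong refl n)
  also have "\<dots> = 1" by (simp add: nodes_eq)
  finally have "(norm (bmode i))\<^sup>2 = 1\<^sup>2" by simp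
  then show ?thesis by (rule power2_eq_imp_eq) auto
qed

interpretation MD: modes Jop Uop "{..<12::nat}" bmode "\<lambda>i. om ^ i"
  by unfold_locales (auto simp: clin_Uop Uop_iso norm_bmode Uop_bmode om_inj norm_power norm_om)

lemma sum_12: "(\<Sum>i<12::nat. f i) = (\<Sum>k<4. f (3 * k) + f (Suc (3 * k)) + f (Suc (Suc (3 * k))))"
  for f :: "nat \<Rightarrow> 'a::comm_monoid_add"
  by (simp add: lessThan_nat_numeral lessThan_Suc eval_nat_numeral add_ac)

lemma character_orthogonality:
  assumes "p \<in> nodes" "q \<in> nodes"
  shows "(\<Sum>k<4::nat. (cnj (cross q) ^ k) * cross p ^ k) = (if p = q then 4 else 0)"
  using assms by (auto simp: nodes_eq cross_def eval_nat_numeral lessThan_Suc algebra_simps)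

lemma fourier_inversion:
  assumes p: "p \<in> nodes"
  shows "(\<Sum>k<4::nat. (\<Sum>q\<in>nodes. cnj (cross q) ^ k * a q) * cross p ^ k) = 4 * a p"
proof -
  have "(\<Sum>k<4::nat. (\<Sum>q\<in>nodes. cnj (cross q) ^ k * a q) * cross p ^ k)
    = (\<Sum>q\<in>nodes. a q * (\<Sum>k<4::nat. (cnj (cross q) ^ k) * cross p ^ k))"
    unfolding sum_distrib_right sum_distrib_left by (subst sum.swap) (simp add: mult_ac)
  also have "\<dots> = (\<Sum>q\<in>nodes. if q = p then 4 * a p else 0)"
    by (intro sum.cong refl) (auto simp: character_orthogonality p)
  finally show ?thesis using p by simp
qed

text \<open>The discrete Fourier transform is inverted on the nodes: the span of the modes consists of the pointwise phase
  directions there.\<close>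

lemma fn_Prj: "fn (MD.Prj f) p = (if p \<in> nodes then
   vector [(fn f p $ 1 - (cross p)\<^sup>2 * fn f p $ 2) / 2, (fn f p $ 2 - (cross p)\<^sup>2 * fn f p $ 1) / 2, fn f p $ 3, fn f p $ 4] else 0)"
proof (cases "p \<in> nodes")
  case False
  then show ?thesis by (auto simp: MD.Prj_def bvec_off intro!: vec4_eqI sum.neutral)
next
  case p: True
  define a where "a q = cnj (cross q) * fn f q $ 1 - cross q * fn f q $ 2" for q
  have ci: "CH.ci (bmode i) f = (\<Sum>q\<in>nodes. hi (bvec i q) (fn f q))" for i
    by (subst ci_finite_support[of nodes]) (simp_all add: bvec_off)
  have ci0: "CH.ci (bmode (3 * k)) f = (\<Sum>q\<in>nodes. cnj (cross q) ^ k * a q) / (2 * of_real (sqrt 2))" for k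
    unfolding ci sum_divide_distrib
    by (intro sum.cong refl; simp add: hi_4 bvec_0 a_def; simp add: field_simps)
  have ci1: "CH.ci (bmode (Suc (3 * k))) f = (\<Sum>q\<in>nodes. cnj (cross q) ^ k * fn f q $ 3) / 2" for k
    unfolding ci sum_divide_distrib
    by (intro sum.cong refl) (simp add: hi_4 bvec_1)
  have ci2: "CH.ci (bmode (Suc (Suc (3 * k)))) f = (\<Sum>q\<in>nodes. cnj (cross q) ^ k * fn f q $ 4) / 2" for k
    unfolding ci sum_divide_distrib
    by (intro sum.cong refl) (simp add: hi_4 bvec_2)
  have s8: "of_real (sqrt 2) * of_real (sqrt 2) = (2::complex)"
    by (simp flip: of_real_mult)
  have s8': "x / (2 * of_real (sqrt 2)) * (1 / (2 * of_real (sqrt 2)) * y) = x * y / 8" for x y :: complex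
    using s8 by (simp add: field_simps)
  have *: "fn (MD.Prj f) p $ j = (\<Sum>k<4. (CH.ci (bmode (3 * k)) f * bvec (3 * k) p $ j
      + CH.ci (bmode (Suc (3 * k))) f * bvec (Suc (3 * k)) p $ j) + CH.ci (bmode (Suc (Suc (3 * k)))) f * bvec (Suc (Suc (3 * k))) p $ j)" for j
    unfolding MD.Prj_def by (simp add: sum_12)
  have 1: "fn (MD.Prj f) p $ 1 = cross p / 8 * (\<Sum>k<4. (\<Sum>q\<in>nodes. cnj (cross q) ^ k * a q) * cross p ^ k)"
    unfolding * sum_distrib_left
    by (intro sum.cong refl) (simp add: bvec_0 bvec_1 bvec_2 p ci0 s8' s8)
  have 2: "fn (MD.Prj f) p $ 2 = - cnj (cross p) / 8 * (\<Sum>k<4. (\<Sum>q\<in>nodes. cnj (cross q) ^ k * a q) * cross p ^ k)"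
    unfolding * sum_distrib_left
    by (intro sum.cong refl) (simp add: bvec_0 bvec_1 bvec_2 p ci0 s8' s8)
  have 3: "fn (MD.Prj f) p $ 3 = 1 / 4 * (\<Sum>k<4. (\<Sum>q\<in>nodes. cnj (cross q) ^ k * fn f q $ 3) * cross p ^ k)"
    unfolding * sum_distrib_left
    by (intro sum.cong refl) (simp add: bvec_0 bvec_1 bvec_2 p ci1)
  have 4: "fn (MD.Prj f) p $ 4 = 1 / 4 * (\<Sum>k<4. (\<Sum>q\<in>nodes. cnj (cross q) ^ k * fn f q $ 4) * cross p ^ k)"
    unfolding * sum_distrib_left
    by (intro sum.cong refl) (simp add: bvec_0 bvec_1 bvec_2 p ci2)
  have cc: "cross p * cnj (cross p) = 1" "(cnj (cross p))\<^sup>2 = (cross p)\<^sup>2"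
    using p by (auto simp: nodes_eq cross_def)
  have "fn (MD.Prj f) p $ 1 = (fn f p $ 1 - (cross p)\<^sup>2 * fn f p $ 2) / 2"
  proof -
    have "fn (MD.Prj f) p $ 1 = ((cross p * cnj (cross p)) * fn f p $ 1 - (cross p)\<^sup>2 * fn f p $ 2) / 2"
      unfolding 1 fourier_inversion[OF p] a_def by (simp add: algebra_simps power2_eq_square)
    then show ?thesis by (simp only: cc mult_1)
  qed
  moreover have "fn (MD.Prj f) p $ 2 = (fn f p $ 2 - (cross p)\<^sup>2 * fn f p $ 1) / 2"
  proof -
    have "fn (MD.Prj f) p $ 2 = ((cross p * cnj (cross p)) * fn f p $ 2 - (cnj (cross p))\<^sup>2 * fn f p $ 1) / 2"
      unfolding 2 fourier_inversion[OF p] a_def by (simp add: algebra_simps power2_eq_square)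
    then show ?thesis by (simp only: cc mult_1)
  qed
  moreover have "fn (MD.Prj f) p $ 3 = fn f p $ 3" "fn (MD.Prj f) p $ 4 = fn f p $ 4"
    by (simp_all add: 3 4 fourier_inversion[OF p])
  ultimately show ?thesis using p by (intro vec4_eqI) simp_all
qed


lemma G0_nodes:
  assumes p: "p \<in> nodes"
  shows "fn (H0op f + MD.Prj f) p = vector [- fn f p $ 1 / 2 - 3 * (cross p)\<^sup>2 * fn f p $ 2 / 2,
    - 3 * (cross p)\<^sup>2 * fn f p $ 1 / 2 - fn f p $ 2 / 2, fn f p $ 3, fn f p $ 4]"
  by (rule vec4_eqI) (simp_all add: fn_Prj p M0_def field_simps)

lemma G0_off: "p \<notin> nodes \<Longrightarrow> fn (H0op f + MD.Prj f) p = fn f p"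
  by (simp add: fn_Prj M0_def)

text \<open>On a node, \<open>G\<^sub>0\<close> is \<open>1\<close> on phase directions and in the second equation and \<open>-2\<close> on amplitude
  directions; off the nodes it is \<open>1\<close>. Both numbers solve \<open>t\<^sup>2 + t = 2\<close>.\<close>

lemma G0_square: "(H0op (H0op f + MD.Prj f) + MD.Prj (H0op f + MD.Prj f)) + (H0op f + MD.Prj f) = 2 *\<^sub>R f"
proof (rule ell2_eqI)
  fix p
  define g where "g = H0op f + MD.Prj f"
  show "fn ((H0op (H0op f + MD.Prj f) + MD.Prj (H0op f + MD.Prj f)) + (H0op f + MD.Prj f)) p = fn (2 *\<^sub>R f) p"
  proof (cases "p \<in> nodes")
    case True
    have 2: "(cross p)\<^sup>2 * ((cross p)\<^sup>2 * a) = a" for a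
      using cross_sq[OF True] by (elim disjE; simp only:; simp)
    have G: "fn (H0op g + MD.Prj g) p = vector [- fn g p $ 1 / 2 - 3 * (cross p)\<^sup>2 * fn g p $ 2 / 2,
    - 3 * (cross p)\<^sup>2 * fn g p $ 1 / 2 - fn g p $ 2 / 2, fn g p $ 3, fn g p $ 4]" by (rule G0_nodes[OF True])
    have g: "fn g p = vector [- fn f p $ 1 / 2 - 3 * (cross p)\<^sup>2 * fn f p $ 2 / 2,
    - 3 * (cross p)\<^sup>2 * fn f p $ 1 / 2 - fn f p $ 2 / 2, fn f p $ 3, fn f p $ 4]"
      unfolding g_def by (rule G0_nodes[OF True])
    have "fn ((H0op g + MD.Prj g) + g) p = fn (2 *\<^sub>R f) p"
      unfolding plus_ell2.rep_eq[of "H0op g + MD.Prj g" g] G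
      by (rule vec4_eqI; unfold g; simp add: algebra_simps 2 cross_pow4[OF True] scaleR_conv_of_real; simp add: field_simps)
    then show ?thesis by (simp only: g_def)
  next
    case False
    have "fn ((H0op g + MD.Prj g) + g) p = fn (2 *\<^sub>R f) p"
      unfolding plus_ell2.rep_eq[of "H0op g + MD.Prj g" g] G0_off[OF False] unfolding g_def G0_off[OF False]
      by (simp add: scaleR_2)
    then show ?thesis by (simp only: g_def)
  qed
qed

lemma G0_bound: "norm (H0op f + MD.Prj f + f) \<le> 2 * norm f"
proof (rule norm_le_pointwise)
  fix p
  show "norm (fn (H0op f + MD.Prj f + f) p) \<le> 2 * norm (fn f p)"
  proof (cases "p \<in> nodes")
    case False
    then show ?thesis unfolding plus_ell2.rep_eq[of "H0op f + MD.Prj f" f] G0_off[OF False]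
      using norm_triangle_ineq[of "fn f p" "fn f p"] by simp
  next
    case True
    define u w where uw: "u = fn f p $ 1" "w = fn f p $ 2"
    have e: "fn (H0op f + MD.Prj f + f) p = vector [(u - 3 * (cross p)\<^sup>2 * w) / 2, (w - 3 * (cross p)\<^sup>2 * u) / 2,
        2 * fn f p $ 3, 2 * fn f p $ 4]"
      unfolding plus_ell2.rep_eq[of "H0op f + MD.Prj f" f] G0_nodes[OF True]
      by (rule vec4_eqI) (simp_all add: uw field_simps)
    have par: "(cmod (a + b))\<^sup>2 + (cmod (a - b))\<^sup>2 \<le> 16 * ((cmod u)\<^sup>2 + (cmod w)\<^sup>2)"
      if "(cmod a)\<^sup>2 = (cmod x)\<^sup>2" "(cmod b)\<^sup>2 = 4 * (cmod y)\<^sup>2"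
        "(cmod x)\<^sup>2 + (cmod y)\<^sup>2 = 2 * ((cmod u)\<^sup>2 + (cmod w)\<^sup>2)" for a b x y
    proof -
      have "(cmod (a + b))\<^sup>2 + (cmod (a - b))\<^sup>2 = 2 * (cmod x)\<^sup>2 + 8 * (cmod y)\<^sup>2"
        unfolding cmod_parallelogram that by simp
      also have "\<dots> \<le> 8 * ((cmod x)\<^sup>2 + (cmod y)\<^sup>2)" by simp
      also have "\<dots> = 16 * ((cmod u)\<^sup>2 + (cmod w)\<^sup>2)" unfolding that by simp
      finally show ?thesis .
    qed
    have q: "(cmod (u - 3 * (cross p)\<^sup>2 * w))\<^sup>2 + (cmod (w - 3 * (cross p)\<^sup>2 * u))\<^sup>2 \<le> 16 * ((cmod u)\<^sup>2 + (cmod w)\<^sup>2)"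
    proof -
      have a: "cmod (2 * z) = 2 * cmod z" for z by (simp add: norm_mult)
      from cross_sq[OF True] show ?thesis
      proof
        assume s: "(cross p)\<^sup>2 = 1"
        have "(cmod (- (u + w) + 2 * (u - w)))\<^sup>2 + (cmod (- (u + w) - 2 * (u - w)))\<^sup>2 \<le> 16 * ((cmod u)\<^sup>2 + (cmod w)\<^sup>2)"
          by (rule par[of _ "u + w" _ "u - w"]) (simp_all only: norm_minus_cancel a power_mult_distrib cmod_parallelogram, simp)
        then show ?thesis by (simp add: s algebra_simps)
      next
        assume s: "(cross p)\<^sup>2 = - 1"
        have "(cmod (- (u - w) + 2 * (u + w)))\<^sup>2 + (cmod (- (u - w) - 2 * (u + w)))\<^sup>2 \<le> 16 * ((cmod u)\<^sup>2 + (cmod w)\<^sup>2)"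
          by (rule par[of _ "u - w" _ "u + w"]) (simp_all only: norm_minus_cancel a power_mult_distrib, simp, use cmod_parallelogram[of u w] in linarith)
        moreover have "cmod (- (u - w) - 2 * (u + w)) = cmod (w + 3 * u)"
          using norm_minus_cancel[of "w + 3 * u"] by (simp add: algebra_simps)
        moreover have "- (u - w) + 2 * (u + w) = u + 3 * w" by simp
        ultimately show ?thesis by (simp add: s)
      qed
    qed
    show ?thesis unfolding e
    proof (rule norm4_mono, unfold vector_4_nth)
      show "(cmod ((u - 3 * (cross p)\<^sup>2 * w) / 2))\<^sup>2 + (cmod ((w - 3 * (cross p)\<^sup>2 * u) / 2))\<^sup>2
        + (cmod (2 * fn f p $ 3))\<^sup>2 + (cmod (2 * fn f p $ 4))\<^sup>2
        \<le> 2\<^sup>2 * ((cmod (fn f p $ 1))\<^sup>2 + (cmod (fn f p $ 2))\<^sup>2 + (cmod (fn f p $ 3))\<^sup>2 + (cmod (fn f p $ 4))\<^sup>2)"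
        using q unfolding norm_divide power_divide norm_mult[of 2] power_mult_distrib uw[symmetric] by simp
    qed simp
  qed
qed simp

lemma H0_nilpotent: "sig (H0op (sig (H0op (Qop f)))) = 0"
proof (rule ell2_eqI)
  fix p
  show "fn (sig (H0op (sig (H0op (Qop f))))) p = fn 0 p"
  proof (cases "p \<in> nodes")
    case True
    have 2: "(cross p)\<^sup>2 * ((cross p)\<^sup>2 * a) = a" for a
      using cross_sq[OF True] by (elim disjE; simp only:; simp)
    show ?thesis by (rule vec4_eqI) (simp_all add: True M0_def algebra_simps 2 cross_pow4)
  qed (simp_all add: M0_def vec4_eqI)
qed

lemma H0_lower: "inner f (H0op f) \<ge> (norm f)\<^sup>2 - 3 * (norm (Qop f))\<^sup>2"
proof -
  have QQ: "(norm (Qop f))\<^sup>2 = inner f (Qop f)"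
    unfolding power2_norm_eq_inner inner_ell2_def by (intro infsum_cong) simp
  have "0 \<le> inner f (H0op f - f + 3 *\<^sub>R Qop f)"
    unfolding inner_ell2_def
  proof (rule infsum_nonneg)
    fix p
    show "0 \<le> inner (fn f p) (fn (H0op f - f + 3 *\<^sub>R Qop f) p)"
    proof (cases "p \<in> nodes")
      case True
      define u w where uw: "u = fn f p $ 1" "w = fn f p $ 2"
      have n: "inner (fn f p) (fn f p) = (cmod u)\<^sup>2 + (cmod w)\<^sup>2 + (cmod (fn f p $ 3))\<^sup>2 + (cmod (fn f p $ 4))\<^sup>2"
        by (simp add: norm4_sq uw flip: power2_norm_eq_inner)
      have m: "inner (fn f p) (M0 p (fn f p)) = - (cmod (u + t * w))\<^sup>2" if "(cross p)\<^sup>2 = t" "t = 1 \<or> t = -1" for t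
      proof -
        have M: "M0 p (fn f p) = vector [- u - t * w, - t * u - w, 0, 0]"
          by (simp add: M0_def True that(1) uw)
        show ?thesis using that(2) unfolding M cmod_power2
          by (auto simp: inner_vec_def sum_4 inner_complex_def uw power2_eq_square algebra_simps)
      qed
      have b: "(cmod (u + t * w))\<^sup>2 \<le> 2 * ((cmod u)\<^sup>2 + (cmod w)\<^sup>2)" if "t = 1 \<or> t = -1" for t
      proof -
        have "(cmod (u + w))\<^sup>2 \<le> 2 * ((cmod u)\<^sup>2 + (cmod w)\<^sup>2)" "(cmod (u - w))\<^sup>2 \<le> 2 * ((cmod u)\<^sup>2 + (cmod w)\<^sup>2)"
          using cmod_parallelogram[of u w] zero_le_power2[of "cmod (u + w)"] zero_le_power2[of "cmod (u - w)"] by linarith+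
        then show ?thesis using that by auto
      qed
      have "inner (fn f p) (fn (H0op f - f + 3 *\<^sub>R Qop f) p) = inner (fn f p) (M0 p (fn f p)) + 2 * inner (fn f p) (fn f p)"
        by (simp add: True inner_diff_right inner_add_right)
      moreover have "- 2 * ((cmod u)\<^sup>2 + (cmod w)\<^sup>2) \<le> inner (fn f p) (M0 p (fn f p))"
        using m[OF refl cross_sq[OF True]] b[OF cross_sq[OF True]] by linarith
      moreover have "0 \<le> K" if "K = m + 2 * n" "- 2 * (a + b) \<le> m" "n = a + b + c + d" "0 \<le> c" "0 \<le> d"
        for K m n a b c d :: real using that by simp
      ultimately show ?thesis
        using n zero_le_power2[of "cmod (fn f p $ 3)"] zero_le_power2[of "cmod (fn f p $ 4)"] by blast
    qed (simp add: M0_def)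
  qed
  then have "0 \<le> inner f (H0op f) - inner f f + 3 * inner f (Qop f)"
    by (simp add: inner_diff_right inner_add_right)
  then show ?thesis using QQ power2_norm_eq_inner[of f] by linarith
qed

lemma Q_sig: "Qop (sig f) = sig (Qop f)" and Q_H0: "Qop (H0op f) = H0op (Qop f)"
  by (rule ell2_eqI; auto simp: M0_def intro!: vec4_eqI)+

lemma H0_bmode: "H0op (bmode i) = 0"
proof (rule ell2_eqI)
  fix p
  show "fn (H0op (bmode i)) p = fn 0 p"
  proof (cases "p \<in> nodes")
    case True
    have c: "(cross p)\<^sup>2 * (cnj (cross p) * a) = cross p * a" "(cross p)\<^sup>2 * (cross p * a) = cnj (cross p) * a" for a
      using True by (auto simp: nodes_eq cross_def)
    show ?thesis
      by (rule mod3_cases[of i]; hypsubst; rule vec4_eqI)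
        (simp_all add: True M0_def bvec_0 bvec_1 bvec_2 c mult.assoc)
  qed (simp add: M0_def bvec_off)
qed

lemma H0_sig_bmode: "H0op (sig (bmode (3 * k))) = (-2) *\<^sub>R sig (bmode (3 * k))"
proof (rule ell2_eqI)
  fix p
  show "fn (H0op (sig (bmode (3 * k)))) p = fn ((-2) *\<^sub>R sig (bmode (3 * k))) p"
  proof (cases "p \<in> nodes")
    case True
    have c: "(cross p)\<^sup>2 * (cnj (cross p) * a) = cross p * a" "(cross p)\<^sup>2 * (cross p * a) = cnj (cross p) * a" for a
      using True by (auto simp: nodes_eq cross_def)
    show ?thesis
      by (rule vec4_eqI; simp add: True M0_def bvec_0 c mult.assoc; simp add: scaleR_conv_of_real)
  qed (simp add: M0_def bvec_off vec4_eqI)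
qed

lemma ci_bmode: "CH.ci (bmode i) f = (\<Sum>q\<in>nodes. hi (bvec i q) (fn f q))"
  by (subst ci_finite_support[of nodes]) (simp_all add: bvec_off)

lemma neutral_bmode: "CH.ci (bmode (3 * k)) (sig (bmode (3 * k))) = 0"
  unfolding ci_bmode by (intro sum.neutral ballI; simp add: hi_4 bvec_0; simp add: mult_ac)

lemma sig_bmode: "sig (bmode (Suc (3 * k))) = 1 *\<^sub>R bmode (Suc (3 * k))"
  "sig (bmode (Suc (Suc (3 * k)))) = (-1) *\<^sub>R bmode (Suc (Suc (3 * k)))"
proof -
  have "fn (sig (bmode (Suc (3 * k)))) p = fn (1 *\<^sub>R bmode (Suc (3 * k))) p"
    "fn (sig (bmode (Suc (Suc (3 * k))))) p = fn ((-1) *\<^sub>R bmode (Suc (Suc (3 * k)))) p" for p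
    by (cases "p \<in> nodes"; rule vec4_eqI; simp add: bvec_1 bvec_2 bvec_off)+
  then show "sig (bmode (Suc (3 * k))) = 1 *\<^sub>R bmode (Suc (3 * k))"
    "sig (bmode (Suc (Suc (3 * k)))) = (-1) *\<^sub>R bmode (Suc (Suc (3 * k)))" by (blast intro: ell2_eqI)+
qed

section \<open>The linearization at a scalar cross\<close>

locale small_cross = symmetric_cross +
  assumes eps_small: "\<epsilon> \<le> 1 / 10 ^ 9" and \<Psi>_l2: "\<Psi> \<in> l2"
begin

text \<open>The matrix of the linearization at \<open>(\<Psi>, 0)\<close>; the first two components decouple from the others.\<close>

definition MH :: "lattice \<Rightarrow> complex^4 \<Rightarrow> complex^4" where
  "MH p v = (let \<rho> = of_real ((cmod (\<Psi> p))\<^sup>2) in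
    vector [(1 - 2 * \<rho>) * v$1 - (\<Psi> p)\<^sup>2 * v$2, - (cnj (\<Psi> p))\<^sup>2 * v$1 + (1 - 2 * \<rho>) * v$2,
      (1 - \<rho>) * v$3, (1 - \<rho>) * v$4])"

lemma MH_nth [simp]:
  "MH p v $ 1 = (1 - 2 * of_real ((cmod (\<Psi> p))\<^sup>2)) * v$1 - (\<Psi> p)\<^sup>2 * v$2"
  "MH p v $ 2 = - (cnj (\<Psi> p))\<^sup>2 * v$1 + (1 - 2 * of_real ((cmod (\<Psi> p))\<^sup>2)) * v$2"
  "MH p v $ 3 = (1 - of_real ((cmod (\<Psi> p))\<^sup>2)) * v$3"
  "MH p v $ 4 = (1 - of_real ((cmod (\<Psi> p))\<^sup>2)) * v$4"
  by (simp_all only: MH_def Let_def vector_4_nth)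

definition MV :: "lattice \<Rightarrow> complex^4 \<Rightarrow> complex^4" where "MV p v = MH p v - M0 p v"

lemma component_bound: "cmod (v $ i) \<le> norm (v :: complex^4)"
  by (rule Finite_Cartesian_Product.norm_nth_le)

lemma eps2_small: "\<epsilon>\<^sup>2 \<le> \<epsilon> / 10 ^ 9"
  using mult_left_mono[OF eps_small, of \<epsilon>] eps by (simp add: power2_eq_square)

lemma norm_MV: "norm (MV p v) \<le> (204 * \<epsilon>\<^sup>2) * norm v"
proof (cases "p \<in> nodes")
  case True
  have cr: "(cnj (cross p))\<^sup>2 = (cross p)\<^sup>2" "cmod ((cross p)\<^sup>2) = 1"
    using True by (auto simp: nodes_eq cross_def)
  have sq: "(\<Psi> p)\<^sup>2 = of_real (x\<^sup>2) * (cross p)\<^sup>2" "(cnj (\<Psi> p))\<^sup>2 = of_real (x\<^sup>2) * (cross p)\<^sup>2"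
    "(cmod (\<Psi> p))\<^sup>2 = x\<^sup>2"
    using node_value[OF True] cr by (auto simp: power_mult_distrib norm_mult cross_norm[OF True])
  define d where "d = 1 - x\<^sup>2"
  have d: "\<bar>d\<bar> \<le> 4 * \<epsilon>\<^sup>2" unfolding d_def by (rule x2_near)
  have n: "cmod (of_real d * a) \<le> (4 * \<epsilon>\<^sup>2) * norm v" if "cmod a \<le> norm v" for a
    unfolding norm_mult norm_of_real using d that by (intro mult_mono) auto
  have xd: "x\<^sup>2 = 1 - d" by (simp add: d_def)
  have c1: "MV p v $ 1 = of_real d * v$1 + of_real d * v$1 + of_real d * ((cross p)\<^sup>2 * v$2)"
    unfolding MV_def vector_minus_component MH_nth sq xd by (simp add: M0_def True algebra_simps)
  have c2: "MV p v $ 2 = of_real d * v$2 + of_real d * v$2 + of_real d * ((cross p)\<^sup>2 * v$1)"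
    unfolding MV_def vector_minus_component MH_nth sq xd by (simp add: M0_def True algebra_simps)
  have c3: "MV p v $ 3 = of_real d * v$3" "MV p v $ 4 = of_real d * v$4"
    unfolding MV_def vector_minus_component MH_nth sq xd by (simp_all add: M0_def True algebra_simps)
  have k: "cmod ((cross p)\<^sup>2 * v$i) \<le> norm v" for i
    unfolding norm_mult cr by (simp add: component_bound)
  have three: "cmod (a + b + c) \<le> cmod a + cmod b + cmod c" for a b c :: complex
    using norm_triangle_ineq[of "a + b" c] norm_triangle_ineq[of a b] by linarith
  have "cmod (MV p v $ 1) \<le> 3 * ((4 * \<epsilon>\<^sup>2) * norm v)" unfolding c1
    using three[of "of_real d * v$1" "of_real d * v$1" "of_real d * ((cross p)\<^sup>2 * v$2)"] n[OF component_bound[of v 1]] n[OF k[of 2]] by linarith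
  moreover have "cmod (MV p v $ 2) \<le> 3 * ((4 * \<epsilon>\<^sup>2) * norm v)" unfolding c2
    using three[of "of_real d * v$2" "of_real d * v$2" "of_real d * ((cross p)\<^sup>2 * v$1)"] n[OF component_bound[of v 2]] n[OF k[of 1]] by linarith
  moreover have "cmod (MV p v $ 3) \<le> (4 * \<epsilon>\<^sup>2) * norm v" "cmod (MV p v $ 4) \<le> (4 * \<epsilon>\<^sup>2) * norm v"
    unfolding c3 by (intro n component_bound)+
  moreover have "0 \<le> \<epsilon>\<^sup>2 * norm v" by simp
  moreover have "3 * ((4 * \<epsilon>\<^sup>2) * norm v) = 12 * (\<epsilon>\<^sup>2 * norm v)" "(4 * \<epsilon>\<^sup>2) * norm v = 4 * (\<epsilon>\<^sup>2 * norm v)"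
    "(204 * \<epsilon>\<^sup>2) * norm v = 204 * (\<epsilon>\<^sup>2 * norm v)" by simp_all
  ultimately show ?thesis using norm4_le[of "MV p v"] by linarith
next
  case False
  define r where "r = (cmod (\<Psi> p))\<^sup>2"
  have r: "r \<le> 17 * \<epsilon>\<^sup>2" "0 \<le> r"
    using power_mono[OF off_bound[OF False], of 2] by (simp_all add: r_def power_mult_distrib power2_eq_square) (use zero_le_square[of \<epsilon>] in linarith)
  have n: "cmod (c * a) \<le> (17 * \<epsilon>\<^sup>2) * norm v" if "cmod c = r" "cmod a \<le> norm v" for a c
    unfolding norm_mult that(1) using r that by (intro mult_mono) auto
  have cs: "cmod ((\<Psi> p)\<^sup>2) = r" "cmod ((cnj (\<Psi> p))\<^sup>2) = r" "cmod (of_real r) = r" using r by (simp_all add: r_def norm_power)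
  have three: "cmod (- a - b - c) \<le> cmod a + cmod b + cmod c" for a b c :: complex
    using norm_triangle_ineq4[of "- a - b" c] norm_triangle_ineq4[of "- a" b] by simp
  have c1: "MV p v $ 1 = - of_real r * v$1 - of_real r * v$1 - (\<Psi> p)\<^sup>2 * v$2"
    unfolding MV_def vector_minus_component MH_nth r_def[symmetric] by (simp add: M0_def False algebra_simps)
  have c2: "MV p v $ 2 = - of_real r * v$2 - of_real r * v$2 - (cnj (\<Psi> p))\<^sup>2 * v$1"
    unfolding MV_def vector_minus_component MH_nth r_def[symmetric] by (simp add: M0_def False algebra_simps)
  have c3: "MV p v $ 3 = - (of_real r * v$3)" "MV p v $ 4 = - (of_real r * v$4)"
    unfolding MV_def vector_minus_component MH_nth r_def[symmetric] by (simp_all add: M0_def False algebra_simps)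
  have "cmod (MV p v $ 1) \<le> 3 * ((17 * \<epsilon>\<^sup>2) * norm v)" unfolding c1
    using three[of "of_real r * v$1" "of_real r * v$1" "(\<Psi> p)\<^sup>2 * v$2"] n[OF cs(3) component_bound[of v 1]] n[OF cs(1) component_bound[of v 2]] by simp
  moreover have "cmod (MV p v $ 2) \<le> 3 * ((17 * \<epsilon>\<^sup>2) * norm v)" unfolding c2
    using three[of "of_real r * v$2" "of_real r * v$2" "(cnj (\<Psi> p))\<^sup>2 * v$1"] n[OF cs(3) component_bound[of v 2]] n[OF cs(2) component_bound[of v 1]] by simp
  moreover have "cmod (MV p v $ 3) \<le> (17 * \<epsilon>\<^sup>2) * norm v" "cmod (MV p v $ 4) \<le> (17 * \<epsilon>\<^sup>2) * norm v"
    unfolding c3 norm_minus_cancel by (intro n cs component_bound)+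
  moreover have "0 \<le> \<epsilon>\<^sup>2 * norm v" by simp
  moreover have "3 * ((17 * \<epsilon>\<^sup>2) * norm v) = 51 * (\<epsilon>\<^sup>2 * norm v)" "(17 * \<epsilon>\<^sup>2) * norm v = 17 * (\<epsilon>\<^sup>2 * norm v)"
    "(204 * \<epsilon>\<^sup>2) * norm v = 204 * (\<epsilon>\<^sup>2 * norm v)" by simp_all
  ultimately show ?thesis using norm4_le[of "MV p v"] by linarith
qed

lemma norm_MH: "norm (MH p v) \<le> 3 * norm v"
proof -
  have "norm (MH p v) \<le> norm (MV p v) + norm (M0 p v)"
    using norm_triangle_ineq[of "MV p v" "M0 p v"] by (simp add: MV_def)
  also have "\<dots> \<le> (204 * \<epsilon>\<^sup>2) * norm v + 2 * norm v" by (intro add_mono norm_MV norm_M0)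
  also have "(204 * \<epsilon>\<^sup>2) * norm v \<le> 1 * norm v" using eps2_small eps_small by (intro mult_right_mono) auto
  finally show ?thesis by simp
qed

definition Hop :: "ell2 \<Rightarrow> ell2" where "Hop f = sitewise MH f - \<epsilon> *\<^sub>R Lap f"
definition Vop :: "ell2 \<Rightarrow> ell2" where "Vop = sitewise MV"

lemma fn_Hop: "fn (Hop f) p = MH p (fn f p) - \<epsilon> *\<^sub>R lap (fn f) p"
  by (simp add: Hop_def fn_sitewise[OF norm_MH] fn_Lap)

lemma fn_Vop [simp]: "fn (Vop f) p = MV p (fn f p)"
  unfolding Vop_def by (rule fn_sitewise[OF norm_MV])

lemma norm_Vop: "norm (Vop f) \<le> (204 * \<epsilon>\<^sup>2) * norm f"
  by (rule norm_le_pointwise) (simp_all add: norm_MV)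

lemma Hop_eq: "Hop f = H0op f + Vop f - \<epsilon> *\<^sub>R Lap f"
  by (rule ell2_eqI) (simp add: fn_Hop fn_Lap MV_def)

lemma clin_Lap: "CH.clin Lap"
proof -
  have "linear Lap"
    by (rule linearI; rule ell2_eqI) (simp_all add: fn_Lap lap_def scaleR_add_right split: prod.splits)
  moreover have "Lap (Jop f) = Jop (Lap f)" for f
    by (rule ell2_eqI) (simp add: fn_Lap lap_def vector_add_ldistrib split: prod.splits)
  ultimately show ?thesis unfolding CH.clin_def using norm_Lap by blast
qed

lemma clin_sitewise_MH: "CH.clin (sitewise MH)"
  by (rule clin_sitewise[OF _ _ norm_MH]) (auto intro!: vec4_eqI simp: algebra_simps)

lemma clin_Hop: "CH.clin Hop"
proof -
  have "linear Hop" unfolding Hop_def[abs_def]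
    by (intro linear_compose_sub linear_compose_scale_right CH.clin_linear clin_sitewise_MH clin_Lap)
  moreover have "Hop (Jop f) = Jop (Hop f)" for f
  proof -
    have a: "sitewise MH (Jop f) = Jop (sitewise MH f)" "Lap (Jop f) = Jop (Lap f)"
      using clin_sitewise_MH clin_Lap by (simp_all add: CH.clin_def)
    show ?thesis unfolding Hop_def a by (rule ell2_eqI, rule vec4_eqI; simp; simp add: scaleR_conv_of_real algebra_simps)
  qed
  moreover have "norm (Hop f) \<le> (3 + \<epsilon> * 4) * norm f" for f
  proof -
    have "norm (Hop f) \<le> norm (sitewise MH f) + norm (\<epsilon> *\<^sub>R Lap f)"
      unfolding Hop_def by (rule norm_triangle_ineq4)
    also have "\<dots> \<le> 3 * norm f + \<epsilon> * (4 * norm f)"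
    proof (intro add_mono)
      show "norm (sitewise MH f) \<le> 3 * norm f"
        by (rule norm_le_pointwise) (simp_all add: fn_sitewise[OF norm_MH] norm_MH)
      show "norm (\<epsilon> *\<^sub>R Lap f) \<le> \<epsilon> * (4 * norm f)"
        using eps norm_Lap[of f] by (simp add: mult_left_mono)
    qed
    finally show ?thesis by (simp add: algebra_simps)
  qed
  ultimately show ?thesis unfolding CH.clin_def by blast
qed

lemma Hop_sym: "inner (Hop f) g = inner f (Hop g)"
proof -
  have "inner (MH p v) w = inner v (MH p w)" for p v w
  proof -
    have "hi (MH p v) w = hi v (MH p w)" by (simp add: hi_4 algebra_simps)
    then show ?thesis by (metis Re_hi)
  qed
  then have "inner (sitewise MH f) g = inner f (sitewise MH g)" by (rule sitewise_sym[OF norm_MH])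
  then show ?thesis unfolding Hop_def by (simp add: inner_diff_left inner_diff_right Lap_selfadjoint)
qed

lemma \<Psi>_rotl: "\<Psi> (rotl p) = \<i> * \<Psi> p"
  by (cases p) (simp add: rotl_def rot)

lemma MU_simps: "MU (v + w) = MU v + MU w" "MU (r *\<^sub>R v) = r *\<^sub>R MU v" "MU (v - w) = MU v - MU w"
  by (rule vec4_eqI; simp add: MU_def algebra_simps)+

lemma Lap_U: "Lap (Uop f) = Uop (Lap f)"
  by (rule ell2_eqI) (auto simp: fn_Lap lap_def rotl_def MU_simps add_ac split: prod.splits)

lemma Hop_U: "Hop (Uop f) = Uop (Hop f)"
proof -
  have M: "MH p (MU v) = MU (MH (rotl p) v)" for p v
    by (rule vec4_eqI) (simp_all add: MU_def \<Psi>_rotl norm_mult power_mult_distrib algebra_simps)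
  have "fn (Hop (Uop f)) p = fn (Uop (Hop f)) p" for p
  proof -
    have "lap (fn (Uop f)) p = fn (Uop (Lap f)) p" by (simp only: fn_Lap[symmetric] Lap_U)
    then have L: "lap (fn (Uop f)) p = MU (lap (fn f) (rotl p))" by (simp add: fn_Lap)
    show ?thesis unfolding fn_Hop L fn_Uop M MU_simps ..
  qed
  then show ?thesis by (rule ell2_eqI)
qed

lemma Hop_near: "norm (Hop f - H0op f) \<le> (5 * \<epsilon>) * norm f"
proof -
  have "norm (Hop f - H0op f) = norm (Vop f - \<epsilon> *\<^sub>R Lap f)" by (simp add: Hop_eq)
  also have "\<dots> \<le> norm (Vop f) + norm (\<epsilon> *\<^sub>R Lap f)" by (rule norm_triangle_ineq4)
  also have "\<dots> \<le> (204 * \<epsilon>\<^sup>2) * norm f + \<epsilon> * (4 * norm f)"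
    using eps norm_Lap[of f] norm_Vop[of f] by (intro add_mono) (simp_all add: mult_left_mono)
  also have "(204 * \<epsilon>\<^sup>2) * norm f \<le> \<epsilon> * norm f"
    using eps2_small eps by (intro mult_right_mono) auto
  finally show ?thesis by (simp add: algebra_simps)
qed

sublocale KG: krein_gap Jop Uop "{..<12::nat}" bmode "\<lambda>i. om ^ i" Hop H0op sig "5 * \<epsilon>" Qop
proof unfold_locales
  show "5 * \<epsilon> \<le> 1 / 10000000" using eps_small by simp
  show "sig (Uop f) = Uop (sig f)" for f
    by (rule ell2_eqI) (auto intro!: vec4_eqI simp: MU_def)
  show "H0op (H0op f + modes.Prj Jop {..<12} bmode f) + modes.Prj Jop {..<12} bmode (H0op f + modes.Prj Jop {..<12} bmode f) +
         (H0op f + modes.Prj Jop {..<12} bmode f) = 2 *\<^sub>R f" for f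
    by (rule G0_square)
  show "norm (H0op f + modes.Prj Jop {..<12} bmode f + f) \<le> 2 * norm f" for f
    by (rule G0_bound)
  show "inner f (H0op f) \<ge> (norm f)\<^sup>2 - 3 * (norm (Qop f))\<^sup>2" for f by (rule H0_lower)
qed (use eps in \<open>simp_all add: clin_Hop clin_H0op clin_sig clin_Qop Hop_sym sig_sym sig_sig Hop_U Hop_near
  H0_bmode norm_Qop Q_sig Q_H0 H0_nilpotent norm_H0op\<close>)

lemma mode_l2:
  assumes "\<And>p. norm (F p) \<le> c * cmod (\<Psi> p)" shows "F \<in> l2"
proof -
  have "(\<lambda>p. c\<^sup>2 * (norm (\<Psi> p))\<^sup>2) summable_on UNIV"
    using \<Psi>_l2 by (intro summable_on_cmult_right) (simp add: l2_def)
  then show ?thesis unfolding l2_def mem_Collect_eq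
    by (rule summable_on_comparison_test)
      (auto simp flip: power_mult_distrib intro!: power_mono assms)
qed

text \<open>Six families of functions built from \<open>\<Psi>\<close> and its conjugate. The coefficient \<open>a\<close> belongs to the gauge
  symmetry and \<open>c, c', d, d'\<close> to the internal rotations; these are zero modes. With \<open>a'\<close> one obtains the
  gauge direction multiplied by an alternating sign on the nodes.\<close>

definition zmode :: "complex \<Rightarrow> complex \<Rightarrow> complex \<Rightarrow> complex \<Rightarrow> complex \<Rightarrow> complex \<Rightarrow> ell2" where
  "zmode a a' c c' d d' = Ell (\<lambda>p. vector [a * \<Psi> p + a' * cnj (\<Psi> p), - a * cnj (\<Psi> p) - a' * \<Psi> p,
      c * \<Psi> p + c' * cnj (\<Psi> p), d * \<Psi> p + d' * cnj (\<Psi> p)])"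

lemma fn_zmode: "fn (zmode a a' c c' d d') p = vector [a * \<Psi> p + a' * cnj (\<Psi> p), - a * cnj (\<Psi> p) - a' * \<Psi> p,
      c * \<Psi> p + c' * cnj (\<Psi> p), d * \<Psi> p + d' * cnj (\<Psi> p)]"
  unfolding zmode_def
proof (subst Ell_inverse)
  have two: "cmod (s * \<Psi> p + t * cnj (\<Psi> p)) \<le> (cmod s + cmod t) * cmod (\<Psi> p)"
    "cmod (- s * cnj (\<Psi> p) - t * \<Psi> p) \<le> (cmod s + cmod t) * cmod (\<Psi> p)" for s t p
    using norm_triangle_ineq[of "s * \<Psi> p" "t * cnj (\<Psi> p)"] norm_triangle_ineq4[of "- s * cnj (\<Psi> p)" "t * \<Psi> p"]
    by (simp_all add: norm_mult algebra_simps)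
  show "(\<lambda>p. vector [a * \<Psi> p + a' * cnj (\<Psi> p), - a * cnj (\<Psi> p) - a' * \<Psi> p,
      c * \<Psi> p + c' * cnj (\<Psi> p), d * \<Psi> p + d' * cnj (\<Psi> p)] :: complex^4) \<in> l2"
  proof (rule mode_l2[where c = "2 * (cmod a + cmod a') + (cmod c + cmod c') + (cmod d + cmod d')"])
    fix p
    show "norm (vector [a * \<Psi> p + a' * cnj (\<Psi> p), - a * cnj (\<Psi> p) - a' * \<Psi> p,
      c * \<Psi> p + c' * cnj (\<Psi> p), d * \<Psi> p + d' * cnj (\<Psi> p)] :: complex^4)
      \<le> (2 * (cmod a + cmod a') + (cmod c + cmod c') + (cmod d + cmod d')) * cmod (\<Psi> p)"
      using two(1)[of a p a'] two(2)[of a p a'] two(1)[of c p c'] two(1)[of d p d']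
      by (intro order_trans[OF norm4_le]) (simp add: algebra_simps)
  qed
qed simp

lemma lap_nth: "lap F p $ i = lap (\<lambda>q. F q $ i) p" for F :: "lattice \<Rightarrow> complex^4"
  by (simp add: lap_def split: prod.splits)

lemma eqn': "of_real \<epsilon> * lap \<Psi> p = (1 - of_real ((cmod (\<Psi> p))\<^sup>2)) * \<Psi> p"
  using eqn[of p] by simp

lemma eqn_cnj: "of_real \<epsilon> * lap (\<lambda>q. cnj (\<Psi> q)) p = (1 - of_real ((cmod (\<Psi> p))\<^sup>2)) * cnj (\<Psi> p)"
proof -
  have "lap (\<lambda>q. cnj (\<Psi> q)) p = cnj (lap \<Psi> p)" by (simp add: lap_def split: prod.splits)
  then show ?thesis using arg_cong[OF eqn'[of p], of cnj] by simp
qed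

lemma lap_lin: "lap (\<lambda>q. a * \<Psi> q + b * cnj (\<Psi> q)) p = a * lap \<Psi> p + b * lap (\<lambda>q. cnj (\<Psi> q)) p"
  "lap (\<lambda>q. - a * cnj (\<Psi> q) - b * \<Psi> q) p = - a * lap (\<lambda>q. cnj (\<Psi> q)) p - b * lap \<Psi> p"
  by (simp_all add: lap_def algebra_simps split: prod.splits)

lemma Hop_zmode:
  "fn (Hop (zmode a a' c c' d d')) p = a' *s vector [(\<Psi> p)^3 - of_real ((cmod (\<Psi> p))\<^sup>2) * cnj (\<Psi> p),
     of_real ((cmod (\<Psi> p))\<^sup>2) * \<Psi> p - (cnj (\<Psi> p))^3, 0, 0]"
proof -
  define r where "r = (of_real ((cmod (\<Psi> p))\<^sup>2) :: complex)"
  have r: "\<Psi> p * cnj (\<Psi> p) = r" unfolding r_def by (simp only: complex_norm_square)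
  have e1: "of_real \<epsilon> * lap \<Psi> p = (1 - r) * \<Psi> p" and e2: "of_real \<epsilon> * lap (\<lambda>q. cnj (\<Psi> q)) p = (1 - r) * cnj (\<Psi> p)"
    using eqn'[of p] eqn_cnj[of p] by (simp_all only: r_def)
  have l: "of_real \<epsilon> * lap (\<lambda>q. s * \<Psi> q + t * cnj (\<Psi> q)) p = (1 - r) * (s * \<Psi> p + t * cnj (\<Psi> p))"
    "of_real \<epsilon> * lap (\<lambda>q. - s * cnj (\<Psi> q) - t * \<Psi> q) p = (1 - r) * (- s * cnj (\<Psi> p) - t * \<Psi> p)" for s t
  proof -
    have "of_real \<epsilon> * lap (\<lambda>q. s * \<Psi> q + t * cnj (\<Psi> q)) p = s * (of_real \<epsilon> * lap \<Psi> p) + t * (of_real \<epsilon> * lap (\<lambda>q. cnj (\<Psi> q)) p)"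
      unfolding lap_lin by (simp add: algebra_simps)
    then show "of_real \<epsilon> * lap (\<lambda>q. s * \<Psi> q + t * cnj (\<Psi> q)) p = (1 - r) * (s * \<Psi> p + t * cnj (\<Psi> p))"
      unfolding e1 e2 by (simp add: algebra_simps)
    have "of_real \<epsilon> * lap (\<lambda>q. - s * cnj (\<Psi> q) - t * \<Psi> q) p = - s * (of_real \<epsilon> * lap (\<lambda>q. cnj (\<Psi> q)) p) - t * (of_real \<epsilon> * lap \<Psi> p)"
      unfolding lap_lin by (simp add: algebra_simps)
    then show "of_real \<epsilon> * lap (\<lambda>q. - s * cnj (\<Psi> q) - t * \<Psi> q) p = (1 - r) * (- s * cnj (\<Psi> p) - t * \<Psi> p)"
      unfolding e1 e2 by (simp add: algebra_simps)
  qed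
  have c: "fn (Hop (zmode a a' c c' d d')) p $ i = MH p (fn (zmode a a' c c' d d') p) $ i - of_real \<epsilon> * lap (\<lambda>q. fn (zmode a a' c c' d d') q $ i) p" for i
    unfolding fn_Hop vector_minus_component vector_scaleR_component lap_nth by (simp add: scaleR_conv_of_real)
  have "fn (Hop (zmode a a' c c' d d')) p $ 1 = a' * ((\<Psi> p)^3 - r * cnj (\<Psi> p))"
    "fn (Hop (zmode a a' c c' d d')) p $ 2 = a' * (r * \<Psi> p - (cnj (\<Psi> p))^3)"
    "fn (Hop (zmode a a' c c' d d')) p $ 3 = 0" "fn (Hop (zmode a a' c c' d d')) p $ 4 = 0"
    unfolding c MH_nth fn_zmode vector_4_nth l r_def[symmetric] unfolding r[symmetric]
    by (simp_all add: algebra_simps power3_eq_cube power2_eq_square)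
  then show ?thesis by (intro vec4_eqI) (simp_all add: r_def)
qed

lemma Hop_zmode_0: "Hop (zmode a 0 c c' d d') = 0"
  by (rule ell2_eqI) (simp add: Hop_zmode)

lemma zmode_U: "Uop (zmode a a' c c' d d') = zmode a (- a') (om * \<i> * c) (- om * \<i> * c') (om\<^sup>2 * \<i> * d) (- om\<^sup>2 * \<i> * d')"
  by (rule ell2_eqI, rule vec4_eqI) (simp_all add: fn_zmode MU_def \<Psi>_rotl algebra_simps)

lemma zmode_sc: "CH.sc z (zmode a a' c c' d d') = zmode (z * a) (z * a') (z * c) (z * c') (z * d) (z * d')"
  by (rule ell2_eqI, rule vec4_eqI) (simp_all add: fn_zmode algebra_simps)

lemma om_vals: "om ^ 4 = om * \<i>" "om ^ 5 = om\<^sup>2 * \<i>" "om ^ 6 = -1" "om ^ 10 = - om * \<i>" "om ^ 11 = - om\<^sup>2 * \<i>"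
  using om_powers(1)[of 2] om_powers(2)[of 1] om_powers(3)[of 1] om_powers(2)[of 3] om_powers(3)[of 3]
  by (simp_all add: eval_nat_numeral)

lemma x_pos: "0 < x" using x_near by linarith

lemma ci_modes:
  "CH.ci (bmode 0) (zmode 1 0 0 0 0 0) = of_real (2 * sqrt 2 * x)"
  "CH.ci (bmode 6) (zmode 0 1 0 0 0 0) = of_real (2 * sqrt 2 * x)"
  "CH.ci (bmode 4) (zmode 0 0 1 0 0 0) = of_real (2 * x)"
  "CH.ci (bmode 10) (zmode 0 0 0 1 0 0) = of_real (2 * x)"
  "CH.ci (bmode 5) (zmode 0 0 0 0 1 0) = of_real (2 * x)"
  "CH.ci (bmode 11) (zmode 0 0 0 0 0 1) = of_real (2 * x)"
proof -
  have s: "4 / complex_of_real (sqrt 2) = 2 * complex_of_real (sqrt 2)"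
    by (simp add: field_simps flip: of_real_mult)
  have nv: "\<Psi> (-1, 0) = of_real x" "\<Psi> (0, -1) = of_real x * \<i>" "\<Psi> (1, 0) = - of_real x" "\<Psi> (0, 1) = - (of_real x * \<i>)"
    using node_value[of "(-1,0)"] node_value[of "(0,-1)"] node_value[of "(1,0)"] node_value[of "(0,1)"]
    by (auto simp: nodes_eq cross_def)
  note d = ci_bmode nodes_eq hi_4 bvec_def fn_zmode nv cross_def Let_def power2_eq_square power3_eq_cube
  show "CH.ci (bmode 0) (zmode 1 0 0 0 0 0) = of_real (2 * sqrt 2 * x)"
    using s by (simp add: d) (simp add: field_simps)
  show "CH.ci (bmode 6) (zmode 0 1 0 0 0 0) = of_real (2 * sqrt 2 * x)"
    using s by (simp add: d) (simp add: field_simps)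
  show "CH.ci (bmode 4) (zmode 0 0 1 0 0 0) = of_real (2 * x)" by (simp add: d)
  show "CH.ci (bmode 10) (zmode 0 0 0 1 0 0) = of_real (2 * x)" by (simp add: d)
  show "CH.ci (bmode 5) (zmode 0 0 0 0 1 0) = of_real (2 * x)" by (simp add: d)
  show "CH.ci (bmode 11) (zmode 0 0 0 0 0 1) = of_real (2 * x)" by (simp add: d)
qed

lemma exact_zero:
  assumes "i < 12" "Hop f = 0" "Uop f = CH.sc (om ^ i) f" "CH.ci (bmode i) f = of_real c" "c \<noteq> 0"
  shows "KG.k i 0 = 0" and "of_real (c\<^sup>2) * KG.d1 i 0 0 = - CH.ci f (sig f)"
proof -
  have r: "KG.R 0 0 = 0" by (rule KG.R_0) simp
  show "KG.k i 0 = 0" using KG.rayleigh(1)[of i f] assms by (simp add: r CH.ci_0)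
  show "of_real (c\<^sup>2) * KG.d1 i 0 0 = - CH.ci f (sig f)"
    using KG.rayleigh(2)[of i f] assms by (simp add: r)
qed

text \<open>The zero modes of the phase symmetries lie in these sectors. The gauge mode is neutral for \<open>\<sigma>\<close>, so its zero
  is at least double.\<close>

lemma zero_sectors: "KG.k 0 0 = 0" "KG.k 4 0 = 0" "KG.k 5 0 = 0" "KG.k 10 0 = 0" "KG.k 11 0 = 0"
  "KG.d1 0 0 0 = 0"
proof -
  have x0: "2 * sqrt 2 * x \<noteq> 0" "2 * x \<noteq> 0" using x_pos by auto
  have U: "Uop (zmode 1 0 0 0 0 0) = CH.sc (om ^ 0) (zmode 1 0 0 0 0 0)"
    "Uop (zmode 0 0 1 0 0 0) = CH.sc (om ^ 4) (zmode 0 0 1 0 0 0)"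
    "Uop (zmode 0 0 0 0 1 0) = CH.sc (om ^ 5) (zmode 0 0 0 0 1 0)"
    "Uop (zmode 0 0 0 1 0 0) = CH.sc (om ^ 10) (zmode 0 0 0 1 0 0)"
    "Uop (zmode 0 0 0 0 0 1) = CH.sc (om ^ 11) (zmode 0 0 0 0 0 1)"
    unfolding zmode_U zmode_sc om_vals by simp_all
  show "KG.k 0 0 = 0" by (rule exact_zero(1)[OF _ Hop_zmode_0 U(1) ci_modes(1) x0(1)]) simp
  show "KG.k 4 0 = 0" by (rule exact_zero(1)[OF _ Hop_zmode_0 U(2) ci_modes(3) x0(2)]) simp
  show "KG.k 5 0 = 0" by (rule exact_zero(1)[OF _ Hop_zmode_0 U(3) ci_modes(5) x0(2)]) simp
  show "KG.k 10 0 = 0" by (rule exact_zero(1)[OF _ Hop_zmode_0 U(4) ci_modes(4) x0(2)]) simp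
  show "KG.k 11 0 = 0" by (rule exact_zero(1)[OF _ Hop_zmode_0 U(5) ci_modes(6) x0(2)]) simp
  have "CH.ci (zmode 1 0 0 0 0 0) (sig (zmode 1 0 0 0 0 0)) = 0"
  proof -
    have "inner (fn (zmode 1 0 0 0 0 0) p) (fn (sig (zmode 1 0 0 0 0 0)) p) = 0"
      "inner (fn (Jop (zmode 1 0 0 0 0 0)) p) (fn (sig (zmode 1 0 0 0 0 0)) p) = 0" for p
      by (simp_all add: fn_zmode inner_vec_def sum_4 inner_complex_def)
    then show ?thesis by (simp add: CH.ci_def inner_ell2_def complex_eq_iff del: fn_Jop fn_sig)
  qed
  then show "KG.d1 0 0 0 = 0" using exact_zero(2)[OF _ Hop_zmode_0 U(1) ci_modes(1) x0(1)] x_pos by simp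
qed

end

section \<open>Splitting at second order\<close>

context small_cross begin

text \<open>Two steps on the lattice lead from a node to itself in four ways, to the opposite node in one and to each
  adjacent node in two.\<close>

lemma far_nodes_zero:
  assumes "\<And>p. p \<notin> nodes \<Longrightarrow> g p = (0 :: complex^4)"
  shows "p \<in> nodes \<Longrightarrow> lap g p = 0"
    and "lap (lap g) (-1, 0) = 4 *\<^sub>R g (-1, 0) + g (1, 0) + 2 *\<^sub>R g (0, -1) + 2 *\<^sub>R g (0, 1)"
    and "lap (lap g) (1, 0) = 4 *\<^sub>R g (1, 0) + g (-1, 0) + 2 *\<^sub>R g (0, -1) + 2 *\<^sub>R g (0, 1)"
    and "lap (lap g) (0, -1) = 4 *\<^sub>R g (0, -1) + g (0, 1) + 2 *\<^sub>R g (-1, 0) + 2 *\<^sub>R g (1, 0)"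
    and "lap (lap g) (0, 1) = 4 *\<^sub>R g (0, 1) + g (0, -1) + 2 *\<^sub>R g (-1, 0) + 2 *\<^sub>R g (1, 0)"
proof -
  have z: "g (n, m) = 0" if "(n, m) \<noteq> (-1, 0)" "(n, m) \<noteq> (0, -1)" "(n, m) \<noteq> (1, 0)" "(n, m) \<noteq> (0, 1)" for n m
    using assms that by (simp add: nodes_eq)
  have s: "(4::real) *\<^sub>R v = v + v + v + v" "(2::real) *\<^sub>R v = v + v" for v :: "complex^4"
    using scaleR_add_left[of 2 2 v] by (simp_all add: scaleR_2)
  show "p \<in> nodes \<Longrightarrow> lap g p = 0" by (auto simp: nodes_eq lap_def z)
  show "lap (lap g) (-1, 0) = 4 *\<^sub>R g (-1, 0) + g (1, 0) + 2 *\<^sub>R g (0, -1) + 2 *\<^sub>R g (0, 1)"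
    "lap (lap g) (1, 0) = 4 *\<^sub>R g (1, 0) + g (-1, 0) + 2 *\<^sub>R g (0, -1) + 2 *\<^sub>R g (0, 1)"
    "lap (lap g) (0, -1) = 4 *\<^sub>R g (0, -1) + g (0, 1) + 2 *\<^sub>R g (-1, 0) + 2 *\<^sub>R g (1, 0)"
    "lap (lap g) (0, 1) = 4 *\<^sub>R g (0, 1) + g (0, -1) + 2 *\<^sub>R g (-1, 0) + 2 *\<^sub>R g (1, 0)"
    unfolding s by (simp_all add: lap_def z)
qed

text \<open>First-order correction of a phase mode. Its residual is of order \<open>\<epsilon>\<^sup>2\<close>, so the Rayleigh formula determines
  \<open>k\<^sub>i(0)\<close> up to \<open>O(\<epsilon>\<^sup>3)\<close>.\<close>

definition trial :: "nat \<Rightarrow> ell2" where "trial i = bmode i + \<epsilon> *\<^sub>R Lap (bmode i)"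

definition spread :: "nat \<Rightarrow> real" where "spread i = inner (bmode i) (Lap (Lap (bmode i)))"

lemma Lap_bmode_node: "p \<in> nodes \<Longrightarrow> fn (Lap (bmode i)) p = 0"
proof -
  have "fn (bmode i) = bvec i" by (rule ext) simp
  then show "p \<in> nodes \<Longrightarrow> fn (Lap (bmode i)) p = 0"
    using far_nodes_zero(1)[of "bvec i" p] by (simp add: fn_Lap bvec_off)
qed

lemma H0_Lap_bmode: "H0op (Lap (bmode i)) = Lap (bmode i)"
  by (rule ell2_eqI) (use Lap_bmode_node in \<open>auto simp: M0_def intro!: vec4_eqI\<close>)

lemma Vop_bmode: "Vop (bmode i) = (1 - x\<^sup>2) *\<^sub>R bmode i"
proof (rule ell2_eqI)
  fix p
  show "fn (Vop (bmode i)) p = fn ((1 - x\<^sup>2) *\<^sub>R bmode i) p"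
  proof (cases "p \<in> nodes")
    case False
    then show ?thesis by (auto simp: bvec_off MV_def M0_def intro!: vec4_eqI)
  next
    case True
    have M0: "M0 p (bvec i p) = 0" using arg_cong[OF H0_bmode, of "\<lambda>f. fn f p" i] by simp
    have c: "(cross p)\<^sup>2 * (cnj (cross p) * a) = cross p * a" "(cross p)\<^sup>2 * (cross p * a) = cnj (cross p) * a" for a
      using True by (auto simp: nodes_eq cross_def)
    have cr: "(cnj (cross p))\<^sup>2 = (cross p)\<^sup>2" using True by (auto simp: nodes_eq cross_def)
    have sq: "(\<Psi> p)\<^sup>2 = of_real (x\<^sup>2) * (cross p)\<^sup>2" "(cnj (\<Psi> p))\<^sup>2 = of_real (x\<^sup>2) * (cross p)\<^sup>2"
      "(cmod (\<Psi> p))\<^sup>2 = x\<^sup>2"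
      using node_value[OF True] cr by (auto simp: power_mult_distrib norm_mult cross_norm[OF True])
    have "MH p (bvec i p) = (1 - x\<^sup>2) *\<^sub>R bvec i p"
    proof (rule mod3_cases[of i])
      fix k assume i: "i = 3 * k"
      have u: "bvec i p $ 1 = cross p * (cross p ^ k / (2 * of_real (sqrt 2)))" "bvec i p $ 2 = - (cnj (cross p) * (cross p ^ k / (2 * of_real (sqrt 2))))"
        "bvec i p $ 3 = 0" "bvec i p $ 4 = 0" by (simp_all add: i bvec_0[OF True])
      show ?thesis
        by (rule vec4_eqI; unfold MH_nth vector_scaleR_component sq u; simp add: c mult.assoc scaleR_conv_of_real; simp add: algebra_simps add_divide_distrib diff_divide_distrib)
    next
      fix k assume i: "i = Suc (3 * k)"
      have u: "bvec i p $ 1 = 0" "bvec i p $ 2 = 0" "bvec i p $ 4 = 0" by (simp_all add: i bvec_1[OF True])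
      show ?thesis
        by (rule vec4_eqI; unfold MH_nth vector_scaleR_component sq u; simp add: scaleR_conv_of_real)
    next
      fix k assume i: "i = Suc (Suc (3 * k))"
      have u: "bvec i p $ 1 = 0" "bvec i p $ 2 = 0" "bvec i p $ 3 = 0" by (simp_all add: i bvec_2[OF True])
      show ?thesis
        by (rule vec4_eqI; unfold MH_nth vector_scaleR_component sq u; simp add: scaleR_conv_of_real)
    qed
    then show ?thesis by (simp add: MV_def M0)
  qed
qed

lemma ci_bmode_Lap: "CH.ci (bmode i) (Lap (bmode i)) = 0"
  unfolding ci_bmode by (intro sum.neutral ballI) (simp add: Lap_bmode_node hi_4)

lemma inner_bmode_off: "(\<And>p. p \<in> nodes \<Longrightarrow> fn g p = 0) \<Longrightarrow> inner (bmode i) g = 0"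
  by (subst inner_finite_support[of nodes]) (simp_all add: bvec_off)

lemma trial_U: "Uop (trial i) = CH.sc (om ^ i) (trial i)"
  unfolding trial_def
  by (simp add: CH.clin_add[OF clin_Uop] CH.clin_scaleR[OF clin_Uop] Lap_U[symmetric] Uop_bmode
    CH.clin_sc[OF clin_Lap] CH.sc_add CH.sc_scaleR)

lemma ci_bmode_trial: "CH.ci (bmode i) (trial i) = 1"
  by (simp add: trial_def CH.ci_add_right CH.ci_self norm_bmode ci_bmode_Lap
    CH.ci_sc_right[of _ "of_real _", unfolded CH.sc_of_real])

lemma Hop_trial: "Hop (trial i) = Vop (trial i) - \<epsilon>\<^sup>2 *\<^sub>R Lap (Lap (bmode i))"
  unfolding Hop_eq by (subst trial_def, subst (2) trial_def)
    (simp add: CH.clin_add[OF clin_H0op] CH.clin_scaleR[OF clin_H0op] H0_bmode H0_Lap_bmode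
      CH.clin_add[OF clin_Lap] CH.clin_scaleR[OF clin_Lap] scaleR_add_right power2_eq_square)

lemma norm_Lap_bmode: "norm (Lap (bmode i)) \<le> 4" "norm (Lap (Lap (bmode i))) \<le> 16"
  using norm_Lap[of "bmode i"] norm_Lap[of "Lap (bmode i)"] by (simp_all add: norm_bmode)

lemma norm_trial: "norm (trial i) \<le> 2"
proof -
  have "\<epsilon> * norm (Lap (bmode i)) \<le> (1/1000) * 4" using eps norm_Lap_bmode(1)[of i] by (intro mult_mono) auto
  then show ?thesis using norm_triangle_ineq[of "bmode i" "\<epsilon> *\<^sub>R Lap (bmode i)"] eps
    by (simp add: trial_def norm_bmode)
qed

lemma norm_Hop_trial: "norm (Hop (trial i)) \<le> 424 * \<epsilon>\<^sup>2"
proof -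
  have "norm (Vop (trial i)) \<le> (204 * \<epsilon>\<^sup>2) * 2"
    by (rule order_trans[OF norm_Vop mult_left_mono]) (simp_all add: norm_trial)
  moreover have "norm (\<epsilon>\<^sup>2 *\<^sub>R Lap (Lap (bmode i))) \<le> \<epsilon>\<^sup>2 * 16"
    using norm_Lap_bmode(2)[of i] by (simp add: mult_left_mono)
  ultimately show ?thesis unfolding Hop_trial
    using norm_triangle_ineq4[of "Vop (trial i)" "\<epsilon>\<^sup>2 *\<^sub>R Lap (Lap (bmode i))"] by simp
qed

text \<open>The contribution \<open>3\<epsilon>\<^sup>2\<close> is the amplitude defect \<open>1 - x\<^sup>2\<close> of the cross, and \<open>spread\<close> measures the
  coupling of the nodes through one intermediate site.\<close>

lemma inner_Hop_trial: "\<bar>inner (trial i) (Hop (trial i)) - (3 - spread i) * \<epsilon>\<^sup>2\<bar> \<le> 1729 * \<epsilon>^3"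
proof -
  define b L where "b = bmode i" and "L = Lap (bmode i)"
  have "inner (trial i) (Hop (trial i)) = inner b (Vop (trial i)) - \<epsilon>\<^sup>2 * spread i
      + \<epsilon> * inner L (Hop (trial i))"
    by (subst trial_def, subst Hop_trial, subst Hop_trial)
      (simp add: b_def L_def spread_def inner_add_left inner_diff_right algebra_simps)
  moreover have "inner b (Vop (trial i)) = 1 - x\<^sup>2"
  proof -
    have "inner b (Vop (trial i)) = inner b (Vop b) + inner b (Vop (trial i) - Vop b)" by (simp add: inner_diff_right)
    also have "inner b (Vop b) = 1 - x\<^sup>2" by (simp add: b_def Vop_bmode norm_bmode flip: power2_norm_eq_inner)
    also have "inner b (Vop (trial i) - Vop b) = 0"
      unfolding b_def by (rule inner_bmode_off) (simp add: trial_def Lap_bmode_node)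
    finally show ?thesis by simp
  qed
  moreover have "\<bar>\<epsilon> * inner L (Hop (trial i))\<bar> \<le> 1696 * \<epsilon>^3"
  proof -
    have "\<bar>inner L (Hop (trial i))\<bar> \<le> 4 * (424 * \<epsilon>\<^sup>2)"
      by (rule order_trans[OF Cauchy_Schwarz_ineq2 mult_mono]) (simp_all add: L_def norm_Lap_bmode norm_Hop_trial)
    then have "\<epsilon> * \<bar>inner L (Hop (trial i))\<bar> \<le> \<epsilon> * (4 * (424 * \<epsilon>\<^sup>2))" using eps by (intro mult_left_mono) auto
    then show ?thesis using eps by (simp add: abs_mult power2_eq_square power3_eq_cube)
  qed
  moreover note x_expansion
  moreover have "(3 - spread i) * \<epsilon>\<^sup>2 = 3 * \<epsilon>\<^sup>2 - \<epsilon>\<^sup>2 * spread i" by (simp add: algebra_simps)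
  moreover have "\<bar>v + e - w\<bar> \<le> 1729 * c" if "\<bar>e\<bar> \<le> 1696 * c" "\<bar>v - w\<bar> \<le> 33 * c" for e c v w :: real using that by linarith
  note this[of "\<epsilon> * inner L (Hop (trial i))" "\<epsilon>^3" "1 - x\<^sup>2" "3 * \<epsilon>\<^sup>2"]
  ultimately show ?thesis by (simp add: algebra_simps)
qed

lemma kr_trial:
  assumes i: "i < 12" shows "\<bar>KG.kr i 0 - (3 - spread i) * \<epsilon>\<^sup>2\<bar> \<le> 1730 * \<epsilon>^3"
    and "cmod (KG.d1 i 0 0 + CH.ci (trial i) (sig (trial i))) \<le> 3400 * \<epsilon>\<^sup>2"
proof -
  define f where "f = trial i"
  define h where "h = Hop f"
  define r where "r = KG.R 0 h"
  have nf: "norm f \<le> 2" by (simp add: f_def norm_trial)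
  have nh: "norm h \<le> 424 * \<epsilon>\<^sup>2" by (simp add: h_def f_def norm_Hop_trial)
  have nr: "norm r \<le> 848 * \<epsilon>\<^sup>2" using KG.R_norm[of 0 h] nh by (simp add: r_def)
  have e2: "\<epsilon>\<^sup>2 \<le> 1 / 10^9" "\<epsilon>\<^sup>2 * \<epsilon>\<^sup>2 \<le> \<epsilon>^3 / 10^9"
  proof -
    show "\<epsilon>\<^sup>2 \<le> 1 / 10^9" using eps2_small eps by simp
    have "\<epsilon>^3 * \<epsilon> \<le> \<epsilon>^3 * (1/10^9)" using eps eps_small by (intro mult_left_mono) auto
    then show "\<epsilon>\<^sup>2 * \<epsilon>\<^sup>2 \<le> \<epsilon>^3 / 10^9" by (simp add: power2_eq_square power3_eq_cube)
  qed
  have i': "i \<in> {..<12}" using i by simp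
  have k: "KG.k i 0 = CH.ci f h - CH.ci h r" and d: "KG.d1 i 0 0 = - CH.ci (f - r) (sig (f - r))"
    using KG.rayleigh[OF i' trial_U] by (simp_all add: ci_bmode_trial f_def h_def r_def)
  have "KG.kr i 0 = inner f h - inner h r" using arg_cong[OF k, of Re] by (simp add: KG.kr_def CH.Re_ci)
  moreover have "\<bar>inner h r\<bar> \<le> \<epsilon>^3"
  proof -
    have "\<bar>inner h r\<bar> \<le> (424 * \<epsilon>\<^sup>2) * (848 * \<epsilon>\<^sup>2)"
      by (rule order_trans[OF Cauchy_Schwarz_ineq2 mult_mono]) (simp_all add: nh nr)
    also have "\<dots> = 359552 * (\<epsilon>\<^sup>2 * \<epsilon>\<^sup>2)" by simp
    also have "\<dots> \<le> 359552 * (\<epsilon>^3 / 10^9)" by (intro mult_left_mono e2) auto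
    also have "\<dots> \<le> \<epsilon>^3" using eps by simp
    finally show ?thesis .
  qed
  moreover have "\<bar>inner f h - (3 - spread i) * \<epsilon>\<^sup>2\<bar> \<le> 1729 * \<epsilon>^3" unfolding f_def h_def by (rule inner_Hop_trial)
  ultimately show "\<bar>KG.kr i 0 - (3 - spread i) * \<epsilon>\<^sup>2\<bar> \<le> 1730 * \<epsilon>^3" by linarith
  have "KG.d1 i 0 0 + CH.ci f (sig f) = CH.ci f (sig r) + CH.ci r (sig (f - r))"
    unfolding d by (simp add: CH.clin_diff[OF clin_sig] CH.ci_diff_left CH.ci_diff_right)
  also have "cmod \<dots> \<le> norm f * norm (sig r) + norm r * norm (sig (f - r))"
    using norm_triangle_ineq[of "CH.ci f (sig r)" "CH.ci r (sig (f - r))"] CH.cmod_ci_le[of f "sig r"] CH.cmod_ci_le[of r "sig (f - r)"] by linarith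
  also have "\<dots> \<le> 2 * (848 * \<epsilon>\<^sup>2) + (848 * \<epsilon>\<^sup>2) * 2.001"
    unfolding KG.norm_\<sigma>
  proof (intro add_mono mult_mono nf nr)
    show "norm (f - r) \<le> 2.001" using norm_triangle_ineq4[of f r] nf nr e2 by simp
  qed auto
  also have "\<dots> \<le> 3400 * \<epsilon>\<^sup>2" by simp
  finally show "cmod (KG.d1 i 0 0 + CH.ci (trial i) (sig (trial i))) \<le> 3400 * \<epsilon>\<^sup>2" by (simp add: f_def)
qed

lemma trial_neutral: "i = 3 * k \<Longrightarrow> cmod (CH.ci (trial i) (sig (trial i))) \<le> 16 * \<epsilon>\<^sup>2"
proof -
  assume i: "i = 3 * k"
  define L where "L = Lap (bmode i)"
  have "CH.ci (bmode i) (sig L) = 0"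
    unfolding ci_bmode L_def by (intro sum.neutral ballI) (simp add: Lap_bmode_node hi_4)
  moreover from this have "CH.ci L (sig (bmode i)) = 0"
    by (metis CH.ci_commute KG.ci_\<sigma> complex_cnj_zero)
  moreover have "CH.ci (bmode i) (sig (bmode i)) = 0" unfolding i by (rule neutral_bmode)
  ultimately have "CH.ci (trial i) (sig (trial i)) = (of_real (\<epsilon> * \<epsilon>)) * CH.ci L (sig L)"
    unfolding trial_def L_def[symmetric] CH.sc_of_real[symmetric]
    by (simp add: CH.clin_add[OF clin_sig] CH.clin_sc[OF clin_sig] CH.ci_add_left CH.ci_add_right CH.ci_sc_left CH.ci_sc_right)
  then have "cmod (CH.ci (trial i) (sig (trial i))) = \<epsilon>\<^sup>2 * cmod (CH.ci L (sig L))"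
    by (simp add: norm_mult power2_eq_square)
  also have "cmod (CH.ci L (sig L)) \<le> norm L * norm (sig L)" by (rule CH.cmod_ci_le)
  also have "\<dots> \<le> 4 * 4" unfolding KG.norm_\<sigma> by (intro mult_mono) (simp_all add: L_def norm_Lap_bmode)
  finally show ?thesis by (simp add: mult_left_mono)
qed

lemma spread_values: "spread 3 = 5" "spread 9 = 5" "spread 1 = 9" "spread 2 = 9" "spread 7 = 1" "spread 8 = 1"
proof -
  have s: "spread i = inner (bvec i (-1,0)) (lap (lap (bvec i)) (-1,0)) + inner (bvec i (0,-1)) (lap (lap (bvec i)) (0,-1))
      + inner (bvec i (1,0)) (lap (lap (bvec i)) (1,0)) + inner (bvec i (0,1)) (lap (lap (bvec i)) (0,1))" for i
  proof -
    have e: "fn (bmode i) = bvec i" by (rule ext) simp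
    have "fn (Lap (Lap (bmode i))) p = lap (lap (bvec i)) p" for p
      unfolding fn_Lap by (rule arg_cong[of _ _ "\<lambda>f. lap f p"], rule ext) (simp add: fn_Lap e)
    then show ?thesis
      unfolding spread_def by (subst inner_finite_support[of nodes]) (simp_all add: bvec_off nodes_eq add_ac)
  qed
  have l: "lap (lap (bvec i)) (-1, 0) = 4 *\<^sub>R bvec i (-1, 0) + bvec i (1, 0) + 2 *\<^sub>R bvec i (0, -1) + 2 *\<^sub>R bvec i (0, 1)"
    "lap (lap (bvec i)) (1, 0) = 4 *\<^sub>R bvec i (1, 0) + bvec i (-1, 0) + 2 *\<^sub>R bvec i (0, -1) + 2 *\<^sub>R bvec i (0, 1)"
    "lap (lap (bvec i)) (0, -1) = 4 *\<^sub>R bvec i (0, -1) + bvec i (0, 1) + 2 *\<^sub>R bvec i (-1, 0) + 2 *\<^sub>R bvec i (1, 0)"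
    "lap (lap (bvec i)) (0, 1) = 4 *\<^sub>R bvec i (0, 1) + bvec i (0, -1) + 2 *\<^sub>R bvec i (-1, 0) + 2 *\<^sub>R bvec i (1, 0)" for i
    by (rule far_nodes_zero(2), rule bvec_off, assumption, rule far_nodes_zero(3), rule bvec_off, assumption,
      rule far_nodes_zero(4), rule bvec_off, assumption, rule far_nodes_zero(5), rule bvec_off, assumption)
  note d = s l inner_add_right inner_scaleR_right
  have q: "sqrt 2 * (sqrt 2 * a) = 2 * a" for a by (simp flip: mult.assoc)
  note e = bvec_def nodes_eq cross_def Let_def power2_eq_square power3_eq_cube inner_vec_def sum_4 inner_complex_def
     Re_divide Im_divide q
  show "spread 3 = 5" "spread 9 = 5" "spread 1 = 9" "spread 2 = 9" "spread 7 = 1" "spread 8 = 1"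
    unfolding d by (simp_all add: e)
qed

end

section \<open>Splitting of the alternating mode at fourth order\<close>

text \<open>An antiunitary map \<open>C\<close> intertwining \<open>P z\<close> and \<open>P (- cnj z)\<close> permutes the sectors and reflects the
  zeros in the imaginary axis.\<close>

lemma (in krein_pencil) antiunitary_symmetry:
  assumes C_add: "\<And>f g. C (f + g) = C f + C g" and C_Prj: "\<And>f. C (Prj f) = Prj (C f)"
    and C_P: "\<And>z f. C (P z f) = P (- cnj z) (C f)"
    and C_ci: "\<And>f g. ci (C f) (C g) = cnj (ci f g)"
    and ij: "C (b i) = s *\<^sub>R b j" "\<bar>s\<bar> = 1" and z: "cmod z \<le> 1/100"
  shows "k j (- cnj z) = cnj (k i z)"
proof -
  have z': "cmod (- cnj z) \<le> 1/100" using z by simp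
  have ss: "s * s = 1" using ij(2) by (auto simp: abs_if split: if_splits)
  have "Ht (- cnj z) (C (R z (b i))) = C (Ht z (R z (b i)))" by (simp add: Ht_def C_add C_Prj C_P)
  then have "R (- cnj z) (s *\<^sub>R b j) = C (R z (b i))" using z by (intro R_eqI[OF z']) (simp add: ij)
  then have e: "s *\<^sub>R e j (- cnj z) = C (e i z)"
    using R_sc[OF z', of "of_real s" "b j"] by (simp only: sc_of_real e_def)
  have "ci (b j) (e j (- cnj z)) = ci (s *\<^sub>R b j) (s *\<^sub>R e j (- cnj z))"
    using ss by (simp add: sc_of_real[symmetric] ci_sc_left ci_sc_right flip: of_real_mult mult.assoc)
  also have "\<dots> = cnj (ci (b i) (e i z))" by (simp only: e ij(1)[symmetric] C_ci)
  finally show ?thesis by (simp add: k_def)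
qed

text \<open>The symmetry behind the pairs \<open>\<plusminus>\<lambda>\<close>: the second and the fourth component of the linearization are the formal
  complex conjugates of the first and the third.\<close>

definition MC :: "complex^4 \<Rightarrow> complex^4" where
  "MC v = vector [cnj (v$2), cnj (v$1), cnj (v$4), cnj (v$3)]"

lemma MC_nth [simp]: "MC v $ 1 = cnj (v$2)" "MC v $ 2 = cnj (v$1)" "MC v $ 3 = cnj (v$4)" "MC v $ 4 = cnj (v$3)"
  by (simp_all add: MC_def)

definition Cop :: "ell2 \<Rightarrow> ell2" where "Cop = sitewise (\<lambda>p. MC)"

lemma fn_Cop [simp]: "fn (Cop f) p = MC (fn f p)"
  unfolding Cop_def by (rule fn_sitewise[of _ 1]) (rule norm4_mono; simp)

lemma ci_Cop: "CH.ci (Cop f) (Cop g) = cnj (CH.ci f g)"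
proof -
  have "inner (MC v) (MC w) = inner v w" "inner (\<i> *s MC v) (MC w) = - inner (\<i> *s v) w" for v w
    by (simp_all add: inner_vec_def sum_4 inner_complex_def)
  then show ?thesis by (simp add: CH.ci_def inner_ell2_def complex_eq_iff infsum_uminus)
qed

context small_cross begin

lemma Cop_Hop: "Cop (Hop f) = Hop (Cop f)"
proof (rule ell2_eqI)
  fix p
  have l: "lap (fn (Cop f)) p = MC (lap (fn f) p)"
    by (rule vec4_eqI) (simp_all add: lap_def split: prod.splits)
  show "fn (Cop (Hop f)) p = fn (Hop (Cop f)) p"
    unfolding fn_Cop fn_Hop l by (rule vec4_eqI) (simp_all add: algebra_simps)
qed

lemma Cop_P: "Cop (KG.P z f) = KG.P (- cnj z) (Cop f)"
proof -
  have "Cop (f - g) = Cop f - Cop g" for f g by (rule ell2_eqI, rule vec4_eqI) simp_all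
  moreover have "Cop (CH.sc z (sig f)) = - (CH.sc (cnj z) (sig (Cop f)))"
    by (rule ell2_eqI, rule vec4_eqI) simp_all
  ultimately show ?thesis by (simp add: KG.P_def Cop_Hop CH.sc_neg_left)
qed

lemma Cop_Prj: "Cop (MD.Prj f) = MD.Prj (Cop f)"
proof (rule ell2_eqI)
  fix p
  have "p \<in> nodes \<Longrightarrow> (cnj (cross p))\<^sup>2 = (cross p)\<^sup>2" by (auto simp: nodes_eq cross_def)
  then show "fn (Cop (MD.Prj f)) p = fn (MD.Prj (Cop f)) p"
    by (cases "p \<in> nodes"; intro vec4_eqI; simp add: fn_Prj)
qed

lemma Cop_bmode: "Cop (bmode 3) = (-1) *\<^sub>R bmode 9" "Cop (bmode 6) = (-1) *\<^sub>R bmode 6"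
  "Cop (bmode 1) = 1 *\<^sub>R bmode 2" "Cop (bmode 7) = 1 *\<^sub>R bmode 8"
proof -
  note d = bvec_def nodes_eq cross_def Let_def power2_eq_square power3_eq_cube scaleR_conv_of_real
  have "fn (Cop (bmode 3)) p = fn ((-1) *\<^sub>R bmode 9) p" "fn (Cop (bmode 6)) p = fn ((-1) *\<^sub>R bmode 6) p"
   "fn (Cop (bmode 1)) p = fn (1 *\<^sub>R bmode 2) p" "fn (Cop (bmode 7)) p = fn (1 *\<^sub>R bmode 8) p" for p
    by (cases "p \<in> nodes"; intro vec4_eqI; auto simp: d)+
  then show "Cop (bmode 3) = (-1) *\<^sub>R bmode 9" "Cop (bmode 6) = (-1) *\<^sub>R bmode 6"
    "Cop (bmode 1) = 1 *\<^sub>R bmode 2" "Cop (bmode 7) = 1 *\<^sub>R bmode 8" by (blast intro: ell2_eqI)+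
qed

lemma k_reflect:
  assumes "cmod z \<le> 1/100"
  shows "KG.k 9 (- cnj z) = cnj (KG.k 3 z)" "KG.k 6 (- cnj z) = cnj (KG.k 6 z)"
    "KG.k 2 (- cnj z) = cnj (KG.k 1 z)" "KG.k 8 (- cnj z) = cnj (KG.k 7 z)"
proof -
  have a: "Cop (f + g) = Cop f + Cop g" for f g by (rule ell2_eqI, rule vec4_eqI) simp_all
  note r = KG.antiunitary_symmetry[where C = Cop, OF a Cop_Prj Cop_P ci_Cop]
  show "KG.k 9 (- cnj z) = cnj (KG.k 3 z)" by (rule r[OF Cop_bmode(1) _ assms]) simp
  show "KG.k 6 (- cnj z) = cnj (KG.k 6 z)" by (rule r[OF Cop_bmode(2) _ assms]) simp
  show "KG.k 2 (- cnj z) = cnj (KG.k 1 z)" by (rule r[OF Cop_bmode(3) _ assms]) simp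
  show "KG.k 8 (- cnj z) = cnj (KG.k 7 z)" by (rule r[OF Cop_bmode(4) _ assms]) simp
qed

text \<open>In sector \<open>6\<close> the trial function \<open>(cnj \<Psi>, -\<Psi>, 0, 0)\<close> has a residual of order \<open>\<epsilon>\<^sup>3\<close> only. It would
  be an exact zero mode if \<open>\<Psi>\<^sup>4\<close> were equal to \<open>\<bar>\<Psi>\<bar>\<^sup>4\<close>, as is the case on the axes.\<close>

abbreviation "f6 \<equiv> zmode 0 1 0 0 0 0"

lemma fn_f6: "fn f6 p = vector [cnj (\<Psi> p), - \<Psi> p, 0, 0]"
  by (simp add: fn_zmode)

lemma fn_Hop_f6: "fn (Hop f6) p = vector [(\<Psi> p)^3 - of_real ((cmod (\<Psi> p))\<^sup>2) * cnj (\<Psi> p),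
     of_real ((cmod (\<Psi> p))\<^sup>2) * \<Psi> p - (cnj (\<Psi> p))^3, 0, 0]"
  unfolding Hop_zmode by (rule vec4_eqI) simp_all

lemma fn_Hop_f6_axis:
  assumes "fst p = 0 \<or> snd p = 0" shows "fn (Hop f6) p = 0"
proof -
  define z where "z = \<Psi> p"
  have "z ^ 4 = of_real (cmod z ^ 4)" using axis_power4[of "fst p" "snd p"] assms by (simp add: z_def)
  also have "\<dots> = (of_real ((cmod z)\<^sup>2))\<^sup>2" by (simp flip: power_mult)
  also have "\<dots> = of_real ((cmod z)\<^sup>2) * (z * cnj z)" by (simp only: power2_eq_square[of "of_real _ :: complex"] complex_norm_square[symmetric])
  finally have "z * z ^ 3 = z * (of_real ((cmod z)\<^sup>2) * cnj z)" by (simp add: eval_nat_numeral mult_ac)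
  then have 1: "z ^ 3 = of_real ((cmod z)\<^sup>2) * cnj z" by (cases "z = 0") auto
  have 2: "(cnj z) ^ 3 = of_real ((cmod z)\<^sup>2) * z" using arg_cong[OF 1, of cnj]
    by (simp only: complex_cnj_power complex_cnj_mult complex_cnj_cnj complex_cnj_complex_of_real)
  show ?thesis unfolding fn_Hop_f6 z_def[symmetric] 1 2 by (rule vec4_eqI) simp_all
qed

lemma norm_fn_Hop_f6: "norm (fn (Hop f6) p) \<le> 4 * (cmod (\<Psi> p))^3"
proof -
  have "cmod (z ^ 3 - of_real ((cmod z)\<^sup>2) * cnj z) \<le> 2 * (cmod z)^3" for z
    using norm_triangle_ineq4[of "z ^ 3" "of_real ((cmod z)\<^sup>2) * cnj z"]
    by (simp add: norm_mult norm_power power3_eq_cube power2_eq_square)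
  from this[of "\<Psi> p"] this[of "cnj (\<Psi> p)"] show ?thesis
    using norm4_le[of "fn (Hop f6) p"] unfolding fn_Hop_f6 vector_4_nth
    by (simp add: norm_minus_commute)
qed

definition g6 :: ell2 where "g6 = f6 - Qop f6"

lemma fn_g6: "fn g6 p = (if p \<in> nodes then 0 else fn f6 p)" by (simp add: g6_def)

text \<open>Off the nodes the stationary equation bounds \<open>\<Psi>\<close> by \<open>\<epsilon>\<close> times the lattice Laplacian, whose norm on
  \<open>\<ell>\<^sup>2\<close> is at most \<open>4\<close>. This turns the bounds in the sup norm into bounds in \<open>\<ell>\<^sup>2\<close>.\<close>

lemma norm_f6: "norm f6 \<le> 31/10" "norm g6 \<le> 28 * \<epsilon>"
proof -
  have g: "norm g6 \<le> (11/5 * \<epsilon>) * norm (Lap f6)"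
  proof (rule norm_le_pointwise)
    fix p
    show "norm (fn g6 p) \<le> (11/5 * \<epsilon>) * norm (fn (Lap f6) p)"
    proof (cases "p \<in> nodes")
      case True then show ?thesis using eps by (simp add: fn_g6)
    next
      case False
      have "(cmod (\<Psi> p))\<^sup>2 \<le> (1/1000)\<^sup>2" by (intro power_mono off_small[OF False]) simp
      then have a: "10/11 \<le> 1 - (cmod (\<Psi> p))\<^sup>2" by (simp add: power2_eq_square)
      have "10/11 * cmod (\<Psi> p) \<le> (1 - (cmod (\<Psi> p))\<^sup>2) * cmod (\<Psi> p)" by (rule mult_right_mono[OF a]) simp
      also have "\<dots> = cmod (of_real (1 - (cmod (\<Psi> p))\<^sup>2) * \<Psi> p)" using a by (simp only: norm_mult norm_of_real)
      also have "\<dots> = \<epsilon> * cmod (lap \<Psi> p)" using eps by (simp add: eqn norm_mult del: of_real_diff)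
      also have "lap \<Psi> p = - (fn (Lap f6) p $ 2)" by (simp add: fn_Lap lap_nth fn_f6) (simp add: lap_def split: prod.splits)
      also have "\<epsilon> * cmod (- (fn (Lap f6) p $ 2)) \<le> \<epsilon> * norm (fn (Lap f6) p)"
        using eps component_bound[of "fn (Lap f6) p" 2] by (simp add: mult_left_mono)
      finally have "cmod (\<Psi> p) \<le> 11/10 * \<epsilon> * norm (fn (Lap f6) p)" by simp
      moreover have "norm (fn f6 p) \<le> 2 * cmod (\<Psi> p)" using norm4_le[of "fn f6 p"] by (simp add: fn_f6)
      ultimately show ?thesis using False by (simp add: fn_g6)
    qed
  qed (use eps in simp)
  also have "\<dots> \<le> (11/5 * \<epsilon>) * (4 * norm f6)" using eps norm_Lap[of f6] by (intro mult_left_mono) auto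
  finally have g: "norm g6 \<le> 44/5 * \<epsilon> * norm f6" by simp
  have x2: "x\<^sup>2 \<le> 1.01" using x2_near eps2_small eps_small by simp
  have q: "(norm (Qop f6))\<^sup>2 = 8 * x\<^sup>2"
  proof -
    have "(norm (Qop f6))\<^sup>2 = (\<Sum>p\<in>nodes. (norm (fn f6 p))\<^sup>2)"
      unfolding power2_norm_eq_inner by (subst inner_finite_support[of nodes]) (auto intro!: sum.cong)
    also have "\<dots> = (\<Sum>p\<in>nodes. 2 * x\<^sup>2)"
      by (intro sum.cong refl) (simp add: norm4_sq fn_f6 node_value norm_mult cross_norm)
    finally show ?thesis by (simp add: nodes_eq)
  qed
  then have "(norm (Qop f6))\<^sup>2 \<le> 3\<^sup>2" using x2 by simp
  then have n3: "norm (Qop f6) \<le> 3" by (rule power2_le_imp_le) simp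
  have "f6 = Qop f6 + g6" by (simp add: g6_def)
  then have "norm f6 \<le> 3 + norm g6" using norm_triangle_ineq[of "Qop f6" g6] n3 by simp
  moreover have "44/5 * \<epsilon> * norm f6 \<le> 1/1000 * norm f6" using eps_small by (intro mult_right_mono) auto
  ultimately show f: "norm f6 \<le> 31/10" using g by simp
  have "44/5 * \<epsilon> * norm f6 \<le> 44/5 * \<epsilon> * (31/10)" using eps f by (intro mult_left_mono) auto
  then show "norm g6 \<le> 28 * \<epsilon>" using g eps by linarith
qed

lemma norm_Hop_f6: "norm (Hop f6) \<le> 1904 * \<epsilon>^3"
proof -
  have "norm (Hop f6) \<le> (68 * \<epsilon>\<^sup>2) * norm g6"
  proof (rule norm_le_pointwise)
    fix p
    show "norm (fn (Hop f6) p) \<le> (68 * \<epsilon>\<^sup>2) * norm (fn g6 p)"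
    proof (cases "p \<in> nodes")
      case True
      then have "fst p = 0 \<or> snd p = 0" by (auto simp: nodes_eq)
      then show ?thesis by (simp add: fn_Hop_f6_axis)
    next
      case False
      have "(cmod (\<Psi> p))\<^sup>2 \<le> (4.1 * \<epsilon>)\<^sup>2" by (intro power_mono off_bound[OF False]) simp
      then have "4 * (cmod (\<Psi> p))\<^sup>2 \<le> 68 * \<epsilon>\<^sup>2" by (simp add: power_mult_distrib power2_eq_square) (use zero_le_square[of \<epsilon>] in linarith)
      then have "4 * (cmod (\<Psi> p))\<^sup>2 * cmod (\<Psi> p) \<le> 68 * \<epsilon>\<^sup>2 * norm (fn g6 p)"
        using component_bound[of "fn g6 p" 2] False by (intro mult_mono[of "4 * _"]) (auto simp: fn_g6 fn_f6)
      moreover have "4 * (cmod (\<Psi> p))^3 = 4 * (cmod (\<Psi> p))\<^sup>2 * cmod (\<Psi> p)" by (simp add: power2_eq_square power3_eq_cube)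
      ultimately show ?thesis using order_trans[OF norm_fn_Hop_f6[of p]] by (simp only:)
    qed
  qed simp
  also have "\<dots> \<le> (68 * \<epsilon>\<^sup>2) * (28 * \<epsilon>)" by (intro mult_left_mono norm_f6) simp
  finally show ?thesis by (simp add: power2_eq_square power3_eq_cube)
qed

definition diags :: "lattice set" where "diags = {(-1, -1), (1, -1), (1, 1), (-1, 1)}"

text \<open>At the four diagonal neighbours \<open>\<Psi> = \<epsilon>(1 + \<i>) \<i>\<^sup>m + O(\<epsilon>\<^sup>2)\<close>, so \<open>\<Psi>\<^sup>4\<close> is close to
  \<open>-4\<epsilon>\<^sup>4\<close> instead of \<open>4\<epsilon>\<^sup>4\<close>.\<close>

lemma diag_term:
  assumes "p \<in> diags" shows "\<bar>inner (fn f6 p) (fn (Hop f6) p) + 16 * \<epsilon>^4\<bar> \<le> 704 * \<epsilon>^5"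
proof -
  define z where "z = \<Psi> p"
  have G: "inner (fn f6 p) (fn (Hop f6) p) = 2 * (Re (z^4) - (cmod z)^4)"
  proof -
    have "hi (fn f6 p) (fn (Hop f6) p) = z^4 + (cnj z)^4 - 2 * ((of_real ((cmod z)\<^sup>2))\<^sup>2)"
      unfolding fn_f6 fn_Hop_f6 hi_4 vector_4_nth z_def[symmetric] complex_norm_square
      by (simp add: eval_nat_numeral algebra_simps)
    moreover have "(of_real ((cmod z)\<^sup>2))\<^sup>2 = (of_real ((cmod z)^4) :: complex)" by (simp flip: power_mult)
    ultimately have "Re (hi (fn f6 p) (fn (Hop f6) p)) = Re (z^4) + Re ((cnj z)^4) - 2 * (cmod z)^4" by simp
    moreover have "Re ((cnj z)^4) = Re (z^4)" by (simp flip: complex_cnj_power)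
    ultimately show ?thesis unfolding Re_hi[symmetric] by simp
  qed
  obtain m where m: "z = \<i>^m * \<Psi> (-1,-1)"
  proof -
    have r: "\<Psi> (1,-1) = \<i> * \<Psi> (-1,-1)" "\<Psi> (1,1) = \<i> * \<Psi> (1,-1)" "\<Psi> (-1,1) = \<i> * \<Psi> (1,1)"
      using rot[of "-1" "-1"] rot[of "-1" 1] rot[of 1 1] by simp_all
    have "z = \<i>^0 * \<Psi> (-1,-1) \<or> z = \<i>^1 * \<Psi> (-1,-1) \<or> z = \<i>^2 * \<Psi> (-1,-1) \<or> z = \<i>^3 * \<Psi> (-1,-1)"
      using assms by (auto simp: diags_def z_def r power3_eq_cube)
    then show ?thesis using that by blast
  qed
  define w where "w = \<Psi> (-1,-1) / of_real \<epsilon>"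
  have w: "\<Psi> (-1,-1) = of_real \<epsilon> * w" using eps by (simp add: w_def)
  have "(\<i>^m)^4 = (1::complex)" by (simp flip: power_mult add: mult.commute[of m])
  then have z4: "z^4 = of_real (\<epsilon>^4) * w^4" by (simp add: m w power_mult_distrib)
  have cz: "cmod z = \<epsilon> * cmod w" using eps by (simp add: m w norm_mult norm_power)
  have c4: "(cmod z)^4 = \<epsilon>^4 * (cmod w)^4" by (simp add: cz power_mult_distrib)
  define a where "a = 1 + \<i>"
  have wa: "cmod (w - a) \<le> 13 * \<epsilon>"
  proof -
    have "\<Psi> (-1,-1) - of_real \<epsilon> * (1 + \<i>) = of_real \<epsilon> * (w - a)" by (simp add: w a_def algebra_simps)
    then have "\<epsilon> * cmod (w - a) \<le> \<epsilon> * (13 * \<epsilon>)" using diagonal_value eps by (simp add: norm_mult power2_eq_square)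
    then show ?thesis using eps by (simp only: mult_le_cancel_left_pos)
  qed
  have a2: "(cmod a)\<^sup>2 = 2" by (simp add: a_def cmod_power2)
  have na': "cmod a \<le> 142/100" by (rule power2_le_imp_le) (simp_all add: a2, simp add: power2_eq_square)
  then have na: "cmod a \<le> 3/2" by simp
  have nw: "cmod w \<le> 3/2"
  proof -
    show ?thesis using norm_triangle_sub[of w a] na' wa eps_small by simp
  qed
  have d4: "cmod (w^4 - a^4) \<le> 176 * \<epsilon>"
  proof -
    have "w^4 - a^4 = (w - a) * (w^3 + w\<^sup>2 * a + w * a\<^sup>2 + a^3)" by (simp add: eval_nat_numeral algebra_simps)
    then have "cmod (w^4 - a^4) = cmod (w - a) * cmod (w^3 + w\<^sup>2 * a + w * a\<^sup>2 + a^3)" by (simp only: norm_mult)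
    also have "\<dots> \<le> (13 * \<epsilon>) * ((3/2)^3 + (3/2)\<^sup>2 * (3/2) + (3/2) * (3/2)\<^sup>2 + (3/2)^3)"
    proof (intro mult_mono[OF wa] order_trans[OF norm_add4] add_mono)
    qed (use eps in \<open>simp_all only: norm_power norm_mult norm_ge_zero\<close>, (intro mult_mono power_mono nw na; simp)+)
    also have "\<dots> \<le> 176 * \<epsilon>" using eps by (simp add: power2_eq_square power3_eq_cube)
    finally show ?thesis .
  qed
  have a4: "a^4 = -4" by (simp add: a_def eval_nat_numeral algebra_simps)
  have r: "\<bar>Re (w^4) + 4\<bar> \<le> 176 * \<epsilon>" using d4 abs_Re_le_cmod[of "w^4 - a^4"] by (simp add: a4)
  have c: "\<bar>(cmod w)^4 - 4\<bar> \<le> 176 * \<epsilon>"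
  proof -
    have "\<bar>cmod (w^4) - cmod (a^4)\<bar> \<le> cmod (w^4 - a^4)" by (rule norm_triangle_ineq3)
    then show ?thesis using d4 by (simp add: a4 norm_power)
  qed
  have "inner (fn f6 p) (fn (Hop f6) p) + 16 * \<epsilon>^4 = \<epsilon>^4 * (2 * (Re (w^4) + 4) - 2 * ((cmod w)^4 - 4))"
  proof -
    have "Re (z^4) = \<epsilon>^4 * Re (w^4)" unfolding z4 by (simp del: of_real_power)
    then show ?thesis unfolding G c4 by (simp add: algebra_simps)
  qed
  also have "\<bar>\<dots>\<bar> \<le> \<epsilon>^4 * (704 * \<epsilon>)"
  proof -
    have "\<bar>2 * (Re (w^4) + 4) - 2 * ((cmod w)^4 - 4)\<bar> \<le> 704 * \<epsilon>" using r c by (simp add: abs_le_iff)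
    then show ?thesis using eps by (simp add: abs_mult)
  qed
  finally show ?thesis by (simp add: eval_nat_numeral mult_ac)
qed

text \<open>The four diagonal sites dominate: at the sites that are neither on the axes nor adjacent to a node \<open>\<Psi>\<close> is
  \<open>O(\<epsilon>\<^sup>2)\<close>.\<close>

lemma inner_Hop_f6: "\<bar>inner f6 (Hop f6) + 64 * \<epsilon>^4\<bar> \<le> 103200 * \<epsilon>^5"
proof -
  define hD where "hD = sitewise (\<lambda>p v. if p \<in> diags then v else 0) (Hop f6)"
  have fhD: "fn hD p = (if p \<in> diags then fn (Hop f6) p else 0)" for p
    unfolding hD_def by (rule fn_sitewise[of _ 1]) simp
  have "norm (Hop f6 - hD) \<le> (1156 * \<epsilon>^4) * norm g6"
  proof (rule norm_le_pointwise)
    fix p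
    show "norm (fn (Hop f6 - hD) p) \<le> (1156 * \<epsilon>^4) * norm (fn g6 p)"
    proof (cases "p \<in> diags \<or> fst p = 0 \<or> snd p = 0")
      case True
      then show ?thesis by (auto simp: fhD fn_Hop_f6_axis)
    next
      case False
      obtain n m where p: "p = (n, m)" by (cases p)
      have pn: "p \<notin> nodes" using False by (auto simp: nodes_eq)
      have "cmod (\<Psi> p) \<le> 17 * \<epsilon>\<^sup>2"
        by (rule far_bound[OF pn]) (use False in \<open>auto simp: p nodes_eq diags_def\<close>)
      then have "(cmod (\<Psi> p))\<^sup>2 \<le> (17 * \<epsilon>\<^sup>2)\<^sup>2" by (intro power_mono) auto
      then have "4 * (cmod (\<Psi> p))\<^sup>2 \<le> 1156 * \<epsilon>^4" by (simp add: power_mult_distrib flip: power_mult)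
      then have "4 * (cmod (\<Psi> p))\<^sup>2 * cmod (\<Psi> p) \<le> 1156 * \<epsilon>^4 * norm (fn g6 p)"
        using component_bound[of "fn g6 p" 2] pn eps by (intro mult_mono[of "4 * _"]) (auto simp: fn_g6 fn_f6)
      moreover have "4 * (cmod (\<Psi> p))^3 = 4 * (cmod (\<Psi> p))\<^sup>2 * cmod (\<Psi> p)" by (simp add: power2_eq_square power3_eq_cube)
      ultimately have "norm (fn (Hop f6) p) \<le> 1156 * \<epsilon>^4 * norm (fn g6 p)" using order_trans[OF norm_fn_Hop_f6[of p]] by (simp only:)
      then show ?thesis using False by (simp add: fhD)
    qed
  qed simp
  also have "\<dots> \<le> (1156 * \<epsilon>^4) * (28 * \<epsilon>)" using eps by (intro mult_left_mono norm_f6) simp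
  also have "\<dots> = 32368 * \<epsilon>^5" by (simp add: eval_nat_numeral)
  finally have r: "norm (Hop f6 - hD) \<le> 32368 * \<epsilon>^5" .
  have "\<bar>inner f6 (Hop f6 - hD)\<bar> \<le> (31/10) * (32368 * \<epsilon>^5)"
    by (rule order_trans[OF Cauchy_Schwarz_ineq2 mult_mono]) (use r norm_f6 in auto)
  moreover have "inner f6 (Hop f6) = inner f6 hD + inner f6 (Hop f6 - hD)" by (simp add: inner_diff_right)
  moreover have "\<bar>inner f6 hD + 64 * \<epsilon>^4\<bar> \<le> 2816 * \<epsilon>^5"
  proof -
    have "inner f6 hD = inner hD f6" by (rule inner_commute)
    also have "\<dots> = (\<Sum>p\<in>diags. inner (fn f6 p) (fn (Hop f6) p))"
      by (subst inner_finite_support[of diags]) (auto simp: fhD diags_def inner_commute)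
    finally have "inner f6 hD + 64 * \<epsilon>^4 = (\<Sum>p\<in>diags. inner (fn f6 p) (fn (Hop f6) p) + 16 * \<epsilon>^4)"
      by (simp add: diags_def)
    also have "\<bar>\<dots>\<bar> \<le> (\<Sum>p\<in>diags. 704 * \<epsilon>^5)"
      by (rule order_trans[OF sum_abs sum_mono]) (rule diag_term)
    finally show ?thesis by (simp add: diags_def)
  qed
  moreover have "0 \<le> \<epsilon>^5" using eps by simp
  ultimately show ?thesis by linarith
qed

lemma f6_U: "Uop f6 = CH.sc (om ^ 6) f6"
  unfolding zmode_U zmode_sc om_vals by simp

text \<open>The Rayleigh formula for \<open>f6\<close>, whose projection onto the mode has the square \<open>8x\<^sup>2\<close>: the energy
  \<open>-64\<epsilon>\<^sup>4\<close> gives \<open>-8\<epsilon>\<^sup>4\<close>. The form \<open>\<langle>f6, \<sigma> f6\<rangle>\<close> vanishes exactly, so the divided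
  difference is as small as the residual.\<close>

lemma kr_6:
  shows "\<bar>KG.kr 6 0 + 8 * \<epsilon>^4\<bar> \<le> 14000 * \<epsilon>^5" and "cmod (KG.d1 6 0 0) \<le> 4000 * \<epsilon>^3"
proof -
  define h where "h = Hop f6"
  define r where "r = KG.R 0 h"
  have nh: "norm h \<le> 1904 * \<epsilon>^3" by (simp add: h_def norm_Hop_f6)
  have nr: "norm r \<le> 3808 * \<epsilon>^3" using KG.R_norm[of 0 h] nh by (simp add: r_def)
  have x2: "\<bar>1 - x\<^sup>2\<bar> \<le> 4 * \<epsilon>\<^sup>2" "79/80 \<le> x\<^sup>2" using x2_near eps2_small eps_small by auto
  have c: "(cmod (CH.ci (bmode 6) f6))\<^sup>2 = 8 * x\<^sup>2"
    unfolding ci_modes(2) norm_mult norm_of_real by (simp add: power_mult_distrib)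
  have six: "(6::nat) \<in> {..<12}" by simp
  have k: "of_real (8 * x\<^sup>2) * KG.k 6 0 = CH.ci f6 h - CH.ci h r"
    and d: "of_real (8 * x\<^sup>2) * KG.d1 6 0 0 = - CH.ci (f6 - r) (sig (f6 - r))"
    using KG.rayleigh[OF six f6_U] by (simp_all only: c h_def r_def)
  have k': "8 * x\<^sup>2 * KG.kr 6 0 = inner f6 h - inner h r"
    using arg_cong[OF k, of Re] by (simp add: KG.kr_def CH.Re_ci del: of_real_mult of_real_power)
  have e6: "\<epsilon>^6 \<le> \<epsilon>^5 * (1/10^9)"
  proof -
    have "\<epsilon>^5 * \<epsilon> \<le> \<epsilon>^5 * (1/10^9)" using eps eps_small by (intro mult_left_mono) auto
    then show ?thesis by (simp add: eval_nat_numeral mult_ac)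
  qed
  have "\<bar>inner h r\<bar> \<le> \<epsilon>^5"
  proof -
    have "\<bar>inner h r\<bar> \<le> (1904 * \<epsilon>^3) * (3808 * \<epsilon>^3)"
      using eps by (intro order_trans[OF Cauchy_Schwarz_ineq2 mult_mono] nh nr) auto
    also have "\<dots> = 7250432 * \<epsilon>^6" by (simp add: eval_nat_numeral)
    also have "\<dots> \<le> 7250432 * (\<epsilon>^5 * (1/10^9))" by (intro mult_left_mono e6) auto
    also have "\<dots> \<le> \<epsilon>^5" using eps by simp
    finally show ?thesis .
  qed
  moreover have "\<bar>64 * \<epsilon>^4 * (x\<^sup>2 - 1)\<bar> \<le> \<epsilon>^5"
  proof -
    have "\<bar>64 * \<epsilon>^4 * (x\<^sup>2 - 1)\<bar> = 64 * \<epsilon>^4 * \<bar>1 - x\<^sup>2\<bar>" using eps by (simp add: abs_mult abs_minus_commute)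
    also have "\<dots> \<le> 64 * \<epsilon>^4 * (4 * \<epsilon>\<^sup>2)" using eps x2 by (intro mult_left_mono) auto
    also have "\<dots> = 256 * \<epsilon>^6" by (simp add: eval_nat_numeral)
    also have "\<dots> \<le> 256 * (\<epsilon>^5 * (1/10^9))" by (intro mult_left_mono e6) auto
    also have "\<dots> \<le> \<epsilon>^5" using eps by simp
    finally show ?thesis .
  qed
  moreover have "\<bar>inner f6 h + 64 * \<epsilon>^4\<bar> \<le> 103200 * \<epsilon>^5" unfolding h_def by (rule inner_Hop_f6)
  moreover have "8 * x\<^sup>2 * (KG.kr 6 0 + 8 * \<epsilon>^4) = (inner f6 h + 64 * \<epsilon>^4) - inner h r + 64 * \<epsilon>^4 * (x\<^sup>2 - 1)"
    using k' by (simp add: algebra_simps)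
  moreover have "\<bar>l\<bar> \<le> 103202 * v" if "\<bar>a\<bar> \<le> v" "\<bar>b\<bar> \<le> v" "\<bar>c\<bar> \<le> 103200 * v" "l = c - a + b" for a b c l v :: real
    using that by linarith
  ultimately have "\<bar>8 * x\<^sup>2 * (KG.kr 6 0 + 8 * \<epsilon>^4)\<bar> \<le> 103202 * \<epsilon>^5" by blast
  then have "8 * x\<^sup>2 * \<bar>KG.kr 6 0 + 8 * \<epsilon>^4\<bar> \<le> 103202 * \<epsilon>^5" by (simp add: abs_mult)
  moreover have "8 * (79/80) * \<bar>KG.kr 6 0 + 8 * \<epsilon>^4\<bar> \<le> 8 * x\<^sup>2 * \<bar>KG.kr 6 0 + 8 * \<epsilon>^4\<bar>"
    using x2 by (intro mult_right_mono) auto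
  moreover have "u \<le> 14000 * \<epsilon>^5" if "8 * (79/80) * u \<le> w" "w \<le> 103202 * \<epsilon>^5" for u w
    using that zero_less_power[OF eps(1), of 5] by linarith
  ultimately show "\<bar>KG.kr 6 0 + 8 * \<epsilon>^4\<bar> \<le> 14000 * \<epsilon>^5" by blast
  have "CH.ci f6 (sig f6) = 0"
  proof -
    have "inner (fn f6 p) (fn (sig f6) p) = 0" "inner (fn (Jop f6) p) (fn (sig f6) p) = 0" for p
      by (simp_all add: fn_zmode inner_vec_def sum_4 inner_complex_def)
    then show ?thesis by (simp add: CH.ci_def inner_ell2_def complex_eq_iff del: fn_Jop fn_sig)
  qed
  then have "of_real (8 * x\<^sup>2) * KG.d1 6 0 0 = CH.ci f6 (sig r) + CH.ci r (sig (f6 - r))"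
    unfolding d by (simp add: CH.clin_diff[OF clin_sig] CH.ci_diff_left CH.ci_diff_right)
  also have "cmod \<dots> \<le> norm f6 * norm (sig r) + norm r * norm (sig (f6 - r))"
    using norm_triangle_ineq[of "CH.ci f6 (sig r)" "CH.ci r (sig (f6 - r))"] CH.cmod_ci_le[of f6 "sig r"] CH.cmod_ci_le[of r "sig (f6 - r)"] by linarith
  also have "\<dots> \<le> (31/10) * (3808 * \<epsilon>^3) + (3808 * \<epsilon>^3) * (32/10)"
    unfolding KG.norm_\<sigma>
  proof (intro add_mono mult_mono norm_f6 nr)
    have "\<epsilon>^3 \<le> (1/1000)^3" using eps by (intro power_mono) auto
    then have "3808 * \<epsilon>^3 \<le> 1/10" by (simp add: power3_eq_cube)
    then show "norm (f6 - r) \<le> 32/10" using norm_triangle_ineq4[of f6 r] norm_f6(1) nr by simp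
  qed (use eps in auto)
  also have "\<dots> \<le> 24000 * \<epsilon>^3" using eps by simp
  finally have "cmod (of_real (8 * x\<^sup>2) * KG.d1 6 0 0) \<le> 24000 * \<epsilon>^3" .
  moreover have "cmod (of_real (8 * x\<^sup>2) * KG.d1 6 0 0) = 8 * x\<^sup>2 * cmod (KG.d1 6 0 0)"
    by (simp only: norm_mult norm_of_real) simp
  ultimately have "8 * x\<^sup>2 * cmod (KG.d1 6 0 0) \<le> 24000 * \<epsilon>^3" by (simp only:)
  moreover have "8 * (79/80) * cmod (KG.d1 6 0 0) \<le> 8 * x\<^sup>2 * cmod (KG.d1 6 0 0)"
    using x2 by (intro mult_right_mono) auto
  moreover have "0 < \<epsilon>^3" using eps by simp
  ultimately show "cmod (KG.d1 6 0 0) \<le> 4000 * \<epsilon>^3" by linarith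
qed

end

section \<open>The list of small roots\<close>

text \<open>The sectors of the ten small roots, listed so that consecutive roots \<open>2m - 1\<close> and \<open>2m\<close> are opposite and the odd
  ones are negative. The entry with index \<open>0\<close> is a dummy.\<close>

definition sec :: "nat \<Rightarrow> nat" where "sec j = [0, 3, 9, 9, 3, 8, 7, 1, 2, 6, 6] ! j"

lemma ball_upto_10: "(\<forall>j\<in>{1..10::nat}. P j) \<longleftrightarrow> P 1 \<and> P 2 \<and> P 3 \<and> P 4 \<and> P 5 \<and> P 6 \<and> P 7 \<and> P 8 \<and> P 9 \<and> P 10"
proof -
  have "{1..10::nat} = set [1, 2, 3, 4, 5, 6, 7, 8, 9, 10]" by (simp add: eval_nat_numeral atLeastAtMostSuc_conv) blast
  then show ?thesis by (simp only: list.simps ball_simps simp_thms)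
qed

context small_cross begin

lemma powers: "\<epsilon>^3 \<le> \<epsilon>\<^sup>2 / 1000000" "\<epsilon>\<^sup>2 \<le> 1/1000000" "0 < \<epsilon>\<^sup>2" "0 < \<epsilon>^3"
proof -
  have "\<epsilon>\<^sup>2 * \<epsilon> \<le> \<epsilon>\<^sup>2 * (1/1000000)" using eps_small by (intro mult_left_mono) auto
  then show "\<epsilon>^3 \<le> \<epsilon>\<^sup>2 / 1000000" by (simp add: power2_eq_square power3_eq_cube mult_ac)
  show "\<epsilon>\<^sup>2 \<le> 1/1000000" using eps2_small eps_small by simp
qed (use eps in auto)

lemma definite_sector:
  assumes i: "i < 12" "sig (bmode i) = s *\<^sub>R bmode i" "\<bar>s\<bar> = 1" and k0: "\<bar>KG.kr i 0 - c * \<epsilon>\<^sup>2\<bar> \<le> 1730 * \<epsilon>^3" and c: "\<bar>c\<bar> \<le> 6"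
  obtains y where "KG.k i (of_real y) = 0" "KG.d1 i (of_real y) (of_real y) \<noteq> 0"
    "\<And>z. cmod z \<le> 1/100 \<Longrightarrow> KG.k i z = 0 \<Longrightarrow> z = of_real y" "\<bar>y - s * c * \<epsilon>\<^sup>2\<bar> \<le> 3000 * \<epsilon>^3"
proof -
  have "\<bar>c * \<epsilon>\<^sup>2\<bar> \<le> 6 * \<epsilon>\<^sup>2" using c by (simp add: abs_mult mult_right_mono)
  then have kr: "\<bar>KG.kr i 0\<bar> \<le> 7 * \<epsilon>\<^sup>2" 
    using k0 powers abs_triangle_ineq2[of "KG.kr i 0" "c * \<epsilon>\<^sup>2"] by simp
  then have "\<bar>KG.kr i 0\<bar> \<le> 1/1000" using powers by linarith
  then obtain y where y: "\<bar>y\<bar> \<le> 2 * \<bar>KG.kr i 0\<bar>" "KG.k i (of_real y) = 0" "KG.d1 i (of_real y) (of_real y) \<noteq> 0"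
    "\<And>z. cmod z \<le> 1/100 \<Longrightarrow> KG.k i z = 0 \<Longrightarrow> z = of_real y"
    "\<bar>y - s * KG.kr i 0\<bar> \<le> 5 * (5 * \<epsilon> + \<bar>y\<bar>) * \<bar>y\<bar>"
    using KG.definite_root[of i s] i by blast
  have y14: "\<bar>y\<bar> \<le> 14 * \<epsilon>\<^sup>2" using y(1) kr by linarith
  have "5 * (5 * \<epsilon> + \<bar>y\<bar>) * \<bar>y\<bar> \<le> (30 * \<epsilon>) * (14 * \<epsilon>\<^sup>2)"
  proof (rule mult_mono)
    show "5 * (5 * \<epsilon> + \<bar>y\<bar>) \<le> 30 * \<epsilon>" using y14 eps2_small eps by simp
  qed (use y14 eps in auto)
  then have "\<bar>y - s * KG.kr i 0\<bar> \<le> 420 * \<epsilon>^3" using y(5) by (simp add: power2_eq_square power3_eq_cube)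
  moreover have "\<bar>s * KG.kr i 0 - s * c * \<epsilon>\<^sup>2\<bar> \<le> 1730 * \<epsilon>^3"
  proof -
    have "s * KG.kr i 0 - s * c * \<epsilon>\<^sup>2 = s * (KG.kr i 0 - c * \<epsilon>\<^sup>2)" by (simp add: algebra_simps)
    then show ?thesis using k0 i by (simp add: abs_mult)
  qed
  moreover have "\<bar>u - w\<bar> \<le> 3000 * e" if "\<bar>u - v\<bar> \<le> 420 * e" "\<bar>v - w\<bar> \<le> 1730 * e" "0 < e" for u v w e :: real
    using that by linarith
  ultimately have "\<bar>y - s * c * \<epsilon>\<^sup>2\<bar> \<le> 3000 * \<epsilon>^3" using powers by blast
  with y that show ?thesis by blast
qed

lemma zero_definite_sector:
  assumes i: "i < 12" "sig (bmode i) = s *\<^sub>R bmode i" "\<bar>s\<bar> = 1" and k0: "KG.k i 0 = 0"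
  shows "cmod z \<le> 1/100 \<Longrightarrow> KG.k i z = 0 \<longleftrightarrow> z = 0" and "KG.d1 i 0 0 \<noteq> 0"
proof -
  have kr: "KG.kr i 0 = 0" by (simp add: KG.kr_def k0)
  then obtain y where y: "\<bar>y\<bar> \<le> 2 * \<bar>KG.kr i 0\<bar>" "KG.d1 i (of_real y) (of_real y) \<noteq> 0"
    "\<And>z. cmod z \<le> 1/100 \<Longrightarrow> KG.k i z = 0 \<Longrightarrow> z = of_real y"
    using KG.definite_root[of i s] i by auto
  have y0: "y = 0" using y(1) kr by simp
  show "KG.d1 i 0 0 \<noteq> 0" using y(2) y0 by simp
  show "KG.k i z = 0 \<longleftrightarrow> z = 0" if "cmod z \<le> 1/100" using y(3)[OF that] y0 k0 by auto
qed

lemma neutral_sector: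
  assumes i: "i = 3 * n" "i < 12" and kap: "0 < \<kappa>" "\<kappa> \<le> 4 * \<epsilon>"
    and k0: "\<bar>KG.kr i 0 + \<kappa>\<^sup>2 / 2\<bar> \<le> 2000 * \<epsilon> * \<kappa>\<^sup>2" and d0: "cmod (KG.d1 i 0 0) \<le> 2000 * \<epsilon> * \<kappa>"
  obtains p q where "0 < p" "q < 0" "p \<le> 1/100" "-1/100 \<le> q" "KG.k i (of_real p) = 0" "KG.k i (of_real q) = 0"
    "\<bar>p - \<kappa>\<bar> \<le> 12832 * \<epsilon> * \<kappa>"
    "KG.d1 i (of_real p) (of_real p) \<noteq> 0" "KG.d1 i (of_real q) (of_real q) \<noteq> 0"
    "\<And>z. cmod z \<le> 1/100 \<Longrightarrow> KG.k i z = 0 \<Longrightarrow> z = of_real p \<or> z = of_real q" "\<bar>q + \<kappa>\<bar> \<le> 12832 * \<epsilon> * \<kappa>"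
proof -
  have I: "i \<in> {..<12}" using i by simp
  have n: "H0op (sig (bmode i)) = (-2) *\<^sub>R sig (bmode i)" "CH.ci (bmode i) (sig (bmode i)) = 0"
    unfolding i by (rule H0_sig_bmode neutral_bmode)+
  have e: "8 * 2000 * \<epsilon> \<le> 1" using eps_small by simp
  show ?thesis
    by (rule KG.neutral_roots[OF I n eps(1) order_refl eps(2) kap _ e k0 d0]) (simp, rule that, simp_all)
qed


text \<open>The reflection of zeros shows that sectors \<open>3, 9\<close>, sectors \<open>1, 2\<close> and sectors \<open>7, 8\<close> have opposite zeros, and that
  those of sector \<open>6\<close> are opposite to each other. The constant exceeds \<open>4 \<cdot> 12832\<close> and \<open>3000\<close>.\<close>

lemma root_list:
  obtains z :: "nat \<Rightarrow> real" where
    "\<bar>z 1 + 2 * \<epsilon>\<bar> \<le> 60000 * \<epsilon>\<^sup>2" "\<bar>z 3 + 2 * \<epsilon>\<bar> \<le> 60000 * \<epsilon>\<^sup>2"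
    "\<bar>z 5 + 2 * \<epsilon>\<^sup>2\<bar> \<le> 60000 * \<epsilon>^3" "\<bar>z 7 + 6 * \<epsilon>\<^sup>2\<bar> \<le> 60000 * \<epsilon>^3" "\<bar>z 9 + 4 * \<epsilon>\<^sup>2\<bar> \<le> 60000 * \<epsilon>^3"
    "\<And>k. k \<in> {1, 3, 5, 7, 9} \<Longrightarrow> z (k + 1) = - z k"
    "\<And>j. j \<in> {1..10} \<Longrightarrow> z j \<noteq> 0 \<and> \<bar>z j\<bar> \<le> 1/100 \<and> sec j < 12 \<and> KG.d1 (sec j) (of_real (z j)) (of_real (z j)) \<noteq> 0"
    "\<And>i w. i < 12 \<Longrightarrow> cmod w \<le> 1/100 \<Longrightarrow>
       KG.k i w = 0 \<longleftrightarrow> (w = 0 \<and> i \<in> {0,4,5,10,11}) \<or> (\<exists>j\<in>{1..10}. i = sec j \<and> w = of_real (z j))"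
    "\<And>i. i \<in> {4,5,10,11} \<Longrightarrow> KG.d1 i 0 0 \<noteq> 0"
    "\<And>j j'. j \<in> {1..10} \<Longrightarrow> j' \<in> {1..10} \<Longrightarrow> sec j = sec j' \<Longrightarrow> z j = z j' \<Longrightarrow> j = j'"
proof -
  have sg: "sig (bmode 1) = 1 *\<^sub>R bmode 1" "sig (bmode 2) = (-1) *\<^sub>R bmode 2"
    "sig (bmode 7) = 1 *\<^sub>R bmode 7" "sig (bmode 8) = (-1) *\<^sub>R bmode 8"
    "sig (bmode 4) = 1 *\<^sub>R bmode 4" "sig (bmode 5) = (-1) *\<^sub>R bmode 5"
    "sig (bmode 10) = 1 *\<^sub>R bmode 10" "sig (bmode 11) = (-1) *\<^sub>R bmode 11"
    using sig_bmode[of 0] sig_bmode[of 1] sig_bmode[of 2] sig_bmode[of 3] by (simp_all add: eval_nat_numeral)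
  have kr: "\<bar>KG.kr 1 0 - (-6) * \<epsilon>\<^sup>2\<bar> \<le> 1730 * \<epsilon>^3" "\<bar>KG.kr 2 0 - (-6) * \<epsilon>\<^sup>2\<bar> \<le> 1730 * \<epsilon>^3"
    "\<bar>KG.kr 7 0 - 2 * \<epsilon>\<^sup>2\<bar> \<le> 1730 * \<epsilon>^3" "\<bar>KG.kr 8 0 - 2 * \<epsilon>\<^sup>2\<bar> \<le> 1730 * \<epsilon>^3"
    "\<bar>KG.kr 3 0 - (-2) * \<epsilon>\<^sup>2\<bar> \<le> 1730 * \<epsilon>^3" "\<bar>KG.kr 9 0 - (-2) * \<epsilon>\<^sup>2\<bar> \<le> 1730 * \<epsilon>^3"
    using kr_trial(1)[of 1] kr_trial(1)[of 2] kr_trial(1)[of 7] kr_trial(1)[of 8] kr_trial(1)[of 3] kr_trial(1)[of 9]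
    by (simp_all add: spread_values spread_values(3)[simplified])
  obtain y1 where y1: "KG.k 1 (of_real y1) = 0" "KG.d1 1 (of_real y1) (of_real y1) \<noteq> 0"
    "\<And>z. cmod z \<le> 1/100 \<Longrightarrow> KG.k 1 z = 0 \<Longrightarrow> z = of_real y1" "\<bar>y1 - 1 * (-6) * \<epsilon>\<^sup>2\<bar> \<le> 3000 * \<epsilon>^3"
    by (rule definite_sector[OF _ sg(1) _ kr(1)]) auto
  obtain y2 where y2: "KG.d1 2 (of_real y2) (of_real y2) \<noteq> 0"
    "\<And>z. cmod z \<le> 1/100 \<Longrightarrow> KG.k 2 z = 0 \<Longrightarrow> z = of_real y2"
    by (rule definite_sector[OF _ sg(2) _ kr(2)]) auto
  obtain y7 where y7: "KG.k 7 (of_real y7) = 0" "KG.d1 7 (of_real y7) (of_real y7) \<noteq> 0"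
    "\<And>z. cmod z \<le> 1/100 \<Longrightarrow> KG.k 7 z = 0 \<Longrightarrow> z = of_real y7" "\<bar>y7 - 1 * 2 * \<epsilon>\<^sup>2\<bar> \<le> 3000 * \<epsilon>^3"
    by (rule definite_sector[OF _ sg(3) _ kr(3)]) auto
  obtain y8 where y8: "KG.d1 8 (of_real y8) (of_real y8) \<noteq> 0"
    "\<And>z. cmod z \<le> 1/100 \<Longrightarrow> KG.k 8 z = 0 \<Longrightarrow> z = of_real y8"
    by (rule definite_sector[OF _ sg(4) _ kr(4)]) auto
  have b1: "\<bar>y1\<bar> \<le> 1/100" "y1 \<noteq> 0" and b7: "\<bar>y7\<bar> \<le> 1/100" "y7 \<noteq> 0"
    using y1(4) y7(4) powers by linarith+
  have r2: "KG.k 2 (of_real (- y1)) = 0" and r8: "KG.k 8 (of_real (- y7)) = 0"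
    using k_reflect(3)[of "of_real y1"] k_reflect(4)[of "of_real y7"] y1(1) y7(1) b1 b7 by simp_all
  have y2': "y2 = - y1" and y8': "y8 = - y7"
    using y2(2)[of "of_real (- y1)"] y8(2)[of "of_real (- y7)"] r2 r8 b1 b7 by (simp_all flip: of_real_minus)
  have d3: "cmod (KG.d1 i 0 0) \<le> 2000 * \<epsilon> * (2 * \<epsilon>)" if "i = 3 * n" "i < 12" for i n
  proof -
    have "cmod (KG.d1 i 0 0) \<le> 3400 * \<epsilon>\<^sup>2 + 16 * \<epsilon>\<^sup>2"
      using norm_triangle_ineq4[of "KG.d1 i 0 0 + CH.ci (trial i) (sig (trial i))" "CH.ci (trial i) (sig (trial i))"]
        kr_trial(2)[OF that(2)] trial_neutral[OF that(1)] by simp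
    then have "cmod (KG.d1 i 0 0) \<le> 4000 * \<epsilon>\<^sup>2" using powers by linarith
    then show ?thesis by (simp add: power2_eq_square)
  qed
  have k3: "\<bar>KG.kr i 0 + (2 * \<epsilon>)\<^sup>2 / 2\<bar> \<le> 2000 * \<epsilon> * (2 * \<epsilon>)\<^sup>2" if "\<bar>KG.kr i 0 - (-2) * \<epsilon>\<^sup>2\<bar> \<le> 1730 * \<epsilon>^3" for i
    using that powers by (simp add: power2_eq_square power3_eq_cube)
  have e2: "0 < 2 * \<epsilon>" "2 * \<epsilon> \<le> 4 * \<epsilon>" "0 < 4 * \<epsilon>\<^sup>2" "4 * \<epsilon>\<^sup>2 \<le> 4 * \<epsilon>" using eps eps2_small by auto
  obtain p3 q3 where s3: "0 < p3" "q3 < 0" "p3 \<le> 1/100" "-1/100 \<le> q3" "KG.k 3 (of_real p3) = 0" "KG.k 3 (of_real q3) = 0"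
    "\<bar>p3 - 2 * \<epsilon>\<bar> \<le> 12832 * \<epsilon> * (2 * \<epsilon>)"
    "KG.d1 3 (of_real p3) (of_real p3) \<noteq> 0" "KG.d1 3 (of_real q3) (of_real q3) \<noteq> 0"
    "\<And>z. cmod z \<le> 1/100 \<Longrightarrow> KG.k 3 z = 0 \<Longrightarrow> z = of_real p3 \<or> z = of_real q3" "\<bar>q3 + 2 * \<epsilon>\<bar> \<le> 12832 * \<epsilon> * (2 * \<epsilon>)"
    by (rule neutral_sector[of 3 1, OF _ _ e2(1,2) k3[OF kr(5)] d3[of 3 1]]) simp_all
  obtain p9 q9 where s9: "0 < p9" "q9 < 0"
    "KG.d1 9 (of_real p9) (of_real p9) \<noteq> 0" "KG.d1 9 (of_real q9) (of_real q9) \<noteq> 0"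
    "\<And>z. cmod z \<le> 1/100 \<Longrightarrow> KG.k 9 z = 0 \<Longrightarrow> z = of_real p9 \<or> z = of_real q9"
    by (rule neutral_sector[of 9 3, OF _ _ e2(1,2) k3[OF kr(6)] d3[of 9 3]]) simp_all
  have k6: "\<bar>KG.kr 6 0 + (4 * \<epsilon>\<^sup>2)\<^sup>2 / 2\<bar> \<le> 2000 * \<epsilon> * (4 * \<epsilon>\<^sup>2)\<^sup>2"
  proof -
    have "2000 * \<epsilon> * (4 * \<epsilon>\<^sup>2)\<^sup>2 = 32000 * \<epsilon>^5" "(4 * \<epsilon>\<^sup>2)\<^sup>2 / 2 = 8 * \<epsilon>^4" by (simp_all add: eval_nat_numeral)
    moreover have "0 < \<epsilon>^5" using eps by simp
    ultimately show ?thesis using kr_6(1) by simp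
  qed
  have d6: "cmod (KG.d1 6 0 0) \<le> 2000 * \<epsilon> * (4 * \<epsilon>\<^sup>2)"
    using kr_6(2) powers by (simp add: power2_eq_square power3_eq_cube)
  obtain p6 q6 where s6: "0 < p6" "q6 < 0" "p6 \<le> 1/100" "-1/100 \<le> q6" "KG.k 6 (of_real p6) = 0" "KG.k 6 (of_real q6) = 0"
    "\<bar>p6 - 4 * \<epsilon>\<^sup>2\<bar> \<le> 12832 * \<epsilon> * (4 * \<epsilon>\<^sup>2)"
    "KG.d1 6 (of_real p6) (of_real p6) \<noteq> 0" "KG.d1 6 (of_real q6) (of_real q6) \<noteq> 0"
    "\<And>z. cmod z \<le> 1/100 \<Longrightarrow> KG.k 6 z = 0 \<Longrightarrow> z = of_real p6 \<or> z = of_real q6"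
    by (rule neutral_sector[of 6 2, OF _ _ e2(3,4) k6 d6]) simp_all
  have r9: "KG.k 9 (of_real (- p3)) = 0" "KG.k 9 (of_real (- q3)) = 0" and r6: "KG.k 6 (of_real (- p6)) = 0"
    using k_reflect(1)[of "of_real p3"] k_reflect(1)[of "of_real q3"] k_reflect(2)[of "of_real p6"] s3 s6 by simp_all
  have "of_real (- p3) = (of_real p9 :: complex) \<or> of_real (- p3) = (of_real q9 :: complex)"
    "of_real (- q3) = (of_real p9 :: complex) \<or> of_real (- q3) = (of_real q9 :: complex)"
    "of_real (- p6) = (of_real p6 :: complex) \<or> of_real (- p6) = (of_real q6 :: complex)"
    by (rule s9 s6; use s3 s6 r9 r6 in simp)+
  then have pq9: "p9 = - q3" "q9 = - p3" "q6 = - p6"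
    using s3(1,2) s9(1,2) s6(1,2) unfolding of_real_eq_iff by auto
  define z where "z j = [0, q3, - q3, - p3, p3, - y7, y7, y1, - y1, - p6, p6] ! j" for j
  show thesis
  proof (rule that[of z])
    show "\<bar>z 1 + 2 * \<epsilon>\<bar> \<le> 60000 * \<epsilon>\<^sup>2" "\<bar>z 3 + 2 * \<epsilon>\<bar> \<le> 60000 * \<epsilon>\<^sup>2"
      using s3 powers by (simp_all add: z_def power2_eq_square)
    show "\<bar>z 5 + 2 * \<epsilon>\<^sup>2\<bar> \<le> 60000 * \<epsilon>^3" "\<bar>z 7 + 6 * \<epsilon>\<^sup>2\<bar> \<le> 60000 * \<epsilon>^3" "\<bar>z 9 + 4 * \<epsilon>\<^sup>2\<bar> \<le> 60000 * \<epsilon>^3"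
      using y1 y7 s6 powers by (simp_all add: z_def power2_eq_square power3_eq_cube)
    show "z (k + 1) = - z k" if "k \<in> {1, 3, 5, 7, 9}" for k
      using that by (auto simp: z_def)
    have "\<forall>j\<in>{1..10}. z j \<noteq> 0 \<and> \<bar>z j\<bar> \<le> 1/100 \<and> sec j < 12 \<and> KG.d1 (sec j) (of_real (z j)) (of_real (z j)) \<noteq> 0"
      unfolding ball_upto_10
      using s3 s9 s6 y1(2) y2(1) y7(2) y8(1) b1 b7 by (simp add: z_def sec_def pq9 y2' y8')
    then show "j \<in> {1..10} \<Longrightarrow> z j \<noteq> 0 \<and> \<bar>z j\<bar> \<le> 1/100 \<and> sec j < 12 \<and> KG.d1 (sec j) (of_real (z j)) (of_real (z j)) \<noteq> 0" for j
      by blast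
    have "\<forall>j\<in>{1..10}. \<forall>j'\<in>{1..10}. sec j = sec j' \<longrightarrow> z j = z j' \<longrightarrow> j = j'"
      unfolding ball_upto_10 using s3(1,2) s6(1) by (simp add: z_def sec_def)
    then show "j \<in> {1..10} \<Longrightarrow> j' \<in> {1..10} \<Longrightarrow> sec j = sec j' \<Longrightarrow> z j = z j' \<Longrightarrow> j = j'" for j j' by blast
    show "i \<in> {4,5,10,11} \<Longrightarrow> KG.d1 i 0 0 \<noteq> 0" for i
      using zero_definite_sector(2)[OF _ sg(5) _ zero_sectors(2)] zero_definite_sector(2)[OF _ sg(6) _ zero_sectors(3)]
        zero_definite_sector(2)[OF _ sg(7) _ zero_sectors(4)] zero_definite_sector(2)[OF _ sg(8) _ zero_sectors(5)]
      by auto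
    show "KG.k i w = 0 \<longleftrightarrow> (w = 0 \<and> i \<in> {0,4,5,10,11}) \<or> (\<exists>j\<in>{1..10}. i = sec j \<and> w = of_real (z j))"
      if i: "i < 12" and w: "cmod w \<le> 1/100" for i w
    proof -
      have c: "(\<exists>j\<in>{1..10}. Q j) \<longleftrightarrow> Q 1 \<or> Q 2 \<or> Q 3 \<or> Q 4 \<or> Q 5 \<or> Q 6 \<or> Q 7 \<or> Q 8 \<or> Q 9 \<or> Q 10" for Q :: "nat \<Rightarrow> bool"
        using ball_upto_10[of "\<lambda>j. \<not> Q j"] by blast
      have k: "KG.k 0 w = 0 \<longleftrightarrow> w = 0" "KG.k 1 w = 0 \<longleftrightarrow> w = of_real y1" "KG.k 2 w = 0 \<longleftrightarrow> w = of_real (- y1)"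
        "KG.k 3 w = 0 \<longleftrightarrow> w = of_real q3 \<or> w = of_real p3" "KG.k 4 w = 0 \<longleftrightarrow> w = 0" "KG.k 5 w = 0 \<longleftrightarrow> w = 0"
        "KG.k 6 w = 0 \<longleftrightarrow> w = of_real (- p6) \<or> w = of_real p6" "KG.k 7 w = 0 \<longleftrightarrow> w = of_real y7"
        "KG.k 8 w = 0 \<longleftrightarrow> w = of_real (- y7)" "KG.k 9 w = 0 \<longleftrightarrow> w = of_real (- q3) \<or> w = of_real (- p3)"
        "KG.k 10 w = 0 \<longleftrightarrow> w = 0" "KG.k 11 w = 0 \<longleftrightarrow> w = 0"
      proof -
        show "KG.k 0 w = 0 \<longleftrightarrow> w = 0"
          using KG.neutral_double_root[of 0 w] H0_sig_bmode[of 0] neutral_bmode[of 0] zero_sectors w by auto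
        show "KG.k 4 w = 0 \<longleftrightarrow> w = 0" by (rule zero_definite_sector(1)[OF _ sg(5) _ zero_sectors(2) w]) auto
        show "KG.k 5 w = 0 \<longleftrightarrow> w = 0" by (rule zero_definite_sector(1)[OF _ sg(6) _ zero_sectors(3) w]) auto
        show "KG.k 10 w = 0 \<longleftrightarrow> w = 0" by (rule zero_definite_sector(1)[OF _ sg(7) _ zero_sectors(4) w]) auto
        show "KG.k 11 w = 0 \<longleftrightarrow> w = 0" by (rule zero_definite_sector(1)[OF _ sg(8) _ zero_sectors(5) w]) auto
        show "KG.k 1 w = 0 \<longleftrightarrow> w = of_real y1" using y1(1,3) w by blast
        show "KG.k 7 w = 0 \<longleftrightarrow> w = of_real y7" using y7(1,3) w by blast
        show "KG.k 2 w = 0 \<longleftrightarrow> w = of_real (- y1)" using y2(2)[OF w] r2 y2' by blast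
        show "KG.k 8 w = 0 \<longleftrightarrow> w = of_real (- y7)" using y8(2)[OF w] r8 y8' by blast
        show "KG.k 3 w = 0 \<longleftrightarrow> w = of_real q3 \<or> w = of_real p3" using s3(10)[OF w] s3(5,6) by blast
        show "KG.k 6 w = 0 \<longleftrightarrow> w = of_real (- p6) \<or> w = of_real p6" using s6(10)[OF w] s6(5) r6 pq9(3) by blast
        show "KG.k 9 w = 0 \<longleftrightarrow> w = of_real (- q3) \<or> w = of_real (- p3)" using s9(5)[OF w] r9 pq9 by blast
      qed
      have "i \<in> {0,1,2,3,4,5,6,7,8,9,10,11}" using i by (simp only: insert_iff empty_iff) presburger
      then show ?thesis unfolding c by (elim insertE emptyE; simp add: k k(2)[simplified] z_def sec_def)
    qed
  qed
qed

end

section \<open>From the pencil to spectra and multiplicities\<close>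

interpretation LS: vector_space "\<lambda>c (f :: lattice \<Rightarrow> complex^4) p. c *s f p"
  by (rule vector_space_lattice)

lemma sum_function: "(\<Sum>i\<in>A. f i) p = (\<Sum>i\<in>A. f i p)" for f :: "'i \<Rightarrow> 'b \<Rightarrow> 'c::comm_monoid_add"
  by (induction A rule: infinite_finite_induct) auto

text \<open>The complex dimension in the space of all lattice functions, from a finite independent family in \<open>\<ell>\<^sup>2\<close>.\<close>

lemma cdim_span:
  assumes fin: "finite A" and ind: "\<And>c i. (\<Sum>i\<in>A. CH.sc (c i) (v i)) = 0 \<Longrightarrow> i \<in> A \<Longrightarrow> c i = 0"
  shows "cdim (fn ` {f. \<exists>c. f = (\<Sum>i\<in>A. CH.sc (c i) (v i))}) = card A"
proof -
  define w where "w i = fn (v i)" for i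
  have comb: "(\<Sum>i\<in>A. (\<lambda>p. c i *s w i p)) = fn (\<Sum>i\<in>A. CH.sc (c i) (v i))" for c
    by (auto simp: fun_eq_iff sum_function w_def)
  have inj: "inj_on w A"
  proof (rule inj_onI, rule ccontr)
    fix i j assume ij: "i \<in> A" "j \<in> A" "w i = w j" "i \<noteq> j"
    define c :: "'a \<Rightarrow> complex" where "c l = (if l = i then 1 else if l = j then -1 else 0)" for l
    have v: "v i = v j" using ij by (simp add: w_def fn_inject)
    have "(\<Sum>l\<in>A. CH.sc (c l) (v l)) = (\<Sum>l\<in>{i,j}. CH.sc (c l) (v l))"
      by (intro sum.mono_neutral_right fin) (use ij in \<open>auto simp: c_def CH.sc_0\<close>)
    also have "\<dots> = 0" using ij v by (simp add: c_def CH.sc_neg_left)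
    finally have "c i = 0" using ij by (intro ind)
    then show False by (simp add: c_def)
  qed
  have B: "LS.independent (w ` A)"
  proof (rule LS.independent_if_scalars_zero)
    fix g x assume 0: "(\<Sum>x\<in>w ` A. (\<lambda>p. g x *s x p)) = 0" and x: "x \<in> w ` A"
    then obtain i where i: "i \<in> A" "x = w i" by blast
    have "fn (\<Sum>i\<in>A. CH.sc (g (w i)) (v i)) = fn 0"
      using 0 unfolding sum.reindex[OF inj] o_def comb by (simp add: fun_eq_iff)
    then have "(\<Sum>i\<in>A. CH.sc (g (w i)) (v i)) = 0" by (simp only: fn_inject)
    then show "g x = 0" using ind[of "\<lambda>i. g (w i)"] i by simp
  qed (simp add: fin)
  show ?thesis unfolding cdim_def
  proof (rule LS.dim_unique[of "w ` A"])
    show "w ` A \<subseteq> fn ` {f. \<exists>c. f = (\<Sum>i\<in>A. CH.sc (c i) (v i))}"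
    proof (intro image_subsetI)
      fix i assume i: "i \<in> A"
      have "(\<Sum>l\<in>A. CH.sc (if l = i then 1 else 0) (v l)) = (\<Sum>l\<in>A. if l = i then v i else 0)"
        by (intro sum.cong) (auto simp: CH.sc_0 CH.sc_1)
      also have "\<dots> = v i" using fin i by simp
      finally have "v i = (\<Sum>l\<in>A. CH.sc (if l = i then 1 else 0) (v l))" ..
      then show "w i \<in> fn ` {f. \<exists>c. f = (\<Sum>i\<in>A. CH.sc (c i) (v i))}" 
        unfolding w_def by (intro imageI CollectI exI)
    qed
    show "fn ` {f. \<exists>c. f = (\<Sum>i\<in>A. CH.sc (c i) (v i))} \<subseteq> LS.span (w ` A)"
    proof (intro subsetI, elim imageE CollectE exE)
      fix F f c assume F: "F = fn f" "f = (\<Sum>i\<in>A. CH.sc (c i) (v i))"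
      have "(\<Sum>i\<in>A. (\<lambda>p. c i *s w i p)) \<in> LS.span (w ` A)"
        by (rule LS.span_sum, rule LS.span_scale, rule LS.span_base) (rule imageI)
      then show "F \<in> LS.span (w ` A)" unfolding comb F by simp
    qed
    show "card (w ` A) = card A" by (rule card_image[OF inj])
  qed (rule B)
qed

text \<open>An operator on lattice functions that is unitarily equivalent, by a map \<open>W\<close> commuting with \<open>\<sigma>\<close>, to the
  linearization at a scalar cross. All spectral data are transported along \<open>W\<close>.\<close>

locale transported_cross = small_cross +
  fixes Hraw :: "(lattice \<Rightarrow> complex^4) \<Rightarrow> lattice \<Rightarrow> complex^4" and W :: "ell2 \<Rightarrow> ell2"
  assumes clin_W: "CH.clin W" and surj_W: "surj W" and norm_W: "norm (W f) = norm f"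
    and W_sig: "W (sig f) = sig (W f)" and Hraw_W: "Hraw (fn (W f)) = fn (W (Hop f))"
begin

lemma inj_W: "inj W"
proof (rule injI)
  fix f g assume "W f = W g"
  then have "norm (f - g) = 0" using norm_W[of "f - g"] by (simp add: CH.clin_diff[OF clin_W])
  then show "f = g" by simp
qed

lemma l2_W: "F \<in> l2 \<longleftrightarrow> (\<exists>f. F = fn (W f))"
proof
  assume "F \<in> l2"
  then have "F = fn (Ell F)" by (simp add: Ell_inverse)
  moreover obtain f where "Ell F = W f" using surj_W by (metis surjD)
  ultimately show "\<exists>f. F = fn (W f)" by auto
qed auto

lemma fn_W_inject: "fn (W f) = fn (W g) \<longleftrightarrow> f = g" by (simp add: fn_inject inj_eq[OF inj_W])

lemma fn_W_0: "fn (W f) = (\<lambda>p. 0) \<longleftrightarrow> f = 0"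
proof -
  have "(\<lambda>p. 0) = fn (W 0)" by (simp add: CH.clin_0[OF clin_W] fun_eq_iff)
  then show ?thesis by (simp only: fn_W_inject)
qed

lemma pencil_W: "pencil Hraw \<mu> (fn (W f)) = fn (W (KG.P (\<i> * \<mu>) f))"
  by (rule ext) (simp add: pencil_def KG.P_def Hraw_W CH.clin_diff[OF clin_W] CH.clin_sc[OF clin_W] W_sig)

lemma shifted_op_W: "shifted_op Hraw \<mu> (fn (W f)) = fn (W (CH.sc (- \<i>) (KG.T (\<i> * \<mu>) f)))"
  unfolding shifted_op_pencil pencil_W
  by (rule ext) (simp add: KG.T_def CH.clin_sc[OF clin_W] W_sig)

lemma shifted_op_power_W:
  "(shifted_op Hraw \<mu> ^^ n) (fn (W f)) = fn (W (CH.sc ((- \<i>) ^ n) ((KG.T (\<i> * \<mu>) ^^ n) f)))"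
  by (induction n)
    (simp_all add: shifted_op_W KG.T_def KG.P_sc CH.clin_sc[OF KG.clin_\<sigma>] CH.sc_sc CH.sc_1)

lemma image_W:
  assumes "\<And>f. fn (W f) \<in> V \<longleftrightarrow> Q f" "V \<subseteq> l2" shows "V = fn ` W ` {f. Q f}"
proof
  show "V \<subseteq> fn ` W ` {f. Q f}"
  proof
    fix F assume F: "F \<in> V"
    then obtain f where "F = fn (W f)" using assms(2) l2_W by blast
    then show "F \<in> fn ` W ` {f. Q f}" using F assms(1) by auto
  qed
qed (use assms(1) in auto)

lemma gen_eigenspace_W: "gen_eigenspace Hraw \<mu> = fn ` W ` {f. \<exists>n. (KG.T (\<i> * \<mu>) ^^ n) f = 0}"
proof -
  have "CH.sc ((- \<i>) ^ n) f = 0 \<longleftrightarrow> f = 0" for n f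
    using CH.norm_sc[of "(- \<i>) ^ n" f] by (auto simp: norm_power CH.sc_zero)
  then have "fn (W f) \<in> gen_eigenspace Hraw \<mu> \<longleftrightarrow> (\<exists>n. (KG.T (\<i> * \<mu>) ^^ n) f = 0)" for f
    by (simp add: gen_eigenspace_def shifted_op_power_W fn_W_0)
  moreover have "gen_eigenspace Hraw \<mu> \<subseteq> l2" by (auto simp: gen_eigenspace_def)
  ultimately show ?thesis by (rule image_W)
qed

lemma eigenspace_W: "eigenspace Hraw \<mu> = fn ` W ` {f. KG.P (\<i> * \<mu>) f = 0}"
proof -
  have "CH.sc (- \<i>) f = 0 \<longleftrightarrow> f = 0" for f
    using CH.norm_sc[of "- \<i>" f] by (auto simp: CH.sc_zero)
  then have "fn (W f) \<in> eigenspace Hraw \<mu> \<longleftrightarrow> KG.P (\<i> * \<mu>) f = 0" for f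
    by (simp add: eigenspace_shifted_op shifted_op_W fn_W_0 KG.T_eq_0)
  moreover have "eigenspace Hraw \<mu> \<subseteq> l2" by (auto simp: eigenspace_def)
  ultimately show ?thesis by (rule image_W)
qed

lemma not_in_spectrum:
  assumes "bij (KG.P (\<i> * \<mu>))" "\<exists>K. \<forall>f. norm f \<le> K * norm (KG.P (\<i> * \<mu>) f)"
  shows "\<mu> \<notin> spectrum Hraw"
proof -
  have "bij_betw (pencil Hraw \<mu>) l2 l2"
  proof (rule bij_betwI')
    show "(pencil Hraw \<mu> F = pencil Hraw \<mu> G) = (F = G)" if "F \<in> l2" "G \<in> l2" for F G
      using that bij_is_inj[OF assms(1)] unfolding l2_W by (auto simp: pencil_W fn_W_inject inj_eq)
    show "pencil Hraw \<mu> F \<in> l2" if "F \<in> l2" for F using that unfolding l2_W by (auto simp: pencil_W)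
    show "\<exists>F\<in>l2. G = pencil Hraw \<mu> F" if G: "G \<in> l2" for G
    proof -
      obtain g where "G = fn (W g)" using G l2_W by blast
      moreover obtain f where "g = KG.P (\<i> * \<mu>) f" using bij_is_surj[OF assms(1)] by (metis surjD)
      ultimately have "G = pencil Hraw \<mu> (fn (W f))" by (simp add: pencil_W)
      then show ?thesis by (intro bexI[of _ "fn (W f)"]) simp_all
    qed
  qed
  moreover obtain K where "norm f \<le> K * norm (KG.P (\<i> * \<mu>) f)" for f using assms(2) by blast
  then have "l2_norm (fn (W f)) \<le> K * l2_norm (pencil Hraw \<mu> (fn (W f)))" for f
    by (simp add: pencil_W norm_W flip: norm_ell2)
  then have "\<forall>F\<in>l2. l2_norm F \<le> K * l2_norm (pencil Hraw \<mu> F)"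
    using l2_W by metis
  ultimately show ?thesis unfolding spectrum_def by blast
qed

lemma cdim_W:
  assumes fin: "finite A" and ind: "\<And>c i. (\<Sum>i\<in>A. CH.sc (c i) (v i)) = 0 \<Longrightarrow> i \<in> A \<Longrightarrow> c i = 0"
  shows "cdim (fn ` W ` {f. \<exists>c. f = (\<Sum>i\<in>A. CH.sc (c i) (v i))}) = card A"
proof -
  have W: "W (\<Sum>i\<in>A. CH.sc (c i) (v i)) = (\<Sum>i\<in>A. CH.sc (c i) (W (v i)))" for c
    by (simp add: CH.clin_sum[OF clin_W] CH.clin_sc[OF clin_W])
  have "W ` {f. \<exists>c. f = (\<Sum>i\<in>A. CH.sc (c i) (v i))} = {f. \<exists>c. f = (\<Sum>i\<in>A. CH.sc (c i) (W (v i)))}"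
    by (auto simp flip: W)
  moreover have "c i = 0" if "(\<Sum>i\<in>A. CH.sc (c i) (W (v i))) = 0" "i \<in> A" for c i
  proof (rule ind[OF _ that(2)])
    have "W (\<Sum>i\<in>A. CH.sc (c i) (v i)) = W 0" using that(1) by (simp only: W CH.clin_0[OF clin_W])
    then show "(\<Sum>i\<in>A. CH.sc (c i) (v i)) = 0" by (rule injD[OF inj_W])
  qed
  ultimately show ?thesis using cdim_span[OF fin, of "\<lambda>i. W (v i)"] by presburger
qed

lemma geom_mult_W:
  assumes z: "cmod (\<i> * \<mu>) \<le> 1/100" "cnj (\<i> * \<mu>) = \<i> * \<mu>"
  shows "geom_mult Hraw \<mu> = card (KG.zeros (\<i> * \<mu>))"
  unfolding geom_mult_def eigenspace_W KG.kernel[OF z(1)]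
  by (rule cdim_W) (simp, rule KG.e_independent[OF z])

lemma alg_mult_simple:
  assumes z: "cmod (\<i> * \<mu>) \<le> 1/100" "cnj (\<i> * \<mu>) = \<i> * \<mu>"
    and nd: "\<And>i. i \<in> KG.zeros (\<i> * \<mu>) \<Longrightarrow> KG.d1 i (\<i> * \<mu>) (\<i> * \<mu>) \<noteq> 0"
  shows "alg_mult Hraw \<mu> = card (KG.zeros (\<i> * \<mu>))"
proof -
  have nd': "CH.ci (KG.e i (\<i> * \<mu>)) (sig (KG.e i (\<i> * \<mu>))) \<noteq> 0" if "i \<in> KG.zeros (\<i> * \<mu>)" for i
    using nd[OF that] unfolding KG.d1_def z(2) by simp
  have "(\<exists>n. (KG.T (\<i> * \<mu>) ^^ n) f = 0) \<longleftrightarrow> (\<exists>c. f = (\<Sum>i\<in>KG.zeros (\<i> * \<mu>). CH.sc (c i) (KG.e i (\<i> * \<mu>))))" for f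
    by (rule KG.generalized_kernel_simple[OF z]) (rule nd')
  then have "alg_mult Hraw \<mu> = cdim (fn ` W ` {f. \<exists>c. f = (\<Sum>i\<in>KG.zeros (\<i> * \<mu>). CH.sc (c i) (KG.e i (\<i> * \<mu>)))})"
    by (simp only: alg_mult_def gen_eigenspace_W)
  also have "\<dots> = card (KG.zeros (\<i> * \<mu>))"
    by (rule cdim_W) (simp, rule KG.e_independent[OF z])
  finally show ?thesis .
qed

text \<open>The kernel has one Jordan chain of length two, above the gauge mode in sector \<open>0\<close>. The additional index
  \<open>None\<close> stands for the second element of the chain.\<close>

lemma alg_mult_zero:
  assumes nd: "\<And>i. i \<in> KG.zeros 0 \<Longrightarrow> i \<noteq> 0 \<Longrightarrow> KG.d1 i 0 0 \<noteq> 0"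
  shows "alg_mult Hraw 0 = Suc (card (KG.zeros 0))"
proof -
  have z: "cmod 0 \<le> 1/100" "cnj 0 = 0" by auto
  define w where "w = KG.R 0 (sig (KG.e 0 0))"
  have i0: "0 \<in> KG.zeros 0" using zero_sectors by simp
  have n0: "CH.ci (KG.e 0 0) (sig (KG.e 0 0)) = 0" using zero_sectors(6) by (simp add: KG.d1_def)
  have "KG.d2 0 0 0 0 \<noteq> 0"
    by (rule KG.d2_nz) (use H0_sig_bmode[of 0] neutral_bmode[of 0] in auto)
  then have m: "CH.ci (KG.e 0 0) (sig w) \<noteq> 0" by (simp add: KG.d2_def w_def)
  have nd': "CH.ci (KG.e i 0) (sig (KG.e i 0)) \<noteq> 0" if "i \<in> KG.zeros 0" "i \<noteq> 0" for i
    using nd[OF that] by (simp add: KG.d1_def)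
  have chain: "(\<exists>n. (KG.T 0 ^^ n) f = 0) \<longleftrightarrow> (\<exists>c d. f = (\<Sum>i\<in>KG.zeros 0. CH.sc (c i) (KG.e i 0)) + CH.sc d w)"
    "(\<Sum>i\<in>KG.zeros 0. CH.sc (c i) (KG.e i 0)) + CH.sc d w = 0 \<Longrightarrow> d = 0" for f c d
    by (rule KG.generalized_kernel_chain[OF z i0 n0 w_def m]; (rule nd')?; assumption)+
  define A where "A = insert None (Some ` KG.zeros 0)"
  define v where "v x = (case x of None \<Rightarrow> w | Some i \<Rightarrow> KG.e i 0)" for x
  have fin: "finite A" by (simp add: A_def)
  have comb: "(\<Sum>x\<in>A. CH.sc (c x) (v x)) = (\<Sum>i\<in>KG.zeros 0. CH.sc (c (Some i)) (KG.e i 0)) + CH.sc (c None) w" for c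
    by (simp add: A_def v_def sum.reindex add.commute)
  have "{f. \<exists>n. (KG.T 0 ^^ n) f = 0} = {f. \<exists>c. f = (\<Sum>x\<in>A. CH.sc (c x) (v x))}"
  proof -
    have "(\<exists>c d. f = (\<Sum>i\<in>KG.zeros 0. CH.sc (c i) (KG.e i 0)) + CH.sc d w) \<longleftrightarrow> (\<exists>c. f = (\<Sum>x\<in>A. CH.sc (c x) (v x)))" for f
    proof
      assume "\<exists>c d. f = (\<Sum>i\<in>KG.zeros 0. CH.sc (c i) (KG.e i 0)) + CH.sc d w"
      then obtain c d where "f = (\<Sum>i\<in>KG.zeros 0. CH.sc (c i) (KG.e i 0)) + CH.sc d w" by blast
      then have "f = (\<Sum>x\<in>A. CH.sc (case x of None \<Rightarrow> d | Some i \<Rightarrow> c i) (v x))" unfolding comb by simp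
      then show "\<exists>c. f = (\<Sum>x\<in>A. CH.sc (c x) (v x))"
        by (rule exI[of _ "\<lambda>x. case x of None \<Rightarrow> d | Some i \<Rightarrow> c i"])
    next
      assume "\<exists>c. f = (\<Sum>x\<in>A. CH.sc (c x) (v x))"
      then obtain c where "f = (\<Sum>x\<in>A. CH.sc (c x) (v x))" by blast
      then show "\<exists>c d. f = (\<Sum>i\<in>KG.zeros 0. CH.sc (c i) (KG.e i 0)) + CH.sc d w" unfolding comb by (intro exI)
    qed
    then show ?thesis using chain(1) by simp
  qed
  moreover have "cdim (fn ` W ` {f. \<exists>c. f = (\<Sum>x\<in>A. CH.sc (c x) (v x))}) = card A"
  proof (rule cdim_W[OF fin])
    fix c x assume 0: "(\<Sum>x\<in>A. CH.sc (c x) (v x)) = 0" and x: "x \<in> A"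
    have d: "c None = 0" using 0 unfolding comb by (rule chain(2))
    then have "(\<Sum>i\<in>KG.zeros 0. CH.sc (c (Some i)) (KG.e i 0)) = 0" using 0 unfolding comb by (simp add: CH.sc_0)
    then have "c (Some i) = 0" if "i \<in> KG.zeros 0" for i by (rule KG.e_independent[OF z _ that])
    then show "c x = 0" using x d by (auto simp: A_def)
  qed
  moreover have "card A = Suc (card (KG.zeros 0))" by (simp add: A_def card_image)
  ultimately show ?thesis by (simp add: alg_mult_def gen_eigenspace_W)
qed

end

section \<open>Reduction of the vector cross to the scalar cross\<close>

text \<open>The constant unitary matrix that maps perturbations of \<open>(\<Psi>, 0)\<close> to perturbations of
  \<open>(cos \<delta> u\<Psi>, sin \<delta> u\<Psi>)\<close>. The phase \<open>u\<close> acts on the first component only, where it is needed to absorb the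
  gauge factor; the conjugate components are treated accordingly.\<close>

definition MW :: "real \<Rightarrow> complex \<Rightarrow> complex^4 \<Rightarrow> complex^4" where
  "MW \<delta> u v = (let c = of_real (cos \<delta>); s = of_real (sin \<delta>) in
     vector [c * (u * v$1) - s * v$3, c * (cnj u * v$2) - s * v$4,
       s * (u * v$1) + c * v$3, s * (cnj u * v$2) + c * v$4])"

definition Wop :: "real \<Rightarrow> complex \<Rightarrow> ell2 \<Rightarrow> ell2" where "Wop \<delta> u = sitewise (\<lambda>p. MW \<delta> u)"

definition MW' :: "real \<Rightarrow> complex \<Rightarrow> complex^4 \<Rightarrow> complex^4" where
  "MW' \<delta> u v = (let c = of_real (cos \<delta>); s = of_real (sin \<delta>) in
     vector [cnj u * (c * v$1 + s * v$3), u * (c * v$2 + s * v$4),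
       c * v$3 - s * v$1, c * v$4 - s * v$2])"

lemma MW_nth [simp]:
  "MW \<delta> u v $ 1 = of_real (cos \<delta>) * (u * v$1) - of_real (sin \<delta>) * v$3"
  "MW \<delta> u v $ 2 = of_real (cos \<delta>) * (cnj u * v$2) - of_real (sin \<delta>) * v$4"
  "MW \<delta> u v $ 3 = of_real (sin \<delta>) * (u * v$1) + of_real (cos \<delta>) * v$3"
  "MW \<delta> u v $ 4 = of_real (sin \<delta>) * (cnj u * v$2) + of_real (cos \<delta>) * v$4"
  by (simp_all only: MW_def Let_def vector_4_nth)

lemma MW'_nth [simp]:
  "MW' \<delta> u v $ 1 = cnj u * (of_real (cos \<delta>) * v$1 + of_real (sin \<delta>) * v$3)"
  "MW' \<delta> u v $ 2 = u * (of_real (cos \<delta>) * v$2 + of_real (sin \<delta>) * v$4)"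
  "MW' \<delta> u v $ 3 = of_real (cos \<delta>) * v$3 - of_real (sin \<delta>) * v$1"
  "MW' \<delta> u v $ 4 = of_real (cos \<delta>) * v$4 - of_real (sin \<delta>) * v$2"
  by (simp_all only: MW'_def Let_def vector_4_nth)

lemma cos_sin_1: "(of_real (cos \<delta>))\<^sup>2 + (of_real (sin \<delta>))\<^sup>2 = (1 :: complex)"
  unfolding of_real_power[symmetric] of_real_add[symmetric] by (simp add: add.commute)

lemma rotation_norm:
  "(cmod (of_real (cos \<delta>) * a - of_real (sin \<delta>) * b))\<^sup>2 + (cmod (of_real (sin \<delta>) * a + of_real (cos \<delta>) * b))\<^sup>2
    = (cmod a)\<^sup>2 + (cmod b)\<^sup>2"
proof -
  have "(cos \<delta>)\<^sup>2 + (sin \<delta>)\<^sup>2 = 1" by (simp add: add.commute)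
  moreover have "(c * a1 - s * b1)\<^sup>2 + (c * a2 - s * b2)\<^sup>2 + ((s * a1 + c * b1)\<^sup>2 + (s * a2 + c * b2)\<^sup>2) = a1\<^sup>2 + a2\<^sup>2 + (b1\<^sup>2 + b2\<^sup>2)"
    if "c\<^sup>2 + s\<^sup>2 = 1" for a1 a2 b1 b2 c s :: real using that by algebra
  ultimately show ?thesis by (simp add: cmod_power2)
qed

context
  fixes u :: complex assumes u: "cmod u = 1"
begin

lemma u_cnj: "u * cnj u = 1"
  using u by (simp flip: complex_norm_square)

lemma norm_MW: "norm (MW \<delta> u v) = norm v"
proof -
  have "(norm (MW \<delta> u v))\<^sup>2 = (norm v)\<^sup>2"
    using rotation_norm[of \<delta> "u * v$1" "v$3"] rotation_norm[of \<delta> "cnj u * v$2" "v$4"]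
    by (simp add: norm4_sq norm_mult u)
  then show ?thesis by simp
qed

lemma MW_MW': "MW \<delta> u (MW' \<delta> u v) = v"
proof -
  have "c * (u * (u' * (c * a + s * b))) - s * (c * b - s * a) = a" "s * (u * (u' * (c * a + s * b))) + c * (c * b - s * a) = b"
    "c * (u' * (u * (c * a + s * b))) - s * (c * b - s * a) = a" "s * (u' * (u * (c * a + s * b))) + c * (c * b - s * a) = b"
    if "u * u' = 1" "c\<^sup>2 + s\<^sup>2 = 1" for u u' a b c s :: complex using that by algebra+
  note r = this[OF u_cnj cos_sin_1]
  show "MW \<delta> u (MW' \<delta> u v) = v" by (rule vec4_eqI) (simp_all only: MW_nth MW'_nth r)
qed

lemma fn_Wop: "fn (Wop \<delta> u f) p = MW \<delta> u (fn f p)"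
  unfolding Wop_def by (rule fn_sitewise[of _ 1]) (simp add: norm_MW)

lemma clin_Wop: "CH.clin (Wop \<delta> u)"
  unfolding Wop_def
  by (rule clin_sitewise[of _ 1]) (auto intro!: vec4_eqI simp: norm_MW algebra_simps)

lemma norm_Wop: "norm (Wop \<delta> u f) = norm f"
  by (simp add: norm_ell2 l2_norm_def fn_Wop norm_MW)

lemma surj_Wop: "surj (Wop \<delta> u)"
proof (rule surjI)
  fix f
  have n: "norm (MW' \<delta> u v) \<le> 1 * norm v" for v using norm_MW[of \<delta> "MW' \<delta> u v"] by (simp add: MW_MW')
  show "Wop \<delta> u (sitewise (\<lambda>p. MW' \<delta> u) f) = f"
    by (rule ell2_eqI) (simp only: fn_Wop fn_sitewise[OF n] MW_MW')
qed

text \<open>The invariance of the nonlinearity under rotations of the pair of fields, in linearized form. It uses only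
  \<open>cos\<^sup>2 \<delta> + sin\<^sup>2 \<delta> = 1\<close> and \<open>\<bar>u\<bar> = 1\<close>.\<close>

lemma H_node_MW:
  "H_node 1 1 (of_real (cos \<delta>) * (u * z)) (of_real (sin \<delta>) * (u * z)) *v MW \<delta> u v =
   MW \<delta> u (vector [(1 - 2 * of_real ((cmod z)\<^sup>2)) * v$1 - z\<^sup>2 * v$2, - (cnj z)\<^sup>2 * v$1 + (1 - 2 * of_real ((cmod z)\<^sup>2)) * v$2,
      (1 - of_real ((cmod z)\<^sup>2)) * v$3, (1 - of_real ((cmod z)\<^sup>2)) * v$4])"
proof -
  define c s :: complex where "c = of_real (cos \<delta>)" and "s = of_real (sin \<delta>)"
  have cs: "c\<^sup>2 + s\<^sup>2 = 1" by (simp only: c_def s_def cos_sin_1)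
  have real: "cnj c = c" "cnj s = s" by (simp_all add: c_def s_def)
  define z' u' where "z' = cnj z" and "u' = cnj u"
  have uu: "u * u' = 1" by (simp only: u'_def u_cnj)
  have N: "of_real ((cmod z)\<^sup>2) = z * z'" by (simp only: z'_def complex_norm_square)
  have N1: "of_real (1 - 2 * (cmod (c * (u * z)))\<^sup>2 - 1 * (cmod (s * (u * z)))\<^sup>2) = 1 - 2 * (c\<^sup>2 * (z * z')) - s\<^sup>2 * (z * z')"
    "of_real (1 - 1 * (cmod (c * (u * z)))\<^sup>2 - 2 * (cmod (s * (u * z)))\<^sup>2) = 1 - c\<^sup>2 * (z * z') - 2 * (s\<^sup>2 * (z * z'))"
    by (simp_all add: norm_mult u c_def s_def power_mult_distrib del: of_real_power flip: N)
       (simp_all flip: of_real_power)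
  show ?thesis
    unfolding c_def[symmetric] s_def[symmetric] H_node_def Let_def N1 N of_real_1
    apply (rule vec4_eqI)
    apply (simp_all only: matrix_vector_mult_def vec_lambda_beta sum_4 vector_4_nth MW_nth complex_cnj_mult real
      c_def[symmetric] s_def[symmetric] z'_def[symmetric] u'_def[symmetric])
    using cs uu apply algebra+
    done
qed

end

lemma (in small_cross) transported_cross_Wop:
  assumes u: "cmod u = 1"
  shows "transported_cross \<epsilon> \<Psi>
    (H_op 1 1 \<epsilon> (\<lambda>p. of_real (cos \<delta>) * (u * \<Psi> p)) (\<lambda>p. of_real (sin \<delta>) * (u * \<Psi> p))) (Wop \<delta> u)"
proof unfold_locales
  show "Wop \<delta> u (sig f) = sig (Wop \<delta> u f)" for f
    by (rule ell2_eqI, rule vec4_eqI) (simp_all add: fn_Wop[OF u] algebra_simps)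
  show "H_op 1 1 \<epsilon> (\<lambda>p. of_real (cos \<delta>) * (u * \<Psi> p)) (\<lambda>p. of_real (sin \<delta>) * (u * \<Psi> p)) (fn (Wop \<delta> u f)) = fn (Wop \<delta> u (Hop f))" for f
  proof
    fix p
    have l: "lap (fn (Wop \<delta> u f)) p = MW \<delta> u (lap (fn f) p)"
      by (rule vec4_eqI) (simp_all add: lap_def fn_Wop[OF u] algebra_simps split: prod.splits)
    show "H_op 1 1 \<epsilon> (\<lambda>p. of_real (cos \<delta>) * (u * \<Psi> p)) (\<lambda>p. of_real (sin \<delta>) * (u * \<Psi> p)) (fn (Wop \<delta> u f)) p = fn (Wop \<delta> u (Hop f)) p"
      unfolding H_op_def l unfolding fn_Wop[OF u] H_node_MW[OF u] fn_Hop
      by (rule vec4_eqI) (simp_all add: algebra_simps MH_def Let_def)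
  qed
qed (use clin_Wop[OF u] surj_Wop[OF u] norm_Wop[OF u] in auto)

text \<open>The eigenvalue \<open>\<lambda>\<^sub>k\<close> is \<open>-\<i> z\<^sub>k\<close>. Its algebraic multiplicity is the number of sectors having \<open>z\<^sub>k\<close> as
  a root, which equals the number of coinciding entries of the list, as the sectors of coinciding entries are distinct.\<close>

lemma (in transported_cross) spectral_picture:
  obtains z :: "nat \<Rightarrow> real" where
    "\<bar>z 1 + 2 * \<epsilon>\<bar> \<le> 60000 * \<epsilon>\<^sup>2" "\<bar>z 3 + 2 * \<epsilon>\<bar> \<le> 60000 * \<epsilon>\<^sup>2"
    "\<bar>z 5 + 2 * \<epsilon>\<^sup>2\<bar> \<le> 60000 * \<epsilon>^3" "\<bar>z 7 + 6 * \<epsilon>\<^sup>2\<bar> \<le> 60000 * \<epsilon>^3" "\<bar>z 9 + 4 * \<epsilon>\<^sup>2\<bar> \<le> 60000 * \<epsilon>^3"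
    "\<And>k. k \<in> {1, 3, 5, 7, 9} \<Longrightarrow> z (k + 1) = - z k"
    "alg_mult Hraw 0 = 6" "geom_mult Hraw 0 = 5"
    "\<And>k. k \<in> {1..10} \<Longrightarrow> z k \<noteq> 0"
    "\<And>k. k \<in> {1..10} \<Longrightarrow> alg_mult Hraw (- \<i> * of_real (z k)) = card {j\<in>{1..10}. z j = z k}"
    "\<And>\<mu>. \<mu> \<in> spectrum Hraw \<Longrightarrow> \<mu> \<noteq> 0 \<Longrightarrow> \<mu> \<notin> (\<lambda>k. - \<i> * of_real (z k)) ` {1..10} \<Longrightarrow> 1/100 \<le> cmod \<mu> \<and> Re \<mu> = 0"
proof (rule root_list)
  fix z :: "nat \<Rightarrow> real" assume
    z: "\<bar>z 1 + 2 * \<epsilon>\<bar> \<le> 60000 * \<epsilon>\<^sup>2" "\<bar>z 3 + 2 * \<epsilon>\<bar> \<le> 60000 * \<epsilon>\<^sup>2"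
    "\<bar>z 5 + 2 * \<epsilon>\<^sup>2\<bar> \<le> 60000 * \<epsilon>^3" "\<bar>z 7 + 6 * \<epsilon>\<^sup>2\<bar> \<le> 60000 * \<epsilon>^3" "\<bar>z 9 + 4 * \<epsilon>\<^sup>2\<bar> \<le> 60000 * \<epsilon>^3"
    "\<And>k. k \<in> {1, 3, 5, 7, 9} \<Longrightarrow> z (k + 1) = - z k" and
    zr: "\<And>j. j \<in> {1..10} \<Longrightarrow> z j \<noteq> 0 \<and> \<bar>z j\<bar> \<le> 1/100 \<and> sec j < 12 \<and> KG.d1 (sec j) (of_real (z j)) (of_real (z j)) \<noteq> 0" and
    roots: "\<And>i w. i < 12 \<Longrightarrow> cmod w \<le> 1/100 \<Longrightarrow>
       KG.k i w = 0 \<longleftrightarrow> (w = 0 \<and> i \<in> {0,4,5,10,11}) \<or> (\<exists>j\<in>{1..10}. i = sec j \<and> w = of_real (z j))" and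
    d0: "\<And>i. i \<in> {4,5,10,11} \<Longrightarrow> KG.d1 i 0 0 \<noteq> 0" and
    inj: "\<And>j j'. j \<in> {1..10} \<Longrightarrow> j' \<in> {1..10} \<Longrightarrow> sec j = sec j' \<Longrightarrow> z j = z j' \<Longrightarrow> j = j'"
  have zeros0: "KG.zeros 0 = {0,4,5,10,11}"
  proof -
    have z: "cmod 0 \<le> 1/100" by simp
    have "KG.k i 0 = 0 \<longleftrightarrow> i \<in> {0,4,5,10,11}" if "i < 12" for i
      unfolding roots[OF that z] using zr by force
    moreover have "i < 12" if "i \<in> {0,4,5,10,11}" for i :: nat using that by auto
    ultimately show ?thesis by blast
  qed
  have zeros: "KG.zeros (of_real (z k)) = sec ` {j\<in>{1..10}. z j = z k}" if k: "k \<in> {1..10}" for k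
  proof -
    have w: "cmod (of_real (z k)) \<le> 1/100" using zr[OF k] by simp
    have "KG.k i (of_real (z k)) = 0 \<longleftrightarrow> (\<exists>j\<in>{1..10}. i = sec j \<and> z j = z k)" if "i < 12" for i
      unfolding roots[OF that w] using zr[OF k] by (metis of_real_eq_0_iff of_real_eq_iff)
    moreover have "sec j < 12" if "j \<in> {1..10}" for j using zr[OF that] by blast
    ultimately show ?thesis by blast
  qed
  show thesis
  proof (rule that[of z])
    show "alg_mult Hraw 0 = 6"
    proof -
      have "alg_mult Hraw 0 = Suc (card (KG.zeros 0))"
        by (rule alg_mult_zero, rule d0, unfold zeros0) blast
      then show ?thesis unfolding zeros0 by simp
    qed
    have "geom_mult Hraw 0 = card (KG.zeros (\<i> * 0))" by (rule geom_mult_W) simp_all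
    then show "geom_mult Hraw 0 = 5" unfolding mult_zero_right zeros0 by simp
    show "alg_mult Hraw (- \<i> * of_real (z k)) = card {j\<in>{1..10}. z j = z k}" if k: "k \<in> {1..10}" for k
    proof -
      have e: "\<i> * (- \<i> * of_real (z k)) = of_real (z k)" by simp
      have "alg_mult Hraw (- \<i> * of_real (z k)) = card (KG.zeros (\<i> * (- \<i> * of_real (z k))))"
      proof (rule alg_mult_simple; unfold e)
        show "cmod (of_real (z k)) \<le> 1/100" using zr[OF k] by simp
        show "KG.d1 i (of_real (z k)) (of_real (z k)) \<noteq> 0" if i: "i \<in> KG.zeros (of_real (z k))" for i
        proof -
          obtain j where "j \<in> {1..10}" "z j = z k" "i = sec j" using i unfolding zeros[OF k] by blast
          then show ?thesis using zr[of j] by simp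
        qed
      qed simp
      also have "\<dots> = card {j\<in>{1..10}. z j = z k}"
        unfolding e zeros[OF k] by (rule card_image) (auto intro!: inj_onI inj)
      finally show ?thesis .
    qed
    show "1/100 \<le> cmod \<mu> \<and> Re \<mu> = 0"
      if "\<mu> \<in> spectrum Hraw" "\<mu> \<noteq> 0" "\<mu> \<notin> (\<lambda>k. - \<i> * of_real (z k)) ` {1..10}" for \<mu>
    proof -
      have far: "1/100 \<le> cmod \<mu>"
      proof (rule ccontr)
        assume "\<not> 1/100 \<le> cmod \<mu>"
        then have s: "cmod (\<i> * \<mu>) \<le> 1/100" by (simp add: norm_mult)
        have "\<i> * \<mu> \<noteq> of_real (z j)" if "j \<in> {1..10}" for j
        proof
          assume "\<i> * \<mu> = of_real (z j)"
          then have "\<mu> = - \<i> * of_real (z j)" by (simp flip: \<open>\<i> * \<mu> = of_real (z j)\<close>)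
          then show False using that \<open>\<mu> \<notin> _\<close> by blast
        qed
        then have "KG.k i (\<i> * \<mu>) \<noteq> 0" if "i \<in> {..<12}" for i
          using roots[of i "\<i> * \<mu>"] s that \<open>\<mu> \<noteq> 0\<close> by auto
        then have "\<mu> \<notin> spectrum Hraw"
          by (intro not_in_spectrum KG.resolvent_small[OF s])
        then show False using that by blast
      qed
      moreover have "Re \<mu> = 0"
      proof (rule ccontr)
        assume "Re \<mu> \<noteq> 0"
        then have "\<mu> \<notin> spectrum Hraw"
          using far by (intro not_in_spectrum KG.nonreal_resolvent) (auto simp: norm_mult)
        then show False using that by blast
      qed
      ultimately show ?thesis by blast
    qed
  qed (use z zr in auto)
qed

text \<open>Normalizing the phase at \<open>(-1,0)\<close> moves the solution by at most twice its distance \<open>1/4000\<close> from the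
  cross, which keeps it within \<open>1/1000\<close>.\<close>

lemma cross_family_gauge:
  assumes eps: "0 < \<epsilon>" "\<epsilon> \<le> 1/10^9" and l2: "\<phi> \<in> l2" and stat: "scalar_stationary \<epsilon> \<phi>"
    and near: "\<And>p. cmod (\<phi> p - cross p) \<le> 1/4000"
  obtains u \<Psi> where "cmod u = 1" "\<phi> = (\<lambda>p. u * \<Psi> p)" "small_cross \<epsilon> \<Psi>"
proof -
  define w where "w = \<phi> (-1, 0)"
  have w1: "cmod (w - 1) \<le> 1/4000" using near[of "(-1,0)"] by (simp add: w_def cross_def)
  then have w0: "w \<noteq> 0" by auto
  define u where "u = w / of_real (cmod w)"
  have u: "cmod u = 1" using w0 by (simp add: u_def norm_divide)
  define \<Psi> where "\<Psi> p = cnj u * \<phi> p" for p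
  have uu: "u * cnj u = 1" using u by (simp flip: complex_norm_square)
  have cu: "cmod (cnj u - 1) \<le> 2/4000"
  proof -
    have "u - 1 = (u - w) + (w - 1)" by simp
    moreover have "u - w = u * of_real (1 - cmod w)" using w0 by (simp add: u_def field_simps)
    then have "cmod (u - w) = \<bar>1 - cmod w\<bar>" by (simp only: norm_mult u norm_of_real mult_1)
    moreover have "\<bar>1 - cmod w\<bar> \<le> 1/4000"
      using w1 norm_triangle_ineq3[of w 1] by (simp add: abs_minus_commute)
    moreover note w1 norm_triangle_ineq[of "u - w" "w - 1"]
    ultimately have "cmod (u - 1) \<le> 2/4000" by simp
    then show ?thesis using complex_mod_cnj[of "u - 1"] by simp
  qed
  have "small_cross \<epsilon> \<Psi>"
  proof unfold_locales
    show "scalar_stationary \<epsilon> \<Psi>" unfolding scalar_stationary_def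
    proof
      fix p
      have "of_real (1 - (cmod (\<phi> p))\<^sup>2) * \<phi> p = of_real \<epsilon> * lap \<phi> p" using stat by (simp only: scalar_stationary_def)
      then have "cnj u * (of_real (1 - (cmod (\<phi> p))\<^sup>2) * \<phi> p) = cnj u * (of_real \<epsilon> * lap \<phi> p)" by simp
      moreover have "lap \<Psi> p = cnj u * lap \<phi> p" by (simp add: \<Psi>_def lap_def algebra_simps split: prod.splits)
      moreover have "cmod (\<Psi> p) = cmod (\<phi> p)" by (simp add: \<Psi>_def norm_mult u)
      ultimately show "of_real (1 - (cmod (\<Psi> p))\<^sup>2) * \<Psi> p = of_real \<epsilon> * lap \<Psi> p"
        by (simp add: \<Psi>_def mult_ac)
    qed
    show "cmod (\<Psi> p - cross p) \<le> 1/1000" for p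
    proof -
      have "\<Psi> p - cross p = cnj u * (\<phi> p - cross p) + (cnj u - 1) * cross p" by (simp add: \<Psi>_def algebra_simps)
      then have "cmod (\<Psi> p - cross p) \<le> cmod (cnj u * (\<phi> p - cross p)) + cmod ((cnj u - 1) * cross p)"
        using norm_triangle_ineq by metis
      also have "\<dots> \<le> 1/4000 + 2/4000 * 1"
        unfolding norm_mult using near[of p] u cu
        by (intro add_mono mult_mono) (auto simp: cross_def)
      finally show ?thesis by simp
    qed
    show "Im (\<Psi> (-1, 0)) = 0"
    proof -
      have "\<Psi> (-1, 0) = (cnj w * w) / of_real (cmod w)" by (simp add: \<Psi>_def u_def w_def)
      also have "\<dots> = of_real ((cmod w)\<^sup>2) / of_real (cmod w)" by (simp only: complex_norm_square mult.commute)
      also have "\<dots> = of_real ((cmod w)\<^sup>2 / cmod w)" by simp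
      finally show ?thesis by (simp only: Im_complex_of_real)
    qed
    show "\<Psi> \<in> l2" using l2 by (simp add: l2_def \<Psi>_def norm_mult u)
  qed (use eps in auto)
  moreover have "\<phi> = (\<lambda>p. u * \<Psi> p)" using uu by (simp add: \<Psi>_def fun_eq_iff flip: mult.assoc)
  ultimately show thesis using u that by blast
qed

section \<open>The spectrum of the vector vortex cross\<close>

lemma cross_nodes_value:
  "j < 4 \<Longrightarrow> cross (cross_nodes ! j) = cis (pi * real j / 2)" "p \<notin> set cross_nodes \<Longrightarrow> cross p = 0"
proof -
  have "cis (pi * 2 / 2) = -1" by simp
  moreover have "cis (pi * 3 / 2) = - \<i>"
    using cis_mult[of pi "pi / 2"] by (simp add: algebra_simps)
  ultimately show "j < 4 \<Longrightarrow> cross (cross_nodes ! j) = cis (pi * real j / 2)"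
    by (auto simp: cross_nodes_def cross_def less_Suc_eq numeral_eq_Suc)
  show "p \<notin> set cross_nodes \<Longrightarrow> cross p = 0" by (auto simp: cross_nodes_def cross_def)
qed

lemma bigo_root:
  assumes e: "0 < \<epsilon>\<^sub>2" and b: "\<And>\<epsilon>. 0 < \<epsilon> \<Longrightarrow> \<epsilon> < \<epsilon>\<^sub>2 \<Longrightarrow> \<bar>Z \<epsilon> + c * \<epsilon> ^ m\<bar> \<le> C * \<epsilon> ^ n"
  shows "(\<lambda>\<epsilon>. - \<i> * of_real (Z \<epsilon>) - of_real c * \<i> * of_real (\<epsilon> ^ m)) \<in> O[at_right 0](\<lambda>\<epsilon>. of_real (\<epsilon> ^ n))"
proof (rule bigoI)
  have n: "norm (- \<i> * of_real (Z \<epsilon>) - of_real c * \<i> * of_real (\<epsilon> ^ m)) = \<bar>Z \<epsilon> + c * \<epsilon> ^ m\<bar>" for \<epsilon>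
  proof -
    have "- \<i> * of_real (Z \<epsilon>) - of_real c * \<i> * of_real (\<epsilon> ^ m) = (- \<i>) * of_real (Z \<epsilon> + c * \<epsilon> ^ m)"
      by (simp add: algebra_simps)
    then show ?thesis by (simp only: norm_mult norm_of_real norm_minus_cancel norm_ii mult_1)
  qed
  have "\<forall>\<^sub>F \<epsilon> in at_right 0. 0 < \<epsilon> \<and> \<epsilon> < \<epsilon>\<^sub>2"
    using e by (auto simp: eventually_at_right_field)
  then show "\<forall>\<^sub>F \<epsilon> in at_right 0. norm (- \<i> * of_real (Z \<epsilon>) - of_real c * \<i> * of_real (\<epsilon> ^ m)) \<le> C * norm (of_real (\<epsilon> ^ n) :: complex)"
    by eventually_elim (simp only: n norm_of_real, use b in auto)
qed

theorem proposition5p1: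
  fixes \<delta> \<epsilon>\<^sub>0 :: real and \<Phi> :: "real \<Rightarrow> lattice \<Rightarrow> complex"
    and H :: "real \<Rightarrow> (lattice \<Rightarrow> complex^4) \<Rightarrow> lattice \<Rightarrow> complex^4"
  assumes "0 \<le> \<delta>" and "\<delta> \<le> 2 * pi"
    and "\<epsilon>\<^sub>0 > 0" and "vortex_cross_family \<epsilon>\<^sub>0 \<Phi>"
    and "\<And>\<epsilon>. H \<epsilon> = H_op 1 1 \<epsilon> (\<lambda>p. of_real (cos \<delta>) * \<Phi> \<epsilon> p) (\<lambda>p. of_real (sin \<delta>) * \<Phi> \<epsilon> p)"
  shows "\<exists>(lam :: nat \<Rightarrow> real \<Rightarrow> complex) r. r > 0 \<and>
    (\<lambda>\<epsilon>. lam 1 \<epsilon> - 2 * \<i> * of_real \<epsilon>) \<in> O[at_right 0](\<lambda>\<epsilon>. of_real (\<epsilon> ^ 2)) \<and>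
    (\<lambda>\<epsilon>. lam 3 \<epsilon> - 2 * \<i> * of_real \<epsilon>) \<in> O[at_right 0](\<lambda>\<epsilon>. of_real (\<epsilon> ^ 2)) \<and>
    (\<lambda>\<epsilon>. lam 5 \<epsilon> - 2 * \<i> * of_real (\<epsilon> ^ 2)) \<in> O[at_right 0](\<lambda>\<epsilon>. of_real (\<epsilon> ^ 3)) \<and>
    (\<lambda>\<epsilon>. lam 7 \<epsilon> - 6 * \<i> * of_real (\<epsilon> ^ 2)) \<in> O[at_right 0](\<lambda>\<epsilon>. of_real (\<epsilon> ^ 3)) \<and>
    (\<lambda>\<epsilon>. lam 9 \<epsilon> - 4 * \<i> * of_real (\<epsilon> ^ 2)) \<in> O[at_right 0](\<lambda>\<epsilon>. of_real (\<epsilon> ^ 3)) \<and>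
    (\<forall>\<^sub>F \<epsilon> in at_right 0.
      (\<forall>k\<in>{1, 3, 5, 7, 9}. lam (k + 1) \<epsilon> = - lam k \<epsilon>) \<and>
      alg_mult (H \<epsilon>) 0 = 6 \<and> geom_mult (H \<epsilon>) 0 = 5 \<and>
      (\<forall>k\<in>{1..10}. Re (lam k \<epsilon>) = 0 \<and> lam k \<epsilon> \<noteq> 0 \<and>
         alg_mult (H \<epsilon>) (lam k \<epsilon>) = card {j\<in>{1..10}. lam j \<epsilon> = lam k \<epsilon>}) \<and>
      (\<forall>\<mu> \<in> spectrum (H \<epsilon>) - insert 0 ((\<lambda>k. lam k \<epsilon>) ` {1..10}). r \<le> cmod \<mu> \<and> Re \<mu> = 0))"
proof -
  note fam = assms(4)[unfolded vortex_cross_family_def]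
  have zero: "\<Phi> 0 p = cross p" for p
  proof (cases "p \<in> set cross_nodes")
    case True
    moreover have "length cross_nodes = 4" by (simp add: cross_nodes_def)
    ultimately obtain j where "j < 4" "p = cross_nodes ! j" by (metis in_set_conv_nth)
    then show ?thesis using fam cross_nodes_value(1) by simp
  next
    case False
    then show ?thesis using fam cross_nodes_value(2)[of p] by metis
  qed
  obtain \<epsilon>\<^sub>1 where e1: "\<epsilon>\<^sub>1 > 0" "\<epsilon>\<^sub>1 \<le> \<epsilon>\<^sub>0"
    and near: "\<And>\<epsilon> p. 0 \<le> \<epsilon> \<Longrightarrow> \<epsilon> < \<epsilon>\<^sub>1 \<Longrightarrow> norm (\<Phi> \<epsilon> p - \<Phi> 0 p) \<le> 1/4000"
    using l2_real_analytic_sup_continuous[of \<Phi> \<epsilon>\<^sub>0 "1/4000"] fam assms(3) by auto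
  define \<epsilon>\<^sub>2 where "\<epsilon>\<^sub>2 = min \<epsilon>\<^sub>1 (1/10^9)"
  have e2: "\<epsilon>\<^sub>2 > 0" using e1 by (simp add: \<epsilon>\<^sub>2_def)
  define good where "good \<epsilon> z \<longleftrightarrow>
    \<bar>z 1 + 2 * \<epsilon>\<bar> \<le> 60000 * \<epsilon>\<^sup>2 \<and> \<bar>z 3 + 2 * \<epsilon>\<bar> \<le> 60000 * \<epsilon>\<^sup>2 \<and>
    \<bar>z 5 + 2 * \<epsilon>\<^sup>2\<bar> \<le> 60000 * \<epsilon>^3 \<and> \<bar>z 7 + 6 * \<epsilon>\<^sup>2\<bar> \<le> 60000 * \<epsilon>^3 \<and> \<bar>z 9 + 4 * \<epsilon>\<^sup>2\<bar> \<le> 60000 * \<epsilon>^3 \<and>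
    (\<forall>k\<in>{1, 3, 5, 7, 9}. z (k + 1) = - z k) \<and>
    alg_mult (H \<epsilon>) 0 = 6 \<and> geom_mult (H \<epsilon>) 0 = 5 \<and>
    (\<forall>k\<in>{1..10}. z k \<noteq> 0 \<and> alg_mult (H \<epsilon>) (- \<i> * of_real (z k)) = card {j\<in>{1..10}. z j = z k}) \<and>
    (\<forall>\<mu>\<in>spectrum (H \<epsilon>) - insert 0 ((\<lambda>k. - \<i> * of_real (z k)) ` {1..10}). 1/100 \<le> cmod \<mu> \<and> Re \<mu> = 0)"
    for \<epsilon> and z :: "nat \<Rightarrow> real"
  have "\<exists>z. good \<epsilon> z" if \<epsilon>: "0 < \<epsilon>" "\<epsilon> < \<epsilon>\<^sub>2" for \<epsilon>
  proof -
    have "\<Phi> \<epsilon> \<in> l2" "scalar_stationary \<epsilon> (\<Phi> \<epsilon>)"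
      using fam \<epsilon> e1 by (auto simp: l2_real_analytic_on_def \<epsilon>\<^sub>2_def)
    moreover have "cmod (\<Phi> \<epsilon> p - cross p) \<le> 1/4000" for p
      using near[of \<epsilon> p] \<epsilon> by (simp add: zero \<epsilon>\<^sub>2_def)
    ultimately obtain u \<Psi> where u: "cmod u = 1" and \<Phi>: "\<Phi> \<epsilon> = (\<lambda>p. u * \<Psi> p)" and small: "small_cross \<epsilon> \<Psi>"
    proof (rule cross_family_gauge[rotated 2])
    qed (use \<epsilon> in \<open>simp_all add: \<epsilon>\<^sub>2_def\<close>)
    interpret transported_cross \<epsilon> \<Psi> "H \<epsilon>" "Wop \<delta> u"
      using small_cross.transported_cross_Wop[OF small u, of \<delta>] unfolding assms(5) \<Phi> .
    show ?thesis
    proof (rule spectral_picture)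
      fix z :: "nat \<Rightarrow> real"
      assume z: "\<bar>z 1 + 2 * \<epsilon>\<bar> \<le> 60000 * \<epsilon>\<^sup>2" "\<bar>z 3 + 2 * \<epsilon>\<bar> \<le> 60000 * \<epsilon>\<^sup>2"
        "\<bar>z 5 + 2 * \<epsilon>\<^sup>2\<bar> \<le> 60000 * \<epsilon>^3" "\<bar>z 7 + 6 * \<epsilon>\<^sup>2\<bar> \<le> 60000 * \<epsilon>^3" "\<bar>z 9 + 4 * \<epsilon>\<^sup>2\<bar> \<le> 60000 * \<epsilon>^3"
        "\<And>k. k \<in> {1, 3, 5, 7, 9} \<Longrightarrow> z (k + 1) = - z k"
        "alg_mult (H \<epsilon>) 0 = 6" "geom_mult (H \<epsilon>) 0 = 5"
        "\<And>k. k \<in> {1..10} \<Longrightarrow> z k \<noteq> 0"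
        "\<And>k. k \<in> {1..10} \<Longrightarrow> alg_mult (H \<epsilon>) (- \<i> * of_real (z k)) = card {j\<in>{1..10}. z j = z k}"
        "\<And>\<mu>. \<mu> \<in> spectrum (H \<epsilon>) \<Longrightarrow> \<mu> \<noteq> 0 \<Longrightarrow> \<mu> \<notin> (\<lambda>k. - \<i> * of_real (z k)) ` {1..10} \<Longrightarrow> 1/100 \<le> cmod \<mu> \<and> Re \<mu> = 0"
      have "good \<epsilon> z" unfolding good_def by (intro conjI ballI z) auto
      then show "\<exists>z. good \<epsilon> z" by (intro exI[of _ z])
    qed
  qed
  then obtain Z where Z: "\<And>\<epsilon>. 0 < \<epsilon> \<Longrightarrow> \<epsilon> < \<epsilon>\<^sub>2 \<Longrightarrow> good \<epsilon> (\<lambda>k. Z k \<epsilon>)"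
  proof -
    assume "\<And>\<epsilon>. 0 < \<epsilon> \<Longrightarrow> \<epsilon> < \<epsilon>\<^sub>2 \<Longrightarrow> \<exists>z. good \<epsilon> z"
    then have "good \<epsilon> (\<lambda>k. (SOME z. good \<epsilon> z) k)" if "0 < \<epsilon>" "\<epsilon> < \<epsilon>\<^sub>2" for \<epsilon>
      using someI_ex[of "good \<epsilon>"] that by blast
    then show thesis by (rule that[of "\<lambda>k \<epsilon>. (SOME z. good \<epsilon> z) k"])
  qed
  define lam where "lam k \<epsilon> = - \<i> * of_real (Z k \<epsilon>)" for k \<epsilon>
  have lam_eq: "lam j \<epsilon> = lam k \<epsilon> \<longleftrightarrow> Z j \<epsilon> = Z k \<epsilon>" for j k \<epsilon> by (simp add: lam_def)
  have b: "\<bar>Z 1 \<epsilon> + 2 * \<epsilon> ^ 1\<bar> \<le> 60000 * \<epsilon> ^ 2" "\<bar>Z 3 \<epsilon> + 2 * \<epsilon> ^ 1\<bar> \<le> 60000 * \<epsilon> ^ 2"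
    "\<bar>Z 5 \<epsilon> + 2 * \<epsilon> ^ 2\<bar> \<le> 60000 * \<epsilon> ^ 3" "\<bar>Z 7 \<epsilon> + 6 * \<epsilon> ^ 2\<bar> \<le> 60000 * \<epsilon> ^ 3"
    "\<bar>Z 9 \<epsilon> + 4 * \<epsilon> ^ 2\<bar> \<le> 60000 * \<epsilon> ^ 3" if "0 < \<epsilon>" "\<epsilon> < \<epsilon>\<^sub>2" for \<epsilon>
    using Z[OF that] by (simp_all add: good_def)
  have ev: "\<forall>\<^sub>F \<epsilon> in at_right 0. 0 < \<epsilon> \<and> \<epsilon> < \<epsilon>\<^sub>2"
    using e2 by (auto simp: eventually_at_right_field)
  show ?thesis
  proof (intro exI[of _ lam] exI[of _ "1/100"] conjI)
    show "(\<lambda>\<epsilon>. lam 1 \<epsilon> - 2 * \<i> * of_real \<epsilon>) \<in> O[at_right 0](\<lambda>\<epsilon>. of_real (\<epsilon> ^ 2))"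
      "(\<lambda>\<epsilon>. lam 3 \<epsilon> - 2 * \<i> * of_real \<epsilon>) \<in> O[at_right 0](\<lambda>\<epsilon>. of_real (\<epsilon> ^ 2))"
      "(\<lambda>\<epsilon>. lam 5 \<epsilon> - 2 * \<i> * of_real (\<epsilon> ^ 2)) \<in> O[at_right 0](\<lambda>\<epsilon>. of_real (\<epsilon> ^ 3))"
      "(\<lambda>\<epsilon>. lam 7 \<epsilon> - 6 * \<i> * of_real (\<epsilon> ^ 2)) \<in> O[at_right 0](\<lambda>\<epsilon>. of_real (\<epsilon> ^ 3))"
      "(\<lambda>\<epsilon>. lam 9 \<epsilon> - 4 * \<i> * of_real (\<epsilon> ^ 2)) \<in> O[at_right 0](\<lambda>\<epsilon>. of_real (\<epsilon> ^ 3))"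
      using bigo_root[OF e2 b(1)] bigo_root[OF e2 b(2)] bigo_root[OF e2 b(3)] bigo_root[OF e2 b(4)] bigo_root[OF e2 b(5)]
      unfolding lam_def of_real_numeral power_one_right by blast+
    show "\<forall>\<^sub>F \<epsilon> in at_right 0.
      (\<forall>k\<in>{1, 3, 5, 7, 9}. lam (k + 1) \<epsilon> = - lam k \<epsilon>) \<and>
      alg_mult (H \<epsilon>) 0 = 6 \<and> geom_mult (H \<epsilon>) 0 = 5 \<and>
      (\<forall>k\<in>{1..10}. Re (lam k \<epsilon>) = 0 \<and> lam k \<epsilon> \<noteq> 0 \<and>
         alg_mult (H \<epsilon>) (lam k \<epsilon>) = card {j\<in>{1..10}. lam j \<epsilon> = lam k \<epsilon>}) \<and>
      (\<forall>\<mu> \<in> spectrum (H \<epsilon>) - insert 0 ((\<lambda>k. lam k \<epsilon>) ` {1..10}). 1/100 \<le> cmod \<mu> \<and> Re \<mu> = 0)"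
      using ev
    proof eventually_elim
      case (elim \<epsilon>)
      then have g: "good \<epsilon> (\<lambda>k. Z k \<epsilon>)" using Z by blast
      have "lam (k + 1) \<epsilon> = - lam k \<epsilon>" if "k \<in> {1, 3, 5, 7, 9}" for k
      proof -
        have "Z (k + 1) \<epsilon> = - Z k \<epsilon>" using g that unfolding good_def by blast
        then show ?thesis by (simp only: lam_def of_real_minus mult_minus_right)
      qed
      moreover have "Re (lam k \<epsilon>) = 0" for k by (simp add: lam_def)
      moreover have "lam k \<epsilon> \<noteq> 0" "alg_mult (H \<epsilon>) (lam k \<epsilon>) = card {j\<in>{1..10}. lam j \<epsilon> = lam k \<epsilon>}"
        if "k \<in> {1..10}" for k
      proof -
        have "Z k \<epsilon> \<noteq> 0" "alg_mult (H \<epsilon>) (- \<i> * of_real (Z k \<epsilon>)) = card {j\<in>{1..10}. Z j \<epsilon> = Z k \<epsilon>}"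
          using g that unfolding good_def by blast+
        then show "lam k \<epsilon> \<noteq> 0" "alg_mult (H \<epsilon>) (lam k \<epsilon>) = card {j\<in>{1..10}. lam j \<epsilon> = lam k \<epsilon>}"
          unfolding lam_eq by (simp_all add: lam_def)
      qed
      moreover have "alg_mult (H \<epsilon>) 0 = 6" "geom_mult (H \<epsilon>) 0 = 5"
        "\<forall>\<mu> \<in> spectrum (H \<epsilon>) - insert 0 ((\<lambda>k. lam k \<epsilon>) ` {1..10}). 1/100 \<le> cmod \<mu> \<and> Re \<mu> = 0"
        using g unfolding good_def lam_def by blast+
      ultimately show ?case by blast
    qed
  qed simp
qed

end
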